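(* Let $\hat h\in\mathbb{C}[[z]]\setminus\{0\}$ be a solution of a linear $q$-difference equation with coefficients in $\mathbb{C}(z)$, and let $m+1\in\mathbb{N}^*$ be the dimension of the $\mathbb{C}(z)$-vector subspace of $\mathbb{C}((z))$ spanned by $1$ and $\{\sigma_q^i(\hat h):i\in\mathbb{N}\}$. Let $P=a_m\sigma_q^m+\dots+a_0$ with $a_i\in\mathbb{C}[z]$, and $a\in\mathbb{C}[z]$, be such that $\gcd(a,a_0,\dots,a_m)=1$ and $P(\hat h)=a$. Assume that $P$ has at least one slope strictly bigger than $0$. Let $\mu_1<\dots<\mu_r$ be the positive slopes of $P$, set $\mu_{r+1}:=+\infty$, and define $\kappa_1,\dots,\kappa_r$ by $\kappa_i^{-1}:=\mu_i^{-1}-\mu_{i+1}^{-1}$. Let $K\in\mathbb{N}^*$ be minimal such that $K/\kappa_i\in\mathbb{N}^*$ for all $i\in\{1,\dots,r\}$, and let $n\in\mathbb{N}^*$ be minimal such that $n/\kappa_r\in\mathbb{N}^*$. Then there exists a finite set $\Sigma\subset\mathbb{C}^*/q^{n^{-1}\mathbb{Z}}$ such that if $\lambda\in(\mathbb{C}^*/q^{n^{-1}\mathbb{Z}})\setminus\Sigma$, then $$\hat{\mathcal B}_{\kappa_1}\circ\dots\circ\hat{\mathcal B}_{\kappa_r}(\hat h)\in\mathbb{H}^{[\lambda]}_{\kappa_1,K},$$ and for $i=1$ (resp. $i=2,\dots,i=r-1$), $$\mathcal{L}^{[\lambda]}_{\kappa_i,K}\circ\dots\circ\mathcal{L}^{[\lambda]}_{\kappa_1,K}\circ\hat{\mathcal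 B}_{\kappa_1}\circ\dots\circ\hat{\mathcal B}_{\kappa_r}(\hat h)\in\mathbb{H}^{[\lambda]}_{\kappa_{i+1},K}$$ (this condition being imposed for $1\le i\le r-1$). Moreover, the function $$S_q^{[\lambda]}(\hat h):=\mathcal{L}^{[\lambda]}_{\kappa_r,n}\circ\mathcal{L}^{[\lambda]}_{\kappa_{r-1},K}\circ\dots\circ\mathcal{L}^{[\lambda]}_{\kappa_1,K}\circ\hat{\mathcal B}_{\kappa_1}\circ\dots\circ\hat{\mathcal B}_{\kappa_r}(\hat h)\in\mathcal{M}(\mathbb{C}^* )$$ is a solution of $P(\hat h)=P\left(S_q^{[\lambda]}(\hat h)\right)=a\in\mathbb{C}[z]$.
   Context: Here $q\in\mathbb{C}$ is fixed with $|q|>1$, $\mathbb{N}=\{0,1,2,\dots\}$, $\mathbb{N}^*=\mathbb{N}\setminus\{0\}$. A logarithm $\log(q)$ is fixed and $q^\alpha:=e^{\alpha\log q}$ for $\alpha\in\mathbb{C}$. For $\alpha\in\mathbb{Q}$, $\sigma_q^{\alpha}$ sends $y(z)$ to $y(q^\alpha z)$. For $K\in\mathbb{N}^*$, $q^{K^{-1}\mathbb{Z}}=\{q^{\ell}:\ell\in K^{-1}\mathbb{Z}\}$. A linear $q$-difference equation with coefficients in $\mathbb{C}(z)$ is an equation $\sum_i a_i\,\sigma_q^i(y)=a$ with $a_i,a\in\mathbb{C}(z)$, the $a_i$ not all zero. For $p\in\mathbb{C}$, $|p|>1$, $\Theta_p(z):=\sum_{\ell\in\mathbb{Z}}p^{-\ell(\ell+1)/2}z^\ell$.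 Slopes: for $P=\sum_i b_i\sigma_q^{i}$ (finite sum, $b_i\in\mathbb{C}[z]$), the Newton polygon is the convex hull of $\bigcup_{i}\{(i,j): j\in\mathbb{Z},\ j\ge v_0(b_i)\}$, $v_0$ being the $z$-adic valuation. Let $(d_1,n_1),\dots,(d_{s+1},n_{s+1})$, $d_1<\dots<d_{s+1}$, be the minimal set of points such that the lower part of the boundary of the Newton polygon is the (piecewise linear) hull of these points. If $s>0$, the slopes of $P$ are the numbers $\frac{n_{i+1}-n_i}{d_{i+1}-d_i}$; if $s=0$, $P$ has by convention the unique slope $0$. The positive slopes are the slopes belonging to $\mathbb{Q}_{>0}$. $\mathcal{M}(\mathbb{C}^* )$ is the field of meromorphic functions on $\mathbb{C}^*$ and $\mathcal{M}(\mathbb{C}^*,0)$ is the field of functions meromorphic on some punctured neighborhood of $0$ in $\mathbb{C}^*$; two analytic functions are considered equal if their analytic continuations coincide, and a convergent power series is viewed as an element of $\mathcal{M}(\mathbb{C}^*,0)$. $q$-Borel transformation of order $\mu\in\mathbb{Q}_{>0}$: $\hat{\mathcal B}_\mu:\mathbb{C}[[z]]\to\mathbb{C}[[\zeta]]$, $\sum_{\ell\in\mathbb{N}} a_\ell z^\ell\mapsto\sum_{\ell\in\mathbb{N}} a_\ell q^{-\ell(\ell-1)/(2\mu)}\zeta^\ell$. Let $(\mu,K)\in\mathbb{Q}_{>0}\times\mathbb{N}^*$ with $K\in\mu\mathbb{N}^*$ and $\lambda\in\mathbb{C}^*/q^{K^{-1}\mathbb{Z}}$. $\mathbb{H}^{[\lambda]}_{\mu,K}$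 is the set of $f\in\mathcal{M}(\mathbb{C}^*,0)$ for which there exist $\varepsilon>0$ and a connected domain $\Omega\subset\mathbb{C}$ with $\bigcup_{\ell\in K^{-1}\mathbb{Z}}\{z\in\mathbb{C}^*:|z-\lambda q^\ell|<\varepsilon|q^\ell\lambda|\}\subset\Omega$ such that $f$ can be continued to an analytic function on $\Omega$ satisfying, for some constants $L,M>0$, $|f(z)|<L\,|\Theta_{|q|^{1/\mu}}(M|z|)|$ for all $z\in\Omega$. The $q$-Laplace transformation of order $\mu$ is $\mathcal{L}^{[\lambda]}_{\mu,K}:\mathbb{H}^{[\lambda]}_{\mu,K}\to\mathcal{M}(\mathbb{C}^*,0)$, $$\mathcal{L}^{[\lambda]}_{\mu,K}(f)(z)=\frac{\mu}{K}\sum_{\ell\in K^{-1}\mathbb{Z}}\frac{f(q^\ell\lambda)}{\Theta_{q^{1/\mu}}\left(q^{\frac1\mu+\ell}\lambda/z\right)}.$$ With $K,n$ as in the claim one has $K/n\in\mathbb{N}^*$, so $\mathbb{H}^{[\lambda]}_{\kappa_r,K}\subset\mathbb{H}^{[\lambda]}_{\kappa_r,n}$, and $\lambda\in\mathbb{C}^*/q^{n^{-1}\mathbb{Z}}$ is identified with its image in $\mathbb{C}^*/q^{K^{-1}\mathbb{Z}}$. *)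

theory Defs
  imports
    "HOL-Computational_Algebra.Computational_Algebra"
    "HOL-Computational_Algebra.Field_as_Ring"
    "HOL-Complex_Analysis.Complex_Analysis"
begin

section \<open>Powers of \<open>q\<close> and the groups \<open>q\<close> to the \<open>K\<inverse>\<int>\<close>\<close>

text \<open>Throughout, \<open>lq\<close> is the fixed logarithm of \<open>q\<close>, so that \<open>q = exp lq\<close>.\<close>

definition qpow :: "complex \<Rightarrow> real \<Rightarrow> complex" where
  "qpow lq \<alpha> = exp (of_real \<alpha> * lq)"

text \<open>Congruence of nonzero complex numbers modulo the group of all \<open>qpow lq (k / K)\<close>;
  the quotient \<open>(- {0}) // qcong lq K\<close> is the set of logarithmic spirals of level \<open>K\<close>.\<close>

definition qcong :: "complex \<Rightarrow> nat \<Rightarrow> (complex \<times> complex) set" where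
  "qcong lq K = {(x, y). x \<noteq> 0 \<and> (\<exists>k::int. y = qpow lq (of_int k / of_nat K) * x)}"

lemma equiv_qcong: "equiv (- {0}) (qcong lq K)"
proof (rule equivI)
  show "qcong lq K \<subseteq> (- {0}) \<times> (- {0})"
    by (auto simp: qcong_def qpow_def)
  show "refl_on (- {0}) (qcong lq K)"
    by (auto simp: refl_on_def qcong_def qpow_def intro: exI[of _ 0])
  show "sym (qcong lq K)"
  proof (rule symI)
    fix x y assume "(x, y) \<in> qcong lq K"
    then obtain k :: int where "x \<noteq> 0" and y: "y = qpow lq (of_int k / of_nat K) * x"
      by (auto simp: qcong_def)
    moreover from this have "y \<noteq> 0"
      by (simp add: qpow_def)
    moreover from y have "x = qpow lq (of_int (- k) / of_nat K) * y"
      by (simp add: qpow_def flip: exp_add mult.assoc)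
    ultimately show "(y, x) \<in> qcong lq K"
      unfolding qcong_def by blast
  qed
  show "trans (qcong lq K)"
  proof (rule transI)
    fix x y z assume "(x, y) \<in> qcong lq K" "(y, z) \<in> qcong lq K"
    then obtain k l :: int where "x \<noteq> 0" "y = qpow lq (of_int k / of_nat K) * x"
      "z = qpow lq (of_int l / of_nat K) * y"
      by (auto simp: qcong_def)
    then have "z = qpow lq (of_int (l + k) / of_nat K) * x"
      by (simp add: qpow_def add_divide_distrib ring_distribs exp_add)
    with \<open>x \<noteq> 0\<close> show "(x, z) \<in> qcong lq K"
      unfolding qcong_def by blast
  qed
qed


section \<open>Formal \<open>q\<close>-difference equations\<close>

definition qshift_fps :: "complex \<Rightarrow> nat \<Rightarrow> complex fps \<Rightarrow> complex fps" where
  "qshift_fps q i h = fps_compose h (fps_const (q ^ i) * fps_X)"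

text \<open>The expansion at the origin, which embeds the rational functions in the Laurent series.\<close>

definition fls_of_ratfun :: "complex poly fract \<Rightarrow> complex fls" where
  "fls_of_ratfun R = fps_to_fls (fps_of_poly (fst (quot_of_fract R))) /
                     fps_to_fls (fps_of_poly (snd (quot_of_fract R)))"

definition ratfun_scale :: "complex poly fract \<Rightarrow> complex fls \<Rightarrow> complex fls" where
  "ratfun_scale R f = fls_of_ratfun R * f"

lemma fls_of_ratfun_Fract:
  assumes "b \<noteq> 0"
  shows "fls_of_ratfun (Fract a b) = fps_to_fls (fps_of_poly a) / fps_to_fls (fps_of_poly b)"
proof -
  obtain c d where cd: "quot_of_fract (Fract a b) = (c, d)"
    by (cases "quot_of_fract (Fract a b)")
  have "d \<noteq> 0"
    using snd_quot_of_fract_nonzero[of "Fract a b"] cd by simp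
  moreover have "Fract c d = Fract a b"
    using Fract_quot_of_fract[of "Fract a b"] cd by simp
  ultimately have "a * d = c * b"
    using assms by (simp add: eq_fract)
  then have "fps_to_fls (fps_of_poly a) * fps_to_fls (fps_of_poly d) =
      fps_to_fls (fps_of_poly c) * fps_to_fls (fps_of_poly b)"
    by (simp flip: fps_of_poly_mult fls_times_fps_to_fls)
  then show ?thesis
    using assms \<open>d \<noteq> 0\<close> by (simp add: fls_of_ratfun_def cd frac_eq_eq)
qed

lemma vector_space_ratfun_scale: "vector_space ratfun_scale"
proof
  fix R S :: "complex poly fract" and f g :: "complex fls"
  show "ratfun_scale R (f + g) = ratfun_scale R f + ratfun_scale R g"
    by (simp add: ratfun_scale_def ring_distribs)
  have "fls_of_ratfun (R + S) = fls_of_ratfun R + fls_of_ratfun S"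
    by (cases R; cases S)
      (simp add: fls_of_ratfun_Fract add_frac_eq fps_of_poly_add fps_of_poly_mult
        fls_times_fps_to_fls)
  then show "ratfun_scale (R + S) f = ratfun_scale R f + ratfun_scale S f"
    by (simp add: ratfun_scale_def ring_distribs)
  have "fls_of_ratfun (R * S) = fls_of_ratfun R * fls_of_ratfun S"
    by (cases R; cases S)
      (simp add: fls_of_ratfun_Fract fps_of_poly_mult fls_times_fps_to_fls)
  then show "ratfun_scale R (ratfun_scale S f) = ratfun_scale (R * S) f"
    by (simp add: ratfun_scale_def mult.assoc)
  show "ratfun_scale 1 f = f"
    by (simp add: ratfun_scale_def One_fract_def fls_of_ratfun_Fract)
qed

definition solves_qdiff_equation :: "complex \<Rightarrow> complex fps \<Rightarrow> bool" where
  "solves_qdiff_equation q h \<longleftrightarrow>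
     (\<exists>(N::nat) (c :: nat \<Rightarrow> complex poly fract) b. (\<exists>i\<le>N. c i \<noteq> 0) \<and>
        (\<Sum>i\<le>N. ratfun_scale (c i) (fps_to_fls (qshift_fps q i h))) = fls_of_ratfun b)"

definition qshift_space :: "complex \<Rightarrow> complex fps \<Rightarrow> complex fls set" where
  "qshift_space q h =
     module.span ratfun_scale (insert 1 (range (\<lambda>i. fps_to_fls (qshift_fps q i h))))"

text \<open>An operator \<open>b\<^sub>m \<sigma>\<^sub>q\<^sup>m + \<dots> + b\<^sub>0\<close> is given by the number \<open>m\<close> and the
  family \<open>b\<close> of its polynomial coefficients.\<close>

definition qop_fps :: "complex \<Rightarrow> nat \<Rightarrow> (nat \<Rightarrow> complex poly) \<Rightarrow> complex fps \<Rightarrow> complex fps" where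
  "qop_fps q m b h = (\<Sum>i\<le>m. fps_of_poly (b i) * qshift_fps q i h)"

definition qop_fun ::
    "complex \<Rightarrow> nat \<Rightarrow> (nat \<Rightarrow> complex poly) \<Rightarrow> (complex \<Rightarrow> complex) \<Rightarrow> complex \<Rightarrow> complex" where
  "qop_fun q m b f z = (\<Sum>i\<le>m. poly (b i) z * f (q ^ i * z))"


section \<open>Newton polygon and slopes\<close>

definition newton_polygon :: "nat \<Rightarrow> (nat \<Rightarrow> complex poly) \<Rightarrow> (real \<times> real) set" where
  "newton_polygon m b = convex hull
     (\<Union>i\<in>{i. i \<le> m \<and> b i \<noteq> 0}. {(of_nat i, of_int j) | j::int. j \<ge> int (order 0 (b i))})"

definition lower_boundary :: "(real \<times> real) set \<Rightarrow> (real \<times> real) set" where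
  "lower_boundary N = {(x, y) \<in> N. \<forall>y'. (x, y') \<in> N \<longrightarrow> y \<le> y'}"

definition consecutive_in :: "(real \<times> real) set \<Rightarrow> real \<times> real \<Rightarrow> real \<times> real \<Rightarrow> bool" where
  "consecutive_in V p p' \<longleftrightarrow> p \<in> V \<and> p' \<in> V \<and> fst p < fst p' \<and>
     \<not> (\<exists>p''\<in>V. fst p < fst p'' \<and> fst p'' < fst p')"

text \<open>The piecewise linear curve through the points of \<open>V\<close>, taken in the order of their
  abscissae.\<close>

definition polyline :: "(real \<times> real) set \<Rightarrow> (real \<times> real) set" where
  "polyline V = V \<union> \<Union> {closed_segment p p' | p p'. consecutive_in V p p'}"

definition spans_polyline :: "(real \<times> real) set \<Rightarrow> (real \<times> real) set \<Rightarrow> bool" where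
  "spans_polyline V C \<longleftrightarrow> finite V \<and> inj_on fst V \<and> polyline V = C"

definition newton_vertices :: "nat \<Rightarrow> (nat \<Rightarrow> complex poly) \<Rightarrow> (real \<times> real) set" where
  "newton_vertices m b = (THE V. spans_polyline V (lower_boundary (newton_polygon m b)) \<and>
     (\<forall>W. spans_polyline W (lower_boundary (newton_polygon m b)) \<longrightarrow> V \<subseteq> W))"

definition slopes :: "nat \<Rightarrow> (nat \<Rightarrow> complex poly) \<Rightarrow> real set" where
  "slopes m b =
     (if card (newton_vertices m b) \<le> 1 then {0}
      else {(snd p' - snd p) / (fst p' - fst p) | p p'.
              consecutive_in (newton_vertices m b) p p'})"

definition positive_slopes :: "nat \<Rightarrow> (nat \<Rightarrow> complex poly) \<Rightarrow> real set" where
  "positive_slopes m b = {s \<in> slopes m b. s \<in> \<rat> \<and> s > 0}"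


section \<open>Germs of meromorphic functions at the origin\<close>

text \<open>A germ is represented by a function on \<open>\<complex>\<close> of which only the values close to \<open>0\<close>, off a
  discrete set of points, matter: \<^const>\<open>meromorphic_on\<close> leaves the values at the
  points of a discrete set arbitrary, so all identities are stated cosparsely.\<close>

definition mero_germs0 :: "(complex \<Rightarrow> complex) set" where
  "mero_germs0 = {f. \<exists>\<delta>>0. f meromorphic_on (ball 0 \<delta> - {0})}"

text \<open>\<open>F\<close>, considered on \<open>\<Omega>\<close>, extends the germ of \<open>f\<close>.\<close>

definition extends_germ0 ::
    "complex set \<Rightarrow> (complex \<Rightarrow> complex) \<Rightarrow> (complex \<Rightarrow> complex) \<Rightarrow> bool" where
  "extends_germ0 \<Omega> F f \<longleftrightarrow> (\<exists>\<delta>>0. \<forall>\<^sub>\<approx>z\<in>\<Omega> \<inter> (ball 0 \<delta> - {0}). F z = f z)"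


section \<open>The \<open>q\<close>-Borel and \<open>q\<close>-Laplace transformations\<close>

definition Theta :: "complex \<Rightarrow> complex \<Rightarrow> complex" where
  "Theta p z = (\<Sum>\<^sub>\<infinity>l::int. p powi (- (l * (l + 1) div 2)) * z powi l)"

definition q_borel :: "complex \<Rightarrow> real \<Rightarrow> complex fps \<Rightarrow> complex fps" where
  "q_borel lq \<mu> h =
     Abs_fps (\<lambda>l. fps_nth h l * qpow lq (- (of_nat l * (of_nat l - 1) / (2 * \<mu>))))"

text \<open>\<open>F\<close> is an analytic continuation of the germ \<open>f\<close> as required in the definition of the
  domain of the \<open>q\<close>-Laplace transformation.  The origin, where the theta function is not
  defined, is exempt from the growth condition.\<close>

definition H_continuation ::
    "complex \<Rightarrow> real \<Rightarrow> nat \<Rightarrow> complex \<Rightarrow> (complex \<Rightarrow> complex) \<Rightarrow> (complex \<Rightarrow> complex) \<Rightarrow> bool" where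
  "H_continuation lq \<mu> K lam f F \<longleftrightarrow>
     (\<exists>\<epsilon>>0. \<exists>\<Omega>. open \<Omega> \<and> connected \<Omega> \<and>
        (\<Union>k::int. {z. z \<noteq> 0 \<and> norm (z - lam * qpow lq (of_int k / of_nat K))
                                < \<epsilon> * norm (qpow lq (of_int k / of_nat K) * lam)}) \<subseteq> \<Omega> \<and>
        F analytic_on \<Omega> \<and> extends_germ0 \<Omega> F f \<and>
        (\<exists>L>0. \<exists>M>0. \<forall>z\<in>\<Omega> - {0}.
           norm (F z) < L * norm (Theta (of_real (norm (exp lq) powr (1 / \<mu>)))
                                        (of_real (M * norm z)))))"

definition H_space ::
    "complex \<Rightarrow> real \<Rightarrow> nat \<Rightarrow> complex \<Rightarrow> (complex \<Rightarrow> complex) set" where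
  "H_space lq \<mu> K lam = {f \<in> mero_germs0. \<exists>F. H_continuation lq \<mu> K lam f F}"

definition q_laplace_term ::
    "complex \<Rightarrow> real \<Rightarrow> nat \<Rightarrow> complex \<Rightarrow> (complex \<Rightarrow> complex) \<Rightarrow> complex \<Rightarrow> int \<Rightarrow> complex" where
  "q_laplace_term lq \<mu> K lam f z k =
     (SOME F. H_continuation lq \<mu> K lam f F) (qpow lq (of_int k / of_nat K) * lam) /
       Theta (qpow lq (1 / \<mu>)) (qpow lq (1 / \<mu> + of_int k / of_nat K) * lam / z)"

definition q_laplace ::
    "complex \<Rightarrow> real \<Rightarrow> nat \<Rightarrow> complex \<Rightarrow> (complex \<Rightarrow> complex) \<Rightarrow> complex \<Rightarrow> complex" where
  "q_laplace lq \<mu> K lam f z = of_real (\<mu> / of_nat K) * (\<Sum>\<^sub>\<infinity>k. q_laplace_term lq \<mu> K lam f z k)"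

text \<open>The sum in \<^const>\<open>q_laplace\<close> is \<open>0\<close> by convention where the series diverges; the following
  says that this convention is not used close to the origin.\<close>

definition q_laplace_converges ::
    "complex \<Rightarrow> real \<Rightarrow> nat \<Rightarrow> complex \<Rightarrow> (complex \<Rightarrow> complex) \<Rightarrow> bool" where
  "q_laplace_converges lq \<mu> K lam f \<longleftrightarrow>
     (\<exists>\<delta>>0. \<forall>z. 0 < norm z \<and> norm z < \<delta> \<and>
        (\<forall>k::int. Theta (qpow lq (1 / \<mu>)) (qpow lq (1 / \<mu> + of_int k / of_nat K) * lam / z) \<noteq> 0)
        \<longrightarrow> q_laplace_term lq \<mu> K lam f z summable_on UNIV)"

text \<open>For \<open>\<kappa> = (\<kappa>\<^sub>1, \<kappa>\<^sub>2, \<dots>)\<close>: first the transformation of order \<open>\<kappa>\<^sub>r\<close> is applied in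
  the Borel case, and that of order \<open>\<kappa>\<^sub>1\<close> in the Laplace case.\<close>

definition iterated_borel :: "complex \<Rightarrow> (nat \<Rightarrow> real) \<Rightarrow> nat \<Rightarrow> complex fps \<Rightarrow> complex fps" where
  "iterated_borel lq \<kappa> r h = foldr (\<lambda>i. q_borel lq (\<kappa> i)) [1..<Suc r] h"

definition iterated_laplace ::
    "complex \<Rightarrow> (nat \<Rightarrow> real) \<Rightarrow> nat \<Rightarrow> complex \<Rightarrow> nat \<Rightarrow> (complex \<Rightarrow> complex) \<Rightarrow> complex \<Rightarrow> complex"
  where
  "iterated_laplace lq \<kappa> K lam i f = fold (\<lambda>j. q_laplace lq (\<kappa> j) K lam) [1..<Suc i] f"

end

theory Submission
  imports Defs
begin

text \<open>
  Let \<open>\<omega>\<close> be the \<open>K\<close>-th root \<open>qpow lq (1 / K)\<close> of \<open>q\<close>. Each monomial \<open>z\<^sup>j \<sigma>\<^sub>q\<^sup>i\<close> of the operator comes in a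
  family of versions, one for every integer level \<open>\<sigma>\<close>: a dilation by \<open>\<omega>\<close> to the power \<open>K i - \<sigma> j\<close>,
  followed by multiplication by \<open>z\<^sup>j\<close> and by a constant (\<open>qop_apply\<close>). Level \<open>0\<close> is the given equation.
  The formal Borel transformation of order \<open>\<kappa>\<close> raises the level by \<open>N = K / \<kappa>\<close>, and the Laplace
  transformation of the same order lowers it by \<open>N\<close>, because theta is quasi-periodic (\<open>lap_equation\<close>).
  Since the reciprocals of \<open>\<kappa>\<^sub>t, \<dots>, \<kappa>\<^sub>r\<close> add up to that of \<open>\<mu>\<^sub>t\<close>, the transforms pass through the levels
  \<open>K / \<mu>\<^sub>1 > \<dots> > K / \<mu>\<^sub>r > 0\<close>.

  Slopes enter through the exponents \<open>K i - \<sigma> j\<close>. At level \<open>\<sigma> = K s\<close> the terms for which this exponent is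
  maximal lie on a supporting line of the Newton polygon with inclination \<open>1 / s\<close>; two of them exist for
  a slope only (\<open>tie_imp_slope\<close>). Three consequences carry the proof.

  \<^item> There is no slope below \<open>\<mu>\<^sub>1\<close> among the positive ones. Hence at the top level the term with the lowest
    power of \<open>z\<close> also has the largest exponent, it dominates the recurrence for the coefficients, and the
    Borel transform converges (\<open>borel_radius_positive\<close>).

  \<^item> An equation of any level can be solved for the value with the largest dilation. A solution that is
    known near the origin therefore continues to \<open>\<complex>\<close> without the origin, with singularities only on the
    spirals through its own ones and through the roots of a polynomial, the coefficient of that
    value (\<open>qop_extend\<close>).

  \<^item> No slope lies between those that belong to consecutive levels \<open>\<sigma>\<close> and \<open>\<sigma> - N\<close>. Hence the coefficient of a value
    \<open>d\<close> steps back grows at most like \<open>\<bar>z\<bar>\<close> to the power \<open>d / N\<close>, and along spirals the solution grows at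
    most like a theta function with parameter \<open>\<omega>\<^sup>N\<close> (\<open>qop_growth\<close>). This is what the next Laplace
    transformation needs.

  So each Laplace transform, a quotient of Laurent series by theta functions that is defined near the
  origin at first, solves the equation of the next level, extends, and grows slowly enough to be
  transformed again (\<open>resummation_chain\<close>); after the last one the level is \<open>0\<close>. The poles of these quotients lie on the
  spiral of \<open>-\<lambda>\<close>, because theta vanishes on the powers of its parameter with negative sign only. This
  follows from Jacobi's triple product (\<open>Theta_nonzero\<close>). The choice of a continuation in the
  definition of the Laplace transformation is harmless: all continuations agree along the spiral of
  \<open>\<lambda>\<close> (\<open>H_continuation_unique\<close>). The exceptional classes are those of the spirals that carry the
  roots of the finitely many leading polynomials.
\<close>

section \<open>Newton polygons and their slopes\<close>

definition newton_points :: "nat \<Rightarrow> (nat \<Rightarrow> complex poly) \<Rightarrow> (real \<times> real) set" where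
  "newton_points m b = (\<lambda>i. (real i, real (order 0 (b i)))) ` {i. i \<le> m \<and> b i \<noteq> 0}"

lemma finite_newton_points: "finite (newton_points m b)"
  by (simp add: newton_points_def)

lemma newton_points_subset: "newton_points m b \<subseteq> newton_polygon m b"
proof -
  have "newton_points m b \<subseteq> (\<Union>i\<in>{i. i \<le> m \<and> b i \<noteq> 0}. {(of_nat i, of_int j) | j::int. j \<ge> int (order 0 (b i))})"
    unfolding newton_points_def by (force intro: exI[of _ "int _"])
  then show ?thesis
    unfolding newton_polygon_def by (rule order_trans) (rule hull_subset)
qed

lemma convex_newton_polygon: "convex (newton_polygon m b)"
  by (simp add: newton_polygon_def)

lemma newton_polygon_minimal:
  assumes "convex C" "\<And>x y y'. (x, y) \<in> newton_points m b \<Longrightarrow> y \<le> y' \<Longrightarrow> (x, y') \<in> C"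
  shows "newton_polygon m b \<subseteq> C"
  unfolding newton_polygon_def
proof (rule hull_minimal)
  show "(\<Union>i\<in>{i. i \<le> m \<and> b i \<noteq> 0}. {(of_nat i, of_int j) | j::int. j \<ge> int (order 0 (b i))}) \<subseteq> C"
  proof clarify
    fix i and j :: int assume "i \<le> m" "b i \<noteq> 0" "j \<ge> int (order 0 (b i))"
    then show "(of_nat i, of_int j) \<in> C"
      by (intro assms(2)[of _ "real (order 0 (b i))"]) (auto simp: newton_points_def)
  qed
qed (fact assms(1))

text \<open>The generating points have integral ordinates; the heights in between are reached by convexity.\<close>

lemma newton_polygon_up:
  assumes "(x, y) \<in> newton_polygon m b" "y \<le> y'"
  shows "(x, y') \<in> newton_polygon m b"
proof -
  let ?U = "\<Union>i\<in>{i. i \<le> m \<and> b i \<noteq> 0}. {(real i, real_of_int j) | j::int. j \<ge> int (order 0 (b i))}"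
  obtain k :: nat where k: "y' - y \<le> real k" "k > 0"
    by (metis gr0I less_eq_real_def of_nat_0 real_arch_simple order_trans zero_less_one of_nat_1)
  have "(\<lambda>v. (0, real k) + v) ` ?U \<subseteq> ?U"
  proof
    fix v assume "v \<in> (\<lambda>v. (0, real k) + v) ` ?U"
    then obtain i and j :: int where "i \<le> m" "b i \<noteq> 0" "j \<ge> int (order 0 (b i))"
      "v = (0, real k) + (real i, real_of_int j)" by auto
    then have "v = (real i, real_of_int (j + int k))" "j + int k \<ge> int (order 0 (b i))"
      by simp_all
    then have "v \<in> {(real i, real_of_int j) | j::int. j \<ge> int (order 0 (b i))}" by blast
    then show "v \<in> ?U" using \<open>i \<le> m\<close> \<open>b i \<noteq> 0\<close> by (intro UN_I[of i]) simp_all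
  qed
  then have "(\<lambda>v. (0, real k) + v) ` (convex hull ?U) \<subseteq> convex hull ?U"
    by (rule order_trans[OF eq_refl[OF convex_hull_translation[symmetric]] hull_mono])
  with assms(1) have "(0, real k) + (x, y) \<in> newton_polygon m b"
    unfolding newton_polygon_def by (meson image_subset_iff)
  then have 1: "(x, y + real k) \<in> newton_polygon m b" by (simp add: add.commute)
  define t where "t = (y' - y) / real k"
  have t: "0 \<le> t" "t \<le> 1" using assms k by (auto simp: t_def)
  have "(1 - t) *\<^sub>R (x, y) + t *\<^sub>R (x, y + real k) \<in> newton_polygon m b"
    using convexD[OF convex_newton_polygon assms(1) 1, of "1-t" t] t by simp
  also have "(1 - t) *\<^sub>R (x, y) + t *\<^sub>R (x, y + real k) = (x, y')"
  proof -
    have "(1 - t) * y + t * (y + real k) = y + t * real k" by (simp add: algebra_simps)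
    also have "\<dots> = y'" using k by (simp add: t_def)
    finally show ?thesis by (simp add: algebra_simps)
  qed
  finally show ?thesis .
qed

text \<open>The open half plane above a supporting line, with a convex part of the line added, is convex and
  closed upwards. So the polygon meets the line only in the convex hull of the generating points
  on it.\<close>

lemma newton_face:
  assumes above: "\<forall>x y. (x, y) \<in> newton_points m b \<longrightarrow> \<alpha> * x + \<beta> \<le> y"
    and face: "\<forall>x y. (x, y) \<in> newton_points m b \<longrightarrow> y = \<alpha> * x + \<beta> \<longrightarrow> x \<in> I"
    and I: "convex I" and v: "(x, y) \<in> newton_polygon m b"
  shows "\<alpha> * x + \<beta> < y \<or> (y = \<alpha> * x + \<beta> \<and> x \<in> I)"
proof -
  let ?C = "{(x, y). \<alpha> * x + \<beta> < y \<or> (y = \<alpha> * x + \<beta> \<and> x \<in> I)}"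
  have "convex ?C"
  proof (rule convexI)
    fix p p' :: "real \<times> real" and u v :: real
    assume pC: "p \<in> ?C" "p' \<in> ?C" and uv: "0 \<le> u" "0 \<le> v" "u + v = 1"
    obtain x y x' y' where pp: "p = (x, y)" "p' = (x', y')" by (cases p, cases p')
    have 1: "\<alpha> * x + \<beta> < y \<or> (y = \<alpha> * x + \<beta> \<and> x \<in> I)"
      and 2: "\<alpha> * x' + \<beta> < y' \<or> (y' = \<alpha> * x' + \<beta> \<and> x' \<in> I)"
      using pC pp by auto
    define d where "d = y - (\<alpha> * x + \<beta>)"
    define d' where "d' = y' - (\<alpha> * x' + \<beta>)"
    have y: "y = d + \<alpha> * x + \<beta>" "y' = d' + \<alpha> * x' + \<beta>" by (auto simp: d_def d'_def)
    have dd: "0 \<le> d" "0 \<le> d'" using 1 2 by (auto simp: d_def d'_def)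
    have eq: "u * y + v * y' = (u * d + v * d') + \<alpha> * (u * x + v * x') + \<beta>"
    proof -
      have "u * \<beta> + v * \<beta> = \<beta>" using uv by (metis mult_1 ring_class.ring_distribs(2))
      then show ?thesis unfolding y by (simp add: algebra_simps)
    qed
    show "u *\<^sub>R p + v *\<^sub>R p' \<in> ?C"
    proof (cases "u * d + v * d' > 0")
      case True then show ?thesis using eq unfolding pp by simp
    next
      case False
      then have z: "u * d = 0" "v * d' = 0" using dd uv
        by (smt (verit) mult_nonneg_nonneg)+
      have "u * x + v * x' \<in> I"
      proof -
        consider "u = 0" | "v = 0" | "d = 0" "d' = 0" using z by auto
        then show ?thesis
        proof cases
          case 3
          then have "x \<in> I" "x' \<in> I" using 1 2 by (auto simp: d_def d'_def)
          then show ?thesis using convexD[OF I _ _ uv(1,2,3)] by simp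
        next
          case 1 then have "v = 1" "d' = 0" using uv z by auto
          then show ?thesis using \<open>u = 0\<close> 2 by (auto simp: d'_def)
        next
          case 2 then have "u = 1" "d = 0" using uv z by auto
          then show ?thesis using \<open>v = 0\<close> 1 by (auto simp: d_def)
        qed
      qed
      then show ?thesis using eq z unfolding pp by simp
    qed
  qed
  then have "newton_polygon m b \<subseteq> ?C"
    by (rule newton_polygon_minimal) (use above face in fastforce)
  with v show ?thesis by auto
qed

lemma not_extreme_if_lower:
  assumes "(x, y') \<in> newton_polygon m b" "y' < y"
  shows "\<not> (x, y) extreme_point_of newton_polygon m b"
proof -
  have 1: "(x, y + (y - y')) \<in> newton_polygon m b"
    by (rule newton_polygon_up[OF assms(1)]) (use assms in auto)
  have "(x, y) \<in> open_segment (x, y') (x, y + (y - y'))"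
    using assms by (auto simp: in_segment intro!: exI[of _ "1/2"] simp: field_simps)
  then show ?thesis using assms(1) 1 by (auto simp: extreme_point_of_def)
qed

lemma extreme_newton_points:
  assumes "v extreme_point_of newton_polygon m b"
  shows "v \<in> newton_points m b"
proof -
  have "v \<in> (\<Union>i\<in>{i. i \<le> m \<and> b i \<noteq> 0}. {(of_nat i, of_int j) | j::int. j \<ge> int (order 0 (b i))})"
    using assms unfolding newton_polygon_def by (rule extreme_point_of_convex_hull)
  then obtain i and j :: int where ij: "i \<le> m" "b i \<noteq> 0" "j \<ge> int (order 0 (b i))" "v = (real i, of_int j)"
    by auto
  have "(real i, real (order 0 (b i))) \<in> newton_polygon m b"
    using ij newton_points_subset by (force simp: newton_points_def)
  then have "\<not> real (order 0 (b i)) < of_int j"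
    using assms not_extreme_if_lower unfolding ij(4) by blast
  then have "j = int (order 0 (b i))" using ij by linarith
  then show ?thesis using ij by (auto simp: newton_points_def)
qed

text \<open>The lowest point over an abscissa is found on the compact convex hull of the finitely many lowest
  generating points, above which the polygon lies.\<close>

lemma lower_boundary_exists:
  assumes "(x, y) \<in> newton_polygon m b"
  shows "\<exists>y'. (x, y') \<in> lower_boundary (newton_polygon m b)"
proof -
  let ?H = "convex hull newton_points m b"
  let ?C = "{(x, y). \<exists>y'\<le>y. (x, y') \<in> ?H}"
  have "convex ?C"
  proof (rule convexI)
    fix p p' :: "real \<times> real" and u v :: real
    assume pC: "p \<in> ?C" "p' \<in> ?C" and uv: "0 \<le> u" "0 \<le> v" "u + v = 1"
    from pC obtain x y x' y' y1 y2 where pp: "p = (x, y)" "p' = (x', y')"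
      "y1 \<le> y" "(x, y1) \<in> ?H" "y2 \<le> y'" "(x', y2) \<in> ?H" by auto
    then show "u *\<^sub>R p + v *\<^sub>R p' \<in> ?C"
      using uv convexD[OF convex_convex_hull, of "(x, y1)" _ "(x', y2)" u v]
      by (auto intro!: exI[of _ "u * y1 + v * y2"] add_mono mult_left_mono)
  qed
  then have sub: "newton_polygon m b \<subseteq> ?C"
    by (rule newton_polygon_minimal) (auto intro: hull_inc)
  then obtain y0 where y0: "(x, y0) \<in> ?H" using assms by auto
  have "?H \<subseteq> newton_polygon m b"
    by (rule hull_minimal) (simp_all add: newton_points_subset convex_newton_polygon)
  have "compact ({v. fst v = x} \<inter> ?H)"
    by (intro closed_Int_compact finite_imp_compact_convex_hull finite_newton_points closed_Collect_eq
          continuous_intros)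
  moreover have "{v. fst v = x} \<inter> ?H \<noteq> {}" using y0 by (intro Int_emptyI notI) (metis (mono_tags) IntI empty_iff fst_conv mem_Collect_eq)
  ultimately obtain v where v: "v \<in> {v. fst v = x} \<inter> ?H" "\<forall>w\<in>{v. fst v = x} \<inter> ?H. snd v \<le> snd w"
    using continuous_attains_inf[of "{v. fst v = x} \<inter> ?H" snd] continuous_on_snd[OF continuous_on_id]
    by blast
  have "(x, snd v) \<in> lower_boundary (newton_polygon m b)"
    unfolding lower_boundary_def
  proof (clarify, intro conjI allI impI)
    show "(x, snd v) \<in> newton_polygon m b" using v \<open>?H \<subseteq> _\<close> by (cases v) auto
    fix y' assume "(x, y') \<in> newton_polygon m b"
    with sub obtain y'' where "y'' \<le> y'" "(x, y'') \<in> ?H" by auto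
    then have "(x, y'') \<in> {v. fst v = x} \<inter> ?H" by simp
    with v(2) have "snd v \<le> snd (x, y'')" by (rule bspec)
    with \<open>y'' \<le> y'\<close> show "snd v \<le> y'" by simp
  qed
  then show ?thesis by blast
qed

lemma in_closed_segmentE:
  assumes "v \<in> closed_segment p p'"
  obtains u where "0 \<le> u" "u \<le> 1" "v = (1 - u) *\<^sub>R p + u *\<^sub>R p'"
  using assms by (auto simp only: in_segment)

text \<open>A point of a supporting line is interior only to segments of the polygon that stay on that line; so the
  two outermost points of contact are extreme. A vertex with an abscissa between them would lie above
  the segment that joins them, hence above another point of the polygon.\<close>

lemma support_line_edge:
  assumes above: "\<forall>x y. (x, y) \<in> newton_points m b \<longrightarrow> \<alpha> * x + \<beta> \<le> y"
    and p: "p \<in> newton_points m b" "snd p = \<alpha> * fst p + \<beta>"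
    and p': "p' \<in> newton_points m b" "snd p' = \<alpha> * fst p' + \<beta>"
    and between: "\<forall>x y. (x, y) \<in> newton_points m b \<longrightarrow> y = \<alpha> * x + \<beta> \<longrightarrow> fst p \<le> x \<and> x \<le> fst p'"
  shows "p extreme_point_of newton_polygon m b" "p' extreme_point_of newton_polygon m b"
    "fst p < fst p' \<Longrightarrow> consecutive_in {v. v extreme_point_of newton_polygon m b} p p'"
    "closed_segment p p' \<subseteq> lower_boundary (newton_polygon m b)"
proof -
  let ?N = "newton_polygon m b"
  have N: "p \<in> ?N" "p' \<in> ?N" using p p' newton_points_subset by auto
  obtain xp yp xp' yp' where pe: "p = (xp, yp)" "p' = (xp', yp')" by (cases p, cases p')
  have F: "\<alpha> * x + \<beta> < y \<or> (y = \<alpha> * x + \<beta> \<and> x \<in> {xp..xp'})" if "(x, y) \<in> ?N" for x y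
    by (rule newton_face[OF above _ _ that]) (use between pe in auto)
  have ends: "(x0, y0) extreme_point_of ?N" if x0: "(x0, y0) \<in> ?N" "y0 = \<alpha> * x0 + \<beta>"
       "x0 = xp \<or> x0 = xp'" for x0 y0
    unfolding extreme_point_of_def
  proof (intro conjI ballI notI x0(1))
    fix c d assume cd: "c \<in> ?N" "d \<in> ?N" "(x0, y0) \<in> open_segment c d"
    obtain cx cy dx dy where e: "c = (cx, cy)" "d = (dx, dy)" by (cases c, cases d)
    obtain u where u: "c \<noteq> d" "0 < u" "u < 1" "(x0, y0) = (1 - u) *\<^sub>R c + u *\<^sub>R d"
      using cd(3) unfolding in_segment by blast
    have 1: "x0 = (1 - u) * cx + u * dx" "y0 = (1 - u) * cy + u * dy" using u(4) e by auto
    have c: "\<alpha> * cx + \<beta> \<le> cy" "\<alpha> * dx + \<beta> \<le> dy" using F cd e by fastforce+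
    have "(1 - u) * (cy - (\<alpha> * cx + \<beta>)) + u * (dy - (\<alpha> * dx + \<beta>)) = y0 - (\<alpha> * x0 + \<beta>)"
      unfolding 1 by (simp add: algebra_simps)
    also have "\<dots> = 0" using x0 by simp
    finally have "cy = \<alpha> * cx + \<beta>" "dy = \<alpha> * dx + \<beta>"
      using c u by (smt (verit) mult_pos_pos mult_nonneg_nonneg)+
    moreover have "xp \<le> cx" "xp \<le> dx" "cx \<le> xp'" "dx \<le> xp'" 
      using F[of cx cy] F[of dx dy] cd e calculation by auto
    moreover have "(1 - u) * (cx - x0) + u * (dx - x0) = 0" using 1 by (simp add: algebra_simps)
    ultimately have "cx = x0 \<and> dx = x0" using x0(3) u(2,3)
      by (smt (verit) mult_pos_pos mult_nonneg_nonneg mult_pos_neg mult_nonneg_nonpos)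
    with \<open>cy = _\<close> \<open>dy = _\<close> u(1) e show False by auto
  qed
  show E: "p extreme_point_of ?N" "p' extreme_point_of ?N"
    using ends[of xp yp] ends[of xp' yp'] N p p' unfolding pe by auto
  have line: "snd v = \<alpha> * fst v + \<beta>" if "v \<in> closed_segment p p'" for v
  proof -
    from that obtain u where "v = (1 - u) *\<^sub>R p + u *\<^sub>R p'" by (rule in_closed_segmentE)
    then show ?thesis using p p' unfolding pe by (simp add: algebra_simps)
  qed
  have inN: "closed_segment p p' \<subseteq> ?N"
    by (rule closed_segment_subset[OF N convex_newton_polygon])
  show "closed_segment p p' \<subseteq> lower_boundary ?N"
    unfolding lower_boundary_def using line inN F by force
  show "consecutive_in {v. v extreme_point_of ?N} p p'" if lt: "fst p < fst p'"
    unfolding consecutive_in_def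
  proof (intro conjI notI)
    assume "\<exists>p''\<in>{v. v extreme_point_of ?N}. fst p < fst p'' \<and> fst p'' < fst p'"
    then obtain v where v: "v extreme_point_of ?N" "fst p < fst v" "fst v < fst p'" by auto
    define t where "t = (fst v - fst p) / (fst p' - fst p)"
    have t: "0 < t" "t < 1" using v lt by (auto simp: t_def field_simps)
    define w where "w = (1 - t) *\<^sub>R p + t *\<^sub>R p'"
    have "fst w = fst p + t * (fst p' - fst p)" by (simp add: w_def algebra_simps)
    also have "\<dots> = fst v" using lt by (simp add: t_def)
    finally have w: "fst w = fst v" .
    have "w \<in> open_segment p p'" using t lt unfolding in_segment w_def by auto
    moreover have "snd w = \<alpha> * fst w + \<beta>" 
      by (rule line) (use calculation in \<open>auto simp: open_segment_def\<close>)
    moreover have "w \<in> ?N" using inN calculation by (auto simp: open_segment_def)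
    moreover have "w \<noteq> v" using v(1) calculation N by (auto simp: extreme_point_of_def)
    moreover have "\<alpha> * fst v + \<beta> \<le> snd v" 
      using F[of "fst v" "snd v"] v(1) by (auto simp: extreme_point_of_def)
    ultimately have "snd w < snd v" using w by (metis less_eq_real_def prod.expand)
    then show False using not_extreme_if_lower[of "fst v" "snd w" m b "snd v"] v(1) w \<open>w \<in> ?N\<close>
      by (metis prod.collapse)
  qed (use E lt in auto)
qed

lemma support_line_ends:
  assumes "p0 \<in> newton_points m b" "snd p0 = \<alpha> * fst p0 + \<beta>"
  obtains p p' where "p \<in> newton_points m b" "snd p = \<alpha> * fst p + \<beta>"
    "p' \<in> newton_points m b" "snd p' = \<alpha> * fst p' + \<beta>"
    "\<forall>x y. (x, y) \<in> newton_points m b \<longrightarrow> y = \<alpha> * x + \<beta> \<longrightarrow> fst p \<le> x \<and> x \<le> fst p'"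
proof -
  let ?L = "{p \<in> newton_points m b. snd p = \<alpha> * fst p + \<beta>}"
  have fin: "finite ?L" "?L \<noteq> {}" using assms finite_newton_points by (simp, blast)
  have fin': "finite (fst ` ?L)" "fst ` ?L \<noteq> {}" using fin by auto
  obtain p where p: "p \<in> ?L" "\<forall>v\<in>?L. fst p \<le> fst v"
  proof -
    obtain p where "p \<in> ?L" "fst p = Min (fst ` ?L)" using Min_in[OF fin'] by (metis (no_types, lifting) imageE)
    then show ?thesis using Min_le[OF fin'(1)] by (intro that[of p]) (auto simp del: Min_le)
  qed
  obtain p' where p': "p' \<in> ?L" "\<forall>v\<in>?L. fst v \<le> fst p'"
  proof -
    obtain p where "p \<in> ?L" "fst p = Max (fst ` ?L)" using Max_in[OF fin'] by (metis (no_types, lifting) imageE)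
    then show ?thesis using Max_ge[OF fin'(1)] by (intro that[of p]) (auto simp del: Max_ge)
  qed
  show ?thesis by (rule that[of p p']) (use p p' in fastforce)+
qed

text \<open>Separate the polygon from the vertical ray below a boundary point that is not a vertex. The separating
  line passes through the point, and it is not vertical because the point is interior to a segment of
  the polygon that is not vertical. It therefore supports the polygon, along an edge.\<close>

lemma lower_boundary_cases:
  assumes v: "v \<in> lower_boundary (newton_polygon m b)"
    and ne: "\<not> v extreme_point_of newton_polygon m b"
  obtains p p' where "consecutive_in {v. v extreme_point_of newton_polygon m b} p p'"
    "closed_segment p p' \<subseteq> lower_boundary (newton_polygon m b)"
    "v \<in> closed_segment p p'" "fst p < fst v" "fst v < fst p'"
proof -
  let ?N = "newton_polygon m b"
  obtain x y where xy: "v = (x, y)" by (cases v)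
  have vN: "(x, y) \<in> ?N" and low: "\<And>y'. (x, y') \<in> ?N \<Longrightarrow> y \<le> y'"
    using v by (auto simp: lower_boundary_def xy)
  obtain c d where cd: "c \<in> ?N" "d \<in> ?N" "(x, y) \<in> open_segment c d"
    using ne vN unfolding extreme_point_of_def xy by auto
  obtain cx cy dx dy where e: "c = (cx, cy)" "d = (dx, dy)" by (cases c, cases d)
  obtain u where u: "c \<noteq> d" "0 < u" "u < 1" "(x, y) = (1 - u) *\<^sub>R c + u *\<^sub>R d"
    using cd(3) unfolding in_segment by blast
  have 1: "x = (1 - u) * cx + u * dx" "y = (1 - u) * cy + u * dy" using u(4) e by auto
  have "cx \<noteq> dx"
  proof
    assume eq: "cx = dx"
    then have "cx = x" using 1 by (simp add: algebra_simps)
    then have "y \<le> cy" "y \<le> dy" using low cd e eq by auto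
    moreover have "(1 - u) * (cy - y) + u * (dy - y) = 0" using 1 by (simp add: algebra_simps)
    ultimately have "cy = y" "dy = y" using u by (smt (verit) mult_pos_pos mult_nonneg_nonneg)+
    with eq u(1) e show False by simp
  qed
  have S: "convex {(x', y'). x' = x \<and> y' < y}"
  proof -
    have "{(x', y'). x' = x \<and> y' < y} = {x} \<times> {..<y}" by auto
    then show ?thesis by (simp add: convex_Times)
  qed
  have "{(x', y'). x' = x \<and> y' < y} \<inter> ?N = {}" using low by fastforce
  moreover have "(x, y - 1) \<in> {(x', y'). x' = x \<and> y' < y}" by auto
  ultimately obtain a and \<gamma> :: real where a: "a \<noteq> 0" "\<forall>v\<in>{(x', y'). x' = x \<and> y' < y}. a \<bullet> v \<le> \<gamma>"
     "\<forall>v\<in>?N. a \<bullet> v \<ge> \<gamma>"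
    using separating_hyperplane_sets[OF S convex_newton_polygon[of m b]] vN
    by (metis (no_types, lifting) empty_iff)
  obtain a1 a2 where a12: "a = (a1, a2)" by (cases a)
  have below: "a1 * x + a2 * y' \<le> \<gamma>" if "y' < y" for y' using a(2) that a12 by auto
  have aN: "\<gamma> \<le> a1 * x' + a2 * y'" if "(x', y') \<in> ?N" for x' y' using a(3) that a12 by auto
  have tch: "a1 * x + a2 * y = \<gamma>"
  proof (rule antisym)
    have "((\<lambda>t. a1 * x + a2 * t) \<longlongrightarrow> a1 * x + a2 * y) (at_left y)" by (intro tendsto_intros)
    moreover have "\<forall>\<^sub>F t in at_left y. a1 * x + a2 * t \<le> \<gamma>"
      by (rule eventually_mono[OF eventually_at_left_real[of "y - 1" y]]) (auto intro: below)
    ultimately show "a1 * x + a2 * y \<le> \<gamma>" using tendsto_upperbound trivial_limit_at_left_real by blast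
    show "\<gamma> \<le> a1 * x + a2 * y" by (rule aN[OF vN])
  qed
  have a2: "a2 \<ge> 0" using below[of "y - 1"] tch by (simp add: algebra_simps)
  have "a2 \<noteq> 0"
  proof
    assume z: "a2 = 0"
    then have a1: "a1 \<noteq> 0" using a(1) a12 by (auto simp: zero_prod_def)
    have "a1 * (cx - x) \<ge> 0" "a1 * (dx - x) \<ge> 0" using aN[of cx cy] aN[of dx dy] cd e tch z by (auto simp: algebra_simps)
    moreover have "(1 - u) * (a1 * (cx - x)) + u * (a1 * (dx - x)) = 0" unfolding 1 by (simp add: algebra_simps)
    ultimately have "a1 * (cx - x) = 0" "a1 * (dx - x) = 0" using u by (smt (verit) mult_pos_pos mult_nonneg_nonneg)+
    then show False using a1 \<open>cx \<noteq> dx\<close> by simp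
  qed
  with a2 have pos: "a2 > 0" by simp
  define \<alpha> where "\<alpha> = - a1 / a2"
  define \<beta> where "\<beta> = \<gamma> / a2"
  have above: "\<alpha> * x' + \<beta> \<le> y'" if "(x', y') \<in> ?N" for x' y'
    using aN[OF that] pos by (simp add: \<alpha>_def \<beta>_def field_simps)
  have on: "y = \<alpha> * x + \<beta>" using tch pos by (simp add: \<alpha>_def \<beta>_def field_simps)
  have above': "\<forall>x y. (x, y) \<in> newton_points m b \<longrightarrow> \<alpha> * x + \<beta> \<le> y"
    using above newton_points_subset by blast
  have "\<exists>p0. p0 \<in> newton_points m b \<and> snd p0 = \<alpha> * fst p0 + \<beta>"
  proof (rule ccontr)
    assume "\<nexists>p0. p0 \<in> newton_points m b \<and> snd p0 = \<alpha> * fst p0 + \<beta>"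
    then have "\<forall>x y. (x, y) \<in> newton_points m b \<longrightarrow> y = \<alpha> * x + \<beta> \<longrightarrow> x \<in> {}" by force
    from newton_face[OF above' this convex_empty vN] on show False by auto
  qed
  then obtain p0 where "p0 \<in> newton_points m b" "snd p0 = \<alpha> * fst p0 + \<beta>" by blast
  from support_line_ends[OF this] obtain p p' where
    p: "p \<in> newton_points m b" "snd p = \<alpha> * fst p + \<beta>"
    and p': "p' \<in> newton_points m b" "snd p' = \<alpha> * fst p' + \<beta>"
    and btw: "\<forall>x y. (x, y) \<in> newton_points m b \<longrightarrow> y = \<alpha> * x + \<beta> \<longrightarrow> fst p \<le> x \<and> x \<le> fst p'"
    by metis
  note E = support_line_edge[OF above' p p' btw]
  have "x \<in> {fst p..fst p'}"
    using newton_face[OF above' _ _ vN, of "{fst p..fst p'}"] btw on by fastforce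
  moreover have "fst p \<noteq> x" using E(1) ne p(2) on xy by (metis prod.collapse)
  moreover have "fst p' \<noteq> x" using E(2) ne p'(2) on xy by (metis prod.collapse)
  ultimately have x: "fst p < x" "x < fst p'" by auto
  define t where "t = (x - fst p) / (fst p' - fst p)"
  have t: "0 < t" "t < 1" using x by (auto simp: t_def field_simps)
  have fx: "(1 - t) * fst p + t * fst p' = x"
  proof -
    have "(1 - t) * fst p + t * fst p' = fst p + t * (fst p' - fst p)" by (simp add: algebra_simps)
    also have "\<dots> = x" using x by (simp add: t_def)
    finally show ?thesis .
  qed
  have "(1 - t) * snd p + t * snd p' = \<alpha> * ((1 - t) * fst p + t * fst p') + \<beta>"
    unfolding p p' by (simp add: algebra_simps)
  then have "v = (1 - t) *\<^sub>R p + t *\<^sub>R p'"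
    unfolding xy using fx on by (simp add: prod_eq_iff)
  then have "v \<in> closed_segment p p'" using t unfolding in_segment by (intro exI[of _ t]) auto
  then show ?thesis using that[of p p'] E x xy by auto
qed

text \<open>The lower boundary is the polyline through the extreme points, and an extreme point, not being interior
  to a segment, belongs to every set that spans this polyline. In particular the least spanning set
  exists, so that the definite description in the definition of the vertices is justified.\<close>

lemma newton_vertices_extreme:
  "newton_vertices m b = {v. v extreme_point_of newton_polygon m b}"
proof -
  let ?N = "newton_polygon m b" and ?V = "{v. v extreme_point_of newton_polygon m b}"
  have inj: "inj_on fst ?V"
  proof (rule inj_onI)
    fix v w assume "v \<in> ?V" "w \<in> ?V" and eq: "fst v = fst w"
    then have "v extreme_point_of ?N" "w extreme_point_of ?N" "v \<in> ?N" "w \<in> ?N"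
      by (simp_all add: extreme_point_of_def)
    then have "\<not> snd v < snd w" "\<not> snd w < snd v"
      using not_extreme_if_lower[of "fst v" "snd v" m b "snd w"]
        not_extreme_if_lower[of "fst w" "snd w" m b "snd v"] eq by (metis prod.collapse)+
    with eq show "v = w" by (simp add: prod_eq_iff)
  qed
  have "?V \<subseteq> newton_points m b" using extreme_newton_points by auto
  then have fin: "finite ?V" using finite_newton_points finite_subset by blast
  have VL: "?V \<subseteq> lower_boundary ?N"
  proof
    fix v assume v: "v \<in> ?V"
    then have "snd v \<le> y'" if "(fst v, y') \<in> ?N" for y'
      using not_extreme_if_lower[OF that, of "snd v"] by force
    with v show "v \<in> lower_boundary ?N" by (auto simp: lower_boundary_def extreme_point_of_def)
  qed
  have seg: "closed_segment p p' \<subseteq> lower_boundary ?N" if cons: "consecutive_in ?V p p'" for p p'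
  proof -
    let ?c = "(1/2) *\<^sub>R p + (1/2) *\<^sub>R p'"
    have pp: "p \<in> ?V" "p' \<in> ?V" "fst p < fst p'" 
      and nb: "\<And>v. v \<in> ?V \<Longrightarrow> fst p < fst v \<Longrightarrow> fst v < fst p' \<Longrightarrow> False"
      using cons by (auto simp: consecutive_in_def)
    have "?c \<in> ?N" using convexD[OF convex_newton_polygon, of p m b p' "1/2" "1/2"] pp 
      by (auto simp: extreme_point_of_def)
    then obtain y where y: "(fst ?c, y) \<in> lower_boundary ?N" 
      using lower_boundary_exists[of "fst ?c" "snd ?c" m b] by (simp only: prod.collapse) blast
    have c: "fst p < fst ?c" "fst ?c < fst p'" using pp by auto
    then have "\<not> (fst ?c, y) extreme_point_of ?N" using nb by fastforce
    from lower_boundary_cases[OF y this] obtain v w where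
      vw: "consecutive_in ?V v w" "closed_segment v w \<subseteq> lower_boundary ?N" "fst v < fst ?c" "fst ?c < fst w"
      by (metis fst_conv)
    have V: "v \<in> ?V" "w \<in> ?V" and nb': "\<And>u. u \<in> ?V \<Longrightarrow> fst v < fst u \<Longrightarrow> fst u < fst w \<Longrightarrow> False"
      using vw by (auto simp: consecutive_in_def)
    have "fst v = fst p" using nb[OF V(1)] nb'[OF pp(1)] c vw(3,4) by argo
    moreover have "fst w = fst p'" using nb[OF V(2)] nb'[OF pp(2)] c vw(3,4) by argo
    ultimately have "v = p" "w = p'" using inj V pp by (auto dest: inj_onD)
    with vw(2) show ?thesis by simp
  qed
  have span: "spans_polyline ?V (lower_boundary ?N)"
    unfolding spans_polyline_def
  proof (intro conjI fin inj subset_antisym)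
    show "polyline ?V \<subseteq> lower_boundary ?N" unfolding polyline_def using VL seg by blast
    show "lower_boundary ?N \<subseteq> polyline ?V"
    proof
      fix v assume v: "v \<in> lower_boundary ?N"
      show "v \<in> polyline ?V"
      proof (cases "v \<in> ?V")
        case False
        then have "\<not> v extreme_point_of ?N" by simp
        from lower_boundary_cases[OF v this] obtain p p'
          where "consecutive_in ?V p p'" "v \<in> closed_segment p p'" by metis
        then show ?thesis unfolding polyline_def by blast
      qed (auto simp: polyline_def)
    qed
  qed
  have min: "?V \<subseteq> W" if W: "spans_polyline W (lower_boundary ?N)" for W
  proof
    fix v assume v: "v \<in> ?V"
    show "v \<in> W"
    proof (rule ccontr)
      assume nv: "v \<notin> W"
      have "v \<in> polyline W" using W v VL unfolding spans_polyline_def by blast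
      then obtain p p' where "p \<in> W" "p' \<in> W" "v \<in> closed_segment p p'"
        using nv by (auto simp: polyline_def consecutive_in_def)
      moreover have "W \<subseteq> ?N" using W by (auto simp: spans_polyline_def polyline_def lower_boundary_def)
      moreover have "v \<in> open_segment p p'" using calculation nv by (auto simp: open_segment_def)
      ultimately show False using v by (auto simp: extreme_point_of_def)
    qed
  qed
  show ?thesis unfolding newton_vertices_def
    by (rule the_equality) (use span min in auto)
qed

lemma slope_rational: "s \<in> slopes m b \<Longrightarrow> s \<in> \<rat>"
proof -
  have nat: "fst p \<in> \<rat>" "snd p \<in> \<rat>" if "p \<in> newton_vertices m b" for p
    using that extreme_newton_points by (fastforce simp: newton_vertices_extreme newton_points_def)+
  then show "s \<in> slopes m b \<Longrightarrow> s \<in> \<rat>"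
    by (auto simp: slopes_def consecutive_in_def split: if_splits)
qed

definition op_support :: "nat \<Rightarrow> (nat \<Rightarrow> complex poly) \<Rightarrow> (nat \<times> nat) set" where
  "op_support m b = {(i, j). i \<le> m \<and> coeff (b i) j \<noteq> 0}"

lemma finite_op_support: "finite (op_support m b)"
proof -
  have "op_support m b \<subseteq> (SIGMA i:{..m}. {..degree (b i)})"
    by (auto simp: op_support_def le_degree)
  then show ?thesis by (rule finite_subset) auto
qed

lemma coeff_order_0: "coeff p (order 0 p) \<noteq> 0" if "p \<noteq> 0" for p :: "complex poly"
proof -
  obtain r where r: "p = [:- 0, 1:] ^ order 0 p * r" "\<not> [:-0, 1:] dvd r"
    by (rule exE[OF order_decomp[OF \<open>p \<noteq> 0\<close>, of 0]]) blast
  have "coeff r 0 \<noteq> 0" using r(2) poly_eq_0_iff_dvd[of r 0] by (simp add: poly_0_coeff_0)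
  moreover have "coeff ([:- 0, 1:] ^ order 0 p * r) (order 0 p) = coeff r 0"
    using coeff_monom_mult[of 1 "order 0 p" r "order 0 p"] by (simp add: monom_altdef)
  ultimately show ?thesis using r(1) by metis
qed

lemma order_0_le: "order 0 p \<le> j" if "coeff p j \<noteq> 0" for p :: "complex poly"
proof (rule ccontr)
  assume less: "\<not> order 0 p \<le> j"
  obtain r where r: "p = [:- 0, 1:] ^ order 0 p * r" 
    using order_1[of 0 p] by (metis dvdE)
  have "coeff ([:- 0, 1:] ^ order 0 p * r) j = 0"
    using coeff_monom_mult[of 1 "order 0 p" r j] less by (simp add: monom_altdef)
  with r that show False by metis
qed

text \<open>The exponents \<open>i - s j\<close> are, up to a factor, those of the dilations that occur at the level belonging
  to \<open>s\<close>. Two monomials sharing the largest exponent are contact points of a supporting line of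
  inclination \<open>1 / s\<close>.\<close>

lemma tie_imp_slope:
  assumes s: "s > 0"
    and max: "\<And>i j. (i, j) \<in> op_support m b \<Longrightarrow> real i - s * real j \<le> D"
    and t1: "(i1, j1) \<in> op_support m b" "real i1 - s * real j1 = D"
    and t2: "(i2, j2) \<in> op_support m b" "real i2 - s * real j2 = D"
    and ne: "j1 < j2"
  shows "1 / s \<in> positive_slopes m b"
proof -
  have above: "\<forall>x y. (x, y) \<in> newton_points m b \<longrightarrow> 1 / s * x + (- D / s) \<le> y"
  proof (intro allI impI)
    fix x y assume "(x, y) \<in> newton_points m b"
    then obtain i where i: "i \<le> m" "b i \<noteq> 0" "x = real i" "y = real (order 0 (b i))"
      by (auto simp: newton_points_def)
    have "real i - s * real (order 0 (b i)) \<le> D"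
      by (rule max) (use i coeff_order_0 in \<open>auto simp: op_support_def\<close>)
    then have "(real i - D) / s \<le> real (order 0 (b i))"
      using s by (subst pos_divide_le_eq) (auto simp: mult.commute)
    then show "1 / s * x + (- D / s) \<le> y" using i by (simp add: diff_divide_distrib)
  qed
  have tie: "(real i, real j) \<in> newton_points m b" "real j = 1 / s * real i + (- D / s)"
    if "(i, j) \<in> op_support m b" "real i - s * real j = D" for i j
  proof -
    have i: "i \<le> m" "b i \<noteq> 0" "order 0 (b i) \<le> j" using that order_0_le by (auto simp: op_support_def)
    have "real j = (real i - D) / s"
      using that(2) s by (subst eq_divide_eq) (simp add: algebra_simps)
    then show eq: "real j = 1 / s * real i + (- D / s)" by (simp add: diff_divide_distrib)
    have "real i - s * real (order 0 (b i)) \<le> D"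
      by (rule max) (use i coeff_order_0 in \<open>auto simp: op_support_def\<close>)
    then have "s * real j \<le> s * real (order 0 (b i))" using that by simp
    then have "j = order 0 (b i)" using s i by simp
    then show "(real i, real j) \<in> newton_points m b" using i by (auto simp: newton_points_def)
  qed
  obtain p p' where p: "p \<in> newton_points m b" "snd p = 1 / s * fst p + (- D / s)"
    and p': "p' \<in> newton_points m b" "snd p' = 1 / s * fst p' + (- D / s)"
    and btw: "\<forall>x y. (x, y) \<in> newton_points m b \<longrightarrow> y = 1 / s * x + (- D / s) \<longrightarrow> fst p \<le> x \<and> x \<le> fst p'"
    using support_line_ends[of "(real i1, real j1)" m b "1 / s" "- D / s"] tie[OF t1]
    unfolding fst_conv snd_conv by metis
  note E = support_line_edge[OF above p p' btw]
  have "real i1 < real i2" using t1(2) t2(2) ne s by (smt (verit) mult_strict_left_mono of_nat_less_iff)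
  then have lt: "fst p < fst p'" using btw[rule_format, OF tie[OF t1]] btw[rule_format, OF tie[OF t2]] by linarith
  note cons = E(3)[OF lt, folded newton_vertices_extreme]
  have "finite (newton_vertices m b)"
    using extreme_newton_points finite_newton_points[of m b] unfolding newton_vertices_extreme
    by (metis finite_subset mem_Collect_eq subsetI)
  moreover have "p \<in> newton_vertices m b" "p' \<in> newton_vertices m b" "p \<noteq> p'"
    using E lt by (auto simp: newton_vertices_extreme)
  ultimately have "\<not> card (newton_vertices m b) \<le> 1" 
    using card_le_Suc0_iff_eq by auto
  then have "(snd p' - snd p) / (fst p' - fst p) \<in> slopes m b"
    using cons unfolding slopes_def by (simp only: if_False) blast
  moreover have "(snd p' - snd p) / (fst p' - fst p) = 1 / s"
  proof -
    have "snd p' - snd p = (fst p' - fst p) * (1 / s)" unfolding p p' by (simp add: algebra_simps diff_divide_distrib)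
    then show ?thesis using lt by simp
  qed
  ultimately show ?thesis using slope_rational s by (auto simp: positive_slopes_def)
qed

text \<open>Decreasing \<open>s\<close> favours monomials with large \<open>j\<close>. One that ends up ahead of the uppermost maximiser must
  have drawn level with it, and the first time that any monomial does so there is a tie of
  maximisers.\<close>

lemma steepest_vertex_persists:
  fixes S :: "(nat \<times> nat) set"
  assumes "finite S" and v: "(i0, j0) \<in> S" and "s0 < s1"
    and max: "\<And>i j. (i, j) \<in> S \<Longrightarrow> real i - s1 * real j \<le> real i0 - s1 * real j0"
    and top: "\<And>i j. (i, j) \<in> S \<Longrightarrow> real i - s1 * real j = real i0 - s1 * real j0 \<Longrightarrow> j \<le> j0"
    and no_tie: "\<And>s i j. s0 < s \<Longrightarrow> s < s1 \<Longrightarrow> (i, j) \<in> S \<Longrightarrow> j0 < j \<Longrightarrow>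
        real i - s * real j = real i0 - s * real j0 \<Longrightarrow>
        (\<forall>i' j'. (i', j') \<in> S \<longrightarrow> real i' - s * real j' \<le> real i0 - s * real j0) \<Longrightarrow> False"
    and ij: "(i, j) \<in> S"
  shows "real i - s0 * real j \<le> real i0 - s0 * real j0"
proof (rule ccontr)
  assume neg: "\<not> ?thesis"
  \<comment> \<open>the value of \<open>s\<close> at which \<open>(i, j)\<close> catches up; the largest one is the tie\<close>
  define c where "c = (\<lambda>(i :: nat, j :: nat). (real i - real i0) / (real j - real j0))"
  define U where "U = {(i, j) \<in> S. j0 < j}"
  have small: "real i' - s * real j' \<le> real i0 - s * real j0" if "(i', j') \<in> S" "j' \<le> j0" "s \<le> s1" for i' j' s
  proof -
    have "(s1 - s) * (real j0 - real j') \<ge> 0" using that by simp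
    then show ?thesis using max[OF that(1)] by (simp add: algebra_simps)
  qed
  have "j0 < j" using small[OF ij, of s0] neg \<open>s0 < s1\<close> by force
  then have ijU: "(i, j) \<in> U" using ij by (simp add: U_def)
  have "U \<subseteq> S" by (auto simp: U_def)
  then have fin: "finite (c ` U)" using \<open>finite S\<close> finite_subset by blast
  define s where "s = Max (c ` U)"
  have "s \<in> c ` U" unfolding s_def by (rule Max_in[OF fin]) (use ijU in auto)
  then obtain i1 j1 where 1: "(i1, j1) \<in> S" "j0 < j1" "s = (real i1 - real i0) / (real j1 - real j0)"
    by (auto simp: U_def c_def)
  have "c (i, j) \<le> s" unfolding s_def by (rule Max_ge[OF fin]) (use ijU in auto)
  moreover have "s0 < c (i, j)" using neg \<open>j0 < j\<close> by (simp add: c_def pos_less_divide_eq algebra_simps)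
  ultimately have "s0 < s" by simp
  moreover have "s < s1"
  proof -
    have "real i1 - s1 * real j1 < real i0 - s1 * real j0"
      using max[OF 1(1)] top[OF 1(1)] 1(2) by fastforce
    then show ?thesis using 1 by (simp add: pos_divide_less_eq algebra_simps)
  qed
  moreover have "real i1 - s * real j1 = real i0 - s * real j0"
  proof -
    have "s * (real j1 - real j0) = real i1 - real i0" using 1 by simp
    then show ?thesis by (simp add: algebra_simps)
  qed
  moreover have "real i' - s * real j' \<le> real i0 - s * real j0" if "(i', j') \<in> S" for i' j'
  proof (cases "j' \<le> j0")
    case True then show ?thesis using small[OF that True] \<open>s < s1\<close> by simp
  next
    case False
    then have "c (i', j') \<le> s" unfolding s_def using that by (intro Max_ge[OF fin]) (auto simp: U_def)
    then show ?thesis using False by (simp add: c_def pos_divide_le_eq algebra_simps)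
  qed
  ultimately show False using no_tie 1 by blast
qed

text \<open>Here \<open>s\<close> increases without bound, so that a monomial with smaller \<open>j\<close> would overtake the lowest
  maximiser eventually, and the first monomial to do so would produce a tie.\<close>

lemma lowest_vertex_minimal:
  fixes S :: "(nat \<times> nat) set"
  assumes "finite S" and v: "(i0, j0) \<in> S"
    and max: "\<And>i j. (i, j) \<in> S \<Longrightarrow> real i - s1 * real j \<le> real i0 - s1 * real j0"
    and bot: "\<And>i j. (i, j) \<in> S \<Longrightarrow> real i - s1 * real j = real i0 - s1 * real j0 \<Longrightarrow> j0 \<le> j"
    and no_tie: "\<And>s i j. s1 < s \<Longrightarrow> (i, j) \<in> S \<Longrightarrow> j < j0 \<Longrightarrow>
        real i - s * real j = real i0 - s * real j0 \<Longrightarrow>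
        (\<forall>i' j'. (i', j') \<in> S \<longrightarrow> real i' - s * real j' \<le> real i0 - s * real j0) \<Longrightarrow> False"
    and ij: "(i, j) \<in> S"
  shows "j0 \<le> j"
proof (rule ccontr)
  assume neg: "\<not> ?thesis"
  \<comment> \<open>the value of \<open>s\<close> at which \<open>(i, j)\<close> catches up; the first one is the tie\<close>
  define c where "c = (\<lambda>(i :: nat, j :: nat). (real i0 - real i) / (real j0 - real j))"
  define U where "U = {(i, j) \<in> S. j < j0}"
  have large: "real i' - s * real j' \<le> real i0 - s * real j0" if "(i', j') \<in> S" "j0 \<le> j'" "s1 \<le> s" for i' j' s
  proof -
    have "(s - s1) * (real j' - real j0) \<ge> 0" using that by simp
    then show ?thesis using max[OF that(1)] by (simp add: algebra_simps)
  qed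
  have ijU: "(i, j) \<in> U" using ij neg by (simp add: U_def)
  have "U \<subseteq> S" by (auto simp: U_def)
  then have fin: "finite (c ` U)" using \<open>finite S\<close> finite_subset by blast
  define s where "s = Min (c ` U)"
  have "s \<in> c ` U" unfolding s_def by (rule Min_in[OF fin]) (use ijU in auto)
  then obtain i1 j1 where 1: "(i1, j1) \<in> S" "j1 < j0" "s = (real i0 - real i1) / (real j0 - real j1)"
    by (auto simp: U_def c_def)
  have "s1 < s"
  proof -
    have "real i1 - s1 * real j1 < real i0 - s1 * real j0"
      using max[OF 1(1)] bot[OF 1(1)] 1(2) by fastforce
    then show ?thesis using 1 by (simp add: pos_less_divide_eq algebra_simps)
  qed
  moreover have "real i1 - s * real j1 = real i0 - s * real j0"
  proof -
    have "s * (real j0 - real j1) = real i0 - real i1" using 1 by simp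
    then show ?thesis by (simp add: algebra_simps)
  qed
  moreover have "real i' - s * real j' \<le> real i0 - s * real j0" if "(i', j') \<in> S" for i' j'
  proof (cases "j0 \<le> j'")
    case True then show ?thesis using large[OF that True] \<open>s1 < s\<close> by simp
  next
    case False
    then have "s \<le> c (i', j')" unfolding s_def using that by (intro Min_le[OF fin]) (auto simp: U_def)
    then show ?thesis using False by (simp add: c_def pos_le_divide_eq algebra_simps)
  qed
  ultimately show False using no_tie 1 by blast
qed

section \<open>Sums over the integers\<close>

lemma UNIV_int_split: "(UNIV :: int set) = range int \<union> range (\<lambda>n. - int n - 1)"
proof -
  have "x \<in> range int \<union> range (\<lambda>n. - int n - 1)" for x
  proof (cases "0 \<le> x")
    case True then have "x = int (nat x)" by simp
    then show ?thesis by blast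
  next
    case False then have "x = - int (nat (- x - 1)) - 1" by simp
    then show ?thesis by blast
  qed
  then show ?thesis by blast
qed

lemma abs_summable_int:
  fixes f :: "int \<Rightarrow> 'a :: banach"
  assumes "summable (\<lambda>n. norm (f (int n)))" "summable (\<lambda>n. norm (f (- int n - 1)))"
  shows "(\<lambda>l. norm (f l)) summable_on UNIV"
  unfolding UNIV_int_split
proof (rule summable_on_Un_disjoint)
  show "(\<lambda>x. norm (f x)) summable_on range int"
    using assms(1) by (subst summable_on_reindex) (auto simp: o_def summable_on_UNIV_nonneg_real_iff)
  show "(\<lambda>x. norm (f x)) summable_on range (\<lambda>n. - int n - 1)"
    using assms(2) by (subst summable_on_reindex) (auto simp: o_def summable_on_UNIV_nonneg_real_iff inj_on_def)
qed auto

lemma abs_summable_intD: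
  fixes f :: "int \<Rightarrow> 'a :: banach"
  assumes "(\<lambda>l. norm (f l)) summable_on UNIV"
  shows "summable (\<lambda>n. norm (f (int n)))" "summable (\<lambda>n. norm (f (- int n - 1)))"
    "infsum f UNIV = (\<Sum>n. f (int n)) + (\<Sum>n. f (- int n - 1))"
proof -
  have s: "(\<lambda>x. norm (f x)) summable_on range int" "(\<lambda>x. norm (f x)) summable_on range (\<lambda>n. - int n - 1)"
    using assms summable_on_subset_banach by blast+
  have inj: "inj int" "inj (\<lambda>n. - int n - 1)" by (auto simp: inj_on_def)
  show 1: "summable (\<lambda>n. norm (f (int n)))" "summable (\<lambda>n. norm (f (- int n - 1)))"
    using s unfolding summable_on_reindex[OF inj(1)] summable_on_reindex[OF inj(2)] o_def
    by (auto simp: summable_on_UNIV_nonneg_real_iff)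
  have f: "f summable_on range int" "f summable_on range (\<lambda>n. - int n - 1)"
    using s abs_summable_summable by blast+
  have "infsum f UNIV = infsum f (range int) + infsum f (range (\<lambda>n. - int n - 1))"
    unfolding UNIV_int_split by (rule infsum_Un_disjoint[OF f]) auto
  also have "infsum f (range int) = infsum (\<lambda>n. f (int n)) UNIV"
    by (simp add: infsum_reindex[OF inj(1)] o_def)
  also have "\<dots> = (\<Sum>n. f (int n))"
    using norm_summable_imp_has_sum[OF 1(1) summable_sums[OF summable_norm_cancel[OF 1(1)]]] by (rule infsumI)
  also have "infsum f (range (\<lambda>n. - int n - 1)) = infsum (\<lambda>n. f (- int n - 1)) UNIV"
    by (simp add: infsum_reindex[OF inj(2)] o_def)
  also have "\<dots> = (\<Sum>n. f (- int n - 1))"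
    using norm_summable_imp_has_sum[OF 1(2) summable_sums[OF summable_norm_cancel[OF 1(2)]]] by (rule infsumI)
  finally show "infsum f UNIV = (\<Sum>n. f (int n)) + (\<Sum>n. f (- int n - 1))" .
qed

text \<open>The negative powers form a power series in \<open>1 / z\<close> that converges at arbitrarily large arguments, and
  hence everywhere.\<close>

lemma Laurent_series_holomorphic:
  fixes c :: "int \<Rightarrow> complex" and R :: ereal
  assumes "\<And>z. z \<noteq> 0 \<Longrightarrow> ereal (norm z) < R \<Longrightarrow> (\<lambda>l. norm (c l * z powi l)) summable_on UNIV"
  shows "(\<lambda>z. \<Sum>\<^sub>\<infinity>l. c l * z powi l) holomorphic_on (eball 0 R - {0})"
proof (cases "R > 0")
  case False
  then have "eball (0::complex) R = {}" by (auto simp: eball_def) (metis ereal_less(2) norm_ge_zero le_less_trans not_less ereal_less_eq(5))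
  then show ?thesis by (simp add: holomorphic_on_def)
next
  case True
  define f where "f = Abs_fps (\<lambda>n. c (int n))"
  define g where "g = Abs_fps (\<lambda>n. c (- int n - 1))"
  have f: "fps_conv_radius f \<ge> R" unfolding fps_conv_radius_def
  proof (rule conv_radius_geI_ex)
    fix r :: real assume r: "0 < r" "ereal r < R"
    have "summable (\<lambda>n. norm (c (int n) * of_real r powi int n))"
      by (rule abs_summable_intD(1)[OF assms]) (use r in auto)
    then show "\<exists>z. norm z = r \<and> summable (\<lambda>n. fps_nth f n * z ^ n)"
      using r by (intro exI[of _ "of_real r"]) (auto simp: f_def dest: summable_norm_cancel)
  qed
  obtain r0 where r0: "0 < r0" "ereal r0 < R"
    using True ereal_dense2[of 0 R] by (metis ereal_less(2) zero_ereal_def)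
  have g: "fps_conv_radius g \<ge> \<infinity>" unfolding fps_conv_radius_def
  proof (rule conv_radius_geI_ex)
    fix r :: real assume r: "0 < r"
    define s where "s = max r (inverse r0)"
    have s: "0 < s" "r \<le> s" "inverse s \<le> r0"
      using r r0 by (auto simp: s_def le_max_iff_disj inverse_le_iff_le intro: order_trans[OF le_imp_inverse_le[of "inverse r0"]])
    have "norm (of_real (inverse s) :: complex) = inverse s" using s by (simp only: norm_of_real) simp
    then have "ereal (norm (of_real (inverse s) :: complex)) < R"
      using s r0 by (auto intro: le_less_trans[of _ "ereal r0"])
    then have "summable (\<lambda>n. norm (c (- int n - 1) * of_real (inverse s) powi (- int n - 1)))"
      by (intro abs_summable_intD(2)[OF assms]) (use s in auto)
    then have "summable (\<lambda>n. norm (c (- int n - 1) * of_real (inverse s) powi (- int n - 1)) * inverse s)"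
      by (rule summable_mult2)
    also have "(\<lambda>n. norm (c (- int n - 1) * of_real (inverse s) powi (- int n - 1)) * inverse s)
       = (\<lambda>n. norm (fps_nth g n * of_real s ^ n))"
      using s by (auto simp: g_def norm_mult norm_power_int power_int_diff power_int_minus field_simps fun_eq_iff)
    finally have "summable (\<lambda>n. norm (fps_nth g n * of_real r ^ n))"
      by (rule summable_comparison_test'[where N = 0])
        (use r s in \<open>auto simp: norm_mult norm_power intro!: mult_left_mono power_mono\<close>)
    then show "\<exists>z. norm z = r \<and> summable (\<lambda>n. fps_nth g n * z ^ n)"
      using r by (intro exI[of _ "of_real r"]) (auto dest: summable_norm_cancel)
  qed
  have "(\<Sum>\<^sub>\<infinity>l. c l * z powi l) = eval_fps f z + inverse z * eval_fps g (inverse z)"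
    if z: "z \<in> eball 0 R - {0}" for z
  proof -
    have z0: "z \<noteq> 0" "ereal (norm z) < R" using z by (auto simp: eball_def)
    note D = abs_summable_intD[OF assms[OF z0]]
    have "(\<Sum>n. c (- int n - 1) * z powi (- int n - 1)) = (\<Sum>n. inverse z * (fps_nth g n * inverse z ^ n))"
      using z0 by (simp add: g_def power_int_diff power_int_minus field_simps)
    also have "\<dots> = inverse z * eval_fps g (inverse z)"
      unfolding eval_fps_def by (rule suminf_mult, rule summable_fps) (use g in auto)
    finally show ?thesis unfolding D(3) by (simp add: f_def eval_fps_def)
  qed
  moreover have "(\<lambda>z. eval_fps f z + inverse z * eval_fps g (inverse z)) holomorphic_on (eball 0 R - {0})"
  proof -
    have "eval_fps f holomorphic_on (eball 0 R - {0})"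
      by (rule holomorphic_on_eval_fps) (use f in \<open>auto simp: eball_def intro: less_le_trans\<close>)
    moreover have "(eval_fps g \<circ> inverse) holomorphic_on (eball 0 R - {0})"
      by (rule holomorphic_on_compose) (use g in \<open>auto intro!: holomorphic_intros\<close>)
    ultimately show ?thesis by (auto intro!: holomorphic_intros simp: o_def)
  qed
  ultimately show ?thesis using holomorphic_transform by (metis (no_types, lifting))
qed

lemma powi_add: "x \<noteq> 0 \<Longrightarrow> x powi (m + n) = x powi m * x powi n" for x :: "'a :: field"
  by (simp add: power_int_add)

section \<open>The theta function\<close>

definition tri :: "int \<Rightarrow> int" where "tri l = l * (l + 1) div 2"

lemma tri_Suc: "tri (l + 1) = tri l + (l + 1)"
proof -
  have "(l + 1) * (l + 1 + 1) = l * (l + 1) + (l + 1) * 2" by (simp add: algebra_simps)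
  then show ?thesis unfolding tri_def by (simp add: div_mult_self1)
qed

lemma tri_double: "2 * tri l = l * (l + 1)"
  unfolding tri_def by (rule dvd_mult_div_cancel) simp

lemma tri_reflect: "tri (- l - 1) = tri l"
  unfolding tri_def by (simp add: algebra_simps)

definition theta_term :: "complex \<Rightarrow> complex \<Rightarrow> int \<Rightarrow> complex" where
  "theta_term p z l = p powi (- tri l) * z powi l"

lemma Theta_eq: "Theta p z = (\<Sum>\<^sub>\<infinity>l. theta_term p z l)"
  by (simp add: Theta_def theta_term_def tri_def)

lemma summable_gaussian:
  fixes x :: real
  assumes "P > 1" 
  shows "summable (\<lambda>n. P powi (- tri (int n)) * x ^ n)"
proof -
  obtain N where N: "\<bar>x\<bar> * 2 < P ^ N" using assms real_arch_pow[of P "\<bar>x\<bar> * 2"] by auto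
  show ?thesis
  proof (rule summable_ratio_test[of "1/2" N])
    fix n assume "N \<le> n"
    have "2 * \<bar>x\<bar> \<le> P ^ Suc n"
      using N power_increasing[of N "Suc n" P] assms \<open>N \<le> n\<close> by simp
    then have "\<bar>x\<bar> / P ^ Suc n \<le> 1 / 2" using assms by (simp add: field_simps)
    then have "\<bar>x\<bar> / P ^ Suc n * (P powi (- tri (int n)) * \<bar>x\<bar> ^ n) \<le> 1 / 2 * (P powi (- tri (int n)) * \<bar>x\<bar> ^ n)"
      using assms by (intro mult_right_mono) auto
    moreover have "P powi (- tri (int (Suc n))) = P powi (- tri (int n)) / P ^ Suc n"
    proof -
      have "- tri (int (Suc n)) = - tri (int n) - int (Suc n)" using tri_Suc[of "int n"] by (simp add: add.commute)
      moreover have "P powi (- tri (int n) - int (Suc n)) = P powi (- tri (int n)) / P powi (int (Suc n))"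
        using assms by (intro power_int_diff) auto
      ultimately show ?thesis by (simp only: power_int_of_nat)
    qed
    ultimately show "norm (P powi (- tri (int (Suc n))) * x ^ Suc n) \<le> 1 / 2 * norm (P powi (- tri (int n)) * x ^ n)"
      using assms by (simp add: abs_mult power_abs mult_ac)
  qed auto
qed

lemma theta_term_abs_summable:
  assumes "norm p > 1" "z \<noteq> 0"
  shows "(\<lambda>l. norm (theta_term p z l)) summable_on UNIV"
proof (rule abs_summable_int)
  show "summable (\<lambda>n. norm (theta_term p z (int n)))"
    using summable_gaussian[OF assms(1), of "norm z"] by (simp add: theta_term_def norm_mult norm_power_int norm_power)
  have "summable (\<lambda>n. inverse (norm z) * (norm p powi (- tri (int n)) * inverse (norm z) ^ n))"
    by (intro summable_mult summable_gaussian assms)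
  also have "(\<lambda>n. inverse (norm z) * (norm p powi (- tri (int n)) * inverse (norm z) ^ n)) =
      (\<lambda>n. norm (theta_term p z (- int n - 1)))"
    using assms(2) by (auto simp: theta_term_def tri_reflect norm_mult norm_power_int norm_divide norm_inverse norm_power power_int_diff power_int_minus field_simps)
  finally show "summable (\<lambda>n. norm (theta_term p z (- int n - 1)))" .
qed

lemma Theta_holomorphic:
  assumes "norm p > 1"
  shows "Theta p holomorphic_on (- {0})"
proof -
  have "(\<lambda>z. \<Sum>\<^sub>\<infinity>l. p powi (- tri l) * z powi l) holomorphic_on (eball 0 \<infinity> - {0})"
    by (rule Laurent_series_holomorphic) (use theta_term_abs_summable[OF assms] in \<open>simp add: theta_term_def\<close>)
  moreover have "eball 0 \<infinity> - {0} = - {0 :: complex}" by auto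
  moreover have "Theta p = (\<lambda>z. \<Sum>\<^sub>\<infinity>l. p powi (- tri l) * z powi l)"
    by (simp add: fun_eq_iff Theta_eq theta_term_def)
  ultimately show ?thesis by simp
qed

lemma Theta_shift:
  assumes "p \<noteq> 0" "z \<noteq> 0"
  shows "Theta p (p * z) = z * Theta p z"
proof -
  have "Theta p (p * z) = (\<Sum>\<^sub>\<infinity>l. z * theta_term p z (l - 1))"
    unfolding Theta_eq
  proof (rule infsum_cong)
    fix l :: int
    show "theta_term p (p * z) l = z * theta_term p z (l - 1)"
      using tri_Suc[of "l - 1"] assms
      by (simp add: theta_term_def power_int_mult_distrib power_int_diff power_int_add power_int_minus field_simps)
  qed
  also have "\<dots> = z * (\<Sum>\<^sub>\<infinity>l. theta_term p z (l - 1))" by (rule infsum_cmult_right')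
  also have "(\<Sum>\<^sub>\<infinity>l. theta_term p z (l - 1)) = (\<Sum>\<^sub>\<infinity>l. theta_term p z l)"
    by (rule infsum_reindex_bij_witness[of _ "\<lambda>l. l + 1" "\<lambda>l. l - 1"]) auto
  finally show ?thesis by (simp add: Theta_eq)
qed

text \<open>Iterated quasi-periodicity: along a spiral, the values of theta differ by explicit factors.\<close>

lemma Theta_shift_int:
  assumes "p \<noteq> 0" "z \<noteq> 0"
  shows "Theta p (p powi k * z) = p powi tri (k - 1) * z powi k * Theta p z"
proof (induction k rule: int_induct[of _ 0])
  case base show ?case by (simp add: tri_def)
next
  case (step1 k)
  have "Theta p (p powi (k + 1) * z) = Theta p (p * (p powi k * z))"
    using assms by (simp add: power_int_add mult_ac)
  also have "\<dots> = p powi k * z * Theta p (p powi k * z)" by (rule Theta_shift) (use assms in auto)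
  also have "\<dots> = p powi (k + tri (k - 1)) * z powi (k + 1) * Theta p z"
    unfolding step1 using assms by (simp add: power_int_add mult_ac)
  also have "k + tri (k - 1) = tri (k + 1 - 1)" using tri_Suc[of "k - 1"] by simp
  finally show ?case .
next
  case (step2 k)
  have "Theta p (p powi k * z) = Theta p (p * (p powi (k - 1) * z))"
    using assms by (simp add: power_int_diff field_simps)
  also have "\<dots> = p powi (k - 1) * z * Theta p (p powi (k - 1) * z)" by (rule Theta_shift) (use assms in auto)
  finally have *: "p powi (k - 1) * z * Theta p (p powi (k - 1) * z) = p powi tri (k - 1) * z powi k * Theta p z"
    using step2 by simp
  have "tri (k - 1) = (k - 1) + tri (k - 1 - 1)" using tri_Suc[of "k - 2"] by (simp add: algebra_simps)
  moreover have "z powi k = z * z powi (k - 1)" using assms power_int_add[of z 1 "k - 1"] by simp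
  ultimately have "p powi (k - 1) * z * Theta p (p powi (k - 1) * z) = p powi (k - 1) * z * (p powi tri (k - 1 - 1) * z powi (k - 1) * Theta p z)"
    unfolding * using assms by (simp only: power_int_add) (simp add: mult_ac power_int_add)
  then show ?case using assms by simp
qed

text \<open>All terms of the series are positive, so each of them bounds its sum from below.\<close>

lemma Theta_real_ge:
  fixes P x :: real
  assumes "P > 1" "x > 0"
  shows "P powi (- tri l) * x powi l \<le> norm (Theta (of_real P) (of_real x))"
proof -
  let ?t = "\<lambda>l. P powi (- tri l) * x powi l"
  have t: "theta_term (of_real P) (of_real x) l = of_real (?t l)" for l
    by (simp add: theta_term_def)
  have "(\<lambda>l. norm (theta_term (of_real P) (of_real x) l)) summable_on UNIV"
    by (rule theta_term_abs_summable) (use assms in auto)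
  moreover have "norm (theta_term (of_real P) (of_real x) l) = ?t l" for l
    unfolding t norm_of_real using assms by simp
  ultimately have s: "?t summable_on UNIV" by simp
  then have "((\<lambda>l. of_real (?t l) :: complex) has_sum of_real (infsum ?t UNIV)) UNIV"
    by (intro has_sum_of_real has_sum_infsum)
  note hs = infsumI[OF this]
  have "?t l = infsum ?t {l}" by simp
  also have "\<dots> \<le> infsum ?t UNIV"
    by (rule infsum_mono2) (use s assms in auto)
  also have "\<dots> = norm (of_real (infsum ?t UNIV) :: complex)"
    unfolding norm_of_real using assms by (subst abs_of_nonneg) (auto intro!: infsum_nonneg)
  also have "of_real (infsum ?t UNIV) = Theta (of_real P) (of_real x)"
    unfolding Theta_eq t hs ..
  finally show ?thesis .
qed

section \<open>The triple product and the zeros of theta\<close>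

text \<open>The Gaussian binomial coefficients are quotients of the products \<open>(1 - u) \<dots> (1 - u\<^sup>n)\<close>. For \<open>\<bar>u\<bar> < 1\<close> these converge to
  a nonzero limit, which gives the limits and the bounds of the coefficients at the same time.\<close>

definition qfac :: "complex \<Rightarrow> nat \<Rightarrow> complex" where
  "qfac u n = (\<Prod>i<n. 1 - u ^ Suc i)"

definition qbinom :: "complex \<Rightarrow> nat \<Rightarrow> nat \<Rightarrow> complex" where
  "qbinom u n k = (if k \<le> n then qfac u n / (qfac u k * qfac u (n - k)) else 0)"

lemma qfac_nonzero:
  assumes "norm u < 1" shows "qfac u n \<noteq> 0"
proof -
  have "1 - u ^ Suc i \<noteq> 0" for i
  proof
    assume "1 - u ^ Suc i = 0"
    then have "norm u ^ Suc i = 1" by (metis eq_iff_diff_eq_0 norm_one norm_power)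
    moreover have "norm u ^ Suc i \<le> norm u" using assms by (simp add: mult_left_le power_le_one)
    ultimately show False using assms by simp
  qed
  then show ?thesis by (simp add: qfac_def)
qed

lemma qbinom_Pascal:
  assumes "norm u < 1"
  shows "qbinom u (Suc n) (Suc k) = qbinom u n (Suc k) + u ^ (n - k) * qbinom u n k"
proof -
  note nz = qfac_nonzero[OF assms]
  have S: "qfac u (Suc j) = qfac u j * (1 - u ^ Suc j)" for j by (simp add: qfac_def)
  consider "k > n" | "k = n" | "k < n" by linarith
  then show ?thesis
  proof cases
    case 3
    define d where "d = n - Suc k"
    have n: "n = Suc (d + k)" "n - k = Suc d" "n - Suc k = d" using 3 by (auto simp: d_def)
    have z: "1 - u ^ Suc j \<noteq> 0" for j using nz[of "Suc j"] S[of j] by auto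
    have e: "1 - u ^ Suc n = (1 - u ^ Suc d) + u ^ Suc d * (1 - u ^ Suc k)"
      unfolding n by (simp add: algebra_simps power_add)
    have "qbinom u n (Suc k) = qfac u n * (1 - u ^ Suc d) / (qfac u (Suc k) * qfac u (Suc d))"
      using 3 z[of d] nz by (simp add: qbinom_def n(3) S[of d])
    moreover have "u ^ (n - k) * qbinom u n k = qfac u n * (u ^ Suc d * (1 - u ^ Suc k)) / (qfac u (Suc k) * qfac u (Suc d))"
      using 3 z[of k] nz by (simp add: qbinom_def n(2) S[of k] del: power_Suc)
    moreover have "qbinom u (Suc n) (Suc k) = qfac u n * (1 - u ^ Suc n) / (qfac u (Suc k) * qfac u (Suc d))"
      using 3 by (simp add: qbinom_def n(2) S[of n] del: power_Suc)
    ultimately show ?thesis unfolding e by (simp only: add_divide_distrib[symmetric] distrib_left[symmetric])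
  next
    case 2
    moreover have "qfac u 0 = 1" by (simp add: qfac_def)
    ultimately show ?thesis by (simp add: qbinom_def nz)
  qed (simp add: qbinom_def)
qed

lemma q_binomial_theorem:
  assumes "norm u < 1"
  shows "(\<Prod>k<n. 1 + y * u ^ k) = (\<Sum>k\<le>n. u ^ (k choose 2) * qbinom u n k * y ^ k)"
proof (induction n)
  case 0 show ?case by (simp add: qbinom_def qfac_def numeral_2_eq_2)
next
  case (Suc n)
  note nz = qfac_nonzero[OF assms]
  have b0: "qbinom u j 0 = 1" for j using nz by (simp add: qbinom_def) (simp add: qfac_def)
  have top: "qbinom u n (Suc n) = 0" by (simp add: qbinom_def)
  have "(\<Sum>k\<le>Suc n. u ^ (k choose 2) * qbinom u (Suc n) k * y ^ k)
      = 1 + (\<Sum>k\<le>n. u ^ (Suc k choose 2) * qbinom u (Suc n) (Suc k) * y ^ Suc k)"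
    by (subst sum.atMost_Suc_shift) (simp add: b0 numeral_2_eq_2 del: power_Suc)
  also have "\<dots> = 1 + (\<Sum>k\<le>n. u ^ (Suc k choose 2) * qbinom u n (Suc k) * y ^ Suc k)
      + (\<Sum>k\<le>n. u ^ (Suc k choose 2) * u ^ (n - k) * qbinom u n k * y ^ Suc k)"
    unfolding qbinom_Pascal[OF assms] by (simp add: algebra_simps sum.distrib)
  also have "1 + (\<Sum>k\<le>n. u ^ (Suc k choose 2) * qbinom u n (Suc k) * y ^ Suc k)
      = (\<Sum>k\<le>Suc n. u ^ (k choose 2) * qbinom u n k * y ^ k)"
    by (subst sum.atMost_Suc_shift) (simp add: b0 numeral_2_eq_2 del: power_Suc)
  also have "\<dots> = (\<Sum>k\<le>n. u ^ (k choose 2) * qbinom u n k * y ^ k)" by (simp add: top)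
  also have "(\<Sum>k\<le>n. u ^ (Suc k choose 2) * u ^ (n - k) * qbinom u n k * y ^ Suc k)
     = (\<Sum>k\<le>n. y * u ^ n * (u ^ (k choose 2) * qbinom u n k * y ^ k))"
  proof (rule sum.cong[OF refl])
    fix k assume "k \<in> {..n}"
    then have "(Suc k choose 2) + (n - k) = n + (k choose 2)" by (simp add: numeral_2_eq_2)
    then have "u ^ (Suc k choose 2) * u ^ (n - k) = u ^ n * u ^ (k choose 2)" by (metis power_add)
    then show "u ^ (Suc k choose 2) * u ^ (n - k) * qbinom u n k * y ^ Suc k = y * u ^ n * (u ^ (k choose 2) * qbinom u n k * y ^ k)"
      by simp
  qed
  also have "\<dots> = y * u ^ n * (\<Sum>k\<le>n. u ^ (k choose 2) * qbinom u n k * y ^ k)"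
    by (rule sum_distrib_left[symmetric])
  finally show ?case by (simp add: Suc.IH algebra_simps)
qed

lemma tri_choose: "int (n choose 2) = tri (int n - 1)"
proof (induction n)
  case (Suc n)
  then show ?case using tri_Suc[of "int n - 1"] by (simp add: numeral_2_eq_2)
qed (simp add: tri_def)

text \<open>The \<open>q\<close>-binomial theorem for \<open>2 n\<close> factors at the argument \<open>z u\<^sup>1\<^sup>-\<^sup>n\<close>: half of the factors contain
  positive powers of \<open>u\<close>, and from the other half a monomial is split off.\<close>

lemma finite_triple_product:
  assumes u: "norm u < 1" "u \<noteq> 0" and z: "z \<noteq> 0"
  shows "(\<Prod>k<n. 1 + z * u ^ Suc k) * (\<Prod>k<n. 1 + inverse z * u ^ k)
     = (\<Sum>k\<le>2 * n. qbinom u (2 * n) k * (u powi tri (int k - int n) * z powi (int k - int n)))"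
proof -
  define y where "y = z * u powi (1 - int n)"
  have split: "(\<Prod>k<2 * n. f k) = (\<Prod>k<n. f (n + k)) * (\<Prod>k<n. f (n - Suc k))" for f :: "nat \<Rightarrow> complex"
  proof -
    have "(\<Prod>k<2 * n. f k) = (\<Prod>k<n. f k) * (\<Prod>k=n..<n+n. f k)"
      using prod.atLeastLessThan_concat[of 0 n "n+n" f] by (simp add: atLeast0LessThan mult_2)
    also have "(\<Prod>k=n..<n+n. f k) = (\<Prod>k<n. f (n + k))"
      using prod.shift_bounds_nat_ivl[of f 0 n n] by (simp add: atLeast0LessThan add.commute)
    also have "(\<Prod>k<n. f k) = (\<Prod>k<n. f (n - Suc k))" by (rule prod.nat_diff_reindex[symmetric])
    finally show ?thesis by (simp add: mult.commute)
  qed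
  have f1: "1 + y * u ^ (n + k) = 1 + z * u ^ Suc k" for k
  proof -
    have "u powi (1 - int n) * u ^ (n + k) = u powi ((1 - int n) + int (n + k))"
      by (simp only: powi_add[OF u(2)] power_int_of_nat)
    also have "(1 - int n) + int (n + k) = int (Suc k)" by simp
    finally show ?thesis by (simp only: y_def mult.assoc power_int_of_nat)
  qed
  have f2: "1 + y * u ^ (n - Suc k) = (z * u powi (- int k)) * (1 + inverse z * u ^ k)" if "k < n" for k
  proof -
    have "u powi (1 - int n) * u ^ (n - Suc k) = u powi ((1 - int n) + int (n - Suc k))"
      by (simp only: powi_add[OF u(2)] power_int_of_nat)
    also have "(1 - int n) + int (n - Suc k) = - int k" using that by simp
    finally have "1 + y * u ^ (n - Suc k) = 1 + z * u powi (- int k)" by (simp only: y_def mult.assoc)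
    then show ?thesis using u z by (simp add: algebra_simps power_int_minus)
  qed
  have pre: "(\<Prod>k<n. z * u powi (- int k)) = z ^ n * u powi (- tri (int n - 1))"
  proof (induction n)
    case (Suc n)
    have "- tri (int (Suc n) - 1) = - tri (int n - 1) + (- int n)" using tri_Suc[of "int n - 1"] by simp
    then have "u powi (- tri (int (Suc n) - 1)) = u powi (- tri (int n - 1)) * u powi (- int n)"
      by (simp only: powi_add[OF u(2)])
    then show ?case using Suc by (simp add: mult_ac)
  qed (simp add: tri_def)
  have "(\<Prod>k<2 * n. 1 + y * u ^ k) = (\<Prod>k<n. 1 + z * u ^ Suc k) * (\<Prod>k<n. (z * u powi (- int k)) * (1 + inverse z * u ^ k))"
    unfolding split by (intro arg_cong2[of _ _ _ _ "(*)"] prod.cong refl f1 f2) auto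
  also have "\<dots> = (\<Prod>k<n. 1 + z * u ^ Suc k) * (\<Prod>k<n. 1 + inverse z * u ^ k) * (z ^ n * u powi (- tri (int n - 1)))"
  proof -
    have "(\<Prod>k<n. (z * u powi (- int k)) * (1 + inverse z * u ^ k)) = (z ^ n * u powi (- tri (int n - 1))) * (\<Prod>k<n. 1 + inverse z * u ^ k)"
      by (subst prod.distrib) (simp only: pre)
    then show ?thesis by (simp only: mult_ac)
  qed
  finally have "(\<Prod>k<n. 1 + z * u ^ Suc k) * (\<Prod>k<n. 1 + inverse z * u ^ k) * (z ^ n * u powi (- tri (int n - 1)))
      = (\<Sum>k\<le>2 * n. u ^ (k choose 2) * qbinom u (2 * n) k * y ^ k)"
    by (simp only: q_binomial_theorem[OF u(1)])
  also have "\<dots> = (\<Sum>k\<le>2 * n. qbinom u (2 * n) k * (u powi tri (int k - int n) * z powi (int k - int n)) * (z ^ n * u powi (- tri (int n - 1))))"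
  proof (rule sum.cong[OF refl])
    fix k
    have "2 * (tri (int k - 1) + (1 - int n) * int k) = 2 * (tri (int k - int n) - tri (int n - 1))"
      by (simp only: tri_double right_diff_distrib distrib_left) (simp add: algebra_simps)
    then have e: "tri (int k - 1) + (1 - int n) * int k = tri (int k - int n) + (- tri (int n - 1))" by simp
    have "u ^ (k choose 2) * y ^ k = z ^ k * (u powi (tri (int k - 1)) * u powi ((1 - int n) * int k))"
      unfolding y_def power_mult_distrib tri_choose[symmetric] power_int_mult power_int_of_nat by simp
    also have "\<dots> = z ^ k * (u powi tri (int k - int n) * u powi (- tri (int n - 1)))"
      by (simp only: powi_add[OF u(2), symmetric] e)
    also have "z ^ k = z powi (int k - int n) * z ^ n"
      using z by (simp add: power_int_diff)
    finally have fin: "u ^ (k choose 2) * y ^ k = z powi (int k - int n) * z ^ n * (u powi tri (int k - int n) * u powi (- tri (int n - 1)))" .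
    have "u ^ (k choose 2) * qbinom u (2 * n) k * y ^ k = qbinom u (2 * n) k * (u ^ (k choose 2) * y ^ k)"
      by (simp only: mult_ac)
    also have "\<dots> = qbinom u (2 * n) k * (u powi tri (int k - int n) * z powi (int k - int n)) * (z ^ n * u powi (- tri (int n - 1)))"
      unfolding fin by (simp only: mult_ac)
    finally show "u ^ (k choose 2) * qbinom u (2 * n) k * y ^ k =
        qbinom u (2 * n) k * (u powi tri (int k - int n) * z powi (int k - int n)) * (z ^ n * u powi (- tri (int n - 1)))" .
  qed
  also have "\<dots> = (\<Sum>k\<le>2 * n. qbinom u (2 * n) k * (u powi tri (int k - int n) * z powi (int k - int n))) * (z ^ n * u powi (- tri (int n - 1)))"
    by (rule sum_distrib_right[symmetric])
  finally show ?thesis using u z by simp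
qed

lemma qfac_convergent:
  assumes "norm u < 1"
  obtains L where "qfac u \<longlonglongrightarrow> L" "L \<noteq> 0"
proof -
  have "summable (\<lambda>i. norm u * norm u ^ i)" using assms by (intro summable_mult summable_geometric) simp
  also have "(\<lambda>i. norm u * norm u ^ i) = (\<lambda>i. norm ((1 - u ^ Suc i) - 1))"
    by (simp add: fun_eq_iff norm_mult norm_power)
  finally have "summable (\<lambda>i. norm ((1 - u ^ Suc i) - 1))" .
  then have c: "convergent_prod (\<lambda>i. 1 - u ^ Suc i)"
    by (rule abs_convergent_prod_imp_convergent_prod[OF summable_imp_abs_convergent_prod])
  have nz: "1 - u ^ Suc i \<noteq> 0" for i
    using qfac_nonzero[OF assms, of "Suc i"] by (simp add: qfac_def)
  have "(\<lambda>n. qfac u (Suc n)) \<longlonglongrightarrow> prodinf (\<lambda>i. 1 - u ^ Suc i)"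
    using convergent_prod_LIMSEQ[OF c] by (simp add: qfac_def lessThan_Suc_atMost)
  then have "qfac u \<longlonglongrightarrow> prodinf (\<lambda>i. 1 - u ^ Suc i)" by (rule LIMSEQ_imp_Suc)
  then show ?thesis using that prodinf_nonzero[OF c] nz by blast
qed

lemma product_one_plus_nonzero:
  fixes c u :: complex
  assumes "norm u < 1" "\<And>k. 1 + c * u ^ k \<noteq> 0"
  obtains L where "(\<lambda>n. \<Prod>k<n. 1 + c * u ^ k) \<longlonglongrightarrow> L" "L \<noteq> 0"
proof -
  have "summable (\<lambda>i. norm c * norm u ^ i)" using assms by (intro summable_mult summable_geometric) simp
  also have "(\<lambda>i. norm c * norm u ^ i) = (\<lambda>i. norm ((1 + c * u ^ i) - 1))"
    by (simp add: fun_eq_iff norm_mult norm_power)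
  finally have "summable (\<lambda>i. norm ((1 + c * u ^ i) - 1))" .
  then have c: "convergent_prod (\<lambda>i. 1 + c * u ^ i)"
    by (rule abs_convergent_prod_imp_convergent_prod[OF summable_imp_abs_convergent_prod])
  have "(\<lambda>n. \<Prod>k<Suc n. 1 + c * u ^ k) \<longlonglongrightarrow> prodinf (\<lambda>i. 1 + c * u ^ i)"
    using convergent_prod_LIMSEQ[OF c] by (simp only: lessThan_Suc_atMost)
  then have "(\<lambda>n. \<Prod>k<n. 1 + c * u ^ k) \<longlonglongrightarrow> prodinf (\<lambda>i. 1 + c * u ^ i)"
    by (rule LIMSEQ_imp_Suc)
  then show ?thesis using that prodinf_nonzero[OF c] assms(2) by blast
qed

text \<open>The finite triple products tend to a multiple of theta by Tannery's theorem. On the other hand they tend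
  to a product of two convergent infinite products, which is nonzero as soon as no factor vanishes.\<close>

lemma Theta_nonzero:
  assumes p: "norm p > 1" and z: "z \<noteq> 0" and nz: "\<And>k::int. z \<noteq> - (p powi k)"
  shows "Theta p z \<noteq> 0"
proof
  assume zero: "Theta p z = 0"
  define u where "u = inverse p"
  have p0: "p \<noteq> 0" using p by auto
  have u: "norm u < 1" "u \<noteq> 0" using p p0 by (auto simp: u_def norm_inverse inverse_less_1_iff)
  note qnz = qfac_nonzero[OF u(1)]
  have uk: "u ^ k = p powi (- int k)" for k
    by (simp add: u_def power_int_minus power_inverse)
  have "1 + z * u * u ^ k \<noteq> 0" for k
  proof
    assume "1 + z * u * u ^ k = 0"
    then have "z * u ^ Suc k = -1" by (simp add: eq_neg_iff_add_eq_0 add.commute mult_ac)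
    then have "z * p powi (- int (Suc k)) * p powi int (Suc k) = - (p powi int (Suc k))" 
      unfolding uk by simp
    moreover have "z * p powi (- int (Suc k)) * p powi int (Suc k) = z"
      by (simp only: mult.assoc powi_add[OF p0, symmetric]) simp
    ultimately show False using nz[of "int (Suc k)"] by simp
  qed
  from product_one_plus_nonzero[OF u(1) this] obtain L1 where
    L1: "(\<lambda>n. \<Prod>k<n. 1 + z * u * u ^ k) \<longlonglongrightarrow> L1" "L1 \<noteq> 0" .
  have "1 + inverse z * u ^ k \<noteq> 0" for k
  proof
    assume "1 + inverse z * u ^ k = 0"
    then have "z = - (u ^ k)" using z by (simp add: field_simps eq_neg_iff_add_eq_0)
    then show False using nz[of "- int k"] uk by simp
  qed
  from product_one_plus_nonzero[OF u(1) this] obtain L2 where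
    L2: "(\<lambda>n. \<Prod>k<n. 1 + inverse z * u ^ k) \<longlonglongrightarrow> L2" "L2 \<noteq> 0" .
  obtain L where L: "qfac u \<longlonglongrightarrow> L" "L \<noteq> 0" using qfac_convergent[OF u(1)] .
  obtain B where B: "\<And>n. norm (qfac u n) \<le> B" using L(1) by (metis convergent_def convergent_imp_Bseq BseqE)
  have "(\<lambda>n. inverse (qfac u n)) \<longlonglongrightarrow> inverse L" using L by (rule tendsto_inverse)
  then obtain B' where B': "\<And>n. norm (inverse (qfac u n)) \<le> B'" by (metis convergent_def convergent_imp_Bseq BseqE)
  have B0: "B \<ge> 0" "B' \<ge> 0" using norm_ge_zero B[of 0] B'[of 0] order_trans by blast+
  \<comment> \<open>the coefficient of the \<open>l\<close>-th theta term in the \<open>n\<close>-th finite product\<close>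
  define G where "G = (\<lambda>n l. if \<bar>l\<bar> \<le> int n then qbinom u (2 * n) (nat (int n + l)) else 0)"
  have Gb: "norm (G n l) \<le> B * (B' * B')" for n l
  proof (cases "\<bar>l\<bar> \<le> int n")
    case True
    then have "nat (int n + l) \<le> 2 * n" by linarith
    then have "norm (G n l) = norm (qfac u (2 * n)) * (norm (inverse (qfac u (nat (int n + l)))) * norm (inverse (qfac u (2 * n - nat (int n + l)))))"
      using True by (simp add: G_def qbinom_def norm_mult norm_divide norm_inverse field_simps)
    also have "\<dots> \<le> B * (B' * B')" by (intro mult_mono B B' B0 mult_nonneg_nonneg norm_ge_zero)
    finally show ?thesis .
  qed (use B0 in \<open>simp add: G_def\<close>)
  have Glim: "(\<lambda>n. G n l) \<longlonglongrightarrow> inverse L" for l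
  proof -
    have f: "filterlim (\<lambda>n. nat (int n + c)) sequentially sequentially" for c
      unfolding filterlim_at_top
    proof
      fix Z show "\<forall>\<^sub>F n in sequentially. Z \<le> nat (int n + c)"
        using eventually_ge_at_top[of "Z + nat \<bar>c\<bar>"] by eventually_elim linarith
    qed
    have "filterlim (\<lambda>n::nat. 2 * n) sequentially sequentially" by (rule mult_nat_left_at_top) simp
    then have "(\<lambda>n. qfac u (2 * n) / (qfac u (nat (int n + l)) * qfac u (nat (int n + - l)))) \<longlonglongrightarrow> L / (L * L)"
      by (intro tendsto_divide tendsto_mult filterlim_compose[OF L(1)] f) (use L in auto)
    moreover have "\<forall>\<^sub>F n in sequentially. qfac u (2 * n) / (qfac u (nat (int n + l)) * qfac u (nat (int n + - l))) = G n l"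
      using eventually_ge_at_top[of "nat \<bar>l\<bar>"]
    proof eventually_elim
      case (elim n)
      then have "2 * n - nat (int n + l) = nat (int n - l)" "nat (int n + l) \<le> 2 * n" "\<bar>l\<bar> \<le> int n" by linarith+
      then show ?case by (simp add: G_def qbinom_def)
    qed
    ultimately have "(\<lambda>n. G n l) \<longlonglongrightarrow> L / (L * L)" by (rule Lim_transform_eventually)
    then show ?thesis using L by (simp add: inverse_eq_divide)
  qed
  let ?t = "theta_term p z"
  note ts = theta_term_abs_summable[OF p z] abs_summable_intD[OF theta_term_abs_summable[OF p z]]
  \<comment> \<open>the terms of index \<open>k\<close> and \<open>- k - 1\<close> together, to have series over \<open>\<nat>\<close>\<close>
  define a where "a = (\<lambda>k n. G n (int k) * ?t (int k) + G n (- int k - 1) * ?t (- int k - 1))"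
  define M where "M = (\<lambda>k. B * (B' * B') * (norm (?t (int k)) + norm (?t (- int k - 1))))"
  have "(\<lambda>n. suminf (\<lambda>k. a k n)) \<longlonglongrightarrow> suminf (\<lambda>k. inverse L * ?t (int k) + inverse L * ?t (- int k - 1))"
  proof (rule conjunct2[OF conjunct2[OF tannerys_theorem[where M = M]]])
    show "(\<lambda>n. a k n) \<longlonglongrightarrow> inverse L * ?t (int k) + inverse L * ?t (- int k - 1)" for k
      unfolding a_def by (intro tendsto_intros Glim)
    have "norm (a k n) \<le> M k" for k n
      unfolding a_def M_def distrib_left
      by (rule norm_triangle_le, rule add_mono) (auto simp: norm_mult intro!: mult_right_mono Gb)
    then show "\<forall>\<^sub>F (k, n) in sequentially \<times>\<^sub>F sequentially. norm (a k n) \<le> M k" by (intro always_eventually) auto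
    show "summable M" unfolding M_def by (intro summable_mult summable_add ts)
  qed simp
  moreover have "suminf (\<lambda>k. inverse L * ?t (int k) + inverse L * ?t (- int k - 1)) = inverse L * Theta p z"
    unfolding Theta_eq ts(4) distrib_left
    by (subst suminf_add[symmetric]) (auto intro!: summable_mult summable_norm_cancel[OF ts(2)] summable_norm_cancel[OF ts(3)] simp: suminf_mult[OF summable_norm_cancel[OF ts(2)]] suminf_mult[OF summable_norm_cancel[OF ts(3)]])
  moreover have "suminf (\<lambda>k. a k n) = (\<Prod>k<n. 1 + z * u * u ^ k) * (\<Prod>k<n. 1 + inverse z * u ^ k)" for n
  proof -
    have "(\<Prod>k<n. 1 + z * u * u ^ k) * (\<Prod>k<n. 1 + inverse z * u ^ k) =
        (\<Sum>k\<le>2 * n. qbinom u (2 * n) k * (u powi tri (int k - int n) * z powi (int k - int n)))"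
      using finite_triple_product[OF u z, of n] by (simp add: mult_ac)
    also have "\<dots> = (\<Sum>k\<le>2 * n. G n (int k - int n) * ?t (int k - int n))"
      by (intro sum.cong refl) (auto simp: G_def theta_term_def u_def power_int_inverse power_int_minus)
    also have "\<dots> = (\<Sum>l\<in>{- int n..int n}. G n l * ?t l)"
      by (rule sum.reindex_bij_witness[of _ "\<lambda>l. nat (l + int n)" "\<lambda>k. int k - int n"]) auto
    also have "\<dots> = (\<Sum>l\<in>{- int n - 1..int n}. G n l * ?t l)"
      by (rule sum.mono_neutral_left) (auto simp: G_def)
    also have "{- int n - 1..int n} = int ` {..n} \<union> (\<lambda>k. - int k - 1) ` {..n}"
    proof (intro set_eqI iffI)
      fix x assume x: "x \<in> {- int n - 1..int n}"
      show "x \<in> int ` {..n} \<union> (\<lambda>k. - int k - 1) ` {..n}"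
      proof (cases "0 \<le> x")
        case True then show ?thesis using x by (intro UnI1 image_eqI[of _ _ "nat x"]) auto
      next
        case False then show ?thesis using x by (intro UnI2 image_eqI[of _ _ "nat (- x - 1)"]) auto
      qed
    qed auto
    also have "(\<Sum>l\<in>\<dots>. G n l * ?t l) = (\<Sum>k\<le>n. G n (int k) * ?t (int k)) + (\<Sum>k\<le>n. G n (- int k - 1) * ?t (- int k - 1))"
      by (subst sum.union_disjoint) (auto simp: sum.reindex inj_on_def)
    also have "\<dots> = (\<Sum>k\<le>n. a k n)" by (simp add: a_def sum.distrib)
    also have "\<dots> = suminf (\<lambda>k. a k n)"
      by (rule suminf_finite[symmetric]) (auto simp: a_def G_def)
    finally show ?thesis ..
  qed
  ultimately have "(\<lambda>n. (\<Prod>k<n. 1 + z * u * u ^ k) * (\<Prod>k<n. 1 + inverse z * u ^ k)) \<longlonglongrightarrow> 0"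
    using zero by simp
  moreover have "(\<lambda>n. (\<Prod>k<n. 1 + z * u * u ^ k) * (\<Prod>k<n. 1 + inverse z * u ^ k)) \<longlonglongrightarrow> L1 * L2"
    by (intro tendsto_mult L1 L2)
  ultimately have "L1 * L2 = 0" using LIMSEQ_unique by blast
  then show False using L1 L2 by simp
qed

section \<open>The discrete q-Laplace transformation\<close>

text \<open>The transformation of order \<open>\<kappa>\<close> as an operation on sequences \<open>u\<close> of values along the spiral of \<open>lam\<close>.
  With \<open>\<eta>\<close> a \<open>K\<close>-th root of \<open>q\<close> and \<open>N = K / \<kappa>\<close>, the fractional powers of \<open>q\<close> become integral powers
  of \<open>\<eta>\<close>.\<close>

definition lap_term :: "complex \<Rightarrow> nat \<Rightarrow> complex \<Rightarrow> (int \<Rightarrow> complex) \<Rightarrow> complex \<Rightarrow> int \<Rightarrow> complex" where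
  "lap_term \<eta> N lam u z k = u k / Theta (\<eta> ^ N) (\<eta> powi (int N + k) * lam / z)"

definition lap :: "complex \<Rightarrow> nat \<Rightarrow> complex \<Rightarrow> (int \<Rightarrow> complex) \<Rightarrow> complex \<Rightarrow> complex" where
  "lap \<eta> N lam u z = (\<Sum>\<^sub>\<infinity>k. lap_term \<eta> N lam u z k) / of_nat N"

text \<open>Outwards along a spiral of \<open>\<eta>\<close>, this is the growth of theta with parameter \<open>\<eta>\<^sup>N\<close>, up to geometric factors;
  towards the origin, where \<open>nat k\<close> is \<open>0\<close>, it is a constant bound.\<close>

definition gauss_growth :: "complex \<Rightarrow> nat \<Rightarrow> real \<Rightarrow> real \<Rightarrow> int \<Rightarrow> real" where
  "gauss_growth \<eta> N C M k = C * M ^ nat k * norm \<eta> powr ((real (nat k))\<^sup>2 / (2 * real N))"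

lemma gauss_growth_nonneg: "0 \<le> C \<Longrightarrow> 0 \<le> M \<Longrightarrow> 0 \<le> gauss_growth \<eta> N C M k"
  by (simp add: gauss_growth_def)

lemma gauss_growth_mono:
  assumes "0 \<le> C" "1 \<le> M" "1 \<le> norm \<eta>" "k \<le> l"
  shows "gauss_growth \<eta> N C M k \<le> gauss_growth \<eta> N C M l"
proof -
  have "nat k \<le> nat l" using assms by simp
  then have "(real (nat k))\<^sup>2 / (2 * real N) \<le> (real (nat l))\<^sup>2 / (2 * real N)"
    by (intro divide_right_mono power_mono) auto
  then show ?thesis unfolding gauss_growth_def using assms
    by (intro mult_mono power_increasing powr_mono) auto
qed

lemma UNIV_int_residues:
  assumes "N > 0"
  shows "(UNIV :: int set) = (\<Union>b<N. range (\<lambda>a. int N * a + int b))"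
proof -
  have "k \<in> (\<Union>b<N. range (\<lambda>a. int N * a + int b))" for k
  proof (rule UN_I[of "nat (k mod int N)"])
    show "k \<in> range (\<lambda>a. int N * a + int (nat (k mod int N)))"
      using assms by (intro image_eqI[of _ _ "k div int N"]) auto
  qed (use assms in \<open>auto simp: nat_less_iff\<close>)
  then show ?thesis by blast
qed

lemma has_sum_finite_UN:
  fixes f :: "'a \<Rightarrow> 'b :: topological_comm_monoid_add"
  assumes "finite I" "\<And>i. i \<in> I \<Longrightarrow> (f has_sum s i) (A i)"
    "\<And>i j. i \<in> I \<Longrightarrow> j \<in> I \<Longrightarrow> i \<noteq> j \<Longrightarrow> A i \<inter> A j = {}"
  shows "(f has_sum sum s I) (\<Union>i\<in>I. A i)"
  using assms
proof (induction I rule: finite_induct)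
  case (insert i I)
  have "(f has_sum (s i + sum s I)) (A i \<union> (\<Union>i\<in>I. A i))"
  proof (rule has_sum_Un_disjoint)
    show "(f has_sum sum s I) (\<Union>i\<in>I. A i)" by (rule insert.IH) (use insert.prems in auto)
    show "A i \<inter> (\<Union>i\<in>I. A i) = {}" using insert.prems(2)[of i] insert.hyps by fastforce
  qed (use insert.prems in auto)
  then show ?case using insert.hyps by simp
qed simp

lemma has_sum_int_residues:
  fixes f :: "int \<Rightarrow> 'b :: topological_comm_monoid_add"
  assumes N: "N > 0" and f: "\<And>b. b < N \<Longrightarrow> ((\<lambda>a. f (int N * a + int b)) has_sum s b) UNIV"
  shows "(f has_sum (\<Sum>b<N. s b)) UNIV"
proof -
  have "(f has_sum (\<Sum>b<N. s b)) (\<Union>b<N. range (\<lambda>a. int N * a + int b))"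
proof (rule has_sum_finite_UN)
  fix b assume b: "b \<in> {..<N}"
  have "inj (\<lambda>a. int N * a + int b)" using N by (auto simp: inj_on_def)
  from has_sum_reindex[OF this, of f "s b"] show "(f has_sum s b) (range (\<lambda>a. int N * a + int b))"
    using f b by (simp add: o_def)
next
  fix b c assume bc: "b \<in> {..<N}" "c \<in> {..<N}" "b \<noteq> c"
  have "int N * a + int b \<noteq> int N * a' + int c" for a a'
  proof
    assume "int N * a + int b = int N * a' + int c"
    then have "(int N * a + int b) mod int N = (int N * a' + int c) mod int N" by simp
    then show False using bc by simp
  qed
  then show "range (\<lambda>a. int N * a + int b) \<inter> range (\<lambda>a. int N * a + int c) = {}" by auto
qed simp
  then show ?thesis by (simp only: UNIV_int_residues[OF N, symmetric])
qed

text \<open>Along a residue class modulo \<open>N\<close> the denominators differ by explicit factors only, by quasi-periodicity.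
  So each class contributes a Laurent series divided by a single value of theta, and the poles of the
  transform become visible.\<close>

definition lap_coeff :: "complex \<Rightarrow> nat \<Rightarrow> complex \<Rightarrow> (int \<Rightarrow> complex) \<Rightarrow> nat \<Rightarrow> int \<Rightarrow> complex" where
  "lap_coeff \<eta> N lam u b a = u (int N * a + int b) * \<eta> powi (- (int N * tri a)) * (\<eta> ^ b * lam) powi (- (a + 1))"

lemma lap_term_residue:
  assumes "\<eta> \<noteq> 0" "lam \<noteq> 0" "z \<noteq> 0"
  shows "lap_term \<eta> N lam u z (int N * a + int b) =
    z * (lap_coeff \<eta> N lam u b a * z powi a) / Theta (\<eta> ^ N) (\<eta> ^ b * lam / z)"
proof -
  let ?x = "\<eta> ^ b * lam / z"
  have "\<eta> powi (int N + (int N * a + int b)) = \<eta> powi (int N * (a + 1)) * \<eta> powi int b"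
    by (simp only: powi_add[OF assms(1), symmetric]) (simp add: algebra_simps)
  also have "\<dots> = (\<eta> ^ N) powi (a + 1) * \<eta> ^ b" by (simp only: power_int_mult power_int_of_nat)
  finally have "lap_term \<eta> N lam u z (int N * a + int b) = u (int N * a + int b) / Theta (\<eta> ^ N) ((\<eta> ^ N) powi (a + 1) * ?x)"
    by (simp add: lap_term_def mult.assoc)
  also have "Theta (\<eta> ^ N) ((\<eta> ^ N) powi (a + 1) * ?x) = (\<eta> ^ N) powi tri a * ?x powi (a + 1) * Theta (\<eta> ^ N) ?x"
    using Theta_shift_int[of "\<eta> ^ N" ?x "a + 1"] assms by simp
  also have "(\<eta> ^ N) powi tri a = \<eta> powi (int N * tri a)" by (simp only: power_int_mult power_int_of_nat)
  also have "?x powi (a + 1) = (\<eta> ^ b * lam) powi (a + 1) / z powi (a + 1)" by (simp add: power_int_divide_distrib)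
  also have "z powi (a + 1) = z * z powi a" using assms by (simp add: powi_add mult.commute)
  finally show ?thesis unfolding lap_coeff_def power_int_minus[of _ "int N * tri a"] power_int_minus[of _ "a + 1"]
    using assms by (simp add: divide_simps)
qed

text \<open>Within this radius the geometric series that remains after the quadratic exponents have cancelled
  has a ratio below \<open>1 / 2\<close>.\<close>

definition lap_radius :: "complex \<Rightarrow> nat \<Rightarrow> complex \<Rightarrow> real \<Rightarrow> real" where
  "lap_radius \<eta> N lam M = norm lam / (2 * M ^ N * norm \<eta> ^ N)"

lemma lap_radius_pos: "\<eta> \<noteq> 0 \<Longrightarrow> lam \<noteq> 0 \<Longrightarrow> M > 0 \<Longrightarrow> lap_radius \<eta> N lam M > 0"
  by (simp add: lap_radius_def)

lemma square_over_double: "(x * y + b)\<^sup>2 / (2 * x) = x * y\<^sup>2 / 2 + y * b + b\<^sup>2 / (2 * x)" if "x > 0" for x y b :: real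
proof -
  have "(x * y + b)\<^sup>2 = (2 * x) * (x * y\<^sup>2 / 2 + y * b) + b\<^sup>2" by (simp add: power2_eq_square algebra_simps)
  then show ?thesis using that by (simp add: add_divide_distrib)
qed

text \<open>For large positive indices the quadratic exponents of \<open>u\<close> and of the denominators cancel, and a geometric
  series is left. For negative ones \<open>u\<close> is bounded, and the denominators alone give Gaussian decay.\<close>

lemma lap_coeff_summable:
  assumes \<eta>: "norm \<eta> > 1" and N: "N > 0" and lam: "lam \<noteq> 0" and M: "1 \<le> M" and C: "0 \<le> C"
    and u: "\<And>k. norm (u k) \<le> gauss_growth \<eta> N C M k"
    and b: "b < N" and z: "z \<noteq> 0" "norm z < lap_radius \<eta> N lam M"
  shows "(\<lambda>a. norm (lap_coeff \<eta> N lam u b a * z powi a)) summable_on UNIV"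
proof (rule abs_summable_int)
  have \<eta>0: "\<eta> \<noteq> 0" using \<eta> by auto
  let ?Q = "norm \<eta>"
  have Q0: "?Q > 0" using \<eta>0 by simp
  define x where "x = ?Q ^ b * norm lam"
  have "1 \<le> ?Q ^ b" using \<eta> by (intro one_le_power) simp
  then have x: "norm lam \<le> x" using mult_right_mono[of 1 "?Q ^ b" "norm lam"] by (simp add: x_def)
  then have "x > 0" using lam by (meson less_le_trans zero_less_norm_iff)
  note x = x this
  define E where "E = C * M ^ b * ?Q powr ((real b)\<^sup>2 / (2 * real N)) / x"
  have E0: "E \<ge> 0" using C M x by (simp add: E_def)
  define R where "R = M ^ N * ?Q ^ N * norm z / norm lam"
  have R: "0 \<le> R" "R < 1/2"
    using z(2) lam M Q0 by (auto simp: R_def lap_radius_def field_simps)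
  have bound: "norm (lap_coeff \<eta> N lam u b (int n) * z powi int n) \<le> E * R ^ n" for n
  proof -
    have k: "nat (int N * int n + int b) = N * n + b" by (simp add: nat_add_distrib nat_mult_distrib)
    have "norm (u (int N * int n + int b)) \<le> C * M ^ (N * n + b) * ?Q powr ((real (N * n + b))\<^sup>2 / (2 * real N))"
      using u[of "int N * int n + int b"] unfolding gauss_growth_def k .
    moreover have "?Q powr ((real (N * n + b))\<^sup>2 / (2 * real N)) * ?Q powi (- (int N * tri (int n)))
        \<le> ?Q powr ((real b)\<^sup>2 / (2 * real N)) * (?Q ^ N) ^ n"
    proof -
      have "real_of_int (2 * tri (int n)) = real_of_int (int n * (int n + 1))" by (simp only: tri_double)
      then have tr: "real_of_int (- (int N * tri (int n))) = - (real N * (real n * (real n + 1) / 2))" by simp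
      have "?Q powi (- (int N * tri (int n))) = ?Q powr (- (real N * (real n * (real n + 1) / 2)))"
        unfolding tr[symmetric] using Q0 by (intro powr_real_of_int'[symmetric]) auto
      then have "?Q powr ((real (N * n + b))\<^sup>2 / (2 * real N)) * ?Q powi (- (int N * tri (int n))) =
         ?Q powr ((real (N * n + b))\<^sup>2 / (2 * real N) - real N * (real n * (real n + 1) / 2))"
        by (simp only: powr_add[symmetric] diff_conv_add_uminus)
      also have "\<dots> \<le> ?Q powr ((real b)\<^sup>2 / (2 * real N) + real (N * n))"
      proof (rule powr_mono)
        have "(real (N * n + b))\<^sup>2 / (2 * real N) = real N * (real n)\<^sup>2 / 2 + real n * real b + (real b)\<^sup>2 / (2 * real N)"
          using square_over_double[of "real N" "real n" "real b"] N by simp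
        moreover have "real N * (real n * (real n + 1) / 2) = real N * (real n)\<^sup>2 / 2 + real N * real n / 2"
          by (simp add: power2_eq_square field_simps)
        moreover have "real n * real b \<le> real N * real n"
          using b mult_left_mono[of "real b" "real N" "real n"] by (simp add: mult.commute)
        moreover have "0 \<le> real N * real n" "real (N * n) = real N * real n" by simp_all
        ultimately show "(real (N * n + b))\<^sup>2 / (2 * real N) - real N * (real n * (real n + 1) / 2) \<le> (real b)\<^sup>2 / (2 * real N) + real (N * n)"
          by linarith
      qed (use \<eta> in auto)
      also have "\<dots> = ?Q powr ((real b)\<^sup>2 / (2 * real N)) * (?Q ^ N) ^ n"
        using Q0 by (simp add: powr_add powr_realpow power_mult del: of_nat_mult)
      finally show ?thesis .
    qed
    ultimately have "norm (u (int N * int n + int b)) * ?Q powi (- (int N * tri (int n)))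
       \<le> C * M ^ (N * n + b) * (?Q powr ((real b)\<^sup>2 / (2 * real N)) * (?Q ^ N) ^ n)"
      using C M by (smt (verit) mult.assoc mult_left_mono mult_right_mono mult_nonneg_nonneg zero_le_power norm_ge_zero zero_le_power_int)
    moreover have "norm ((\<eta> ^ b * lam) powi (- (int n + 1))) \<le> inverse x * inverse (norm lam) ^ n"
    proof -
      have "norm ((\<eta> ^ b * lam) powi (- (int n + 1))) = inverse (x powi (int n + 1))"
        by (simp only: norm_power_int norm_mult norm_power x_def power_int_minus norm_inverse)
      also have "x powi (int n + 1) = x * x ^ n" using x by (simp add: power_int_add)
      also have "inverse (x * x ^ n) = inverse x * inverse x ^ n" by (simp add: power_inverse)
      also have "\<dots> \<le> inverse x * inverse (norm lam) ^ n"
        using x lam by (intro mult_left_mono power_mono le_imp_inverse_le) auto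
      finally show ?thesis .
    qed
    ultimately have "norm (u (int N * int n + int b)) * ?Q powi (- (int N * tri (int n))) * norm ((\<eta> ^ b * lam) powi (- (int n + 1)))
      \<le> C * M ^ (N * n + b) * (?Q powr ((real b)\<^sup>2 / (2 * real N)) * (?Q ^ N) ^ n) * (inverse x * inverse (norm lam) ^ n)"
      using C M by (elim mult_mono) simp_all
    then have "norm (lap_coeff \<eta> N lam u b (int n)) * norm z ^ n
       \<le> C * M ^ (N * n + b) * (?Q powr ((real b)\<^sup>2 / (2 * real N)) * (?Q ^ N) ^ n) * (inverse x * inverse (norm lam) ^ n) * norm z ^ n"
      unfolding lap_coeff_def norm_mult[of "_ * _"] norm_mult[of "u _"] norm_power_int[of \<eta>]
      by (intro mult_right_mono) auto
    also have "\<dots> = E * R ^ n"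
      by (simp add: E_def R_def power_add power_mult power_mult_distrib power_divide field_simps)
    finally show ?thesis by (simp add: norm_mult norm_power)
  qed
  show "summable (\<lambda>n. norm (lap_coeff \<eta> N lam u b (int n) * z powi int n))"
    by (rule summable_comparison_test'[of "\<lambda>n. E * R ^ n" 0])
      (use bound R in \<open>auto intro!: summable_mult summable_geometric\<close>)
  define y where "y = x / norm z"
  have bound': "norm (lap_coeff \<eta> N lam u b (- int n - 1) * z powi (- int n - 1)) \<le>
      (C / norm z) * ((?Q ^ N) powi (- tri (int n)) * y ^ n)" for n
  proof -
    have "int N * (- int n - 1) + int b = - (int N * int n) - (int N - int b)" by (simp add: algebra_simps)
    moreover have "int N * int n \<ge> 0" "int N - int b > 0" using b by simp_all
    ultimately have "nat (int N * (- int n - 1) + int b) = 0" by linarith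
    then have "norm (u (int N * (- int n - 1) + int b)) \<le> C"
      using u[of "int N * (- int n - 1) + int b"] \<eta>0 by (simp add: gauss_growth_def)
    moreover have "norm ((\<eta> ^ b * lam) powi (- (- int n - 1 + 1))) = x ^ n"
      by (simp add: norm_power norm_mult x_def)
    moreover have "norm (\<eta> powi (- (int N * tri (- int n - 1)))) = (?Q ^ N) powi (- tri (int n))"
      unfolding tri_reflect norm_power_int using power_int_mult[of ?Q "int N" "- tri (int n)"] by simp
    ultimately have "norm (lap_coeff \<eta> N lam u b (- int n - 1)) \<le> C * (?Q ^ N) powi (- tri (int n)) * x ^ n"
      unfolding lap_coeff_def norm_mult[of "_ * _"] norm_mult[of "u _"]
      using x Q0 by (auto intro!: mult_right_mono)
    moreover have "norm (z powi (- int n - 1)) = inverse (norm z) * inverse (norm z) ^ n"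
      using z by (simp add: norm_power_int power_int_diff power_int_minus norm_divide norm_inverse norm_power norm_mult field_simps)
    ultimately have "norm (lap_coeff \<eta> N lam u b (- int n - 1)) * norm (z powi (- int n - 1))
      \<le> C * (?Q ^ N) powi (- tri (int n)) * x ^ n * (inverse (norm z) * inverse (norm z) ^ n)"
      by (simp add: mult_right_mono)
    then show ?thesis by (simp add: norm_mult y_def power_divide field_simps)
  qed
  have "summable (\<lambda>n. (C / norm z) * ((?Q ^ N) powi (- tri (int n)) * y ^ n))"
    using \<eta> N by (intro summable_mult summable_gaussian) (auto intro: one_less_power)
  then show "summable (\<lambda>n. norm (lap_coeff \<eta> N lam u b (- int n - 1) * z powi (- int n - 1)))"
    by (rule summable_comparison_test'[where N = 0]) (use bound' in auto)
qed

lemma lap_residues: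
  assumes \<eta>: "norm \<eta> > 1" and N: "N > 0" and lam: "lam \<noteq> 0" and M: "1 \<le> M" and C: "0 \<le> C"
    and u: "\<And>k. norm (u k) \<le> gauss_growth \<eta> N C M k"
    and z: "z \<noteq> 0" "norm z < lap_radius \<eta> N lam M"
  shows "(\<lambda>k. norm (lap_term \<eta> N lam u z k)) summable_on UNIV"
    "lap_term \<eta> N lam u z summable_on UNIV"
    "lap \<eta> N lam u z = (\<Sum>b<N. z * (\<Sum>\<^sub>\<infinity>a. lap_coeff \<eta> N lam u b a * z powi a) / Theta (\<eta> ^ N) (\<eta> ^ b * lam / z)) / of_nat N"
    "(\<Sum>\<^sub>\<infinity>k. norm (lap_term \<eta> N lam u z k)) =
      (\<Sum>b<N. norm z * (\<Sum>\<^sub>\<infinity>a. norm (lap_coeff \<eta> N lam u b a * z powi a)) / norm (Theta (\<eta> ^ N) (\<eta> ^ b * lam / z)))"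
proof -
  have \<eta>0: "\<eta> \<noteq> 0" using \<eta> by auto
  define T where "T = (\<lambda>b. Theta (\<eta> ^ N) (\<eta> ^ b * lam / z))"
  have res: "lap_term \<eta> N lam u z (int N * a + int b) = z * (lap_coeff \<eta> N lam u b a * z powi a) / T b" for a b
    unfolding T_def by (rule lap_term_residue[OF \<eta>0 lam z(1)])
  note cs = lap_coeff_summable[OF \<eta> N lam M C u _ z]
  have "((\<lambda>a. norm z * norm (lap_coeff \<eta> N lam u b a * z powi a) / norm (T b)) has_sum
      norm z * (\<Sum>\<^sub>\<infinity>a. norm (lap_coeff \<eta> N lam u b a * z powi a)) / norm (T b)) UNIV" if "b < N" for b
    by (intro has_sum_divide_const has_sum_cmult_right has_sum_infsum cs that)
  then have "((\<lambda>a. norm (lap_term \<eta> N lam u z (int N * a + int b))) has_sum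
      norm z * (\<Sum>\<^sub>\<infinity>a. norm (lap_coeff \<eta> N lam u b a * z powi a)) / norm (T b)) UNIV" if "b < N" for b
    using that by (simp only: res norm_divide norm_mult[of z])
  from has_sum_int_residues[OF N this]
  have 1: "((\<lambda>k. norm (lap_term \<eta> N lam u z k)) has_sum
      (\<Sum>b<N. norm z * (\<Sum>\<^sub>\<infinity>a. norm (lap_coeff \<eta> N lam u b a * z powi a)) / norm (T b))) UNIV" .
  then show 2: "(\<lambda>k. norm (lap_term \<eta> N lam u z k)) summable_on UNIV"
    by (rule has_sum_imp_summable)
  show "(\<Sum>\<^sub>\<infinity>k. norm (lap_term \<eta> N lam u z k)) =
      (\<Sum>b<N. norm z * (\<Sum>\<^sub>\<infinity>a. norm (lap_coeff \<eta> N lam u b a * z powi a)) / norm (Theta (\<eta> ^ N) (\<eta> ^ b * lam / z)))"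
    using infsumI[OF 1] unfolding T_def .
  show "lap_term \<eta> N lam u z summable_on UNIV"
    using 2 by (rule abs_summable_summable[where f = "lap_term \<eta> N lam u z"])
  have "((\<lambda>a. z * (lap_coeff \<eta> N lam u b a * z powi a) / T b) has_sum
      z * (\<Sum>\<^sub>\<infinity>a. lap_coeff \<eta> N lam u b a * z powi a) / T b) UNIV" if "b < N" for b
    by (intro has_sum_divide_const has_sum_cmult_right has_sum_infsum
         abs_summable_summable[where f = "\<lambda>a. lap_coeff \<eta> N lam u b a * z powi a"] cs that)
  then have "((\<lambda>a. lap_term \<eta> N lam u z (int N * a + int b)) has_sum
      z * (\<Sum>\<^sub>\<infinity>a. lap_coeff \<eta> N lam u b a * z powi a) / T b) UNIV" if "b < N" for b
    using that by (simp only: res)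
  from infsumI[OF has_sum_int_residues[OF N this]]
  show "lap \<eta> N lam u z = (\<Sum>b<N. z * (\<Sum>\<^sub>\<infinity>a. lap_coeff \<eta> N lam u b a * z powi a) / Theta (\<eta> ^ N) (\<eta> ^ b * lam / z)) / of_nat N"
    unfolding lap_def T_def by (rule arg_cong)
qed

lemma lap_term_dilate:
  assumes "\<eta> \<noteq> 0"
  shows "lap_term \<eta> N lam (\<lambda>k. u (k + e)) z k = lap_term \<eta> N lam u (\<eta> powi e * z) (k + e)"
proof -
  have "\<eta> powi (int N + (k + e)) = \<eta> powi (int N + k) * \<eta> powi e"
    by (simp only: powi_add[OF assms] mult.assoc)
  then have "\<eta> powi (int N + (k + e)) * lam / (\<eta> powi e * z) = \<eta> powi (int N + k) * lam / z"
    using assms by (simp add: field_simps)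
  then show ?thesis by (simp add: lap_term_def)
qed

lemma lap_dilate:
  assumes "\<eta> \<noteq> 0"
  shows "lap \<eta> N lam (\<lambda>k. u (k + e)) z = lap \<eta> N lam u (\<eta> powi e * z)"
  unfolding lap_def lap_term_dilate[OF assms]
  by (subst infsum_reindex_bij_witness[of UNIV "\<lambda>k. k - e" "\<lambda>k. k + e" UNIV]) auto

lemma summable_lap_dilate:
  assumes "\<eta> \<noteq> 0" "lap_term \<eta> N lam u (\<eta> powi e * z) summable_on UNIV"
  shows "lap_term \<eta> N lam (\<lambda>k. u (k + e)) z summable_on UNIV"
  unfolding lap_term_dilate[OF assms(1)]
  by (subst summable_on_reindex_bij_witness[of UNIV "\<lambda>k. k - e" "\<lambda>k. k + e" UNIV]) (use assms in auto)

text \<open>By quasi-periodicity of theta, a factor \<open>(\<eta>\<^sup>k lam)\<^sup>j\<close> of the sequence is traded for a dilation of the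
  transform. This is the reason why the transformation changes the level of an equation.\<close>

lemma lap_term_power:
  assumes \<eta>: "\<eta> \<noteq> 0" and lam: "lam \<noteq> 0" and z: "z \<noteq> 0"
  shows "lap_term \<eta> N lam (\<lambda>k. (\<eta> powi k * lam) ^ j * u k) z k =
    z ^ j * \<eta> powi (int N * int (j choose 2)) * lap_term \<eta> N lam u (\<eta> powi (int N * int j) * z) k"
proof -
  let ?p = "\<eta> ^ N" and ?x = "\<eta> powi k * lam / z"
  let ?y = "?p powi (1 - int j) * ?x"
  have p0: "?p \<noteq> 0" using \<eta> by simp
  have pp: "?p powi l = \<eta> powi (int N * l)" for l by (simp only: power_int_mult power_int_of_nat)
  have "\<eta> powi (int N + k) * lam / z = ?p * ?x" using \<eta> by (simp add: powi_add)
  also have "\<dots> = ?p powi (int j + (1 - int j)) * ?x" by simp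
  also have "\<dots> = ?p powi int j * ?y" by (simp only: powi_add[OF p0] mult.assoc)
  finally have xx: "\<eta> powi (int N + k) * lam / z = ?p powi int j * ?y" .
  have "Theta ?p (?p powi int j * ?y) = ?p powi tri (int j - 1) * ?y powi int j * Theta ?p ?y"
    by (rule Theta_shift_int) (use assms in auto)
  then have "Theta ?p (\<eta> powi (int N + k) * lam / z) = ?p powi tri (int j - 1) * ?y ^ j * Theta ?p ?y"
    by (simp only: xx power_int_of_nat)
  also have "?y ^ j = ?p powi ((1 - int j) * int j) * ?x ^ j"
    unfolding power_mult_distrib power_int_mult power_int_of_nat ..
  also have "?p powi tri (int j - 1) * (?p powi ((1 - int j) * int j) * ?x ^ j) = ?p powi (- int (j choose 2)) * ?x ^ j"
  proof -
    have "2 * (tri (int j - 1) + (1 - int j) * int j) = 2 * (- tri (int j - 1))"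
      by (simp only: distrib_left mult_minus_right tri_double) (simp add: algebra_simps)
    then have "tri (int j - 1) + (1 - int j) * int j = - int (j choose 2)" unfolding tri_choose by simp
    then show ?thesis by (simp only: mult.assoc[symmetric] powi_add[OF p0, symmetric])
  qed
  also have "?y = \<eta> powi (int N + k) * lam / (\<eta> powi (int N * int j) * z)"
  proof -
    have "?p powi (1 - int j) = \<eta> ^ N / \<eta> powi (int N * int j)"
      unfolding pp by (simp add: right_diff_distrib power_int_diff \<eta>)
    then show ?thesis using \<eta> by (simp add: powi_add)
  qed
  finally have T: "Theta ?p (\<eta> powi (int N + k) * lam / z) = ?p powi (- int (j choose 2)) * ?x ^ j *
      Theta ?p (\<eta> powi (int N + k) * lam / (\<eta> powi (int N * int j) * z))" .
  define E where "E = \<eta> powi (int N * int (j choose 2))"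
  have "?p powi (- int (j choose 2)) = inverse E"
    unfolding pp E_def by (simp add: power_int_minus)
  note T = T[unfolded this]
  have "E \<noteq> 0" using \<eta> by (simp add: E_def)
  then show ?thesis unfolding lap_term_def T E_def[symmetric]
    using assms by (simp add: power_divide power_mult_distrib divide_simps)
qed

lemma lap_power:
  assumes "\<eta> \<noteq> 0" "lam \<noteq> 0" "z \<noteq> 0"
  shows "lap \<eta> N lam (\<lambda>k. (\<eta> powi k * lam) ^ j * u k) z =
    z ^ j * \<eta> powi (int N * int (j choose 2)) * lap \<eta> N lam u (\<eta> powi (int N * int j) * z)"
  unfolding lap_def lap_term_power[OF assms] infsum_cmult_right' by simp

lemma lap_sum:
  assumes "finite S" "\<And>i. i \<in> S \<Longrightarrow> lap_term \<eta> N lam (f i) z summable_on UNIV"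
  shows "lap \<eta> N lam (\<lambda>k. \<Sum>i\<in>S. c i * f i k) z = (\<Sum>i\<in>S. c i * lap \<eta> N lam (f i) z)"
proof -
  have "((\<lambda>k. \<Sum>i\<in>S. c i * lap_term \<eta> N lam (f i) z k) has_sum (\<Sum>i\<in>S. c i * (\<Sum>\<^sub>\<infinity>k. lap_term \<eta> N lam (f i) z k))) UNIV"
    using assms
  proof (induction S rule: finite_induct)
    case (insert i S)
    then show ?case by (simp, intro has_sum_add has_sum_cmult_right has_sum_infsum) auto
  qed simp
  moreover have "lap_term \<eta> N lam (\<lambda>k. \<Sum>i\<in>S. c i * f i k) z = (\<lambda>k. \<Sum>i\<in>S. c i * lap_term \<eta> N lam (f i) z k)"
    by (simp add: fun_eq_iff lap_term_def sum_divide_distrib)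
  ultimately have "(\<Sum>\<^sub>\<infinity>k. lap_term \<eta> N lam (\<lambda>k. \<Sum>i\<in>S. c i * f i k) z k) = (\<Sum>i\<in>S. c i * (\<Sum>\<^sub>\<infinity>k. lap_term \<eta> N lam (f i) z k))"
    by (simp add: infsumI)
  then show ?thesis unfolding lap_def by (simp add: sum_divide_distrib)
qed

lemma lap_theta_nonzero:
  assumes \<eta>: "norm \<eta> > 1" and N: "N > 0" and lam: "lam \<noteq> 0" and z: "z \<noteq> 0"
    and np: "\<And>k::int. z \<noteq> - (\<eta> powi k * lam)"
  shows "Theta (\<eta> ^ N) (\<eta> ^ b * lam / z) \<noteq> 0"
proof (rule Theta_nonzero)
  have \<eta>0: "\<eta> \<noteq> 0" using \<eta> by auto
  show "1 < norm (\<eta> ^ N)" using \<eta> N by (simp add: norm_power one_less_power)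
  show "\<eta> ^ b * lam / z \<noteq> 0" using \<eta>0 lam z by simp
  fix k :: int
  show "\<eta> ^ b * lam / z \<noteq> - ((\<eta> ^ N) powi k)"
  proof
    assume "\<eta> ^ b * lam / z = - ((\<eta> ^ N) powi k)"
    then have "\<eta> powi int b * lam = - (\<eta> powi (int N * k) * z)"
      using z by (simp add: divide_simps power_int_mult)
    then have "\<eta> powi (- (int N * k)) * (\<eta> powi int b * lam) = \<eta> powi (- (int N * k)) * (- (\<eta> powi (int N * k) * z))"
      by simp
    also have "\<dots> = - (\<eta> powi (- (int N * k) + int N * k) * z)"
      by (simp only: powi_add[OF \<eta>0]) simp
    also have "\<dots> = - z" by simp
    also have "\<eta> powi (- (int N * k)) * (\<eta> powi int b * lam) = \<eta> powi (- (int N * k) + int b) * lam"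
      by (simp only: powi_add[OF \<eta>0] mult.assoc)
    finally have "z = - (\<eta> powi (- (int N * k) + int b) * lam)"
      by (simp only: minus_minus)
    with np show False by blast
  qed
qed

lemma gauss_growth_one: "norm \<eta> > 1 \<Longrightarrow> 1 \<le> gauss_growth \<eta> N 1 1 k"
  by (simp add: gauss_growth_def ge_one_powr_ge_zero)

text \<open>In each residue class the Laurent series is the theta series of its own denominator. So all \<open>N\<close> classes
  contribute \<open>1\<close>, which explains the normalisation.\<close>

lemma lap_one:
  assumes \<eta>: "norm \<eta> > 1" and N: "N > 0" and lam: "lam \<noteq> 0"
    and z: "z \<noteq> 0" "norm z < lap_radius \<eta> N lam 1" and np: "\<And>k::int. z \<noteq> - (\<eta> powi k * lam)"
  shows "lap \<eta> N lam (\<lambda>_. 1) z = 1"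
proof -
  have \<eta>0: "\<eta> \<noteq> 0" using \<eta> by auto
  have u: "norm (1::complex) \<le> gauss_growth \<eta> N 1 1 k" for k using gauss_growth_one[OF \<eta>] by simp
  note R = lap_residues(3)[OF \<eta> N lam _ _ u z]
  have "z * (\<Sum>\<^sub>\<infinity>a. lap_coeff \<eta> N lam (\<lambda>_. 1) b a * z powi a) / Theta (\<eta> ^ N) (\<eta> ^ b * lam / z) = 1" for b
  proof -
    let ?x = "\<eta> ^ b * lam / z"
    have "z * (lap_coeff \<eta> N lam (\<lambda>_. 1) b a * z powi a) = theta_term (\<eta> ^ N) ?x (- a - 1)" for a
    proof -
      have "\<eta> powi (- (int N * tri a)) = (\<eta> ^ N) powi (- tri (- a - 1))"
        unfolding tri_reflect by (simp only: power_int_mult[symmetric] power_int_of_nat[symmetric]) simp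
      moreover have "z * z powi a = inverse (z powi (- (a + 1)))"
        by (simp only: power_int_minus powi_add[OF z(1)] inverse_inverse_eq power_int_1_right mult.commute)
      moreover have "?x powi (- (a + 1)) = (\<eta> ^ b * lam) powi (- (a + 1)) * inverse (z powi (- (a + 1)))"
        by (simp only: power_int_divide_distrib) (simp only: divide_inverse)
      moreover have "- a - 1 = - (a + 1)" by simp
      moreover have "z * (lap_coeff \<eta> N lam (\<lambda>_. 1) b a * z powi a) =
          \<eta> powi (- (int N * tri a)) * ((\<eta> ^ b * lam) powi (- (a + 1)) * (z * z powi a))"
        unfolding lap_coeff_def by (simp only: mult_1 mult_ac)
      ultimately show ?thesis unfolding theta_term_def by (simp only: )
    qed
    then have "z * (\<Sum>\<^sub>\<infinity>a. lap_coeff \<eta> N lam (\<lambda>_. 1) b a * z powi a) = (\<Sum>\<^sub>\<infinity>a. theta_term (\<eta> ^ N) ?x (- a - 1))"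
      by (simp only: infsum_cmult_right'[symmetric])
    also have "\<dots> = Theta (\<eta> ^ N) ?x" unfolding Theta_eq
      by (rule infsum_reindex_bij_witness[of _ "\<lambda>l. - l - 1" "\<lambda>l. - l - 1"]) auto
    finally show ?thesis using lap_theta_nonzero[OF \<eta> N lam z(1) np] by simp
  qed
  then show ?thesis using R N by simp
qed

text \<open>A power \<open>j\<close> of the variable brings in the factor \<open>\<eta>\<^sup>N\<close> to the power \<open>j choose 2\<close> and a dilation by
  \<open>\<eta>\<close> to the power \<open>N j\<close>; both amount to replacing \<open>\<sigma> + N\<close> by \<open>\<sigma>\<close>. On the right hand side constants
  are reproduced.\<close>

lemma lap_equation:
  fixes S :: "(nat \<times> nat) set" and c :: "nat \<times> nat \<Rightarrow> complex" and \<alpha> :: "nat \<Rightarrow> complex"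
  assumes \<eta>: "norm \<eta> > 1" and N: "N > 0" and lam: "lam \<noteq> 0" and M: "1 \<le> M" and C: "0 \<le> C"
    and u: "\<And>k. norm (u k) \<le> gauss_growth \<eta> N C M k"
    and "finite S"
    and eq: "\<And>k. (\<Sum>(i, j)\<in>S. c (i, j) * \<eta> powi (- ((\<sigma> + int N) * int (j choose 2))) * (\<eta> powi k * lam) ^ j * u (k + (L * int i - (\<sigma> + int N) * int j)))
        = (\<Sum>j\<le>d. \<alpha> j * \<eta> powi (- ((\<sigma> + int N) * int (j choose 2))) * (\<eta> powi k * lam) ^ j)"
    and z: "z \<noteq> 0" and np: "\<And>k::int. z \<noteq> - (\<eta> powi k * lam)"
    and small: "\<And>i j. (i, j) \<in> S \<Longrightarrow> norm (\<eta> powi (L * int i - \<sigma> * int j) * z) < lap_radius \<eta> N lam M"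
    and small': "\<And>j. j \<le> d \<Longrightarrow> norm (\<eta> powi (int N * int j) * z) < lap_radius \<eta> N lam 1"
  shows "(\<Sum>(i, j)\<in>S. c (i, j) * \<eta> powi (- (\<sigma> * int (j choose 2))) * z ^ j * lap \<eta> N lam u (\<eta> powi (L * int i - \<sigma> * int j) * z))
      = (\<Sum>j\<le>d. \<alpha> j * \<eta> powi (- (\<sigma> * int (j choose 2))) * z ^ j)"
proof -
  have \<eta>0: "\<eta> \<noteq> 0" using \<eta> by auto
  have comb: "\<eta> powi (- ((\<sigma> + int N) * int (j choose 2))) * \<eta> powi (int N * int (j choose 2)) = \<eta> powi (- (\<sigma> * int (j choose 2)))" for j
    by (simp only: powi_add[OF \<eta>0, symmetric]) (simp add: algebra_simps)
  define e where "e = (\<lambda>(i :: nat, j :: nat). L * int i - (\<sigma> + int N) * int j)"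
  define f where "f = (\<lambda>ij k. (\<eta> powi k * lam) ^ snd ij * u (k + e ij))"
  define C1 where "C1 = (\<lambda>ij. c ij * \<eta> powi (- ((\<sigma> + int N) * int (snd ij choose 2))))"
  have e': "int N * int j + e (i, j) = L * int i - \<sigma> * int j" for i j by (simp add: e_def algebra_simps)
  have dil: "\<eta> powi e (i, j) * (\<eta> powi (int N * int j) * z) = \<eta> powi (L * int i - \<sigma> * int j) * z" for i j
    unfolding e'[symmetric] by (simp only: powi_add[OF \<eta>0] mult_ac)
  have lf: "lap \<eta> N lam (f (i, j)) z = z ^ j * \<eta> powi (int N * int (j choose 2)) * lap \<eta> N lam u (\<eta> powi (L * int i - \<sigma> * int j) * z)" for i j
    unfolding f_def snd_conv lap_power[OF \<eta>0 lam z, of N j "\<lambda>k. u (k + e (i, j))"] lap_dilate[OF \<eta>0] dil ..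
  have sf: "lap_term \<eta> N lam (f (i, j)) z summable_on UNIV" if "(i, j) \<in> S" for i j
  proof -
    have "lap_term \<eta> N lam u (\<eta> powi e (i, j) * (\<eta> powi (int N * int j) * z)) summable_on UNIV"
      unfolding dil by (rule lap_residues(2)[OF \<eta> N lam M C u _ small[OF that]]) (use \<eta>0 z in auto)
    from summable_lap_dilate[OF \<eta>0 this] show ?thesis
      unfolding f_def snd_conv lap_term_power[OF \<eta>0 lam z, abs_def] by (rule summable_on_cmult_right)
  qed
  define g where "g = (\<lambda>j k. (\<eta> powi k * lam) ^ j * 1)"
  have np': "\<eta> powi l * z \<noteq> - (\<eta> powi k * lam)" for k l
  proof
    assume "\<eta> powi l * z = - (\<eta> powi k * lam)"
    then have "\<eta> powi (- l) * (\<eta> powi l * z) = - (\<eta> powi (- l) * (\<eta> powi k * lam))" by simp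
    then have "\<eta> powi (- l + l) * z = - (\<eta> powi (- l + k) * lam)" by (simp only: powi_add[OF \<eta>0] mult.assoc)
    then show False using np by simp
  qed
  have one: "norm (1::complex) \<le> gauss_growth \<eta> N 1 1 k" for k using gauss_growth_one[OF \<eta>] by simp
  have lg: "lap \<eta> N lam (g j) z = z ^ j * \<eta> powi (int N * int (j choose 2))" if "j \<le> d" for j
    unfolding g_def lap_power[OF \<eta>0 lam z, of N j "\<lambda>k. 1"]
    by (subst lap_one[OF \<eta> N lam _ small'[OF that] np']) (use \<eta>0 z in auto)
  have sg: "lap_term \<eta> N lam (g j) z summable_on UNIV" if "j \<le> d" for j
    unfolding g_def lap_term_power[OF \<eta>0 lam z, abs_def]
    by (rule summable_on_cmult_right, rule lap_residues(2)[OF \<eta> N lam _ _ one _ small'[OF that]]) (use \<eta>0 z in auto)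
  have "(\<lambda>k. \<Sum>ij\<in>S. C1 ij * f ij k) = (\<lambda>k. \<Sum>j\<le>d. \<alpha> j * \<eta> powi (- ((\<sigma> + int N) * int (j choose 2))) * g j k)"
  proof
    fix k
    show "(\<Sum>ij\<in>S. C1 ij * f ij k) = (\<Sum>j\<le>d. \<alpha> j * \<eta> powi (- ((\<sigma> + int N) * int (j choose 2))) * g j k)"
      using eq[of k] by (simp add: C1_def f_def g_def e_def case_prod_unfold mult.assoc)
  qed
  then have "lap \<eta> N lam (\<lambda>k. \<Sum>ij\<in>S. C1 ij * f ij k) z = lap \<eta> N lam (\<lambda>k. \<Sum>j\<le>d. \<alpha> j * \<eta> powi (- ((\<sigma> + int N) * int (j choose 2))) * g j k) z"
    by simp
  also have "lap \<eta> N lam (\<lambda>k. \<Sum>ij\<in>S. C1 ij * f ij k) z = (\<Sum>ij\<in>S. C1 ij * lap \<eta> N lam (f ij) z)"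
    by (rule lap_sum[OF \<open>finite S\<close>]) (use sf in auto)
  also have "lap \<eta> N lam (\<lambda>k. \<Sum>j\<le>d. \<alpha> j * \<eta> powi (- ((\<sigma> + int N) * int (j choose 2))) * g j k) z
      = (\<Sum>j\<le>d. \<alpha> j * \<eta> powi (- ((\<sigma> + int N) * int (j choose 2))) * lap \<eta> N lam (g j) z)"
    by (rule lap_sum) (use sg in auto)
  also have "\<dots> = (\<Sum>j\<le>d. \<alpha> j * \<eta> powi (- (\<sigma> * int (j choose 2))) * z ^ j)"
    by (intro sum.cong refl) (simp add: lg comb[symmetric] mult_ac)
  also have "(\<Sum>ij\<in>S. C1 ij * lap \<eta> N lam (f ij) z) =
      (\<Sum>(i, j)\<in>S. c (i, j) * \<eta> powi (- (\<sigma> * int (j choose 2))) * z ^ j * lap \<eta> N lam u (\<eta> powi (L * int i - \<sigma> * int j) * z))"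
    by (intro sum.cong refl) (auto simp: lf C1_def comb[symmetric] mult_ac)
  finally show ?thesis .
qed

lemma Theta_inverse_analytic:
  assumes "norm p > 1" "c \<noteq> 0"
  shows "(\<lambda>z. Theta p (c / z)) analytic_on (- {0})"
proof -
  have "(Theta p \<circ> (\<lambda>z. c / z)) holomorphic_on (- {0})"
    by (rule holomorphic_on_compose_gen[where t = "- {0}"])
      (use assms in \<open>auto intro!: holomorphic_intros Theta_holomorphic\<close>)
  then show ?thesis by (subst analytic_on_open) (auto simp: o_def open_Compl)
qed

text \<open>Quotients of Laurent series by theta functions: the zeros of the latter are the only possible poles.\<close>

lemma lap_analytic:
  assumes \<eta>: "norm \<eta> > 1" and N: "N > 0" and lam: "lam \<noteq> 0" and M: "1 \<le> M" and C: "0 \<le> C"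
    and u: "\<And>k. norm (u k) \<le> gauss_growth \<eta> N C M k"
  shows "lap \<eta> N lam u meromorphic_on (ball 0 (lap_radius \<eta> N lam M) - {0})"
    "\<lbrakk>z \<noteq> 0; norm z < lap_radius \<eta> N lam M; \<And>k::int. z \<noteq> - (\<eta> powi k * lam)\<rbrakk> \<Longrightarrow> lap \<eta> N lam u analytic_on {z}"
proof -
  let ?B = "ball 0 (lap_radius \<eta> N lam M) - {0} :: complex set"
  have opn: "open ?B" by (simp add: open_delete)
  define H where "H = (\<lambda>b z. \<Sum>\<^sub>\<infinity>a. lap_coeff \<eta> N lam u b a * z powi a)"
  have \<eta>N: "norm (\<eta> ^ N) > 1" and \<eta>0: "\<eta> \<noteq> 0" using \<eta> N by (auto simp: norm_power one_less_power)
  have H: "H b analytic_on ?B" if "b < N" for b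
  proof -
    have "H b holomorphic_on (eball 0 (ereal (lap_radius \<eta> N lam M)) - {0})"
      unfolding H_def by (rule Laurent_series_holomorphic) (use lap_coeff_summable[OF \<eta> N lam M C u that] in auto)
    then show ?thesis by (subst analytic_on_open[OF opn]) (auto simp: eball_def ball_def)
  qed
  have T: "(\<lambda>z. Theta (\<eta> ^ N) (\<eta> ^ b * lam / z)) analytic_on ?B" for b
    by (rule analytic_on_subset[OF Theta_inverse_analytic[OF \<eta>N]]) (use \<eta>0 lam in auto)
  define F where "F = (\<lambda>z. (\<Sum>b<N. z * H b z / Theta (\<eta> ^ N) (\<eta> ^ b * lam / z)) / of_nat N)"
  have eq: "lap \<eta> N lam u z = F z" if "z \<in> ?B" for z
    unfolding F_def H_def by (rule lap_residues(3)[OF \<eta> N lam M C u]) (use that in auto)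
  have "F meromorphic_on ?B" unfolding F_def
    by (intro meromorphic_intros analytic_on_imp_meromorphic_on H T) auto
  then show "lap \<eta> N lam u meromorphic_on ?B"
  proof (rule meromorphic_on_cong[THEN iffD1, rotated -1])
    fix z assume "z \<in> ?B"
    from eventually_at_in_open'[OF opn this] show "\<forall>\<^sub>F w in at z. F w = lap \<eta> N lam u w"
      by (rule eventually_mono) (simp only: eq)
  qed simp
  assume z: "z \<noteq> 0" "norm z < lap_radius \<eta> N lam M" "\<And>k::int. z \<noteq> - (\<eta> powi k * lam)"
  have "F analytic_on {z}" unfolding F_def
    using lap_theta_nonzero[OF \<eta> N lam z(1,3)] z N
    by (intro analytic_intros analytic_on_subset[OF H] analytic_on_subset[OF T]) auto
  moreover have "\<forall>\<^sub>F w in nhds z. F w = lap \<eta> N lam u w"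
    by (rule eventually_mono[OF eventually_nhds_in_open[OF opn, of z]]) (use z eq in auto)
  ultimately show "lap \<eta> N lam u analytic_on {z}" using analytic_at_cong by blast
qed

lemma gauss_growth_dominated:
  assumes "1 \<le> norm \<eta>" "1 \<le> M" "0 \<le> C" "k0 \<le> k" "\<And>k. norm (u k) \<le> gauss_growth \<eta> N C M k"
  shows "norm (u (l - k)) \<le> gauss_growth \<eta> N C M (l - k0)"
  using assms gauss_growth_mono[of C M \<eta> "l - k" "l - k0" N] order_trans by fastforce

lemma powi_between:
  fixes x y w :: real
  assumes "0 < x" "x \<le> y" "y \<le> w"
  shows "y powi a \<le> x powi a + w powi a"
proof (cases "0 \<le> a")
  case True
  then have "y powi a \<le> w powi a" using assms by (intro power_int_mono) auto
  then show ?thesis using assms zero_le_power_int[of x a] by linarith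
next
  case False
  have "x ^ nat (- a) \<le> y ^ nat (- a)" using assms by (intro power_mono) auto
  then have "inverse (y ^ nat (-a)) \<le> inverse (x ^ nat (- a))" using assms by (intro le_imp_inverse_le) auto
  then have "y powi a \<le> x powi a" using False by (simp add: power_int_def power_inverse)
  then show ?thesis using assms zero_le_power_int[of w a] by linarith
qed

text \<open>Contracting the argument by \<open>\<eta>\<^sup>k\<close> shifts the sequence by \<open>k\<close>. All shifts from \<open>k0\<close> onwards are dominated by
  that of the Gaussian majorant by \<open>k0\<close>; so a single contraction of the compact set has to be estimated,
  on which the denominators are bounded away from zero.\<close>

lemma lap_bounded:
  assumes \<eta>: "norm \<eta> > 1" and N: "N > 0" and lam: "lam \<noteq> 0" and M: "1 \<le> M" and C: "0 \<le> C"
    and u: "\<And>k. norm (u k) \<le> gauss_growth \<eta> N C M k"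
    and D: "compact D" "0 \<notin> D" "\<And>z k::int. z \<in> D \<Longrightarrow> z \<noteq> - (\<eta> powi k * lam)"
  shows "\<exists>B k0. \<forall>z\<in>D. \<forall>k\<ge>k0. norm (lap \<eta> N lam u (\<eta> powi (- k) * z)) \<le> B"
proof (cases "D = {}")
  case False
  have \<eta>0: "\<eta> \<noteq> 0" using \<eta> by auto
  have \<eta>N: "norm (\<eta> ^ N) > 1" using \<eta> N by (auto simp: norm_power one_less_power)
  let ?\<delta> = "lap_radius \<eta> N lam M"
  have \<delta>: "?\<delta> > 0" using lap_radius_pos[OF \<eta>0 lam] M by simp
  obtain r1 where r1: "r1 > 0" "\<And>z. z \<in> D \<Longrightarrow> r1 \<le> norm z"
  proof -
    obtain w where "w \<in> D" "\<forall>z\<in>D. norm w \<le> norm z"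
      using continuous_attains_inf[OF D(1) False, of norm] continuous_on_norm_id by blast
    then show ?thesis using that[of "norm w"] D(2) by auto
  qed
  obtain r2 where r2: "\<And>z. z \<in> D \<Longrightarrow> norm z \<le> r2" "r2 > 0"
    using compact_imp_bounded[OF D(1)] by (metis bounded_pos)
  obtain k0 where k0: "r2 / ?\<delta> < norm \<eta> ^ k0" using \<eta> real_arch_pow by blast
  define t where "t = norm \<eta> powi (- int k0)"
  have t: "t > 0" "t * r2 < ?\<delta>"
    using k0 \<delta> \<eta>0 by (auto simp: t_def power_int_minus field_simps)
  \<comment> \<open>the majorant, treated as a sequence to be transformed\<close>
  define W where "W = (\<lambda>k. of_real (gauss_growth \<eta> N C M k) :: complex)"
  have W: "norm (W k) \<le> gauss_growth \<eta> N C M k" for k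
    using gauss_growth_nonneg[of C M \<eta> N k] C M by (simp add: W_def)
  have np: "\<eta> powi l * z \<noteq> - (\<eta> powi k * lam)" if "z \<in> D" for l k z
  proof
    assume "\<eta> powi l * z = - (\<eta> powi k * lam)"
    then have "\<eta> powi (- l) * (\<eta> powi l * z) = - (\<eta> powi (- l) * (\<eta> powi k * lam))" by simp
    then have "\<eta> powi (- l + l) * z = - (\<eta> powi (- l + k) * lam)" by (simp only: powi_add[OF \<eta>0] mult.assoc)
    then show False using D(3)[OF that, of "- l + k"] by simp
  qed
  define cf where "cf = (\<lambda>b a. norm (lap_coeff \<eta> N lam W b a))"
  have "\<exists>T. \<forall>z\<in>D. inverse (norm (Theta (\<eta> ^ N) (\<eta> ^ b * lam / (\<eta> powi (- int k0) * z)))) \<le> T" for b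
  proof -
    have nz: "Theta (\<eta> ^ N) (\<eta> ^ b * lam / (\<eta> powi (- int k0) * z)) \<noteq> 0" if "z \<in> D" for z
      by (rule lap_theta_nonzero[OF \<eta> N lam _ np[OF that]]) (use that D \<eta>0 in auto)
    have c: "continuous_on (- {0}) (\<lambda>z. Theta (\<eta> ^ N) (\<eta> ^ b * lam / \<eta> powi (- int k0) / z))"
      by (intro holomorphic_on_imp_continuous_on analytic_imp_holomorphic Theta_inverse_analytic \<eta>N) (use \<eta>0 lam in auto)
    have "continuous_on D (\<lambda>z. Theta (\<eta> ^ N) (\<eta> ^ b * lam / (\<eta> powi (- int k0) * z)))"
      by (rule continuous_on_eq[OF continuous_on_subset[OF c]]) (use D in auto)
    then have "continuous_on D (\<lambda>z. inverse (norm (Theta (\<eta> ^ N) (\<eta> ^ b * lam / (\<eta> powi (- int k0) * z)))))"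
      by (intro continuous_intros) (use nz in auto)
    then have "bounded ((\<lambda>z. inverse (norm (Theta (\<eta> ^ N) (\<eta> ^ b * lam / (\<eta> powi (- int k0) * z))))) ` D)"
      using D(1) compact_continuous_image compact_imp_bounded by blast
    then show ?thesis unfolding bounded_iff by (metis abs_le_D1 image_eqI real_norm_def)
  qed
  then obtain T where T: "\<And>b z. z \<in> D \<Longrightarrow> inverse (norm (Theta (\<eta> ^ N) (\<eta> ^ b * lam / (\<eta> powi (- int k0) * z)))) \<le> T b"
    by metis
  define h where "h = (\<lambda>b s. \<Sum>\<^sub>\<infinity>a. norm (lap_coeff \<eta> N lam W b a * of_real s powi a))"
  have sm: "(\<lambda>a. norm (lap_coeff \<eta> N lam W b a * z powi a)) summable_on UNIV"
    if "b < N" "z \<noteq> 0" "norm z < ?\<delta>" for b z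
    by (rule lap_coeff_summable[OF \<eta> N lam M C W that])
  define B where "B = (\<Sum>b<N. t * r2 * (h b (t * r1) + h b (t * r2)) * T b)"
  have rr: "r1 \<le> r2" using False r1 r2 by (meson all_not_in_conv order_trans)
  have "norm (lap \<eta> N lam u (\<eta> powi (- k) * z)) \<le> B" if z: "z \<in> D" and k: "k \<ge> int k0" for z k
  proof -
    let ?w = "\<eta> powi (- int k0) * z"
    have nw: "norm ?w = t * norm z" by (simp add: t_def norm_mult norm_power_int)
    have w: "?w \<noteq> 0" "norm ?w < ?\<delta>"
    proof -
      show "?w \<noteq> 0" using z D \<eta>0 by auto
      have "t * norm z \<le> t * r2" using t r2(1)[OF z] by simp
      then show "norm ?w < ?\<delta>" using t nw by linarith
    qed
    have z0: "z \<noteq> 0" using z D by auto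
    have trm: "norm (lap_term \<eta> N lam (\<lambda>l. u (l - k)) z l) \<le> norm (lap_term \<eta> N lam (\<lambda>l. W (l + - int k0)) z l)" for l
    proof -
      have "norm (u (l - k)) \<le> norm (W (l + - int k0))"
        using gauss_growth_dominated[OF _ M C k u, of l] \<eta> gauss_growth_nonneg[of C M \<eta> N "l - int k0"] C M
        by (simp add: W_def)
      then show ?thesis by (simp add: lap_term_def norm_divide divide_right_mono)
    qed
    have s1: "(\<lambda>l. norm (lap_term \<eta> N lam (\<lambda>l. W (l + - int k0)) z l)) summable_on UNIV"
    proof -
      have "(\<lambda>l. norm (lap_term \<eta> N lam W ?w (l + - int k0))) summable_on UNIV"
        using summable_on_reindex_bij_witness[of UNIV "\<lambda>k. k + int k0" "\<lambda>k. k - int k0" UNIV "\<lambda>l. norm (lap_term \<eta> N lam W ?w l)" "\<lambda>l. norm (lap_term \<eta> N lam W ?w (l + - int k0))"]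
          lap_residues(1)[OF \<eta> N lam M C W w] by auto
      then show ?thesis using lap_term_dilate[OF \<eta>0, of N lam W "- int k0" z] by simp
    qed
    have i1: "(\<Sum>\<^sub>\<infinity>l. norm (lap_term \<eta> N lam (\<lambda>l. W (l + - int k0)) z l)) = (\<Sum>\<^sub>\<infinity>l. norm (lap_term \<eta> N lam W ?w l))"
      unfolding lap_term_dilate[OF \<eta>0]
      by (rule infsum_reindex_bij_witness[of _ "\<lambda>k. k + int k0" "\<lambda>k. k - int k0"]) auto
    have s0: "(\<lambda>l. norm (lap_term \<eta> N lam (\<lambda>l. u (l - k)) z l)) summable_on UNIV"
      by (rule summable_on_comparison_test[OF s1]) (use trm in auto)
    have "norm (lap \<eta> N lam u (\<eta> powi (- k) * z)) = norm (lap \<eta> N lam (\<lambda>l. u (l - k)) z)"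
      using lap_dilate[OF \<eta>0, of N lam u "- k" z] by simp
    also have "\<dots> \<le> (\<Sum>\<^sub>\<infinity>l. norm (lap_term \<eta> N lam (\<lambda>l. u (l - k)) z l)) / N"
      unfolding lap_def norm_divide using norm_infsum_bound[OF s0] by (simp add: divide_right_mono)
    also have "\<dots> \<le> (\<Sum>\<^sub>\<infinity>l. norm (lap_term \<eta> N lam (\<lambda>l. u (l - k)) z l))"
    proof -
      have "0 \<le> (\<Sum>\<^sub>\<infinity>l. norm (lap_term \<eta> N lam (\<lambda>l. u (l - k)) z l))" by (rule infsum_nonneg) auto
      then show ?thesis using N by (simp add: divide_le_eq mult_le_cancel_left1)
    qed
    also have "\<dots> \<le> (\<Sum>\<^sub>\<infinity>l. norm (lap_term \<eta> N lam (\<lambda>l. W (l + - int k0)) z l))"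
      by (rule infsum_mono[OF s0 s1]) (use trm in auto)
    also have "\<dots> = (\<Sum>b<N. norm ?w * (\<Sum>\<^sub>\<infinity>a. norm (lap_coeff \<eta> N lam W b a * ?w powi a)) / norm (Theta (\<eta> ^ N) (\<eta> ^ b * lam / ?w)))"
      unfolding i1 by (rule lap_residues(4)[OF \<eta> N lam M C W w])
    also have "\<dots> \<le> B" unfolding B_def
    proof (rule sum_mono)
      fix b assume "b \<in> {..<N}" then have b: "b < N" by simp
      have n1: "norm (of_real (t * r) :: complex) = t * r" if "r > 0" for r unfolding norm_of_real using t that by simp
      have c1: "(\<lambda>a. norm (lap_coeff \<eta> N lam W b a * of_real (t * r1) powi a)) summable_on UNIV"
      proof (intro sm b)
        have "t * r1 \<le> t * r2" using t rr by simp
        then have "t * r1 < ?\<delta>" using t by linarith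
        then show "norm (of_real (t * r1) :: complex) < ?\<delta>" by (simp only: n1[OF r1(1)])
      qed (use t r1 in auto)
      have c2: "(\<lambda>a. norm (lap_coeff \<eta> N lam W b a * of_real (t * r2) powi a)) summable_on UNIV"
        using t r2(2) by (intro sm b) (auto simp: n1 simp del: of_real_mult)
      have "(\<Sum>\<^sub>\<infinity>a. norm (lap_coeff \<eta> N lam W b a * ?w powi a)) \<le>
        (\<Sum>\<^sub>\<infinity>a. norm (lap_coeff \<eta> N lam W b a * of_real (t * r1) powi a) + norm (lap_coeff \<eta> N lam W b a * of_real (t * r2) powi a))"
      proof (rule infsum_mono)
        fix a
        have l: "t * r1 \<le> norm ?w" "norm ?w \<le> t * r2" "0 < t * r1" "0 < norm ?w" "0 < t * r2"
          using t r1 r2 z w by (auto simp: nw)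
        have "norm ?w powi a \<le> (t * r1) powi a + (t * r2) powi a"
          by (rule powi_between) (use l in auto)
        then have "cf b a * norm ?w powi a \<le> cf b a * ((t * r1) powi a + (t * r2) powi a)"
          by (rule mult_left_mono) (simp add: cf_def)
        then show "norm (lap_coeff \<eta> N lam W b a * ?w powi a) \<le> norm (lap_coeff \<eta> N lam W b a * of_real (t * r1) powi a) + norm (lap_coeff \<eta> N lam W b a * of_real (t * r2) powi a)"
          unfolding norm_mult[of "lap_coeff _ _ _ _ _ _"] norm_power_int n1[OF r1(1)] n1[OF r2(2)] cf_def distrib_left .
      qed (use sm[OF b w] c1 c2 summable_on_add in auto)
      also have "\<dots> = h b (t * r1) + h b (t * r2)" unfolding h_def by (rule infsum_add[OF c1 c2])
      finally have "norm ?w * (\<Sum>\<^sub>\<infinity>a. norm (lap_coeff \<eta> N lam W b a * ?w powi a)) \<le> t * r2 * (h b (t * r1) + h b (t * r2))"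
        using nw t r2(1)[OF z] by (intro mult_mono) (auto intro!: infsum_nonneg simp: r2(2) less_imp_le)
      then show "norm ?w * (\<Sum>\<^sub>\<infinity>a. norm (lap_coeff \<eta> N lam W b a * ?w powi a)) / norm (Theta (\<eta> ^ N) (\<eta> ^ b * lam / ?w))
         \<le> t * r2 * (h b (t * r1) + h b (t * r2)) * T b"
        using T[OF z, of b] by (subst divide_inverse, rule mult_mono)
          (use t r2(2) in \<open>auto intro!: infsum_nonneg mult_nonneg_nonneg add_nonneg_nonneg simp: h_def less_imp_le\<close>)
    qed
    finally show ?thesis .
  qed
  then show ?thesis by blast
qed auto

section \<open>Spirals\<close>

definition spirals :: "complex \<Rightarrow> complex set \<Rightarrow> complex set" where
  "spirals \<omega> R = {\<omega> powi k * \<rho> | (k :: int) \<rho>. \<rho> \<in> R}"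

lemma spirals_shift:
  assumes "\<omega> \<noteq> 0" shows "\<omega> powi l * z \<in> spirals \<omega> R \<longleftrightarrow> z \<in> spirals \<omega> R"
proof -
  have *: "\<omega> powi l * z \<in> spirals \<omega> R" if z: "z \<in> spirals \<omega> R" for l z
  proof -
    obtain k \<rho> where "\<rho> \<in> R" "z = \<omega> powi k * \<rho>" using z by (auto simp: spirals_def)
    then have "\<omega> powi l * z = \<omega> powi (l + k) * \<rho>" using assms by (simp add: powi_add)
    then show ?thesis using \<open>\<rho> \<in> R\<close> unfolding spirals_def by blast
  qed
  have "\<omega> powi (- l) * (\<omega> powi l * z) = \<omega> powi (- l + l) * z" by (simp only: powi_add[OF assms] mult.assoc)
  then have "\<omega> powi (- l) * (\<omega> powi l * z) = z" by simp
  then show ?thesis using *[of z l] *[of "\<omega> powi l * z" "- l"] by metis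
qed

lemma spirals_refl: "\<rho> \<in> R \<Longrightarrow> \<rho> \<in> spirals \<omega> R"
  unfolding spirals_def by (force intro: exI[of _ 0])

lemma finite_powi_between:
  fixes Q :: real
  assumes "Q > 1" "0 < a"
  shows "finite {k::int. a \<le> Q powi k \<and> Q powi k \<le> b}"
proof -
  obtain n where n: "b < Q ^ n" using assms real_arch_pow by blast
  obtain m where m: "inverse a < Q ^ m" using assms real_arch_pow by blast
  have "{k::int. a \<le> Q powi k \<and> Q powi k \<le> b} \<subseteq> {- int m..int n}"
  proof clarsimp
    fix k assume k: "a \<le> Q powi k" "Q powi k \<le> b"
    show "- int m \<le> k \<and> k \<le> int n"
    proof (rule ccontr)
      assume "\<not> ?thesis"
      then consider "k < - int m" | "int n < k" by linarith
      then show False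
      proof cases
        case 1
        then have "Q powi k \<le> Q powi (- int m)" using assms by (intro power_int_increasing) auto
        also have "\<dots> < a" using m assms by (simp add: power_int_minus inverse_less_iff_less field_simps)
        finally show False using k by simp
      next
        case 2
        then have "Q powi int n \<le> Q powi k" using assms by (intro power_int_increasing) auto
        then show False using n k by simp
      qed
    qed
  qed
  then show ?thesis by (rule finite_subset) simp
qed

lemma spirals_sparse:
  assumes \<omega>: "norm \<omega> > 1" and R: "finite R" "0 \<notin> R" and z: "z \<noteq> 0"
  shows "\<forall>\<^sub>F w in at z. w \<notin> spirals \<omega> R"
proof -
  define A where "A = {w :: complex. norm z / 2 < norm w \<and> norm w < 2 * norm z}"
  have A: "open A" "z \<in> A" unfolding A_def using z
    by (auto intro!: open_Collect_conj open_Collect_less continuous_intros)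
  have "spirals \<omega> R \<inter> A \<subseteq> (\<Union>\<rho>\<in>R. (\<lambda>k. \<omega> powi k * \<rho>) ` {k. norm z / 2 / norm \<rho> \<le> norm \<omega> powi k \<and> norm \<omega> powi k \<le> 2 * norm z / norm \<rho>})"
  proof
    fix w assume "w \<in> spirals \<omega> R \<inter> A"
    then obtain k \<rho> where w: "\<rho> \<in> R" "w = \<omega> powi k * \<rho>" "norm z / 2 < norm w" "norm w < 2 * norm z"
      by (auto simp: spirals_def A_def)
    then have "norm \<rho> > 0" using R by auto
    then have "norm z / 2 / norm \<rho> \<le> norm \<omega> powi k" "norm \<omega> powi k \<le> 2 * norm z / norm \<rho>"
      using w(3,4) unfolding w(2) by (simp_all add: norm_mult norm_power_int field_simps)
    with w show "w \<in> (\<Union>\<rho>\<in>R. (\<lambda>k. \<omega> powi k * \<rho>) ` {k. norm z / 2 / norm \<rho> \<le> norm \<omega> powi k \<and> norm \<omega> powi k \<le> 2 * norm z / norm \<rho>})"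
      by blast
  qed
  moreover have "finite \<dots>"
  proof (intro finite_UN_I finite_imageI finite_powi_between \<omega> R)
    fix \<rho> assume "\<rho> \<in> R"
    then have "\<rho> \<noteq> 0" using R by auto
    then show "0 < norm z / 2 / norm \<rho>" using z by simp
  qed
  ultimately have fin: "finite (spirals \<omega> R \<inter> A)" by (rule finite_subset)
  have "open (A - (spirals \<omega> R \<inter> A - {z}))" using A(1) fin by (intro open_Diff finite_imp_closed) auto
  from eventually_at_in_open[OF this, of z] A(2) show ?thesis
    by (auto elim!: eventually_mono)
qed

section \<open>Extending solutions outwards\<close>

lemma meromorphic_on_points: "f meromorphic_on A \<longleftrightarrow> (\<forall>z\<in>A. f meromorphic_on {z})"
  by (auto simp: meromorphic_on_def)

lemma analytic_dilate:
  assumes "f analytic_on {c * z}" shows "(\<lambda>w. f (c * w)) analytic_on {z :: complex}"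
  using analytic_on_compose[of "\<lambda>w. c * w" "{z}" f] assms by (auto simp: o_def intro!: analytic_intros)

lemma meromorphic_dilate:
  assumes "f meromorphic_on {c * z}" shows "(\<lambda>w. f (c * w)) meromorphic_on {z :: complex}"
  by (rule meromorphic_on_compose[OF assms]) (auto intro!: analytic_intros)

text \<open>The arguments on the right hand side of the equation are closer to the origin by a factor of at least
  \<open>\<bar>\<omega>\<bar>\<close>. So \<open>k\<close> iterations carry the solution from the disc of radius \<open>\<delta>\<close> to that of radius \<open>\<delta> \<bar>\<omega>\<bar>\<^sup>k\<close>. The
  singular set \<open>X\<close> is invariant under the dilations, so that the iterations do not enlarge it.\<close>

lemma extend_solution:
  fixes \<omega> :: complex and I :: "'i set" and d :: "'i \<Rightarrow> nat"
  assumes \<omega>: "norm \<omega> > 1" and I: "finite I" and d: "\<And>i. i \<in> I \<Longrightarrow> d i \<ge> 1" and \<delta>: "\<delta> > 0"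
    and X0: "0 \<notin> X" and Xinv: "\<And>z l. \<omega> powi l * z \<in> X \<longleftrightarrow> z \<in> X"
    and Xsp: "\<And>z. z \<noteq> 0 \<Longrightarrow> \<forall>\<^sub>F w in at z. w \<notin> X"
    and \<beta>m: "\<And>z. z \<noteq> 0 \<Longrightarrow> \<beta>0 meromorphic_on {z}" "\<And>i z. i \<in> I \<Longrightarrow> z \<noteq> 0 \<Longrightarrow> \<beta> i meromorphic_on {z}"
    and \<beta>a: "\<And>z. z \<noteq> 0 \<Longrightarrow> z \<notin> X \<Longrightarrow> \<beta>0 analytic_on {z}" "\<And>i z. i \<in> I \<Longrightarrow> z \<noteq> 0 \<Longrightarrow> z \<notin> X \<Longrightarrow> \<beta> i analytic_on {z}"
    and gm: "g meromorphic_on (ball 0 \<delta> - {0})"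
    and ga: "\<And>z. z \<noteq> 0 \<Longrightarrow> norm z < \<delta> \<Longrightarrow> z \<notin> X \<Longrightarrow> g analytic_on {z}"
    and eq: "\<And>z. z \<noteq> 0 \<Longrightarrow> norm z < \<delta> \<Longrightarrow> z \<notin> X \<Longrightarrow> g z = \<beta>0 z + (\<Sum>i\<in>I. \<beta> i z * g (\<omega> powi (- int (d i)) * z))"
  shows "\<exists>F. F meromorphic_on (- {0}) \<and> (\<forall>z. z \<noteq> 0 \<longrightarrow> norm z < \<delta> \<longrightarrow> F z = g z) \<and>
    (\<forall>z. z \<noteq> 0 \<longrightarrow> z \<notin> X \<longrightarrow> F analytic_on {z} \<and> F z = \<beta>0 z + (\<Sum>i\<in>I. \<beta> i z * F (\<omega> powi (- int (d i)) * z)))"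
proof -
  have \<omega>0: "\<omega> \<noteq> 0" using \<omega> by auto
  let ?Q = "norm \<omega>"
  define c where "c = (\<lambda>i. \<omega> powi (- int (d i)))"
  have c0: "c i \<noteq> 0" for i using \<omega>0 by (simp add: c_def)
  have cn: "norm (c i * z) * ?Q \<le> norm z" if "i \<in> I" for i z
  proof -
    have "?Q powi (- int (d i)) * ?Q = ?Q powi (1 - int (d i))" using \<omega>0 by (simp add: power_int_diff power_int_minus field_simps)
    also have "\<dots> \<le> ?Q powi 0" using d[OF that] \<omega> by (intro power_int_increasing) auto
    finally have "?Q powi (- int (d i)) * ?Q * norm z \<le> 1 * norm z" by (intro mult_right_mono) auto
    then show ?thesis by (simp add: c_def norm_mult norm_power_int mult_ac)
  qed
  \<comment> \<open>the \<open>k\<close>-th iterate is final on the disc of radius \<open>\<delta> \<bar>\<omega>\<bar>\<^sup>k\<close>\<close>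
  define G where "G = rec_nat g (\<lambda>_ f z. if norm z < \<delta> then g z else \<beta>0 z + (\<Sum>i\<in>I. \<beta> i z * f (c i * z)))"
  have G0: "G 0 = g" by (simp add: G_def)
  have GS: "G (Suc k) z = (if norm z < \<delta> then g z else \<beta>0 z + (\<Sum>i\<in>I. \<beta> i z * G k (c i * z)))" for k z
    by (simp add: G_def)
  have Gg: "G k z = g z" if "norm z < \<delta>" for k z using that by (cases k) (simp_all add: G0 GS)
  have smaller: "norm (c i * z) < \<delta> * ?Q ^ k" if "norm z < \<delta> * ?Q ^ Suc k" "i \<in> I" for i z k
  proof -
    have "norm (c i * z) * ?Q < (\<delta> * ?Q ^ k) * ?Q" using cn[OF that(2), of z] that(1) by (simp add: mult_ac)
    then show ?thesis using \<omega> by (simp add: mult_less_cancel_right)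
  qed
  have stable1: "norm z < \<delta> * ?Q ^ k \<Longrightarrow> G (Suc k) z = G k z" for k z
  proof (induction k arbitrary: z)
    case 0 then show ?case by (simp add: G0 GS)
  next
    case (Suc k)
    show ?case
    proof (cases "norm z < \<delta>")
      case False
      then show ?thesis using Suc.IH[OF smaller[OF Suc.prems]] by (simp add: GS cong: sum.cong)
    qed (simp add: GS)
  qed
  have stable: "k \<le> j \<Longrightarrow> norm z < \<delta> * ?Q ^ k \<Longrightarrow> G j z = G k z" for j k z
  proof (induction j rule: dec_induct)
    case (step j)
    have "\<delta> * ?Q ^ k \<le> \<delta> * ?Q ^ j" using step.hyps \<omega> \<delta> by simp
    then show ?case using step stable1[of z j] by simp
  qed simp
  have Geq: "G k z = \<beta>0 z + (\<Sum>i\<in>I. \<beta> i z * G k (c i * z))" if z: "z \<noteq> 0" "z \<notin> X" "norm z < \<delta> * ?Q ^ k" for k z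
  proof (cases "norm z < \<delta>")
    case True
    have "norm (c i * z) < \<delta>" if "i \<in> I" for i
    proof -
      have "norm (c i * z) * 1 \<le> norm (c i * z) * ?Q" using \<omega> by (intro mult_left_mono) auto
      then show ?thesis using cn[OF that, of z] True by simp
    qed
    then have "(\<Sum>i\<in>I. \<beta> i z * g (c i * z)) = (\<Sum>i\<in>I. \<beta> i z * G k (c i * z))"
      by (intro sum.cong refl) (simp add: Gg)
    then show ?thesis using eq[OF z(1) True z(2)] by (simp add: Gg True c_def)
  next
    case False
    then obtain k' where k: "k = Suc k'" using z(3) by (cases k) auto
    show ?thesis unfolding k GS[of k' z] using False stable1[OF smaller[OF z(3)[unfolded k]]]
      by (simp cong: sum.cong)
  qed
  have Xn: "c i * z \<notin> X" if "z \<notin> X" for i z using that Xinv unfolding c_def by simp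
  have Grec: "G (Suc k) w = \<beta>0 w + (\<Sum>i\<in>I. \<beta> i w * G k (c i * w))"
    if "w \<noteq> 0" "w \<notin> X" "norm w < \<delta> * ?Q ^ Suc k" for k w
    using Geq[OF that] stable1[OF smaller[OF that(3)]] by (simp cong: sum.cong)
  have Gan: "z \<noteq> 0 \<Longrightarrow> z \<notin> X \<Longrightarrow> norm z < \<delta> * ?Q ^ k \<Longrightarrow> G k analytic_on {z}" for k z
  proof (induction k arbitrary: z)
    case 0 then show ?case using ga by (simp add: G0)
  next
    case (Suc k)
    have "open (ball 0 (\<delta> * ?Q ^ Suc k) - {0})" by (simp add: open_delete)
    moreover have "z \<in> ball 0 (\<delta> * ?Q ^ Suc k) - {0}" using Suc.prems by simp
    ultimately have e1: "\<forall>\<^sub>F w in nhds z. w \<in> ball 0 (\<delta> * ?Q ^ Suc k) - {0}" by (rule eventually_nhds_in_open)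
    have e2: "\<forall>\<^sub>F w in nhds z. w \<notin> X" unfolding eventually_nhds_conv_at using Xsp Suc.prems by blast
    have "\<forall>\<^sub>F w in nhds z. \<beta>0 w + (\<Sum>i\<in>I. \<beta> i w * G k (c i * w)) = G (Suc k) w"
      using e1 e2 by eventually_elim (rule Grec[symmetric], auto)
    moreover have "(\<lambda>w. \<beta>0 w + (\<Sum>i\<in>I. \<beta> i w * G k (c i * w))) analytic_on {z}"
      using Suc.prems smaller[OF Suc.prems(3)] Xn c0
      by (intro analytic_intros analytic_dilate \<beta>a Suc.IH) auto
    ultimately show ?case by (rule iffD1[OF analytic_at_cong[OF _ refl]])
  qed
  have Gme: "z \<noteq> 0 \<Longrightarrow> norm z < \<delta> * ?Q ^ k \<Longrightarrow> G k meromorphic_on {z}" for k z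
  proof (induction k arbitrary: z)
    case 0 then show ?case using gm by (simp add: G0) (rule meromorphic_on_subset, auto)
  next
    case (Suc k)
    have "open (ball 0 (\<delta> * ?Q ^ Suc k) - {0})" by (simp add: open_delete)
    moreover have "z \<in> ball 0 (\<delta> * ?Q ^ Suc k) - {0}" using Suc.prems by simp
    ultimately have e1: "\<forall>\<^sub>F w in at z. w \<in> ball 0 (\<delta> * ?Q ^ Suc k) - {0}" by (rule eventually_at_in_open')
    have "\<forall>\<^sub>F w in at z. G (Suc k) w = \<beta>0 w + (\<Sum>i\<in>I. \<beta> i w * G k (c i * w))"
      using e1 Xsp[OF Suc.prems(1)] by eventually_elim (rule Grec, auto)
    then have "G (Suc k) meromorphic_on {z} \<longleftrightarrow> (\<lambda>w. \<beta>0 w + (\<Sum>i\<in>I. \<beta> i w * G k (c i * w))) meromorphic_on {z}"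
      by (intro meromorphic_on_cong) auto
    moreover have "(\<lambda>w. \<beta>0 w + (\<Sum>i\<in>I. \<beta> i w * G k (c i * w))) meromorphic_on {z}"
      using Suc.prems smaller[OF Suc.prems(2)] c0
      by (intro meromorphic_intros meromorphic_dilate \<beta>m Suc.IH) auto
    ultimately show ?case by blast
  qed
  have "\<exists>k. norm z < \<delta> * ?Q ^ k" for z :: complex
  proof -
    obtain k where "norm z / \<delta> < ?Q ^ k" using \<omega> real_arch_pow by blast
    then show ?thesis using \<delta> by (auto simp: field_simps)
  qed
  then obtain n where n: "\<And>z::complex. norm z < \<delta> * ?Q ^ n z" by metis
  define F where "F = (\<lambda>z. G (n z) z)"
  have F: "F z = G k z" if "norm z < \<delta> * ?Q ^ k" for k z
    using stable[of k "max k (n z)" z] stable[of "n z" "max k (n z)" z] that n[of z] by (simp add: F_def)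
  have Fnhd: "\<forall>\<^sub>F w in nhds z. G (n z) w = F w" for z
  proof -
    have "\<forall>\<^sub>F w in nhds z. w \<in> ball 0 (\<delta> * ?Q ^ n z)"
      using n[of z] by (intro eventually_nhds_in_open) auto
    then show ?thesis by eventually_elim (simp add: F)
  qed
  have Fan: "F analytic_on {z}" if "z \<noteq> 0" "z \<notin> X" for z
    using Gan[OF that n] analytic_at_cong[OF Fnhd[of z] refl] by blast
  have Fme: "F meromorphic_on {z}" if "z \<noteq> 0" for z
  proof -
    have "\<forall>\<^sub>F w in at z. G (n z) w = F w" using Fnhd[of z] by (simp add: eventually_nhds_conv_at)
    then have "G (n z) meromorphic_on {z} \<longleftrightarrow> F meromorphic_on {z}" by (intro meromorphic_on_cong) auto
    then show ?thesis using Gme[OF that n] by simp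
  qed
  have Feq: "F z = \<beta>0 z + (\<Sum>i\<in>I. \<beta> i z * F (c i * z))" if "z \<noteq> 0" "z \<notin> X" for z
  proof -
    have "norm (c i * z) < \<delta> * ?Q ^ n z" if "i \<in> I" for i
    proof -
      have "norm (c i * z) * 1 \<le> norm (c i * z) * ?Q" using \<omega> by (intro mult_left_mono) auto
      then show ?thesis using cn[OF that, of z] n[of z] by simp
    qed
    then have "(\<Sum>i\<in>I. \<beta> i z * G (n z) (c i * z)) = (\<Sum>i\<in>I. \<beta> i z * F (c i * z))"
      by (intro sum.cong refl arg_cong2[of _ _ _ _ "(*)"] F[symmetric])
    then show ?thesis using Geq[OF that n] F[OF n] by simp
  qed
  show ?thesis
    by (rule exI[of _ F]) (use Fan Fme Feq F[of _ 0] in \<open>auto simp: G0 c_def meromorphic_on_points[of F "- {0}"]\<close>)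
qed

section \<open>Growth of solutions along spirals\<close>

text \<open>The weight of a term \<open>d\<close> steps back is just what completing the square provides: \<open>k d / N + (k - d)\<^sup>2 / (2 N)\<close>
  is \<open>k\<^sup>2 / (2 N) + d\<^sup>2 / (2 N)\<close>. The second summand does not depend on \<open>k\<close> and is absorbed in \<open>M\<close>.\<close>

lemma gauss_recurrence:
  fixes a :: "'x \<Rightarrow> int \<Rightarrow> real" and d :: "'i \<Rightarrow> nat"
  assumes \<eta>: "norm \<eta> > 1" and N: "N > 0" and I: "finite I" and A: "A \<ge> 0" and R: "R \<ge> 1" and B: "B \<ge> 0"
    and d: "\<And>i. i \<in> I \<Longrightarrow> d i \<ge> 1" "\<And>i. i \<in> I \<Longrightarrow> int (d i) \<le> k1" and k1: "0 \<le> k1"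
    and start: "\<And>x k. x \<in> D \<Longrightarrow> k \<le> k1 \<Longrightarrow> a x k \<le> B"
    and rec: "\<And>x k. x \<in> D \<Longrightarrow> k1 < k \<Longrightarrow>
       a x k \<le> A * R ^ nat k + (\<Sum>i\<in>I. A * norm \<eta> powr (real_of_int k * real (d i) / real N) * a x (k - int (d i)))"
  shows "\<exists>C M. 0 \<le> C \<and> 1 \<le> M \<and> (\<forall>x\<in>D. \<forall>k. a x k \<le> gauss_growth \<eta> N C M k)"
proof -
  let ?Q = "norm \<eta>"
  define P where "P = (\<Sum>i\<in>I. ?Q powr ((real (d i))\<^sup>2 / (2 * real N)))"
  define M where "M = max R (2 * A * P)"
  define C where "C = max B (2 * A)"
  have M: "M \<ge> 1" "M \<ge> R" "M \<ge> 2 * A * P" using R by (auto simp: M_def)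
  have C: "C \<ge> 0" "C \<ge> B" "C \<ge> 2 * A" using B by (auto simp: C_def)
  have "a x k \<le> gauss_growth \<eta> N C M k" if x: "x \<in> D" for x k
  proof (induction "nat k" arbitrary: k rule: less_induct)
    case less
    show ?case
  proof (cases "k \<le> k1")
    case True
    have "1 \<le> M ^ nat k * ?Q powr ((real (nat k))\<^sup>2 / (2 * real N))"
      using M \<eta> mult_mono[of 1 "M ^ nat k" 1 "?Q powr ((real (nat k))\<^sup>2 / (2 * real N))"]
      by (simp add: one_le_power ge_one_powr_ge_zero)
    then have "C * 1 \<le> gauss_growth \<eta> N C M k" unfolding gauss_growth_def mult.assoc using C by (intro mult_left_mono) auto
    then show ?thesis using start[OF x True] C by simp
  next
    case False
    define g where "g = ?Q powr ((real (nat k))\<^sup>2 / (2 * real N))"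
    have g: "g \<ge> 1" using \<eta> by (simp add: g_def ge_one_powr_ge_zero)
    have rk: "real_of_int k = real (nat k)" using False k1 by simp
    have summand: "A * ?Q powr (real_of_int k * real (d i) / real N) * a x (k - int (d i))
       \<le> C * M ^ (nat k - 1) * g * (A * ?Q powr ((real (d i))\<^sup>2 / (2 * real N)))" if i: "i \<in> I" for i
    proof -
      have nk: "nat (k - int (d i)) = nat k - d i" "nat k - d i \<le> nat k - 1" "d i \<le> nat k"
        using d[OF i] False k1 by auto
      have "nat (k - int (d i)) < nat k" using d[OF i] False k1 by simp
      from less.hyps[OF this] have "a x (k - int (d i)) \<le> C * M ^ (nat k - d i) * ?Q powr ((real (nat k - d i))\<^sup>2 / (2 * real N))"
        unfolding gauss_growth_def nk .
      also have "\<dots> \<le> C * M ^ (nat k - 1) * ?Q powr ((real (nat k - d i))\<^sup>2 / (2 * real N))"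
        using C M nk by (intro mult_right_mono mult_left_mono power_increasing) auto
      finally have "A * ?Q powr (real_of_int k * real (d i) / real N) * a x (k - int (d i))
         \<le> A * ?Q powr (real_of_int k * real (d i) / real N) * (C * M ^ (nat k - 1) * ?Q powr ((real (nat k - d i))\<^sup>2 / (2 * real N)))"
        using A by (intro mult_left_mono) auto
      also have "\<dots> = A * C * M ^ (nat k - 1) * ?Q powr (real_of_int k * real (d i) / real N + (real (nat k - d i))\<^sup>2 / (2 * real N))"
        by (simp only: powr_add mult_ac)
      also have "real_of_int k * real (d i) / real N + (real (nat k - d i))\<^sup>2 / (2 * real N)
          = (real (nat k))\<^sup>2 / (2 * real N) + (real (d i))\<^sup>2 / (2 * real N)"
        unfolding rk of_nat_diff[OF nk(3)] using N by (simp add: power2_eq_square field_simps)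
      finally show ?thesis by (simp only: powr_add g_def mult_ac)
    qed
    have "a x k \<le> A * R ^ nat k + (\<Sum>i\<in>I. A * ?Q powr (real_of_int k * real (d i) / real N) * a x (k - int (d i)))"
      using False by (intro rec x) simp
    also have "\<dots> \<le> A * R ^ nat k + (\<Sum>i\<in>I. C * M ^ (nat k - 1) * g * (A * ?Q powr ((real (d i))\<^sup>2 / (2 * real N))))"
      by (intro add_left_mono sum_mono summand)
    also have "(\<Sum>i\<in>I. C * M ^ (nat k - 1) * g * (A * ?Q powr ((real (d i))\<^sup>2 / (2 * real N)))) = C * M ^ (nat k - 1) * g * (A * P)"
      unfolding P_def by (simp only: sum_distrib_left)
    also have "\<dots> \<le> C * M ^ (nat k - 1) * g * (M / 2)"
      using C M g by (intro mult_left_mono) auto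
    also have "\<dots> = C / 2 * M ^ nat k * g"
    proof -
      have "nat k = Suc (nat k - 1)" using False k1 by simp
      then have "M ^ nat k = M * M ^ (nat k - 1)" by (metis power_Suc)
      then show ?thesis by simp
    qed
    also have "A * R ^ nat k \<le> C / 2 * M ^ nat k * g"
    proof -
      have "A * R ^ nat k \<le> C / 2 * M ^ nat k" using C A M R by (intro mult_mono power_mono) auto
      moreover have "C / 2 * M ^ nat k * 1 \<le> C / 2 * M ^ nat k * g" using C M g by (intro mult_left_mono) auto
      ultimately show ?thesis by simp
    qed
    finally show ?thesis by (simp add: gauss_growth_def g_def)
  qed
  qed
  then show ?thesis using C M by blast
qed

text \<open>On the \<open>k\<close>-th dilate of the compact set \<open>D\<close>, \<open>\<bar>z\<bar>\<close> is comparable to \<open>\<bar>\<omega>\<bar>\<^sup>k\<close>. So coefficients of size \<open>\<bar>z\<bar>\<close> to the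
  power \<open>d / N\<close> lead to the preceding recurrence, uniformly on \<open>D\<close>.\<close>

lemma solution_growth:
  fixes \<omega> :: complex and I :: "'i set" and d :: "'i \<Rightarrow> nat"
  assumes \<omega>: "norm \<omega> > 1" and N: "N > 0" and I: "finite I" and d: "\<And>i. i \<in> I \<Longrightarrow> d i \<ge> 1"
    and Xinv: "\<And>z l. \<omega> powi l * z \<in> X \<longleftrightarrow> z \<in> X"
    and Fa: "\<And>z. z \<noteq> 0 \<Longrightarrow> z \<notin> X \<Longrightarrow> F analytic_on {z}"
    and eq: "\<And>z. z \<noteq> 0 \<Longrightarrow> z \<notin> X \<Longrightarrow> F z = \<beta>0 z + (\<Sum>i\<in>I. \<beta> i z * F (\<omega> powi (- int (d i)) * z))"
    and \<beta>0: "C1 \<ge> 0" "R0 > 0" "\<And>z. R0 \<le> norm z \<Longrightarrow> norm (\<beta>0 z) \<le> C1 * norm z ^ e"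
    and \<beta>: "\<And>i z. i \<in> I \<Longrightarrow> R0 \<le> norm z \<Longrightarrow> norm (\<beta> i z) \<le> C1 * norm z powr (real (d i) / real N)"
    and D: "compact D" "0 \<notin> D" "D \<inter> X = {}"
    and bdd: "\<And>z k. z \<in> D \<Longrightarrow> k \<ge> k0 \<Longrightarrow> norm (F (\<omega> powi (- k) * z)) \<le> B"
  shows "\<exists>C M. 0 \<le> C \<and> 1 \<le> M \<and> (\<forall>z\<in>D. \<forall>k. norm (F (\<omega> powi k * z)) \<le> gauss_growth \<omega> N C M k)"
proof (cases "D = {}")
  case False
  have \<omega>0: "\<omega> \<noteq> 0" using \<omega> by auto
  let ?Q = "norm \<omega>"
  obtain r1 where r1: "r1 > 0" "\<And>z. z \<in> D \<Longrightarrow> r1 \<le> norm z"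
  proof -
    obtain w where "w \<in> D" "\<forall>z\<in>D. norm w \<le> norm z"
      using continuous_attains_inf[OF D(1) False, of norm] continuous_on_norm_id by blast
    then show ?thesis using that[of "norm w"] D(2) by auto
  qed
  obtain r2' where r2': "\<And>z. z \<in> D \<Longrightarrow> norm z \<le> r2'"
    using compact_imp_bounded[OF D(1)] by (metis bounded_iff)
  define r2 where "r2 = max 1 r2'"
  have r2: "r2 \<ge> 1" "\<And>z. z \<in> D \<Longrightarrow> norm z \<le> r2" using r2' by (fastforce simp: r2_def)+
  obtain m where m: "R0 / r1 < ?Q ^ m" using \<omega> real_arch_pow by blast
  define k1 where "k1 = int m + (\<Sum>i\<in>I. int (d i))"
  have dk: "int (d i) \<le> k1" if "i \<in> I" for i
    using member_le_sum[of i I "\<lambda>i. int (d i)"] that I by (simp add: k1_def)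
  have "(\<Sum>i\<in>I. int (d i)) \<ge> 0" by (rule sum_nonneg) simp
  then have k1: "0 \<le> k1" "int m \<le> k1" by (auto simp: k1_def)
  have big: "R0 \<le> norm (\<omega> powi k * z)" if "z \<in> D" "k1 < k" for z k
  proof -
    have "?Q ^ m \<le> ?Q powi k" using \<omega> k1 that power_int_increasing[of "int m" k ?Q] by simp
    moreover have "R0 < ?Q ^ m * r1" using m r1(1) by (simp add: divide_less_eq)
    moreover have "?Q ^ m * r1 \<le> ?Q powi k * norm z" using calculation r1 that by (intro mult_mono) auto
    ultimately show ?thesis by (simp add: norm_mult norm_power_int)
  qed
  have off: "\<omega> powi k * z \<noteq> 0" "\<omega> powi k * z \<notin> X" if "z \<in> D" for k z
    using that D \<omega>0 Xinv by auto
  have "\<exists>b. \<forall>z\<in>D. norm (F (\<omega> powi k * z)) \<le> b" for k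
  proof -
    have "continuous_on D (\<lambda>z. F (\<omega> powi k * z))"
    proof (rule continuous_at_imp_continuous_on, rule ballI)
      fix z assume "z \<in> D"
      then have "F analytic_on {\<omega> powi k * z}" using off Fa by blast
      then have "(\<lambda>z. F (\<omega> powi k * z)) analytic_on {z}" by (rule analytic_dilate)
      then show "isCont (\<lambda>z. F (\<omega> powi k * z)) z" by (rule analytic_at_imp_isCont)
    qed
    then have "bounded ((\<lambda>z. F (\<omega> powi k * z)) ` D)"
      using D(1) compact_continuous_image compact_imp_bounded by blast
    then show ?thesis by (auto simp: bounded_iff)
  qed
  then obtain b where b: "\<And>z k. z \<in> D \<Longrightarrow> norm (F (\<omega> powi k * z)) \<le> b k" by metis
  define B' where "B' = \<bar>B\<bar> + (\<Sum>k\<in>{- k0..k1}. \<bar>b k\<bar>)"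
  have start: "norm (F (\<omega> powi k * z)) \<le> B'" if "z \<in> D" "k \<le> k1" for z k
  proof (cases "k \<le> - k0")
    case True
    then have "norm (F (\<omega> powi k * z)) \<le> B" using bdd[OF that(1), of "- k"] by simp
    also have "\<dots> \<le> B'" unfolding B'_def by (smt (verit) sum_nonneg abs_ge_zero)
    finally show ?thesis .
  next
    case False
    have "norm (F (\<omega> powi k * z)) \<le> \<bar>b k\<bar>" using b[OF that(1), of k] by simp
    also have "\<dots> \<le> (\<Sum>k\<in>{- k0..k1}. \<bar>b k\<bar>)" using False that by (intro member_le_sum) auto
    finally show ?thesis by (simp add: B'_def)
  qed
  define R where "R = ?Q ^ e"
  define A where "A = C1 * (r2 ^ e + (\<Sum>i\<in>I. r2 powr (real (d i) / real N)))"
  have A0: "A \<ge> 0" using \<beta>0(1) r2 by (auto simp: A_def intro!: mult_nonneg_nonneg add_nonneg_nonneg sum_nonneg)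
  show ?thesis
  proof (rule gauss_recurrence[OF \<omega> N I A0 _ _ d dk k1(1) start])
    show "R \<ge> 1" using \<omega> by (simp add: R_def one_le_power)
    show "B' \<ge> 0" by (auto simp: B'_def intro!: add_nonneg_nonneg sum_nonneg)
    fix z k assume z: "z \<in> D" and k: "k1 < k"
    let ?w = "\<omega> powi k * z"
    have kn: "k = int (nat k)" using k k1 by simp
    have nw: "norm ?w = ?Q ^ nat k * norm z" 
      by (subst kn) (simp add: norm_mult norm_power del: int_nat_eq)
    have w2: "norm ?w \<le> ?Q ^ nat k * r2" unfolding nw using r2 z by (intro mult_left_mono) auto
    have t0: "norm (\<beta>0 ?w) \<le> A * R ^ nat k"
    proof -
      have "norm (\<beta>0 ?w) \<le> C1 * norm ?w ^ e" by (rule \<beta>0(3)[OF big[OF z k]])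
      also have "\<dots> \<le> C1 * (?Q ^ nat k * r2) ^ e" using w2 \<beta>0(1) by (intro mult_left_mono power_mono) auto
      also have "\<dots> = C1 * r2 ^ e * R ^ nat k" by (simp add: R_def power_mult_distrib power_mult[symmetric] mult.commute)
      also have "\<dots> \<le> A * R ^ nat k" unfolding A_def using \<beta>0(1) \<omega>
        by (intro mult_right_mono mult_left_mono) (auto simp: R_def intro!: sum_nonneg)
      finally show ?thesis .
    qed
    have ti: "norm (\<beta> i ?w * F (\<omega> powi (- int (d i)) * ?w)) \<le>
      A * ?Q powr (real_of_int k * real (d i) / real N) * norm (F (\<omega> powi (k - int (d i)) * z))" if i: "i \<in> I" for i
    proof -
      have "norm (\<beta> i ?w) \<le> C1 * norm ?w powr (real (d i) / real N)" by (rule \<beta>[OF i big[OF z k]])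
      also have "\<dots> \<le> C1 * (?Q ^ nat k * r2) powr (real (d i) / real N)" using w2 \<beta>0(1) by (intro mult_left_mono powr_mono2) auto
      also have "\<dots> = C1 * r2 powr (real (d i) / real N) * ?Q powr (real_of_int k * real (d i) / real N)"
      proof -
        have "(?Q ^ nat k) powr (real (d i) / real N) = ?Q powr (real (nat k) * (real (d i) / real N))"
          using \<omega>0 by (simp add: powr_powr powr_realpow[symmetric])
        also have "real (nat k) * (real (d i) / real N) = real_of_int k * real (d i) / real N" using k k1 by simp
        finally show ?thesis using r2 \<omega>0 by (simp add: powr_mult)
      qed
      also have "C1 * r2 powr (real (d i) / real N) \<le> A"
      proof -
        have "r2 powr (real (d i) / real N) \<le> (\<Sum>i\<in>I. r2 powr (real (d i) / real N))" using i I by (intro member_le_sum) auto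
        also have "\<dots> \<le> r2 ^ e + (\<Sum>i\<in>I. r2 powr (real (d i) / real N))" using r2 by simp
        finally show ?thesis unfolding A_def using \<beta>0(1) by (rule mult_left_mono)
      qed
      finally have 1: "norm (\<beta> i ?w) \<le> A * ?Q powr (real_of_int k * real (d i) / real N)" by (simp add: mult_right_mono)
      have "\<omega> powi (- int (d i)) * ?w = \<omega> powi (- int (d i) + k) * z" by (simp only: powi_add[OF \<omega>0] mult.assoc)
      also have "- int (d i) + k = k - int (d i)" by simp
      finally have 2: "\<omega> powi (- int (d i)) * ?w = \<omega> powi (k - int (d i)) * z" .
      show ?thesis unfolding norm_mult[of "\<beta> i ?w"] 2 using 1 by (rule mult_right_mono) simp
    qed
    have "norm (F ?w) = norm (\<beta>0 ?w + (\<Sum>i\<in>I. \<beta> i ?w * F (\<omega> powi (- int (d i)) * ?w)))"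
      using eq[OF off[OF z]] by simp
    also have "\<dots> \<le> norm (\<beta>0 ?w) + (\<Sum>i\<in>I. norm (\<beta> i ?w * F (\<omega> powi (- int (d i)) * ?w)))"
      by (rule order_trans[OF norm_triangle_ineq add_left_mono[OF norm_sum]])
    also have "\<dots> \<le> A * R ^ nat k + (\<Sum>i\<in>I. A * ?Q powr (real_of_int k * real (d i) / real N) * norm (F (\<omega> powi (k - int (d i)) * z)))"
      by (intro add_mono t0 sum_mono ti)
    finally show "norm (F ?w) \<le> A * R ^ nat k + (\<Sum>i\<in>I. A * ?Q powr (real_of_int k * real (d i) / real N) * norm (F (\<omega> powi (k - int (d i)) * z)))" .
  qed auto
qed (auto intro: exI[of _ 0] exI[of _ 1])

section \<open>q-difference operators as recurrences along spirals\<close>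

text \<open>The versions at level \<open>\<sigma>\<close> of a \<open>q\<close>-difference operator, for \<open>q = \<omega>\<^sup>L\<close>. The set \<open>S\<close> consists of the pairs
  \<open>(i, j)\<close> for which \<open>z\<^sup>j \<sigma>\<^sub>q\<^sup>i\<close> occurs, and \<open>c\<close> gives the coefficients. For \<open>\<sigma> = 0\<close> it is the operator itself;
  for other \<open>\<sigma>\<close> it is its conjugate by the map that multiplies the \<open>l\<close>-th coefficient of a series by \<open>\<omega>\<close> to
  the power \<open>- \<sigma> (l choose 2)\<close>.\<close>

definition qop_weight :: "complex \<Rightarrow> int \<Rightarrow> nat \<times> nat \<Rightarrow> complex" where
  "qop_weight \<omega> \<sigma> ij = \<omega> powi (- (\<sigma> * int (snd ij choose 2)))"

definition qop_exp :: "int \<Rightarrow> int \<Rightarrow> nat \<times> nat \<Rightarrow> int" where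
  "qop_exp L \<sigma> ij = L * int (fst ij) - \<sigma> * int (snd ij)"

definition qop_apply ::
    "complex \<Rightarrow> int \<Rightarrow> int \<Rightarrow> (nat \<times> nat) set \<Rightarrow> (nat \<times> nat \<Rightarrow> complex) \<Rightarrow> (complex \<Rightarrow> complex) \<Rightarrow> complex \<Rightarrow> complex" where
  "qop_apply \<omega> L \<sigma> S c F z = (\<Sum>ij\<in>S. c ij * qop_weight \<omega> \<sigma> ij * z ^ snd ij * F (\<omega> powi qop_exp L \<sigma> ij * z))"

definition qop_rhs :: "complex \<Rightarrow> int \<Rightarrow> complex poly \<Rightarrow> complex \<Rightarrow> complex" where
  "qop_rhs \<omega> \<sigma> a z = (\<Sum>j\<le>degree a. coeff a j * \<omega> powi (- (\<sigma> * int (j choose 2))) * z ^ j)"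

text \<open>The terms with the largest dilation determine the values farthest out. Their coefficients form the
  polynomial by which one has to divide in order to solve the equation for these values.\<close>

definition qop_order :: "int \<Rightarrow> int \<Rightarrow> (nat \<times> nat) set \<Rightarrow> int" where
  "qop_order L \<sigma> S = Max (qop_exp L \<sigma> ` S)"

definition qop_top :: "int \<Rightarrow> int \<Rightarrow> (nat \<times> nat) set \<Rightarrow> (nat \<times> nat) set" where
  "qop_top L \<sigma> S = {ij \<in> S. qop_exp L \<sigma> ij = qop_order L \<sigma> S}"

definition qop_lead :: "complex \<Rightarrow> int \<Rightarrow> int \<Rightarrow> (nat \<times> nat) set \<Rightarrow> (nat \<times> nat \<Rightarrow> complex) \<Rightarrow> complex poly" where
  "qop_lead \<omega> L \<sigma> S c = (\<Sum>ij\<in>qop_top L \<sigma> S. monom (c ij * qop_weight \<omega> \<sigma> ij) (snd ij))"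

lemma qop_exp_le: "finite S \<Longrightarrow> ij \<in> S \<Longrightarrow> qop_exp L \<sigma> ij \<le> qop_order L \<sigma> S"
  by (simp add: qop_order_def)

lemma qop_top_nonempty: "finite S \<Longrightarrow> S \<noteq> {} \<Longrightarrow> qop_top L \<sigma> S \<noteq> {}"
proof -
  assume "finite S" "S \<noteq> {}"
  then have "qop_order L \<sigma> S \<in> qop_exp L \<sigma> ` S" unfolding qop_order_def by (intro Max_in) auto
  then obtain ij where "ij \<in> S" "qop_order L \<sigma> S = qop_exp L \<sigma> ij" by (elim imageE)
  then have "ij \<in> qop_top L \<sigma> S" by (simp add: qop_top_def)
  then show ?thesis by blast
qed

text \<open>No cancellation occurs: for a given exponent, \<open>j\<close> determines \<open>i\<close>.\<close>

lemma qop_lead_coeff: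
  assumes "finite S" "L > 0" "ij \<in> qop_top L \<sigma> S"
  shows "coeff (qop_lead \<omega> L \<sigma> S c) (snd ij) = c ij * qop_weight \<omega> \<sigma> ij"
proof -
  have "kl = ij" if "kl \<in> qop_top L \<sigma> S" "snd kl = snd ij" for kl
  proof -
    have "L * int (fst kl) - \<sigma> * int (snd ij) = L * int (fst ij) - \<sigma> * int (snd ij)"
      using that assms(3) by (simp add: qop_top_def qop_exp_def)
    then have "fst kl = fst ij" using assms(2) by simp
    with that show ?thesis by (simp add: prod_eq_iff)
  qed
  then have "coeff (qop_lead \<omega> L \<sigma> S c) (snd ij) = (\<Sum>kl\<in>qop_top L \<sigma> S. if kl = ij then c ij * qop_weight \<omega> \<sigma> ij else 0)"
    unfolding qop_lead_def coeff_sum coeff_monom by (intro sum.cong refl) auto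
  also have "\<dots> = c ij * qop_weight \<omega> \<sigma> ij"
    using assms by (simp add: qop_top_def)
  finally show ?thesis .
qed

lemma qop_lead_nonzero:
  assumes "\<omega> \<noteq> 0" "finite S" "S \<noteq> {}" "L > 0" "\<And>ij. ij \<in> S \<Longrightarrow> c ij \<noteq> 0"
  shows "qop_lead \<omega> L \<sigma> S c \<noteq> 0"
proof -
  obtain ij where ij: "ij \<in> qop_top L \<sigma> S" using qop_top_nonempty[OF assms(2,3)] by blast
  then have "c ij * qop_weight \<omega> \<sigma> ij \<noteq> 0"
    using assms(1) assms(5)[of ij] by (simp add: qop_top_def qop_weight_def)
  with qop_lead_coeff[OF assms(2,4) ij, of \<omega> c] show ?thesis by auto
qed

text \<open>The equation solved for the value farthest out, with the argument of this value as variable.\<close>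

definition nf_rhs where
  "nf_rhs \<omega> L \<sigma> S c a z = (let w = \<omega> powi (- qop_order L \<sigma> S) * z in qop_rhs \<omega> \<sigma> a w / poly (qop_lead \<omega> L \<sigma> S c) w)"

definition nf_coeff where
  "nf_coeff \<omega> L \<sigma> S c ij z = (let w = \<omega> powi (- qop_order L \<sigma> S) * z in
     - (c ij * qop_weight \<omega> \<sigma> ij * w ^ snd ij) / poly (qop_lead \<omega> L \<sigma> S c) w)"

definition nf_shift where
  "nf_shift L \<sigma> S ij = nat (qop_order L \<sigma> S - qop_exp L \<sigma> ij)"

lemma qop_normal_form:
  assumes \<omega>0: "\<omega> \<noteq> 0" and S: "finite S" and nz: "poly (qop_lead \<omega> L \<sigma> S c) (\<omega> powi (- qop_order L \<sigma> S) * z) \<noteq> 0"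
  shows "qop_apply \<omega> L \<sigma> S c F (\<omega> powi (- qop_order L \<sigma> S) * z) = qop_rhs \<omega> \<sigma> a (\<omega> powi (- qop_order L \<sigma> S) * z) \<longleftrightarrow>
    F z = nf_rhs \<omega> L \<sigma> S c a z + (\<Sum>ij\<in>S - qop_top L \<sigma> S. nf_coeff \<omega> L \<sigma> S c ij z * F (\<omega> powi (- int (nf_shift L \<sigma> S ij)) * z))"
proof -
  define E where "E = qop_order L \<sigma> S"
  define w where "w = \<omega> powi (- E) * z"
  define l where "l = poly (qop_lead \<omega> L \<sigma> S c) w"
  have l: "l \<noteq> 0" using nz by (simp add: l_def w_def E_def)
  have sh: "\<omega> powi qop_exp L \<sigma> ij * w = \<omega> powi (qop_exp L \<sigma> ij - E) * z" for ij
    unfolding w_def by (simp add: power_int_diff power_int_minus \<omega>0 field_simps)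
  have sh': "- int (nf_shift L \<sigma> S ij) = qop_exp L \<sigma> ij - E" if "ij \<in> S" for ij
    using qop_exp_le[OF S that] by (simp add: nf_shift_def E_def)
  have "qop_apply \<omega> L \<sigma> S c F w = (\<Sum>ij\<in>qop_top L \<sigma> S. c ij * qop_weight \<omega> \<sigma> ij * w ^ snd ij * F (\<omega> powi qop_exp L \<sigma> ij * w))
     + (\<Sum>ij\<in>S - qop_top L \<sigma> S. c ij * qop_weight \<omega> \<sigma> ij * w ^ snd ij * F (\<omega> powi qop_exp L \<sigma> ij * w))"
    unfolding qop_apply_def by (subst sum.subset_diff[of "qop_top L \<sigma> S" S]) (use S in \<open>auto simp: qop_top_def\<close>)
  also have "(\<Sum>ij\<in>qop_top L \<sigma> S. c ij * qop_weight \<omega> \<sigma> ij * w ^ snd ij * F (\<omega> powi qop_exp L \<sigma> ij * w)) = l * F z"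
    unfolding l_def qop_lead_def poly_sum poly_monom sum_distrib_right
    by (intro sum.cong refl) (auto simp: qop_top_def E_def[symmetric] sh)
  also have "(\<Sum>ij\<in>S - qop_top L \<sigma> S. c ij * qop_weight \<omega> \<sigma> ij * w ^ snd ij * F (\<omega> powi qop_exp L \<sigma> ij * w))
      = - (l * (\<Sum>ij\<in>S - qop_top L \<sigma> S. nf_coeff \<omega> L \<sigma> S c ij z * F (\<omega> powi (- int (nf_shift L \<sigma> S ij)) * z)))"
    unfolding sum_distrib_left sum_negf[symmetric]
  proof (intro sum.cong refl)
    fix ij assume ij: "ij \<in> S - qop_top L \<sigma> S"
    have "nf_coeff \<omega> L \<sigma> S c ij z = - (c ij * qop_weight \<omega> \<sigma> ij * w ^ snd ij) / l"
      by (simp add: nf_coeff_def Let_def E_def w_def l_def)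
    then show "c ij * qop_weight \<omega> \<sigma> ij * w ^ snd ij * F (\<omega> powi qop_exp L \<sigma> ij * w) =
       - (l * (nf_coeff \<omega> L \<sigma> S c ij z * F (\<omega> powi (- int (nf_shift L \<sigma> S ij)) * z)))"
      using l ij by (simp add: sh sh')
  qed
  finally have *: "qop_apply \<omega> L \<sigma> S c F w = l * F z - l * (\<Sum>ij\<in>S - qop_top L \<sigma> S. nf_coeff \<omega> L \<sigma> S c ij z * F (\<omega> powi (- int (nf_shift L \<sigma> S ij)) * z))"
    by simp
  have r: "nf_rhs \<omega> L \<sigma> S c a z = qop_rhs \<omega> \<sigma> a w / l"
    by (simp add: nf_rhs_def Let_def E_def w_def l_def)
  define s where "s = (\<Sum>ij\<in>S - qop_top L \<sigma> S. nf_coeff \<omega> L \<sigma> S c ij z * F (\<omega> powi (- int (nf_shift L \<sigma> S ij)) * z))"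
  define b where "b = qop_rhs \<omega> \<sigma> a w"
  have "l * F z - l * s = b \<longleftrightarrow> F z = b / l + s"
  proof -
    have "l * F z - l * s = b \<longleftrightarrow> (F z - s) * l = b" by (simp add: algebra_simps)
    also have "\<dots> \<longleftrightarrow> F z - s = b / l" using l by (simp add: eq_divide_eq)
    finally show ?thesis by (simp add: diff_eq_eq)
  qed
  then show ?thesis unfolding E_def[symmetric] w_def[symmetric] * r s_def[symmetric] b_def[symmetric] .
qed

lemma poly_lower_bound_at_infinity:
  fixes p :: "complex poly"
  assumes "p \<noteq> 0"
  shows "\<exists>c>0. \<exists>R\<ge>1. \<forall>z. R \<le> norm z \<longrightarrow> c * norm z ^ degree p \<le> norm (poly p z)"
proof -
  define J where "J = degree p"
  define s where "s = (\<Sum>j<J. norm (coeff p j))"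
  define l where "l = norm (coeff p J)"
  have l: "l > 0" using assms by (simp add: l_def J_def)
  have s0: "s \<ge> 0" by (simp add: s_def sum_nonneg)
  define R where "R = max 1 (2 * s / l)"
  have "l / 2 * norm z ^ J \<le> norm (poly p z)" if z: "R \<le> norm z" for z
  proof -
    have z1: "1 \<le> norm z" and z2: "s \<le> l / 2 * norm z"
      using z l by (auto simp: R_def divide_le_eq mult.commute)
    have low: "norm (\<Sum>j<J. coeff p j * z ^ j) \<le> l / 2 * norm z ^ J"
    proof (cases J)
      case (Suc J')
      have "norm (\<Sum>j<J. coeff p j * z ^ j) \<le> (\<Sum>j<J. norm (coeff p j) * norm z ^ J')"
        by (rule order_trans[OF norm_sum], rule sum_mono)
          (use z1 Suc in \<open>auto simp: norm_mult norm_power intro!: mult_left_mono power_increasing\<close>)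
      also have "\<dots> = s * norm z ^ J'" by (simp add: s_def sum_distrib_right)
      also have "\<dots> \<le> l / 2 * norm z * norm z ^ J'" using z2 by (intro mult_right_mono) auto
      finally show ?thesis by (simp add: Suc)
    qed (use l in simp)
    have "poly p z = coeff p J * z ^ J + (\<Sum>j<J. coeff p j * z ^ j)"
      by (simp add: poly_altdef J_def lessThan_Suc_atMost[symmetric])
    then have "norm (poly p z) \<ge> l * norm z ^ J - norm (\<Sum>j<J. coeff p j * z ^ j)"
      using norm_diff_ineq[of "coeff p J * z ^ J" "\<Sum>j<J. coeff p j * z ^ j"]
      by (simp add: norm_mult norm_power l_def)
    with low show ?thesis by (simp add: algebra_simps)
  qed
  then show ?thesis using l unfolding J_def by (intro exI[of _ "l / 2"] conjI exI[of _ R]) (auto simp: R_def)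
qed

lemma qop_rhs_poly: "\<exists>p. \<forall>z. qop_rhs \<omega> \<sigma> a z = poly p z"
  by (rule exI[of _ "\<Sum>j\<le>degree a. monom (coeff a j * \<omega> powi (- (\<sigma> * int (j choose 2)))) j"])
    (simp add: qop_rhs_def poly_sum poly_monom)

lemma poly_analytic: "(\<lambda>z. poly p (c * z)) analytic_on A" for p :: "complex poly"
  by (rule analytic_on_subset[of _ UNIV]) (auto simp: analytic_on_open intro!: holomorphic_intros)

lemma nf_analytic:
  assumes "\<omega> \<noteq> 0" "poly (qop_lead \<omega> L \<sigma> S c) (\<omega> powi (- qop_order L \<sigma> S) * z) \<noteq> 0"
  shows "nf_rhs \<omega> L \<sigma> S c a analytic_on {z}" "nf_coeff \<omega> L \<sigma> S c ij analytic_on {z}"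
proof -
  obtain p where p: "\<And>z. qop_rhs \<omega> \<sigma> a z = poly p z" using qop_rhs_poly by blast
  show "nf_rhs \<omega> L \<sigma> S c a analytic_on {z}" "nf_coeff \<omega> L \<sigma> S c ij analytic_on {z}"
    unfolding nf_rhs_def[abs_def] nf_coeff_def[abs_def] Let_def p
    by ((intro analytic_on_divide analytic_intros poly_analytic), simp only: singleton_iff, erule ssubst, rule assms(2))+
qed

lemma nf_meromorphic:
  "nf_rhs \<omega> L \<sigma> S c a meromorphic_on {z}" "nf_coeff \<omega> L \<sigma> S c ij meromorphic_on {z}"
proof -
  obtain p where p: "\<And>z. qop_rhs \<omega> \<sigma> a z = poly p z" using qop_rhs_poly by blast
  show "nf_rhs \<omega> L \<sigma> S c a meromorphic_on {z}" "nf_coeff \<omega> L \<sigma> S c ij meromorphic_on {z}"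
    unfolding nf_rhs_def[abs_def] nf_coeff_def[abs_def] Let_def p
    by (intro meromorphic_intros analytic_on_imp_meromorphic_on[OF poly_analytic])+
qed

lemma nf_shift_pos:
  assumes "finite S" "ij \<in> S - qop_top L \<sigma> S"
  shows "nf_shift L \<sigma> S ij \<ge> 1"
proof -
  have "qop_exp L \<sigma> ij < qop_order L \<sigma> S"
    using qop_exp_le[OF assms(1), of ij L \<sigma>] assms(2) by (auto simp: qop_top_def)
  then show ?thesis unfolding nf_shift_def by linarith
qed

text \<open>Solving for the value farthest out introduces no singularities other than the roots of the
  leading polynomial and their dilates.\<close>

lemma qop_extend:
  assumes \<omega>: "norm \<omega> > 1" and S: "finite S"
    and R: "finite R" "0 \<notin> R" and roots: "\<And>z. z \<noteq> 0 \<Longrightarrow> poly (qop_lead \<omega> L \<sigma> S c) z = 0 \<Longrightarrow> z \<in> R"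
    and \<delta>: "\<delta> > 0" and gm: "g meromorphic_on (ball 0 \<delta> - {0})"
    and ga: "\<And>z. z \<noteq> 0 \<Longrightarrow> norm z < \<delta> \<Longrightarrow> z \<notin> spirals \<omega> R \<Longrightarrow> g analytic_on {z}"
    and eq: "\<And>z. z \<noteq> 0 \<Longrightarrow> norm z < \<delta> \<Longrightarrow> z \<notin> spirals \<omega> R \<Longrightarrow> qop_apply \<omega> L \<sigma> S c g z = qop_rhs \<omega> \<sigma> a z"
  shows "\<exists>F. \<exists>\<delta>'>0. F meromorphic_on (- {0}) \<and> (\<forall>z. z \<noteq> 0 \<longrightarrow> norm z < \<delta>' \<longrightarrow> F z = g z) \<and>
    (\<forall>z. z \<noteq> 0 \<longrightarrow> z \<notin> spirals \<omega> R \<longrightarrow> F analytic_on {z} \<and> qop_apply \<omega> L \<sigma> S c F z = qop_rhs \<omega> \<sigma> a z)"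
proof -
  have \<omega>0: "\<omega> \<noteq> 0" using \<omega> by auto
  let ?X = "spirals \<omega> R"
  define E where "E = qop_order L \<sigma> S"
  define \<delta>' where "\<delta>' = min \<delta> (\<delta> * norm \<omega> powi E)"
  have \<delta>': "\<delta>' > 0" "\<delta>' \<le> \<delta>" using \<delta> \<omega>0 by (auto simp: \<delta>'_def)
  have sE: "norm (\<omega> powi (- E) * z) < \<delta>" if "norm z < \<delta>'" for z
  proof -
    have "norm z < \<delta> * norm \<omega> powi E" using that by (simp add: \<delta>'_def)
    then show ?thesis using \<omega>0 by (simp add: norm_mult norm_power_int power_int_minus norm_inverse norm_divide field_simps)
  qed
  have X0: "0 \<notin> ?X" using R \<omega>0 by (auto simp: spirals_def)
  have nz: "poly (qop_lead \<omega> L \<sigma> S c) (\<omega> powi (- E) * z) \<noteq> 0" if "z \<noteq> 0" "z \<notin> ?X" for z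
    using roots[of "\<omega> powi (- E) * z"] spirals_refl[of "\<omega> powi (- E) * z" R \<omega>] spirals_shift[OF \<omega>0] that \<omega>0 by auto
  note nf = qop_normal_form[OF \<omega>0 S, of L \<sigma> c, folded E_def]
  have "\<exists>F. F meromorphic_on (- {0}) \<and> (\<forall>z. z \<noteq> 0 \<longrightarrow> norm z < \<delta>' \<longrightarrow> F z = g z) \<and>
    (\<forall>z. z \<noteq> 0 \<longrightarrow> z \<notin> ?X \<longrightarrow> F analytic_on {z} \<and>
      F z = nf_rhs \<omega> L \<sigma> S c a z + (\<Sum>ij\<in>S - qop_top L \<sigma> S. nf_coeff \<omega> L \<sigma> S c ij z * F (\<omega> powi (- int (nf_shift L \<sigma> S ij)) * z)))"
  proof (rule extend_solution[OF \<omega> _ _ \<delta>'(1) X0])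
    show "finite (S - qop_top L \<sigma> S)" using S by simp
    show "nf_shift L \<sigma> S ij \<ge> 1" if "ij \<in> S - qop_top L \<sigma> S" for ij by (rule nf_shift_pos[OF S that])
    show "(\<omega> powi l * z \<in> ?X) = (z \<in> ?X)" for z l by (rule spirals_shift[OF \<omega>0])
    show "\<forall>\<^sub>F w in at z. w \<notin> ?X" if "z \<noteq> 0" for z by (rule spirals_sparse[OF \<omega> R that])
    show "nf_rhs \<omega> L \<sigma> S c a meromorphic_on {z}" "nf_coeff \<omega> L \<sigma> S c ij meromorphic_on {z}" for z ij
      by (rule nf_meromorphic)+
    show "nf_rhs \<omega> L \<sigma> S c a analytic_on {z}" "nf_coeff \<omega> L \<sigma> S c ij analytic_on {z}" if "z \<noteq> 0" "z \<notin> ?X" for z ij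
      by (rule nf_analytic[OF \<omega>0], use nz[OF that] in \<open>simp add: E_def\<close>)+
    show "g meromorphic_on (ball 0 \<delta>' - {0})" by (rule meromorphic_on_subset[OF gm]) (use \<delta>' in auto)
    show "g analytic_on {z}" if "z \<noteq> 0" "norm z < \<delta>'" "z \<notin> ?X" for z using ga that \<delta>' by auto
    show "g z = nf_rhs \<omega> L \<sigma> S c a z + (\<Sum>ij\<in>S - qop_top L \<sigma> S. nf_coeff \<omega> L \<sigma> S c ij z * g (\<omega> powi (- int (nf_shift L \<sigma> S ij)) * z))"
      if z: "z \<noteq> 0" "norm z < \<delta>'" "z \<notin> ?X" for z
      by (rule iffD1[OF nf[OF nz[OF z(1,3)]]], rule eq)
        (use z \<omega>0 sE[OF z(2)] spirals_shift[OF \<omega>0] in auto)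
  qed
  then obtain F where F: "F meromorphic_on (- {0})" "\<And>z. z \<noteq> 0 \<Longrightarrow> norm z < \<delta>' \<Longrightarrow> F z = g z"
    "\<And>z. z \<noteq> 0 \<Longrightarrow> z \<notin> ?X \<Longrightarrow> F analytic_on {z}"
    "\<And>z. z \<noteq> 0 \<Longrightarrow> z \<notin> ?X \<Longrightarrow> F z = nf_rhs \<omega> L \<sigma> S c a z + (\<Sum>ij\<in>S - qop_top L \<sigma> S. nf_coeff \<omega> L \<sigma> S c ij z * F (\<omega> powi (- int (nf_shift L \<sigma> S ij)) * z))"
    by blast
  have "qop_apply \<omega> L \<sigma> S c F z = qop_rhs \<omega> \<sigma> a z" if z: "z \<noteq> 0" "z \<notin> ?X" for z
  proof -
    let ?z = "\<omega> powi E * z"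
    have z': "?z \<noteq> 0" "?z \<notin> ?X" using z \<omega>0 spirals_shift[OF \<omega>0] by auto
    have eqz: "\<omega> powi (- E) * ?z = z" using \<omega>0 by (simp add: power_int_minus)
    show ?thesis using iffD2[OF nf[OF nz[OF z']] F(4)[OF z']] unfolding eqz .
  qed
  with F \<delta>' show ?thesis by blast
qed

text \<open>The assumption \<open>slope\<close> compares degrees with dilations: after division by the leading polynomial, the
  coefficient of a value \<open>d\<close> steps back is at most of the order of \<open>\<bar>z\<bar>\<close> to the power \<open>d / N\<close>.\<close>

lemma qop_growth:
  assumes \<omega>: "norm \<omega> > 1" and N: "N > 0" and S: "finite S" and lead: "qop_lead \<omega> L \<sigma> S c \<noteq> 0"
    and R: "finite R" "0 \<notin> R" and roots: "\<And>z. z \<noteq> 0 \<Longrightarrow> poly (qop_lead \<omega> L \<sigma> S c) z = 0 \<Longrightarrow> z \<in> R"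
    and slope: "\<And>ij. ij \<in> S \<Longrightarrow> (int (snd ij) - int (degree (qop_lead \<omega> L \<sigma> S c))) * int N \<le> qop_order L \<sigma> S - qop_exp L \<sigma> ij"
    and Fa: "\<And>z. z \<noteq> 0 \<Longrightarrow> z \<notin> spirals \<omega> R \<Longrightarrow> F analytic_on {z}"
    and eq: "\<And>z. z \<noteq> 0 \<Longrightarrow> z \<notin> spirals \<omega> R \<Longrightarrow> qop_apply \<omega> L \<sigma> S c F z = qop_rhs \<omega> \<sigma> a z"
    and D: "compact D" "0 \<notin> D" "D \<inter> spirals \<omega> R = {}"
    and bdd: "\<And>z k. z \<in> D \<Longrightarrow> k \<ge> k0 \<Longrightarrow> norm (F (\<omega> powi (- k) * z)) \<le> B"
  shows "\<exists>C M. 0 \<le> C \<and> 1 \<le> M \<and> (\<forall>z\<in>D. \<forall>k. norm (F (\<omega> powi k * z)) \<le> gauss_growth \<omega> N C M k)"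
proof -
  have \<omega>0: "\<omega> \<noteq> 0" using \<omega> by auto
  let ?X = "spirals \<omega> R" and ?I = "S - qop_top L \<sigma> S"
  define E where "E = qop_order L \<sigma> S"
  define J where "J = degree (qop_lead \<omega> L \<sigma> S c)"
  obtain l R1 where l: "l > 0" "R1 \<ge> 1" "\<And>z. R1 \<le> norm z \<Longrightarrow> l * norm z ^ J \<le> norm (poly (qop_lead \<omega> L \<sigma> S c) z)"
    using poly_lower_bound_at_infinity[OF lead] unfolding J_def by blast
  define t where "t = norm \<omega> powi (- E)"
  have t: "t > 0" using \<omega>0 by (simp add: t_def)
  have nt: "norm (\<omega> powi (- E) * z) = t * norm z" for z by (simp add: t_def norm_mult norm_power_int)
  define R0 where "R0 = R1 / t"
  have R0: "R0 > 0" "\<And>z. R0 \<le> norm z \<Longrightarrow> R1 \<le> t * norm z" using l t by (auto simp: R0_def field_simps)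
  have nz: "poly (qop_lead \<omega> L \<sigma> S c) (\<omega> powi (- E) * z) \<noteq> 0" if "z \<noteq> 0" "z \<notin> ?X" for z
    using roots[of "\<omega> powi (- E) * z"] spirals_refl[of "\<omega> powi (- E) * z" R \<omega>] spirals_shift[OF \<omega>0] that \<omega>0 by auto
  note nf = qop_normal_form[OF \<omega>0 S, of L \<sigma> c, folded E_def]
  define A0 where "A0 = (\<Sum>j\<le>degree a. norm (coeff a j * \<omega> powi (- (\<sigma> * int (j choose 2))))) * t ^ degree a / l"
  define A1 where "A1 = (\<Sum>ij\<in>?I. norm (c ij * qop_weight \<omega> \<sigma> ij) * t powr (real (nf_shift L \<sigma> S ij) / real N) / l)"
  have A: "A0 \<ge> 0" "A1 \<ge> 0" using l t by (auto simp: A0_def A1_def intro!: sum_nonneg divide_nonneg_nonneg mult_nonneg_nonneg)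
  show ?thesis
  proof (rule solution_growth[OF \<omega> N])
    show "finite ?I" using S by simp
    show "nf_shift L \<sigma> S ij \<ge> 1" if "ij \<in> ?I" for ij by (rule nf_shift_pos[OF S that])
    show "(\<omega> powi k * z \<in> ?X) = (z \<in> ?X)" for z k by (rule spirals_shift[OF \<omega>0])
    show "F z = nf_rhs \<omega> L \<sigma> S c a z + (\<Sum>ij\<in>?I. nf_coeff \<omega> L \<sigma> S c ij z * F (\<omega> powi (- int (nf_shift L \<sigma> S ij)) * z))"
      if z: "z \<noteq> 0" "z \<notin> ?X" for z
      by (rule iffD1[OF nf[OF nz[OF z]]], rule eq) (use z \<omega>0 spirals_shift[OF \<omega>0] in auto)
    show "A0 + A1 \<ge> 0" using A by simp
    show "norm (nf_rhs \<omega> L \<sigma> S c a z) \<le> (A0 + A1) * norm z ^ degree a" if z: "R0 \<le> norm z" for z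
    proof -
      let ?w = "\<omega> powi (- E) * z"
      have w: "R1 \<le> norm ?w" "1 \<le> norm ?w" using R0(2)[OF z] l(2) nt by auto
      have "norm (qop_rhs \<omega> \<sigma> a ?w) \<le> (\<Sum>j\<le>degree a. norm (coeff a j * \<omega> powi (- (\<sigma> * int (j choose 2)))) * norm ?w ^ degree a)"
        unfolding qop_rhs_def using w(2)
        by (intro order_trans[OF norm_sum] sum_mono) (auto simp: norm_mult norm_power intro!: mult_left_mono power_increasing)
      moreover have "l \<le> norm (poly (qop_lead \<omega> L \<sigma> S c) ?w)"
      proof -
        have "l * 1 \<le> l * norm ?w ^ J" using w(2) l(1) by (intro mult_left_mono one_le_power) auto
        then show ?thesis using l(3)[OF w(1)] by simp
      qed
      ultimately have "norm (qop_rhs \<omega> \<sigma> a ?w) / norm (poly (qop_lead \<omega> L \<sigma> S c) ?w) \<le>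
         (\<Sum>j\<le>degree a. norm (coeff a j * \<omega> powi (- (\<sigma> * int (j choose 2)))) * norm ?w ^ degree a) / l"
        using l(1) by (intro frac_le sum_nonneg) auto
      also have "\<dots> = A0 * norm z ^ degree a"
        unfolding nt A0_def by (simp add: sum_distrib_right[symmetric] power_mult_distrib)
      also have "\<dots> \<le> (A0 + A1) * norm z ^ degree a" using A by (intro mult_right_mono) auto
      finally show ?thesis by (simp add: nf_rhs_def Let_def norm_divide E_def)
    qed
    show "norm (nf_coeff \<omega> L \<sigma> S c ij z) \<le> (A0 + A1) * norm z powr (real (nf_shift L \<sigma> S ij) / real N)"
      if ij: "ij \<in> ?I" and z: "R0 \<le> norm z" for ij z
    proof -
      let ?w = "\<omega> powi (- E) * z"
      define k where "k = norm (c ij * qop_weight \<omega> \<sigma> ij)"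
      define e where "e = real (nf_shift L \<sigma> S ij) / real N"
      define x where "x = t * norm z"
      have x: "R1 \<le> x" "1 \<le> x" "norm ?w = x" using R0(2)[OF z] l(2) nt by (auto simp: x_def)
      have "x ^ snd ij \<le> x powr (real J + e)"
      proof -
        have "(int (snd ij) - int J) * int N \<le> int (nf_shift L \<sigma> S ij)"
          using slope[of ij] ij qop_exp_le[OF S, of ij L \<sigma>] by (simp add: nf_shift_def J_def)
        then have "(real (snd ij) - real J) * real N \<le> real (nf_shift L \<sigma> S ij)"
          by (metis (mono_tags, lifting) of_int_diff of_int_le_iff of_int_mult of_int_of_nat_eq)
        then have "real (snd ij) - real J \<le> e" unfolding e_def using N by (subst pos_le_divide_eq) auto
        then have "real (snd ij) \<le> real J + e" by simp
        then have "x powr real (snd ij) \<le> x powr (real J + e)" using x by (intro powr_mono) auto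
        then show ?thesis using x(2) by (simp add: powr_realpow)
      qed
      also have "\<dots> = x ^ J * x powr e" using x(2) by (simp add: powr_add powr_realpow)
      finally have 1: "x ^ snd ij \<le> x ^ J * x powr e" .
      have "norm (nf_coeff \<omega> L \<sigma> S c ij z) = k * norm ?w ^ snd ij / norm (poly (qop_lead \<omega> L \<sigma> S c) ?w)"
        by (simp add: nf_coeff_def Let_def E_def norm_divide norm_mult norm_power k_def)
      also have "\<dots> = k * x ^ snd ij / norm (poly (qop_lead \<omega> L \<sigma> S c) ?w)" unfolding x(3) ..
      also have "\<dots> \<le> k * (x ^ J * x powr e) / (l * x ^ J)"
      proof (rule frac_le)
        show "l * x ^ J \<le> norm (poly (qop_lead \<omega> L \<sigma> S c) ?w)" using l(3)[of ?w] x by simp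
        show "0 < l * x ^ J" using l(1) x(2) by simp
      qed (use 1 x in \<open>auto simp: k_def intro!: mult_left_mono\<close>)
      also have "\<dots> = k * t powr e / l * norm z powr e"
      proof -
        have 2: "x \<noteq> 0" using x by auto
        have 3: "x powr e = t powr e * norm z powr e" unfolding x_def using t by (simp add: powr_mult)
        have "k * (x ^ J * x powr e) / (l * x ^ J) = k * x powr e / l" using 2 by simp
        then show ?thesis unfolding 3 by (simp only: times_divide_eq_left mult.assoc)
      qed
      also have "k * t powr e / l \<le> A1"
        unfolding A1_def k_def e_def
        by (rule member_le_sum[OF ij]) (use S l t in auto)
      finally have "norm (nf_coeff \<omega> L \<sigma> S c ij z) \<le> A1 * norm z powr e" by (simp add: mult_right_mono)
      also have "\<dots> \<le> (A0 + A1) * norm z powr e" using A by (intro mult_right_mono) auto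
      finally show ?thesis by (simp add: e_def)
    qed
  qed (use Fa D bdd R0 in auto)
qed

section \<open>Domains of continuation\<close>

lemma qpow_powi: "qpow lq (of_int k / of_nat K) = qpow lq (1 / of_nat K) powi k"
proof -
  have "qpow lq (1 / of_nat K) powi k = exp (of_int k * (of_real (1 / of_nat K) * lq))"
    unfolding qpow_def by (rule exp_power_int)
  also have "of_int k * (of_real (1 / of_nat K) * lq) = of_real (of_int k / of_nat K) * lq"
    by (simp add: field_simps)
  finally show ?thesis by (simp add: qpow_def)
qed

lemma open_compl_spirals:
  assumes \<omega>: "norm \<omega> > 1" and R: "finite R" "0 \<notin> R"
  shows "open (- insert 0 (spirals \<omega> R))"
proof -
  have "\<exists>T. open T \<and> z \<in> T \<and> T \<subseteq> - insert 0 (spirals \<omega> R)" if z: "z \<noteq> 0" "z \<notin> spirals \<omega> R" for z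
  proof -
    have "\<forall>\<^sub>F w in nhds z. w \<notin> spirals \<omega> R"
      unfolding eventually_nhds_conv_at using spirals_sparse[OF \<omega> R z(1)] z by blast
    moreover have "\<forall>\<^sub>F w in nhds z. w \<in> - {0}" by (rule eventually_nhds_in_open) (use z in auto)
    ultimately have "\<forall>\<^sub>F w in nhds z. w \<in> - insert 0 (spirals \<omega> R)" by eventually_elim auto
    then show ?thesis unfolding eventually_nhds by blast
  qed
  then show ?thesis by (subst open_subopen) auto
qed

lemma connected_int_chain:
  fixes A :: "int \<Rightarrow> 'a :: topological_space set"
  assumes "\<And>k. connected (A k)" "\<And>k. A k \<inter> A (k + 1) \<noteq> {}"
  shows "connected (\<Union>k. A k)"
proof -
  define V where "V = (\<lambda>n :: nat. \<Union>k\<in>{- int n..int n}. A k)"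
  have V: "connected (V n) \<and> A 0 \<subseteq> V n" for n
  proof (induction n)
    case 0 show ?case using assms by (simp add: V_def)
  next
    case (Suc n)
    have "{- int (Suc n)..int (Suc n)} = insert (- int n - 1) (insert (int n + 1) {- int n..int n})" by auto
    then have e: "V (Suc n) = A (- int n - 1) \<union> (A (int n + 1) \<union> V n)" by (simp add: V_def)
    have "A (int n) \<subseteq> V n" "A (- int n) \<subseteq> V n" by (auto simp: V_def)
    then have "A (int n + 1) \<inter> V n \<noteq> {}" "A (- int n - 1) \<inter> (A (int n + 1) \<union> V n) \<noteq> {}"
      using assms(2)[of "int n"] assms(2)[of "- int n - 1"] by auto
    then show ?case unfolding e using Suc assms(1) by (auto intro!: connected_Un)
  qed
  have "A k \<subseteq> V (nat \<bar>k\<bar>)" for k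
  proof -
    have "k \<in> {- int (nat \<bar>k\<bar>)..int (nat \<bar>k\<bar>)}" unfolding atLeastAtMost_iff by linarith
    then show ?thesis unfolding V_def by blast
  qed
  then have "(\<Union>k. A k) \<subseteq> \<Union>(range V)" by blast
  moreover have "\<Union>(range V) \<subseteq> (\<Union>k. A k)" unfolding V_def by blast
  ultimately have "(\<Union>k. A k) = \<Union>(range V)" by (rule subset_antisym)
  moreover have "\<Inter>(range V) \<noteq> {}"
    using V assms(2)[of 0] by blast
  ultimately show ?thesis using connected_Union[of "range V"] V by auto
qed

text \<open>The complement of the spirals, a countable set, contains a path from \<open>lam\<close> to \<open>\<omega> lam\<close>. The dilates of a
  neighbourhood of this path form a chain, so that their union is connected; and bounds on it can be
  obtained along the spirals of a compact set.\<close>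

lemma spiral_domain:
  assumes \<omega>: "norm \<omega> > 1" and R: "finite R" "0 \<notin> R" and lam: "lam \<noteq> 0" "lam \<notin> spirals \<omega> R"
  obtains D \<Omega> \<epsilon> where "compact D" "0 \<notin> D" "D \<inter> spirals \<omega> R = {}" "open \<Omega>" "connected \<Omega>" "0 \<notin> \<Omega>" "\<epsilon> > 0"
    "\<And>k z. norm (z - lam * \<omega> powi k) < \<epsilon> * norm (\<omega> powi k * lam) \<Longrightarrow> z \<in> \<Omega>"
    "\<And>z. z \<in> \<Omega> \<Longrightarrow> \<exists>k. \<exists>w\<in>D. z = \<omega> powi k * w"
proof -
  have \<omega>0: "\<omega> \<noteq> 0" using \<omega> by auto
  let ?X = "spirals \<omega> R"
  have "countable ?X"
  proof -
    have "?X = (\<Union>\<rho>\<in>R. range (\<lambda>k::int. \<omega> powi k * \<rho>))" by (auto simp: spirals_def)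
    then show ?thesis using R by (simp add: countable_finite)
  qed
  then have "path_connected (- insert 0 ?X)"
    by (intro path_connected_complement_countable) auto
  moreover have "lam \<in> - insert 0 ?X" using lam by auto
  moreover have "\<omega> * lam \<in> - insert 0 ?X" using lam \<omega>0 spirals_shift[OF \<omega>0, of 1 lam R] by auto
  ultimately obtain \<gamma> where \<gamma>: "path \<gamma>" "path_image \<gamma> \<subseteq> - insert 0 ?X" "pathstart \<gamma> = lam" "pathfinish \<gamma> = \<omega> * lam"
    unfolding path_connected_def by blast
  obtain e where e: "e > 0" "(\<Union>x\<in>path_image \<gamma>. ball x e) \<subseteq> - insert 0 ?X"
    using compact_subset_open_imp_ball_epsilon_subset[OF compact_path_image[OF \<gamma>(1)] open_compl_spirals[OF \<omega> R] \<gamma>(2)] .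
  define D where "D = (\<Union>x\<in>path_image \<gamma>. cball x (e / 2))"
  define U where "U = (\<Union>x\<in>path_image \<gamma>. ball x (e / 2))"
  define A where "A = (\<lambda>k::int. (\<lambda>z. \<omega> powi k * z) ` U)"
  have D: "compact D" unfolding D_def by (rule compact_minkowski_sum_cball[OF compact_path_image[OF \<gamma>(1)]])
  have D2: "D \<subseteq> - insert 0 ?X"
  proof -
    have "cball x (e / 2) \<subseteq> ball x e" for x :: complex using e(1) by auto
    then show ?thesis using e(2) unfolding D_def by blast
  qed
  have UD: "U \<subseteq> D" unfolding U_def D_def by (intro UN_mono ball_subset_cball subset_refl)
  have sub: "path_image \<gamma> \<subseteq> U" using e(1) by (force simp: U_def)
  have conU: "connected U"
  proof (cases "path_image \<gamma> = {}")
    case False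
    have "connected (\<Union>((\<lambda>x. ball x (e / 2) \<union> path_image \<gamma>) ` path_image \<gamma>))"
    proof (rule connected_Union)
      show "\<Inter>((\<lambda>x. ball x (e / 2) \<union> path_image \<gamma>) ` path_image \<gamma>) \<noteq> {}" using False by blast
      fix s assume "s \<in> (\<lambda>x. ball x (e / 2) \<union> path_image \<gamma>) ` path_image \<gamma>"
      then obtain x where x: "x \<in> path_image \<gamma>" "s = ball x (e / 2) \<union> path_image \<gamma>" by blast
      moreover have "x \<in> ball x (e / 2)" using e(1) by simp
      ultimately show "connected s"
        using connected_Un[OF connected_ball connected_path_image[OF \<gamma>(1)], of x "e / 2"] by blast
    qed
    also have "\<Union>((\<lambda>x. ball x (e / 2) \<union> path_image \<gamma>) ` path_image \<gamma>) = U"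
      using sub unfolding U_def by blast
    finally show ?thesis .
  qed (simp add: U_def)
  have opU: "open U" by (auto simp: U_def)
  have opA: "open (A k)" for k
  proof -
    have canc: "\<omega> powi k * (\<omega> powi (- k) * z) = z" "\<omega> powi (- k) * (\<omega> powi k * z) = z" for z
      using \<omega>0 by (simp_all add: power_int_minus)
    have "A k = (\<lambda>z. \<omega> powi (- k) * z) -` U"
    proof (intro set_eqI iffI)
      fix z assume "z \<in> (\<lambda>z. \<omega> powi (- k) * z) -` U"
      then show "z \<in> A k" unfolding A_def
        by (intro image_eqI[of _ _ "\<omega> powi (- k) * z"]) (simp_all only: canc vimage_eq)
    next
      fix z assume "z \<in> A k"
      then show "z \<in> (\<lambda>z. \<omega> powi (- k) * z) -` U" by (auto simp only: A_def canc vimage_eq)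
    qed
    then show ?thesis using opU by (auto intro!: open_vimage continuous_intros)
  qed
  have "lam \<in> U" "\<omega> * lam \<in> U" using sub \<gamma>(3,4) pathstart_in_path_image pathfinish_in_path_image by fastforce+
  have con: "connected (\<Union>k. A k)"
  proof (rule connected_int_chain)
    show "connected (A k)" for k unfolding A_def by (rule connected_continuous_image[OF _ conU]) (intro continuous_intros)
    fix k
    have "\<omega> powi k * (\<omega> * lam) \<in> A k" using \<open>\<omega> * lam \<in> U\<close> by (auto simp: A_def)
    moreover have "\<omega> powi (k + 1) * lam \<in> A (k + 1)" using \<open>lam \<in> U\<close> by (auto simp: A_def)
    moreover have "\<omega> powi (k + 1) * lam = \<omega> powi k * (\<omega> * lam)" using \<omega>0 by (simp add: powi_add)
    ultimately show "A k \<inter> A (k + 1) \<noteq> {}" by auto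
  qed
  show ?thesis
  proof (rule that[of D "\<Union>k. A k" "e / 2 / norm lam"])
    show "0 \<notin> (\<Union>k. A k)" using UD D2 \<omega>0 by (auto simp: A_def)
    show "\<exists>k. \<exists>w\<in>D. z = \<omega> powi k * w" if "z \<in> (\<Union>k. A k)" for z using that UD by (auto simp: A_def)
    fix k z assume z: "norm (z - lam * \<omega> powi k) < e / 2 / norm lam * norm (\<omega> powi k * lam)"
    let ?w = "\<omega> powi (- k) * z"
    have zw: "z = \<omega> powi k * ?w" using \<omega>0 by (simp add: power_int_minus)
    have "z - lam * \<omega> powi k = \<omega> powi k * (?w - lam)" by (subst zw) (simp add: algebra_simps)
    then have "norm (\<omega> powi k) * norm (?w - lam) < norm (\<omega> powi k) * (e / 2)"
      using z lam by (simp add: norm_mult mult.commute)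
    then have "norm (?w - lam) < e / 2" using \<omega>0 by (simp add: mult_less_cancel_left)
    then have "?w \<in> ball lam (e / 2)" by (simp add: dist_norm norm_minus_commute)
    then have "?w \<in> U" using \<gamma>(3) pathstart_in_path_image[of \<gamma>] by (auto simp: U_def)
    then have "z \<in> A k" unfolding A_def using zw by (intro image_eqI)
    then show "z \<in> (\<Union>k. A k)" by blast
  qed (use D D2 con opA e lam in auto)
qed

section \<open>Membership in the domain of the transformation\<close>

text \<open>At positive arguments theta is at least as large as each term of its series. The term with index \<open>k div N\<close> has the quadratic exponent needed at the
  \<open>k\<close>-th step of the spiral; the geometric factors go into \<open>M'\<close>.\<close>

lemma gauss_le_Theta:
  assumes \<omega>: "norm \<omega> > 1" and N: "N > 0" and C: "0 \<le> C" and M: "1 \<le> M" and r: "r > 0"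
  shows "\<exists>L>0. \<exists>M'>0. \<forall>k x. norm \<omega> powi k * r \<le> x \<longrightarrow>
    gauss_growth \<omega> N C M k < L * norm (Theta (of_real (norm \<omega> ^ N)) (of_real (M' * x)))"
proof -
  let ?Q = "norm \<omega>"
  define P where "P = ?Q ^ N"
  have P: "P > 1" using \<omega> N by (simp add: P_def one_less_power)
  have Q0: "?Q > 0" using \<omega> by linarith
  \<comment> \<open>the factor \<open>P\<close> pays for rounding \<open>k / N\<close> down, and \<open>r\<close> for the smallest modulus in the compact set\<close>
  define M' where "M' = M ^ N * P / r"
  have M': "M' > 0" "M' * r = M ^ N * P" using M P r by (auto simp: M'_def)
  define L where "L = C * M ^ N * P + 1"
  have L: "L > 0" "C < L"
  proof -
    have "1 \<le> M ^ N * P" using M P mult_mono[of 1 "M ^ N" 1 P] by (simp add: one_le_power)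
    then have "C * 1 \<le> C * (M ^ N * P)" using C by (intro mult_left_mono) auto
    then show "L > 0" "C < L" using C by (auto simp: L_def mult.assoc)
  qed
  have "gauss_growth \<omega> N C M k < L * norm (Theta (of_real P) (of_real (M' * x)))" if x: "?Q powi k * r \<le> x" for k x
  proof -
    have "0 < ?Q powi k * r" using Q0 r by simp
    then have x0: "x > 0" using x by linarith
    have T: "P powi (- tri l) * (M' * x) powi l \<le> norm (Theta (of_real P) (of_real (M' * x)))" for l
      by (rule Theta_real_ge[OF P]) (use M' x0 in simp)
    show ?thesis
    proof (cases "k < 0")
      case True
      moreover have "\<omega> \<noteq> 0" using \<omega> by auto
      ultimately have "gauss_growth \<omega> N C M k = C" by (simp add: gauss_growth_def)
      also have "\<dots> < L * 1" using L by simp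
      also have "\<dots> \<le> L * norm (Theta (of_real P) (of_real (M' * x)))"
        using T[of 0] L by (intro mult_left_mono) (auto simp: tri_def)
      finally show ?thesis .
    next
      case False
      define n where "n = nat k"
      define l where "l = n div N"
      define b where "b = n mod N"
      have n: "n = N * l + b" "b < N" "k = int n" using N False by (auto simp: l_def b_def n_def)
      define t where "t = P powi (- tri (int l)) * (M' * x) powi int l"
      have "M ^ n * ?Q powr ((real n)\<^sup>2 / (2 * real N)) \<le> M ^ N * P * t"
      proof -
        have "M ^ n \<le> M ^ (N + N * l)" using M n by (intro power_increasing) auto
        then have 1: "M ^ n \<le> M ^ N * (M ^ N) ^ l" by (simp add: power_add power_mult)
        have "?Q powr ((real n)\<^sup>2 / (2 * real N)) \<le> ?Q powr (real N + real n * real l + real N * real l - real N * (real l * (real l + 1) / 2))"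
        proof (rule powr_mono)
          have "real n = real N * real l + real b" using n by simp
          moreover from this have "(real n)\<^sup>2 / (2 * real N) = real N * (real l)\<^sup>2 / 2 + real l * real b + (real b)\<^sup>2 / (2 * real N)"
            using square_over_double[of "real N" "real l" "real b"] N by simp
          moreover have "(real b)\<^sup>2 / (2 * real N) \<le> real N"
          proof -
            have "real b * real b \<le> real N * real N" using n(2) by (intro mult_mono) auto
            moreover have "real N * real N \<ge> 0" by simp
            ultimately have "(real b)\<^sup>2 \<le> real N * (2 * real N)" unfolding power2_eq_square by linarith
            then show ?thesis using N by (simp add: divide_le_eq)
          qed
          moreover have "real n * real l = real N * (real l)\<^sup>2 + real l * real b"
            unfolding calculation(1) by (simp add: power2_eq_square algebra_simps)
          moreover have "real N * (real l * (real l + 1) / 2) = real N * (real l)\<^sup>2 / 2 + real N * real l / 2"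
            by (simp add: power2_eq_square field_simps)
          moreover have "0 \<le> real N * real l" by simp
          ultimately show "(real n)\<^sup>2 / (2 * real N) \<le> real N + real n * real l + real N * real l - real N * (real l * (real l + 1) / 2)"
            by linarith
        qed (use \<omega> in auto)
        also have "\<dots> = P * (?Q ^ n * P) ^ l * P powi (- tri (int l))"
        proof -
          have "real_of_int (2 * tri (int l)) = real_of_int (int l * (int l + 1))" by (simp only: tri_double)
          then have tr: "real_of_int (- (int N * tri (int l))) = - (real N * (real l * (real l + 1) / 2))" by simp
          have "P powi (- tri (int l)) = ?Q powi (- (int N * tri (int l)))"
            using power_int_mult[of ?Q "int N" "- tri (int l)"] by (simp add: P_def)
          also have "\<dots> = ?Q powr (- (real N * (real l * (real l + 1) / 2)))"
            unfolding tr[symmetric] using Q0 by (intro powr_real_of_int'[symmetric]) auto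
          finally have a: "P powi (- tri (int l)) = ?Q powr (- (real N * (real l * (real l + 1) / 2)))" .
          have b: "(?Q ^ n * P) ^ l = ?Q powr (real n * real l + real N * real l)"
          proof -
            have "(?Q ^ n * P) ^ l = ?Q ^ (n * l + N * l)"
              by (simp add: P_def power_mult power_add power_mult_distrib)
            also have "\<dots> = ?Q powr real (n * l + N * l)" using Q0 by (simp only: powr_realpow)
            finally show ?thesis by simp
          qed
          have c: "P = ?Q powr real N" using Q0 by (simp add: P_def powr_realpow)
          show ?thesis unfolding a b by (subst (1) c) (simp only: powr_add[symmetric] diff_conv_add_uminus add.assoc)
        qed
        finally have 2: "?Q powr ((real n)\<^sup>2 / (2 * real N)) \<le> P * (?Q ^ n * P) ^ l * P powi (- tri (int l))" .
        have "M ^ n * ?Q powr ((real n)\<^sup>2 / (2 * real N)) \<le> (M ^ N * (M ^ N) ^ l) * (P * (?Q ^ n * P) ^ l * P powi (- tri (int l)))"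
          using 1 2 M by (intro mult_mono) auto
        also have "\<dots> = M ^ N * P * (P powi (- tri (int l)) * (?Q ^ n * (M' * r)) ^ l)"
          unfolding M'(2) by (simp only: power_mult_distrib mult_ac)
        also have "\<dots> \<le> M ^ N * P * t"
        proof -
          have "M' * (?Q ^ n * r) \<le> M' * x"
            using x n(3) M'(1) by (intro mult_left_mono) auto
          then have "?Q ^ n * (M' * r) \<le> M' * x" by (simp only: mult_ac)
          moreover have "0 \<le> ?Q ^ n * (M' * r)" using M'(1) r Q0 by (intro mult_nonneg_nonneg) auto
          ultimately have "(?Q ^ n * (M' * r)) ^ l \<le> (M' * x) ^ l" by (rule power_mono)
          then show ?thesis unfolding t_def using M P by (intro mult_left_mono) auto
        qed
        finally show ?thesis .
      qed
      then have "gauss_growth \<omega> N C M k \<le> C * (M ^ N * P * t)"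
        unfolding gauss_growth_def n_def[symmetric] using C by (simp add: mult.assoc mult_left_mono)
      also have "\<dots> < L * t"
      proof -
        have "t > 0" using P M' x0 by (simp add: t_def)
        then show ?thesis by (simp add: L_def algebra_simps)
      qed
      also have "\<dots> \<le> L * norm (Theta (of_real P) (of_real (M' * x)))"
        unfolding t_def using T[of "int l"] L by (intro mult_left_mono) auto
      finally show ?thesis .
    qed
  qed
  then show ?thesis using L M' unfolding P_def by blast
qed

lemma H_continuationI:
  assumes \<omega>: "norm \<omega> > 1" "\<omega> = qpow lq (1 / of_nat K)" and N: "N > 0" "norm (exp lq) powr (1 / \<kappa>) = norm \<omega> ^ N"
    and R: "finite R" "0 \<notin> R" and lam: "lam \<noteq> 0" "lam \<notin> spirals \<omega> R"
    and F: "\<And>z. z \<noteq> 0 \<Longrightarrow> z \<notin> spirals \<omega> R \<Longrightarrow> F analytic_on {z}"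
    and \<delta>: "\<delta> > 0" "\<And>z. z \<noteq> 0 \<Longrightarrow> norm z < \<delta> \<Longrightarrow> F z = f z"
    and growth: "\<And>D. compact D \<Longrightarrow> 0 \<notin> D \<Longrightarrow> D \<inter> spirals \<omega> R = {} \<Longrightarrow>
      \<exists>C M. 0 \<le> C \<and> 1 \<le> M \<and> (\<forall>z\<in>D. \<forall>k. norm (F (\<omega> powi k * z)) \<le> gauss_growth \<omega> N C M k)"
  shows "H_continuation lq \<kappa> K lam f F"
proof -
  have \<omega>0: "\<omega> \<noteq> 0" using \<omega> by auto
  obtain D \<Omega> \<epsilon> where D: "compact D" "0 \<notin> D" "D \<inter> spirals \<omega> R = {}" and \<Omega>: "open \<Omega>" "connected \<Omega>" "0 \<notin> \<Omega>" "\<epsilon> > 0"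
    "\<And>k z. norm (z - lam * \<omega> powi k) < \<epsilon> * norm (\<omega> powi k * lam) \<Longrightarrow> z \<in> \<Omega>"
    "\<And>z. z \<in> \<Omega> \<Longrightarrow> \<exists>k. \<exists>w\<in>D. z = \<omega> powi k * w"
    using spiral_domain[OF \<omega>(1) R lam] by blast
  have off: "z \<noteq> 0 \<and> z \<notin> spirals \<omega> R" if "z \<in> \<Omega>" for z
    using \<Omega>(6)[OF that] \<Omega>(3) that D spirals_shift[OF \<omega>0] by blast
  have an: "F analytic_on \<Omega>" by (subst analytic_on_analytic_at) (use off F in blast)
  obtain C M where CM: "0 \<le> C" "1 \<le> M" "\<And>z k. z \<in> D \<Longrightarrow> norm (F (\<omega> powi k * z)) \<le> gauss_growth \<omega> N C M k"
    using growth[OF D] by blast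
  have Dne: "D \<noteq> {}" using \<Omega>(5)[of "lam * \<omega> powi 0" 0] \<Omega>(4,6) lam by fastforce
  obtain r where r: "r > 0" "\<And>z. z \<in> D \<Longrightarrow> r \<le> norm z"
  proof -
    obtain w where "w \<in> D" "\<forall>z\<in>D. norm w \<le> norm z"
      using continuous_attains_inf[OF D(1) Dne, of norm] continuous_on_norm_id by blast
    then show ?thesis using that[of "norm w"] D(2) by auto
  qed
  obtain L M' where L: "L > 0" "M' > 0" "\<And>k x. norm \<omega> powi k * r \<le> x \<Longrightarrow>
    gauss_growth \<omega> N C M k < L * norm (Theta (of_real (norm \<omega> ^ N)) (of_real (M' * x)))"
    using gauss_le_Theta[OF \<omega>(1) N(1) CM(1,2) r(1)] by blast
  have bound: "norm (F z) < L * norm (Theta (of_real (norm (exp lq) powr (1 / \<kappa>))) (of_real (M' * norm z)))" if "z \<in> \<Omega>" for z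
  proof -
    from \<Omega>(6)[OF that] obtain k w where w: "w \<in> D" "z = \<omega> powi k * w" by blast
    have "norm \<omega> powi k * r \<le> norm z" using r w by (simp add: norm_mult norm_power_int mult_left_mono)
    from L(3)[OF this] show ?thesis unfolding N(2) using CM(3)[OF w(1), of k] w(2) by simp
  qed
  have germ: "extends_germ0 \<Omega> F f" unfolding extends_germ0_def
  proof (intro exI conjI)
    have "open (\<Omega> \<inter> (ball 0 \<delta> - {0}))" using \<Omega>(1) by (simp add: open_Int open_delete)
    then show "\<forall>\<^sub>\<approx>z\<in>\<Omega> \<inter> (ball 0 \<delta> - {0}). F z = f z"
      using eventually_in_cosparse[OF order_refl, of "\<Omega> \<inter> (ball 0 \<delta> - {0})"] \<delta>
      by (auto elim!: eventually_mono)
  qed (use \<delta> in auto)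
  have discs: "(\<Union>k::int. {z. z \<noteq> 0 \<and> norm (z - lam * qpow lq (of_int k / of_nat K)) < \<epsilon> * norm (qpow lq (of_int k / of_nat K) * lam)}) \<subseteq> \<Omega>"
    unfolding qpow_powi \<omega>(2)[symmetric] by (intro UN_least subsetI, elim CollectE conjE) (rule \<Omega>(5))
  have "\<exists>L>0. \<exists>M>0. \<forall>z\<in>\<Omega> - {0}. norm (F z) < L * norm (Theta (of_real (norm (exp lq) powr (1 / \<kappa>))) (of_real (M * norm z)))"
    using bound L(1,2) by (intro exI[of _ L] exI[of _ M'] conjI ballI) auto
  with \<Omega>(1,2,4) discs an germ show ?thesis unfolding H_continuation_def by blast
qed

text \<open>The domain of any continuation contains the spiral, hence points close to the origin, where the continuation
  agrees with the germ. By the identity theorem, its difference with \<open>F\<close>, which is meromorphic on the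
  domain without the origin, vanishes.\<close>

lemma H_continuation_unique:
  assumes \<omega>: "norm \<omega> > 1" "\<omega> = qpow lq (1 / of_nat K)" and lam: "lam \<noteq> 0"
    and Fm: "F meromorphic_on (- {0})" and Fa: "\<And>k. F analytic_on {\<omega> powi k * lam}"
    and \<delta>: "\<delta> > 0" "\<And>z. z \<noteq> 0 \<Longrightarrow> norm z < \<delta> \<Longrightarrow> F z = f z"
    and G: "H_continuation lq \<kappa> K lam f G"
  shows "G (\<omega> powi k * lam) = F (\<omega> powi k * lam)"
proof -
  have \<omega>0: "\<omega> \<noteq> 0" using \<omega> by auto
  obtain \<epsilon> \<Omega> where \<Omega>: "\<epsilon> > 0" "open \<Omega>" "connected \<Omega>" 
      "(\<Union>k::int. {z. z \<noteq> 0 \<and> norm (z - lam * qpow lq (of_int k / of_nat K)) < \<epsilon> * norm (qpow lq (of_int k / of_nat K) * lam)}) \<subseteq> \<Omega>"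
      "G analytic_on \<Omega>" "extends_germ0 \<Omega> G f"
    using G unfolding H_continuation_def by blast
  have pts: "\<omega> powi k * lam \<in> \<Omega> - {0}" for k
  proof -
    have "\<omega> powi k * lam \<in> {z. z \<noteq> 0 \<and> norm (z - lam * qpow lq (of_int k / of_nat K)) < \<epsilon> * norm (qpow lq (of_int k / of_nat K) * lam)}"
      unfolding qpow_powi \<omega>(2)[symmetric] using \<Omega>(1) lam \<omega>0 by (simp add: mult.commute)
    then show ?thesis using \<Omega>(4) lam \<omega>0 by blast
  qed
  let ?A = "\<Omega> - {0}"
  have A: "open ?A" "connected ?A" using \<Omega> by (auto intro!: open_delete connected_open_delete)
  define h where "h = (\<lambda>z. G z - F z)"
  have "h meromorphic_on ?A" unfolding h_def
    by (intro meromorphic_intros meromorphic_on_subset[OF analytic_on_imp_meromorphic_on[OF \<Omega>(5)]] meromorphic_on_subset[OF Fm]) auto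
  from meromorphic_imp_constant_or_avoid[OF this A, of 0]
  have zero: "\<forall>\<^sub>\<approx>z\<in>?A. h z = 0"
  proof
    assume av: "\<forall>\<^sub>\<approx>z\<in>?A. h z \<noteq> 0"
    obtain \<delta>' where \<delta>': "\<delta>' > 0" "\<forall>\<^sub>\<approx>z\<in>\<Omega> \<inter> (ball 0 \<delta>' - {0}). G z = f z"
      using \<Omega>(6) unfolding extends_germ0_def by blast
    define m where "m = min \<delta> \<delta>'"
    have m: "m > 0" using \<delta> \<delta>' by (simp add: m_def)
    obtain n where "norm lam / m < norm \<omega> ^ n" using \<omega> real_arch_pow by blast
    then have "norm lam / norm \<omega> ^ n < m" using m \<omega>0 by (simp add: field_simps)
    moreover have "norm (\<omega> powi (- int n) * lam) = norm lam / norm \<omega> ^ n"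
      by (simp add: norm_mult norm_divide norm_inverse norm_power power_int_minus field_simps)
    ultimately have small: "norm (\<omega> powi (- int n) * lam) < m" by simp
    let ?z = "\<omega> powi (- int n) * lam"
    have op: "open (\<Omega> \<inter> (ball 0 m - {0}))" using \<Omega>(2) by (simp add: open_Int open_delete)
    have zin: "?z \<in> \<Omega> \<inter> (ball 0 m - {0})" using pts[of "- int n"] small \<omega>0 by (simp only: Int_iff Diff_iff mem_ball dist_0_norm simp_thms)
    have e1: "\<forall>\<^sub>F w in at ?z. G w = f w"
      by (rule eventually_cosparse_imp_eventually_at[OF \<delta>'(2)]) (use zin in \<open>auto simp: m_def\<close>)
    have e2: "\<forall>\<^sub>F w in at ?z. w \<in> \<Omega> \<inter> (ball 0 m - {0})" by (rule eventually_at_in_open'[OF op zin])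
    have e3: "\<forall>\<^sub>F w in at ?z. h w \<noteq> 0"
      by (rule eventually_cosparse_imp_eventually_at[OF av pts])
    have "\<forall>\<^sub>F w in at ?z. False" using e1 e2 e3
    proof eventually_elim
      case (elim w)
      then have "F w = f w" by (intro \<delta>) (auto simp: m_def)
      with elim show False by (simp add: h_def)
    qed
    then show ?thesis by (simp add: eventually_False)
  qed
  have "\<forall>\<^sub>F w in at (\<omega> powi k * lam). h w = 0"
    by (rule eventually_cosparse_imp_eventually_at[OF zero pts])
  moreover have "isCont h (\<omega> powi k * lam)" unfolding h_def
    using analytic_on_subset[OF \<Omega>(5)] pts[of k] Fa[of k]
    by (intro continuous_intros analytic_at_imp_isCont) auto
  ultimately have "h (\<omega> powi k * lam) = 0"
    using tendsto_unique[of "at (\<omega> powi k * lam)" h "h (\<omega> powi k * lam)" 0]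
    by (auto simp: isCont_def intro: tendsto_eventually)
  then show ?thesis by (simp add: h_def)
qed

section \<open>The q-Borel transform of the formal solution\<close>

lemma choose_two_diff:
  assumes "j \<le> l"
  shows "int ((l - j) choose 2) = int (l choose 2) - int j * int (l - j) - int (j choose 2)"
proof -
  have "2 * int (n choose 2) = int n * (int n - 1)" for n
    unfolding tri_choose tri_double by (simp add: algebra_simps)
  then have "2 * int ((l - j) choose 2) = 2 * (int (l choose 2) - int j * int (l - j) - int (j choose 2))"
    using assms by (simp add: right_diff_distrib of_nat_diff) (simp add: algebra_simps)
  then show ?thesis by simp
qed

lemma real_choose_two: "real l * (real l - 1) / 2 = real (l choose 2)"
proof -
  have "2 * int (l choose 2) = int l * (int l - 1)"
    unfolding tri_choose tri_double by (simp add: algebra_simps)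
  then have "real_of_int (2 * int (l choose 2)) = real_of_int (int l * (int l - 1))" by (rule arg_cong)
  then show ?thesis by simp
qed

lemma qpow_add: "qpow lq (x + y) = qpow lq x * qpow lq y"
  by (simp add: qpow_def exp_add ring_distribs)

text \<open>The quadratic exponents of the single transformations add up.\<close>

lemma iterated_borel_nth:
  "fps_nth (iterated_borel lq \<kappa> r h) l = fps_nth h l * qpow lq (- (real (l choose 2) * (\<Sum>i=1..r. inverse (\<kappa> i))))"
proof -
  have "fps_nth (foldr (\<lambda>i. q_borel lq (\<kappa> i)) is h) l = fps_nth h l * qpow lq (- (real (l choose 2) * (\<Sum>i\<leftarrow>is. inverse (\<kappa> i))))" for "is"
  proof (induction "is")
    case Nil show ?case by (simp add: qpow_def)
  next
    case (Cons i "is")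
    have "real l * (real l - 1) / (2 * \<kappa> i) = real (l choose 2) * inverse (\<kappa> i)"
      unfolding real_choose_two[symmetric] by (simp add: field_simps)
    then have "qpow lq (- (real l * (real l - 1) / (2 * \<kappa> i))) = qpow lq (- (real (l choose 2) * inverse (\<kappa> i)))" by simp
    moreover have "qpow lq (- (real (l choose 2) * (\<Sum>i\<leftarrow>i # is. inverse (\<kappa> i)))) =
      qpow lq (- (real (l choose 2) * (\<Sum>i\<leftarrow>is. inverse (\<kappa> i)))) * qpow lq (- (real (l choose 2) * inverse (\<kappa> i)))"
      unfolding qpow_add[symmetric] by (simp add: algebra_simps)
    ultimately show ?case using Cons by (simp add: q_borel_def)
  qed
  moreover have "(\<Sum>i\<leftarrow>[1..<Suc r]. inverse (\<kappa> i)) = (\<Sum>i=1..r. inverse (\<kappa> i))"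
    by (simp only: interv_sum_list_conv_sum_set_nat set_upt atLeastLessThanSuc_atLeastAtMost)
  ultimately show ?thesis by (simp only: iterated_borel_def)
qed

definition op_coeff :: "(nat \<Rightarrow> complex poly) \<Rightarrow> nat \<times> nat \<Rightarrow> complex" where
  "op_coeff A ij = coeff (A (fst ij)) (snd ij)"

lemma sum_op_support:
  assumes "\<And>i j. i \<le> m \<Longrightarrow> coeff (A i) j = 0 \<Longrightarrow> f i j = 0"
    "\<And>i. i \<le> m \<Longrightarrow> finite (J i)" "\<And>i j. (i, j) \<in> op_support m A \<Longrightarrow> P j \<Longrightarrow> j \<in> J i" "\<And>i j. i \<le> m \<Longrightarrow> j \<in> J i \<Longrightarrow> \<not> P j \<Longrightarrow> f i j = 0"
  shows "(\<Sum>i\<le>m. \<Sum>j\<in>J i. f i j) = (\<Sum>ij\<in>{ij \<in> op_support m A. P (snd ij)}. f (fst ij) (snd ij))"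
proof -
  have "(\<Sum>i\<le>m. \<Sum>j\<in>J i. f i j) = (\<Sum>ij\<in>(SIGMA i:{..m}. J i). f (fst ij) (snd ij))"
    using assms(2) by (subst sum.Sigma) (auto simp: case_prod_unfold)
  also have "\<dots> = (\<Sum>ij\<in>{ij \<in> op_support m A. P (snd ij)}. f (fst ij) (snd ij))"
  proof (rule sum.mono_neutral_right)
    show "finite (SIGMA i:{..m}. J i)" using assms(2) by auto
    show "{ij \<in> op_support m A. P (snd ij)} \<subseteq> (SIGMA i:{..m}. J i)"
      using assms(3) by (auto simp: op_support_def)
    show "\<forall>ij\<in>(SIGMA i:{..m}. J i) - {ij \<in> op_support m A. P (snd ij)}. f (fst ij) (snd ij) = 0"
    proof
      fix ij assume ij: "ij \<in> (SIGMA i:{..m}. J i) - {ij \<in> op_support m A. P (snd ij)}"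
      obtain i j where e: "ij = (i, j)" by (cases ij)
      from ij have "i \<le> m" "j \<in> J i" "coeff (A i) j = 0 \<or> \<not> P j" by (auto simp: e op_support_def)
      then show "f (fst ij) (snd ij) = 0" using assms(1,4) by (auto simp: e)
    qed
  qed
  finally show ?thesis .
qed

lemma qshift_fps_nth: "fps_nth (qshift_fps q i h) l = q ^ (i * l) * fps_nth h l"
  unfolding qshift_fps_def by (subst fps_compose_linear) (simp add: power_mult)

lemma qop_fps_nth:
  "fps_nth (qop_fps q m A h) l =
    (\<Sum>ij\<in>{ij \<in> op_support m A. snd ij \<le> l}. op_coeff A ij * q ^ (fst ij * (l - snd ij)) * fps_nth h (l - snd ij))"
proof -
  have "fps_nth (qop_fps q m A h) l = (\<Sum>i\<le>m. \<Sum>j\<in>{0..l}. coeff (A i) j * (q ^ (i * (l - j)) * fps_nth h (l - j)))"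
    by (simp add: qop_fps_def fps_sum_nth fps_mult_nth qshift_fps_nth)
  also have "\<dots> = (\<Sum>ij\<in>{ij \<in> op_support m A. snd ij \<le> l}. coeff (A (fst ij)) (snd ij) * (q ^ (fst ij * (l - snd ij)) * fps_nth h (l - snd ij)))"
    by (rule sum_op_support[where P = "\<lambda>j. j \<le> l"]) auto
  finally show ?thesis by (simp add: op_coeff_def mult.assoc)
qed

text \<open>Of the three summands in \<open>l choose 2 = ((l - j) choose 2) + j (l - j) + (j choose 2)\<close> the first belongs to
  the transformed coefficient, the second changes the dilation by \<open>- \<sigma> j\<close>, and the third is the weight.\<close>

lemma borel_recurrence:
  assumes \<omega>: "\<omega> \<noteq> 0" "q = \<omega> ^ K"
    and B: "\<And>l. fps_nth B l = fps_nth h l * \<omega> powi (- (\<sigma> * int (l choose 2)))"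
    and eq: "qop_fps q m A h = fps_of_poly a"
  shows "(\<Sum>ij\<in>{ij \<in> op_support m A. snd ij \<le> l}. op_coeff A ij * qop_weight \<omega> \<sigma> ij *
       \<omega> powi (qop_exp (int K) \<sigma> ij * int (l - snd ij)) * fps_nth B (l - snd ij)) = coeff a l * \<omega> powi (- (\<sigma> * int (l choose 2)))"
proof -
  have "coeff a l * \<omega> powi (- (\<sigma> * int (l choose 2))) = fps_nth (qop_fps q m A h) l * \<omega> powi (- (\<sigma> * int (l choose 2)))"
    by (simp add: eq)
  also have "\<dots> = (\<Sum>ij\<in>{ij \<in> op_support m A. snd ij \<le> l}. op_coeff A ij * q ^ (fst ij * (l - snd ij)) * fps_nth h (l - snd ij) * \<omega> powi (- (\<sigma> * int (l choose 2))))"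
    unfolding qop_fps_nth sum_distrib_right ..
  also have "\<dots> = (\<Sum>ij\<in>{ij \<in> op_support m A. snd ij \<le> l}. op_coeff A ij * qop_weight \<omega> \<sigma> ij *
       \<omega> powi (qop_exp (int K) \<sigma> ij * int (l - snd ij)) * fps_nth B (l - snd ij))"
  proof (rule sum.cong[OF refl])
    fix ij assume "ij \<in> {ij \<in> op_support m A. snd ij \<le> l}"
    then have j: "snd ij \<le> l" by simp
    define i j k where "i = fst ij" and "j = snd ij" and "k = l - snd ij"
    have e: "int (K * (i * k)) + (- (\<sigma> * int (l choose 2))) =
        (- (\<sigma> * int (j choose 2)) + (int K * int i - \<sigma> * int j) * int k) + (- (\<sigma> * int (k choose 2)))"
      unfolding choose_two_diff[OF j, folded j_def k_def] by (simp add: algebra_simps)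
    have "q ^ (i * k) * \<omega> powi (- (\<sigma> * int (l choose 2))) = \<omega> powi (int (K * (i * k)) + (- (\<sigma> * int (l choose 2))))"
      unfolding \<omega>(2) power_mult[symmetric] by (simp only: powi_add[OF \<omega>(1)] power_int_of_nat)
    also have "\<dots> = qop_weight \<omega> \<sigma> ij * \<omega> powi (qop_exp (int K) \<sigma> ij * int k) * \<omega> powi (- (\<sigma> * int (k choose 2)))"
      unfolding e qop_weight_def qop_exp_def i_def[symmetric] j_def[symmetric] by (simp only: powi_add[OF \<omega>(1)])
    finally have *: "q ^ (i * k) * \<omega> powi (- (\<sigma> * int (l choose 2))) = \<dots>" .
    have "op_coeff A ij * q ^ (i * k) * fps_nth h k * \<omega> powi (- (\<sigma> * int (l choose 2)))
       = op_coeff A ij * (q ^ (i * k) * \<omega> powi (- (\<sigma> * int (l choose 2)))) * fps_nth h k" by (simp only: mult_ac)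
    also have "\<dots> = op_coeff A ij * qop_weight \<omega> \<sigma> ij * \<omega> powi (qop_exp (int K) \<sigma> ij * int k) * fps_nth B k"
      unfolding * B by (simp only: mult_ac)
    finally show "op_coeff A ij * q ^ (fst ij * (l - snd ij)) * fps_nth h (l - snd ij) * \<omega> powi (- (\<sigma> * int (l choose 2))) =
      op_coeff A ij * qop_weight \<omega> \<sigma> ij * \<omega> powi (qop_exp (int K) \<sigma> ij * int (l - snd ij)) * fps_nth B (l - snd ij)"
      unfolding i_def k_def .
  qed
  finally show ?thesis ..
qed

lemma geometric_recurrence:
  fixes a :: "nat \<Rightarrow> real" and d :: "'i \<Rightarrow> nat"
  assumes I: "finite I" and G: "G \<ge> 0" and d: "\<And>i. i \<in> I \<Longrightarrow> 1 \<le> d i" "\<And>i. i \<in> I \<Longrightarrow> d i \<le> n0"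
    and a: "\<And>n. 0 \<le> a n" and rec: "\<And>n. n0 \<le> n \<Longrightarrow> a n \<le> (\<Sum>i\<in>I. G * a (n - d i))"
  shows "\<exists>C M. M \<ge> 1 \<and> (\<forall>n. a n \<le> C * M ^ n)"
proof -
  define M where "M = max 1 (G * real (card I))"
  define C where "C = (\<Sum>n<n0. a n)"
  have M: "M \<ge> 1" "G * real (card I) \<le> M" by (auto simp: M_def)
  have C: "C \<ge> 0" using a by (simp add: C_def sum_nonneg)
  have "a n \<le> C * M ^ n" for n
  proof (induction n rule: less_induct)
    case (less n)
    show ?case
    proof (cases "n < n0")
      case True
      then have "a n \<le> C" unfolding C_def using a by (intro member_le_sum) auto
      also have "C * 1 \<le> C * M ^ n" using C M by (intro mult_left_mono one_le_power) auto
      finally show ?thesis by simp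
    next
      case False
      have "a n \<le> (\<Sum>i\<in>I. G * a (n - d i))" using False by (intro rec) simp
      also have "\<dots> \<le> (\<Sum>i\<in>I. G * (C * M ^ (n - 1)))"
      proof (intro sum_mono mult_left_mono G)
        fix i assume i: "i \<in> I"
        then have "n - d i < n" using d[OF i] False by linarith
        from less[OF this] have "a (n - d i) \<le> C * M ^ (n - d i)" .
        also have "\<dots> \<le> C * M ^ (n - 1)" using C M d[OF i] by (intro mult_left_mono power_increasing) auto
        finally show "a (n - d i) \<le> C * M ^ (n - 1)" .
      qed
      also have "\<dots> = (G * real (card I)) * (C * M ^ (n - 1))" by simp
      also have "\<dots> \<le> M * (C * M ^ (n - 1))" using M C by (intro mult_right_mono) auto
      also have "\<dots> \<le> C * M ^ n"
      proof (cases n)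
        case 0
        then have "n0 = 0" using False by simp
        then have "I = {}" using d by force
        then have "a n \<le> 0" using rec[of n] False by simp
        then show ?thesis using 0 C M by (simp add: C_def \<open>n0 = 0\<close>)
      qed simp
      finally show ?thesis .
    qed
  qed
  then show ?thesis using M by blast
qed

text \<open>The distinguished monomial has the lowest power of \<open>z\<close>, so it carries the newest coefficient in the
  recurrence, and its dilation is the largest. Hence, after division by the corresponding power of \<open>\<omega>\<close>, the
  factor of the newest coefficient tends to a nonzero limit, and those of the older ones stay
  bounded.\<close>

lemma borel_radius_positive:
  assumes \<omega>: "norm \<omega> > 1" "q = \<omega> ^ K" and K: "K > 0"
    and B: "\<And>l. fps_nth B l = fps_nth h l * \<omega> powi (- (\<sigma> * int (l choose 2)))"
    and eq: "qop_fps q m A h = fps_of_poly a"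
    and top: "i0j0 \<in> qop_top (int K) \<sigma> (op_support m A)"
    and low: "\<And>ij. ij \<in> op_support m A \<Longrightarrow> snd i0j0 \<le> snd ij"
  shows "fps_conv_radius B > 0"
proof -
  have \<omega>0: "\<omega> \<noteq> 0" using \<omega> by auto
  let ?S = "op_support m A" and ?Q = "norm \<omega>"
  define e where "e = qop_exp (int K) \<sigma>"
  define E where "E = qop_order (int K) \<sigma> ?S"
  define n1 where "n1 = snd i0j0"
  define w where "w = (\<lambda>ij. op_coeff A ij * qop_weight \<omega> \<sigma> ij)"
  note fin = finite_op_support[of m A]
  have eE: "e ij \<le> E" if "ij \<in> ?S" for ij using qop_exp_le[OF fin that] by (simp add: e_def E_def)
  have i0: "i0j0 \<in> ?S" "e i0j0 = E" using top by (auto simp: qop_top_def e_def E_def)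
  have w0: "w i0j0 \<noteq> 0" using i0(1) \<omega>0 by (auto simp: w_def op_coeff_def qop_weight_def op_support_def)
  have lt: "e ij < E" if "ij \<in> ?S" "snd ij = n1" "ij \<noteq> i0j0" for ij
  proof -
    have "fst ij \<noteq> fst i0j0" using that by (auto simp: n1_def prod_eq_iff)
    then have "e ij \<noteq> e i0j0" using that K by (simp add: e_def qop_exp_def n1_def)
    then show ?thesis using eE[OF that(1)] i0 by simp
  qed
  define S1 where "S1 = {ij \<in> ?S. snd ij = n1 \<and> ij \<noteq> i0j0}"
  define S2 where "S2 = {ij \<in> ?S. n1 < snd ij}"
  have fS: "finite S1" "finite S2" using fin by (auto simp: S1_def S2_def)
  \<comment> \<open>the normalised factor of the newest coefficient\<close>
  define main where "main = (\<lambda>n. w i0j0 + (\<Sum>ij\<in>S1. w ij * \<omega> powi ((e ij - E) * int n)))"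
  have "main \<longlonglongrightarrow> w i0j0 + (\<Sum>ij\<in>S1. w ij * 0)" unfolding main_def
  proof (intro tendsto_intros)
    fix ij assume "ij \<in> S1"
    then have neg: "e ij - E < 0" using lt by (simp add: S1_def)
    have "norm (\<omega> powi (e ij - E)) < 1"
    proof -
      have "?Q powi (e ij - E) < ?Q powi 0" using neg \<omega> by (intro power_int_strict_increasing) auto
      then show ?thesis by (simp add: norm_power_int)
    qed
    then have "(\<lambda>n. (\<omega> powi (e ij - E)) ^ n) \<longlonglongrightarrow> 0" by (rule LIMSEQ_power_zero)
    then show "(\<lambda>n. \<omega> powi ((e ij - E) * int n)) \<longlonglongrightarrow> 0" by (simp add: power_int_mult)
  qed
  then have "(\<lambda>n. norm (main n)) \<longlonglongrightarrow> norm (w i0j0)" by (intro tendsto_norm) simp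
  then have "\<forall>\<^sub>F n in sequentially. norm (w i0j0) / 2 < norm (main n)"
    by (rule order_tendstoD) (use w0 in simp)
  then obtain n2 where n2: "\<And>n. n2 \<le> n \<Longrightarrow> norm (w i0j0) / 2 < norm (main n)" by (auto simp: eventually_sequentially)
  define n0 where "n0 = n2 + degree a + 1 + (\<Sum>ij\<in>?S. snd ij)"
  have n0S: "snd ij \<le> n0" if "ij \<in> ?S" for ij
    using member_le_sum[OF that, of snd] fin by (simp add: n0_def)
  define d where "d = (\<lambda>ij :: nat \<times> nat. snd ij - n1)"
  define G where "G = (\<Sum>ij\<in>S2. norm (w ij) * ?Q powi (- (e ij * int (d ij)))) / (norm (w i0j0) / 2)"
  have G0: "G \<ge> 0" unfolding G_def by (intro divide_nonneg_nonneg sum_nonneg) auto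
  have "\<exists>C M. M \<ge> 1 \<and> (\<forall>n. norm (fps_nth B n) \<le> C * M ^ n)"
  proof (rule geometric_recurrence[OF fS(2) G0, of d n0])
    show "1 \<le> d ij" if "ij \<in> S2" for ij using that by (simp add: S2_def d_def Suc_le_eq)
    show "d ij \<le> n0" if "ij \<in> S2" for ij using n0S[of ij] that by (simp add: S2_def d_def)
    fix n assume n: "n0 \<le> n"
    define l where "l = n + n1"
    have all: "{ij \<in> ?S. snd ij \<le> l} = insert i0j0 (S1 \<union> S2)"
      using n0S n low i0 by (auto simp: S1_def S2_def l_def n1_def intro: le_neq_implies_less order_trans) (meson le_add1 le_trans)+
    have nb: "l - snd ij = n" if "ij \<in> insert i0j0 S1" for ij using that by (auto simp: S1_def l_def n1_def)
    have n2': "l - snd ij = n - d ij \<and> d ij \<le> n" if "ij \<in> S2" for ij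
      using that n0S[of ij] n by (auto simp: S2_def l_def d_def)
    have "coeff a l = 0" using n by (intro coeff_eq_0) (simp add: l_def n0_def)
    then have "0 = (\<Sum>ij\<in>insert i0j0 (S1 \<union> S2). w ij * \<omega> powi (e ij * int (l - snd ij)) * fps_nth B (l - snd ij))"
      using borel_recurrence[OF \<omega>0 \<omega>(2) B eq, of l] unfolding all w_def e_def by simp
    also have "\<dots> = (\<Sum>ij\<in>insert i0j0 S1. w ij * \<omega> powi (e ij * int (l - snd ij)) * fps_nth B (l - snd ij))
       + (\<Sum>ij\<in>S2. w ij * \<omega> powi (e ij * int (l - snd ij)) * fps_nth B (l - snd ij))"
      using fS by (subst sum.union_disjoint[symmetric]) (auto simp: S1_def S2_def n1_def)
    also have "(\<Sum>ij\<in>insert i0j0 S1. w ij * \<omega> powi (e ij * int (l - snd ij)) * fps_nth B (l - snd ij))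
       = (\<Sum>ij\<in>insert i0j0 S1. w ij * \<omega> powi ((e ij - E) * int n)) * (\<omega> powi (E * int n) * fps_nth B n)"
      unfolding sum_distrib_right
    proof (intro sum.cong refl)
      fix ij assume "ij \<in> insert i0j0 S1"
      have "e ij * int n = (e ij - E) * int n + E * int n" by (simp add: algebra_simps)
      then have "\<omega> powi (e ij * int n) = \<omega> powi ((e ij - E) * int n) * \<omega> powi (E * int n)" by (simp only: powi_add[OF \<omega>0])
      then show "w ij * \<omega> powi (e ij * int (l - snd ij)) * fps_nth B (l - snd ij) = w ij * \<omega> powi ((e ij - E) * int n) * (\<omega> powi (E * int n) * fps_nth B n)"
        unfolding nb[OF \<open>ij \<in> _\<close>] by (simp only: mult_ac)
    qed
    also have "(\<Sum>ij\<in>insert i0j0 S1. w ij * \<omega> powi ((e ij - E) * int n)) = main n"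
      using fS i0 by (subst sum.insert) (auto simp: main_def S1_def)
    finally have "main n * (\<omega> powi (E * int n) * fps_nth B n) = - (\<Sum>ij\<in>S2. w ij * \<omega> powi (e ij * int (l - snd ij)) * fps_nth B (l - snd ij))"
      by (simp add: eq_neg_iff_add_eq_0)
    then have "norm (main n * (\<omega> powi (E * int n) * fps_nth B n)) = norm (\<Sum>ij\<in>S2. w ij * \<omega> powi (e ij * int (l - snd ij)) * fps_nth B (l - snd ij))"
      by (simp only: norm_minus_cancel)
    then have "norm (main n) * (?Q powi (E * int n) * norm (fps_nth B n)) = norm (\<Sum>ij\<in>S2. w ij * \<omega> powi (e ij * int (l - snd ij)) * fps_nth B (l - snd ij))"
      by (simp only: norm_mult norm_power_int)
    also have "\<dots> \<le> (\<Sum>ij\<in>S2. norm (w ij) * ?Q powi (- (e ij * int (d ij))) * ?Q powi (E * int n) * norm (fps_nth B (n - d ij)))"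
    proof (rule order_trans[OF norm_sum], rule sum_mono)
      fix ij assume ij: "ij \<in> S2"
      have "e ij * int (l - snd ij) = - (e ij * int (d ij)) + e ij * int n"
        using n2'[OF ij] by (simp add: of_nat_diff algebra_simps)
      then have "?Q powi (e ij * int (l - snd ij)) = ?Q powi (- (e ij * int (d ij))) * ?Q powi (e ij * int n)"
        using \<omega>0 by (simp only: powi_add norm_eq_zero simp_thms)
      also have "\<dots> \<le> ?Q powi (- (e ij * int (d ij))) * ?Q powi (E * int n)"
        using eE[of ij] ij \<omega> by (intro mult_left_mono power_int_increasing mult_right_mono) (auto simp: S2_def)
      finally have "?Q powi (e ij * int (l - snd ij)) \<le> ?Q powi (- (e ij * int (d ij))) * ?Q powi (E * int n)" .
      then have "norm (w ij) * ?Q powi (e ij * int (l - snd ij)) * norm (fps_nth B (l - snd ij)) \<le>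
          norm (w ij) * (?Q powi (- (e ij * int (d ij))) * ?Q powi (E * int n)) * norm (fps_nth B (l - snd ij))"
        by (intro mult_right_mono mult_left_mono) auto
      then show "norm (w ij * \<omega> powi (e ij * int (l - snd ij)) * fps_nth B (l - snd ij)) \<le> norm (w ij) * ?Q powi (- (e ij * int (d ij))) * ?Q powi (E * int n) * norm (fps_nth B (n - d ij))"
        unfolding norm_mult norm_power_int conjunct1[OF n2'[OF ij]] by (simp only: mult.assoc)
    qed
    also have "\<dots> = ?Q powi (E * int n) * (\<Sum>ij\<in>S2. norm (w ij) * ?Q powi (- (e ij * int (d ij))) * norm (fps_nth B (n - d ij)))"
      unfolding sum_distrib_left by (simp only: mult_ac)
    finally have "norm (main n) * norm (fps_nth B n) \<le> (\<Sum>ij\<in>S2. norm (w ij) * ?Q powi (- (e ij * int (d ij))) * norm (fps_nth B (n - d ij)))"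
    proof -
      assume "norm (main n) * (?Q powi (E * int n) * norm (fps_nth B n)) \<le> ?Q powi (E * int n) * (\<Sum>ij\<in>S2. norm (w ij) * ?Q powi (- (e ij * int (d ij))) * norm (fps_nth B (n - d ij)))"
      moreover have "?Q powi (E * int n) > 0" using \<omega>0 by simp
      ultimately show ?thesis by (simp add: mult.left_commute mult_le_cancel_left_pos)
    qed
    moreover have "norm (w i0j0) / 2 * norm (fps_nth B n) \<le> norm (main n) * norm (fps_nth B n)"
      using n2[of n] n by (intro mult_right_mono) (auto simp: n0_def)
    ultimately have "norm (w i0j0) / 2 * norm (fps_nth B n) \<le> (\<Sum>ij\<in>S2. norm (w ij) * ?Q powi (- (e ij * int (d ij))) * norm (fps_nth B (n - d ij)))" by simp
    also have "\<dots> \<le> (\<Sum>ij\<in>S2. (norm (w i0j0) / 2 * G) * norm (fps_nth B (n - d ij)))"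
    proof (intro sum_mono mult_right_mono)
      fix ij assume ij: "ij \<in> S2"
      have "norm (w ij) * ?Q powi (- (e ij * int (d ij))) \<le> (\<Sum>ij\<in>S2. norm (w ij) * ?Q powi (- (e ij * int (d ij))))"
        by (rule member_le_sum[OF ij]) (use fS in auto)
      also have "\<dots> = norm (w i0j0) / 2 * G" using w0 by (simp add: G_def)
      finally show "norm (w ij) * ?Q powi (- (e ij * int (d ij))) \<le> norm (w i0j0) / 2 * G" .
    qed simp
    also have "\<dots> = norm (w i0j0) / 2 * (\<Sum>ij\<in>S2. G * norm (fps_nth B (n - d ij)))"
      by (simp add: sum_distrib_left mult.assoc)
    finally show "norm (fps_nth B n) \<le> (\<Sum>ij\<in>S2. G * norm (fps_nth B (n - d ij)))"
      using w0 by (simp add: mult_le_cancel_left_pos)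
  qed simp
  then obtain C M where CM: "M \<ge> 1" "\<And>n. norm (fps_nth B n) \<le> C * M ^ n" by blast
  define r where "r = 1 / (2 * M)"
  have r: "r > 0" "M * r = 1 / 2" using CM by (auto simp: r_def)
  have "summable (\<lambda>n. fps_nth B n * of_real r ^ n)"
  proof (rule summable_comparison_test'[where N = 0 and g = "\<lambda>n. C * (1 / 2) ^ n"])
    show "norm (fps_nth B n * of_real r ^ n) \<le> C * (1 / 2) ^ n" for n
      using mult_right_mono[OF CM(2)[of n], of "r ^ n"] r
      by (simp add: norm_mult norm_power power_mult_distrib[symmetric] mult.assoc)
  qed (intro summable_mult summable_geometric, simp)
  then have "ereal (norm (of_real r :: complex)) \<le> fps_conv_radius B"
    unfolding fps_conv_radius_def by (rule conv_radius_geI)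
  moreover have "ereal (norm (of_real r :: complex)) > 0" using r by simp
  ultimately show ?thesis by (rule less_le_trans[rotated])
qed

lemma sums_shift_right:
  fixes g :: "nat \<Rightarrow> complex"
  assumes "g sums s"
  shows "(\<lambda>l. if j \<le> l then g (l - j) else 0) sums s"
proof -
  have "(\<lambda>n. (if j \<le> n + j then g (n + j - j) else 0)) sums (s - (\<Sum>i<j. if j \<le> i then g (i - j) else 0))"
    using assms by (simp add: sum.neutral)
  moreover have "(\<Sum>i<j. if j \<le> i then g (i - j) else 0) = 0" by (rule sum.neutral) auto
  ultimately show ?thesis by (subst (asm) sums_iff_shift) simp
qed

lemma borel_sum_equation:
  assumes \<omega>: "\<omega> \<noteq> 0" "q = \<omega> ^ K"
    and B: "\<And>l. fps_nth B l = fps_nth h l * \<omega> powi (- (\<sigma> * int (l choose 2)))"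
    and eq: "qop_fps q m A h = fps_of_poly a"
    and z: "\<And>ij. ij \<in> op_support m A \<Longrightarrow> ereal (norm (\<omega> powi qop_exp (int K) \<sigma> ij * z)) < fps_conv_radius B"
  shows "qop_apply \<omega> (int K) \<sigma> (op_support m A) (op_coeff A) (eval_fps B) z = qop_rhs \<omega> \<sigma> a z"
proof -
  let ?S = "op_support m A"
  define w where "w = (\<lambda>ij. op_coeff A ij * qop_weight \<omega> \<sigma> ij)"
  define e where "e = qop_exp (int K) \<sigma>"
  define t where "t = (\<lambda>ij l. if snd ij \<le> l then w ij * \<omega> powi (e ij * int (l - snd ij)) * fps_nth B (l - snd ij) * z ^ l else 0)"
  have "t ij sums (w ij * z ^ snd ij * eval_fps B (\<omega> powi e ij * z))" if "ij \<in> ?S" for ij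
  proof -
    have "(\<lambda>l. fps_nth B l * (\<omega> powi e ij * z) ^ l) sums eval_fps B (\<omega> powi e ij * z)"
      by (rule sums_eval_fps) (use z[OF that] in \<open>simp add: e_def\<close>)
    then have "(\<lambda>l. (w ij * z ^ snd ij) * (fps_nth B l * (\<omega> powi e ij * z) ^ l)) sums ((w ij * z ^ snd ij) * eval_fps B (\<omega> powi e ij * z))"
      by (rule sums_mult)
    from sums_shift_right[OF this, of "snd ij"]
    have "(\<lambda>l. if snd ij \<le> l then (w ij * z ^ snd ij) * (fps_nth B (l - snd ij) * (\<omega> powi e ij * z) ^ (l - snd ij)) else 0) sums
      ((w ij * z ^ snd ij) * eval_fps B (\<omega> powi e ij * z))" .
    moreover have "(\<lambda>l. if snd ij \<le> l then (w ij * z ^ snd ij) * (fps_nth B (l - snd ij) * (\<omega> powi e ij * z) ^ (l - snd ij)) else 0) = t ij"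
    proof
      fix l
      have pp: "\<omega> powi (e ij * int (l - snd ij)) = (\<omega> powi e ij) ^ (l - snd ij)"
        by (simp only: power_int_mult power_int_of_nat)
      have "z ^ l = z ^ snd ij * z ^ (l - snd ij)" if "snd ij \<le> l" using that by (simp add: power_add[symmetric])
      then show "(if snd ij \<le> l then (w ij * z ^ snd ij) * (fps_nth B (l - snd ij) * (\<omega> powi e ij * z) ^ (l - snd ij)) else 0) = t ij l"
        unfolding t_def pp power_mult_distrib by (cases "snd ij \<le> l") (simp_all only: if_True if_False mult_ac)
    qed
    ultimately show ?thesis by simp
  qed
  then have "(\<lambda>l. \<Sum>ij\<in>?S. t ij l) sums (\<Sum>ij\<in>?S. w ij * z ^ snd ij * eval_fps B (\<omega> powi e ij * z))"
    by (rule sums_sum)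
  moreover have "(\<Sum>ij\<in>?S. t ij l) = coeff a l * \<omega> powi (- (\<sigma> * int (l choose 2))) * z ^ l" for l
  proof -
    have "(\<Sum>ij\<in>?S. t ij l) = (\<Sum>ij\<in>{ij \<in> ?S. snd ij \<le> l}. w ij * \<omega> powi (e ij * int (l - snd ij)) * fps_nth B (l - snd ij)) * z ^ l"
      unfolding t_def sum_distrib_right by (rule sum.inter_filter[symmetric, OF finite_op_support])
    then show ?thesis using borel_recurrence[OF \<omega> B eq, of l] by (simp add: w_def e_def)
  qed
  moreover have "(\<lambda>l. coeff a l * \<omega> powi (- (\<sigma> * int (l choose 2))) * z ^ l) sums qop_rhs \<omega> \<sigma> a z"
    unfolding qop_rhs_def by (rule sums_finite) (auto simp: coeff_eq_0)
  ultimately show ?thesis unfolding qop_apply_def using sums_unique2 by (simp add: w_def e_def) blast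
qed

section \<open>One step of the resummation\<close>

lemma small_dilates:
  assumes "finite E" "r > 0" "(\<omega> :: complex) \<noteq> 0"
  obtains \<delta> where "\<delta> > 0" "\<And>z e. norm z < \<delta> \<Longrightarrow> e \<in> E \<Longrightarrow> norm (\<omega> powi e * z) < r"
proof -
  define T where "T = 1 + (\<Sum>e\<in>E. norm \<omega> powi e)"
  have s: "(\<Sum>e\<in>E. norm \<omega> powi e) \<ge> 0" by (intro sum_nonneg) simp
  then have T: "T \<ge> 1" by (simp add: T_def)
  show ?thesis
  proof (rule that[of "r / T"])
    show "r / T > 0" using T assms by simp
    fix z :: complex and e assume z: "norm z < r / T" and e: "e \<in> E"
    have "norm \<omega> powi e \<le> (\<Sum>e\<in>E. norm \<omega> powi e)" using assms e by (intro member_le_sum) auto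
    then have "norm \<omega> powi e \<le> T" by (simp add: T_def)
    then have "norm (\<omega> powi e * z) \<le> T * norm z" by (simp add: norm_mult norm_power_int mult_right_mono)
    also have "\<dots> < T * (r / T)" using z T by (intro mult_strict_left_mono) auto
    finally show "norm (\<omega> powi e * z) < r" using T by simp
  qed
qed

text \<open>The functional equation of the transform holds where all the arguments that occur lie within
  the radius of convergence.\<close>

lemma lap_solves_near_0:
  assumes \<eta>: "norm \<eta> > 1" and N: "N > 0" and lam: "lam \<noteq> 0" and S: "finite S"
    and M: "1 \<le> M" and C: "0 \<le> C" and u: "\<And>k. norm (F (\<eta> powi k * lam)) \<le> gauss_growth \<eta> N C M k"
    and eq: "\<And>k. qop_apply \<eta> L (\<sigma> + int N) S c F (\<eta> powi k * lam) = qop_rhs \<eta> (\<sigma> + int N) a (\<eta> powi k * lam)"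
  defines "g \<equiv> lap \<eta> N lam (\<lambda>k. F (\<eta> powi k * lam))"
  shows "\<exists>\<delta>>0. g meromorphic_on (ball 0 \<delta> - {0}) \<and>
    (\<forall>z. z \<noteq> 0 \<longrightarrow> norm z < \<delta> \<longrightarrow> lap_term \<eta> N lam (\<lambda>k. F (\<eta> powi k * lam)) z summable_on UNIV) \<and>
    (\<forall>z. z \<noteq> 0 \<longrightarrow> norm z < \<delta> \<longrightarrow> (\<forall>k::int. z \<noteq> - (\<eta> powi k * lam)) \<longrightarrow>
       g analytic_on {z} \<and> qop_apply \<eta> L \<sigma> S c g z = qop_rhs \<eta> \<sigma> a z)"
proof -
  have \<eta>0: "\<eta> \<noteq> 0" using \<eta> by auto
  let ?u = "\<lambda>k. F (\<eta> powi k * lam)"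
  define r where "r = min (lap_radius \<eta> N lam M) (lap_radius \<eta> N lam 1)"
  have r: "r > 0" using lap_radius_pos[OF \<eta>0 lam] M by (simp add: r_def)
  define E where "E = insert 0 (qop_exp L \<sigma> ` S \<union> (\<lambda>j. int N * int j) ` {..degree a})"
  have "finite E" using S by (simp add: E_def)
  from small_dilates[OF this r \<eta>0] obtain \<delta> where \<delta>: "\<delta> > 0" "\<And>z e. norm z < \<delta> \<Longrightarrow> e \<in> E \<Longrightarrow> norm (\<eta> powi e * z) < r" by blast
  have zr: "norm z < r" if "norm z < \<delta>" for z :: complex using \<delta>(2)[OF that, of 0] by (simp add: E_def)
  note A = lap_analytic[OF \<eta> N lam M C u]
  have "g meromorphic_on (ball 0 \<delta> - {0})" unfolding g_def
  proof (rule meromorphic_on_subset[OF A(1)])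
    have "r \<le> lap_radius \<eta> N lam M" by (simp add: r_def)
    then show "ball 0 \<delta> - {0} \<subseteq> (ball 0 (lap_radius \<eta> N lam M) - {0} :: complex set)"
      using order_less_le_trans[OF zr] by (simp add: subset_iff dist_norm)
  qed
  moreover have "lap_term \<eta> N lam ?u z summable_on UNIV" if z: "z \<noteq> 0" "norm z < \<delta>" for z
    by (rule lap_residues(2)[OF \<eta> N lam M C u z(1)]) (use zr[OF z(2)] in \<open>simp add: r_def\<close>)
  moreover have "g analytic_on {z} \<and> qop_apply \<eta> L \<sigma> S c g z = qop_rhs \<eta> \<sigma> a z"
    if z: "z \<noteq> 0" "norm z < \<delta>" "\<forall>k::int. z \<noteq> - (\<eta> powi k * lam)" for z
  proof
    show "g analytic_on {z}" unfolding g_def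
      by (rule A(2)[OF z(1)]) (use z zr[OF z(2)] in \<open>auto simp: r_def\<close>)
    have "(\<Sum>(i, j)\<in>S. c (i, j) * \<eta> powi (- (\<sigma> * int (j choose 2))) * z ^ j * lap \<eta> N lam ?u (\<eta> powi (L * int i - \<sigma> * int j) * z))
      = (\<Sum>j\<le>degree a. coeff a j * \<eta> powi (- (\<sigma> * int (j choose 2))) * z ^ j)"
    proof (rule lap_equation[OF \<eta> N lam M C u S _ z(1)])
      fix k
      have "\<eta> powi (k + (L * int i - (\<sigma> + int N) * int j)) * lam = \<eta> powi (L * int i - (\<sigma> + int N) * int j) * (\<eta> powi k * lam)" for i j
        by (simp only: powi_add[OF \<eta>0] mult_ac)
      then show "(\<Sum>(i, j)\<in>S. c (i, j) * \<eta> powi (- ((\<sigma> + int N) * int (j choose 2))) * (\<eta> powi k * lam) ^ j * F (\<eta> powi (k + (L * int i - (\<sigma> + int N) * int j)) * lam))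
        = (\<Sum>j\<le>degree a. coeff a j * \<eta> powi (- ((\<sigma> + int N) * int (j choose 2))) * (\<eta> powi k * lam) ^ j)"
        using eq[of k] by (simp only: qop_apply_def qop_rhs_def qop_weight_def qop_exp_def case_prod_unfold prod.collapse)
    next
      fix i j assume "(i, j) \<in> S"
      then have "qop_exp L \<sigma> (i, j) \<in> E" by (simp add: E_def)
      from \<delta>(2)[OF z(2) this] show "norm (\<eta> powi (L * int i - \<sigma> * int j) * z) < lap_radius \<eta> N lam M"
        by (simp add: qop_exp_def r_def)
    next
      fix j assume "j \<le> degree a"
      then have "int N * int j \<in> E" unfolding E_def by (intro insertI2 UnI2 imageI) simp
      from \<delta>(2)[OF z(2) this] show "norm (\<eta> powi (int N * int j) * z) < lap_radius \<eta> N lam 1"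
        by (simp add: r_def)
    qed (use z in auto)
    then show "qop_apply \<eta> L \<sigma> S c g z = qop_rhs \<eta> \<sigma> a z"
      by (simp add: g_def qop_apply_def qop_rhs_def qop_weight_def qop_exp_def case_prod_unfold)
  qed
  ultimately show ?thesis using \<delta>(1) by blast
qed

text \<open>By uniqueness along the spiral, the continuation selected in the definition of the transformation has the
  values of \<open>F\<close> there.\<close>

lemma q_laplace_eq_lap:
  assumes \<omega>: "norm \<omega> > 1" "\<omega> = qpow lq (1 / of_nat K)" and K: "K > 0" and N: "N > 0" "real K / \<kappa> = real N"
    and lam: "lam \<noteq> 0"
    and Fm: "F meromorphic_on (- {0})" and Fa: "\<And>k. F analytic_on {\<omega> powi k * lam}"
    and \<delta>: "\<delta> > 0" "\<And>z. z \<noteq> 0 \<Longrightarrow> norm z < \<delta> \<Longrightarrow> F z = f z"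
    and H: "H_continuation lq \<kappa> K lam f F"
  shows "q_laplace_term lq \<kappa> K lam f z = lap_term \<omega> N lam (\<lambda>k. F (\<omega> powi k * lam)) z"
    "q_laplace lq \<kappa> K lam f = lap \<omega> N lam (\<lambda>k. F (\<omega> powi k * lam))"
proof -
  define G0 where "G0 = (SOME G. H_continuation lq \<kappa> K lam f G)"
  have G0: "H_continuation lq \<kappa> K lam f G0" unfolding G0_def
    by (rule someI[of "H_continuation lq \<kappa> K lam f", OF H])
  have G: "G0 (\<omega> powi k * lam) = F (\<omega> powi k * lam)" for k
    by (rule H_continuation_unique[OF \<omega> lam Fm Fa \<delta> G0])
  have "\<kappa> \<noteq> 0" using N by auto
  then have \<kappa>: "1 / \<kappa> = real N / real K" "\<kappa> / real K = 1 / real N" using N K by (auto simp: field_simps)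
  have "qpow lq (1 / \<kappa>) = \<omega> powi int N" unfolding \<kappa> \<omega>(2) using qpow_powi[of lq "int N" K] by simp
  then have p: "qpow lq (1 / \<kappa>) = \<omega> ^ N" by simp
  have pk: "qpow lq (1 / \<kappa> + of_int k / of_nat K) = \<omega> powi (int N + k)" for k
    unfolding \<kappa> \<omega>(2) qpow_powi[symmetric] by (simp add: add_divide_distrib)
  have kk: "qpow lq (of_int k / of_nat K) = \<omega> powi k" for k unfolding \<omega>(2) by (rule qpow_powi)
  show t: "q_laplace_term lq \<kappa> K lam f z = lap_term \<omega> N lam (\<lambda>k. F (\<omega> powi k * lam)) z" for z
    unfolding fun_eq_iff q_laplace_term_def lap_term_def p pk kk G0_def[symmetric] G by simp
  show "q_laplace lq \<kappa> K lam f = lap \<omega> N lam (\<lambda>k. F (\<omega> powi k * lam))"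
    unfolding fun_eq_iff q_laplace_def lap_def t \<kappa> by simp
qed

lemma q_laplace_convergesI:
  assumes "\<And>z. q_laplace_term lq \<kappa> K lam f z = lap_term \<omega> N lam u z" "\<delta> > 0"
    "\<And>z. z \<noteq> 0 \<Longrightarrow> norm z < \<delta> \<Longrightarrow> lap_term \<omega> N lam u z summable_on UNIV"
  shows "q_laplace_converges lq \<kappa> K lam f"
  unfolding q_laplace_converges_def assms(1) using assms(2,3) by auto

lemma mero_germs0I:
  assumes "F meromorphic_on (- {0})" "\<delta> > 0" "\<And>z. z \<noteq> 0 \<Longrightarrow> norm z < \<delta> \<Longrightarrow> F z = f z"
  shows "f \<in> mero_germs0"
proof -
  have op: "open (ball 0 \<delta> - {0} :: complex set)" by (simp add: open_delete)
  have "F meromorphic_on (ball 0 \<delta> - {0})" by (rule meromorphic_on_subset[OF assms(1)]) auto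
  moreover have "F meromorphic_on (ball 0 \<delta> - {0}) \<longleftrightarrow> f meromorphic_on (ball 0 \<delta> - {0})"
  proof (rule meromorphic_on_cong)
    fix z assume "z \<in> ball 0 \<delta> - {0 :: complex}"
    from eventually_at_in_open'[OF op this] show "\<forall>\<^sub>F w in at z. F w = f w"
      by (rule eventually_mono) (use assms(3) in auto)
  qed simp
  ultimately show ?thesis unfolding mero_germs0_def using assms(2) by blast
qed

text \<open>The discs around the coarser spiral are among those around the finer one, so the same domain serves.\<close>

lemma H_continuation_coarser:
  assumes "H_continuation lq \<kappa> K lam f F" "K = c * n" "n > 0" "c > 0"
  shows "H_continuation lq \<kappa> n lam f F"
proof -
  have *: "(\<Union>k::int. {z. z \<noteq> 0 \<and> norm (z - lam * qpow lq (of_int k / of_nat n)) < \<epsilon> * norm (qpow lq (of_int k / of_nat n) * lam)})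
    \<subseteq> (\<Union>k::int. {z. z \<noteq> 0 \<and> norm (z - lam * qpow lq (of_int k / of_nat K)) < \<epsilon> * norm (qpow lq (of_int k / of_nat K) * lam)})" for \<epsilon>
  proof (rule UN_least)
    fix k :: int
    have "(of_int k / of_nat n :: real) = of_int (k * int c) / of_nat K" using assms by simp
    then show "{z. z \<noteq> 0 \<and> norm (z - lam * qpow lq (of_int k / of_nat n)) < \<epsilon> * norm (qpow lq (of_int k / of_nat n) * lam)}
      \<subseteq> (\<Union>k::int. {z. z \<noteq> 0 \<and> norm (z - lam * qpow lq (of_int k / of_nat K)) < \<epsilon> * norm (qpow lq (of_int k / of_nat K) * lam)})"
      by (intro order_trans[OF _ UN_upper[of "k * int c"]]) simp_all
  qed
  show ?thesis using assms(1) unfolding H_continuation_def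
    by (elim ex_forward conj_forward) (assumption | erule order_trans[OF *])+
qed

text \<open>The last transformation sums over the spirals of \<open>\<omega>\<^sup>c\<close>, whereas all others, and the singularities, refer to
  \<open>\<omega>\<close>. The following two lemmas translate between the two.\<close>

lemma qop_rescale:
  "qop_apply (\<omega> ^ k) L \<sigma> S c F = qop_apply \<omega> (int k * L) (int k * \<sigma>) S c F"
  "qop_rhs (\<omega> ^ k) \<sigma> a = qop_rhs \<omega> (int k * \<sigma>) a"
proof -
  have p: "(\<omega> ^ k) powi e = \<omega> powi (int k * e)" for e by (simp only: power_int_mult power_int_of_nat)
  show "qop_apply (\<omega> ^ k) L \<sigma> S c F = qop_apply \<omega> (int k * L) (int k * \<sigma>) S c F"
    by (simp add: fun_eq_iff qop_apply_def qop_weight_def qop_exp_def p algebra_simps)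
  show "qop_rhs (\<omega> ^ k) \<sigma> a = qop_rhs \<omega> (int k * \<sigma>) a"
    by (simp add: fun_eq_iff qop_rhs_def p algebra_simps)
qed

lemma gauss_growth_rescale:
  assumes "c > 0" "N > 0"
  shows "gauss_growth \<omega> (c * N) C M (int c * k) = gauss_growth (\<omega> ^ c) N C (M ^ c) k"
proof (cases "\<omega> = 0")
  case False
  have n: "nat (int c * k) = c * nat k" by (simp add: nat_mult_distrib)
  have "(norm \<omega> ^ c) powr ((real (nat k))\<^sup>2 / (2 * real N)) = norm \<omega> powr (real c * ((real (nat k))\<^sup>2 / (2 * real N)))"
    using False by (simp add: powr_realpow[symmetric] powr_powr)
  also have "real c * ((real (nat k))\<^sup>2 / (2 * real N)) = (real (c * nat k))\<^sup>2 / (2 * real (c * N))"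
    using assms by (simp add: power2_eq_square)
  finally show ?thesis by (simp add: gauss_growth_def n power_mult norm_power)
qed (use assms in \<open>simp add: gauss_growth_def power_0_left zero_less_mult_iff\<close>)

lemma qop_apply_untransformed:
  assumes "q = \<omega> ^ K"
  shows "qop_apply \<omega> (int K) 0 (op_support m A) (op_coeff A) G z = qop_fun q m A G z"
    "qop_rhs \<omega> 0 a z = poly a z"
proof -
  have p: "\<omega> powi (int K * int i) = q ^ i" for i
    unfolding assms power_mult[symmetric] of_nat_mult[symmetric] by (rule power_int_of_nat)
  have "qop_fun q m A G z = (\<Sum>i\<le>m. \<Sum>j\<in>{..degree (A i)}. coeff (A i) j * z ^ j * G (q ^ i * z))"
    by (simp add: qop_fun_def poly_altdef sum_distrib_right)
  also have "\<dots> = (\<Sum>ij\<in>{ij \<in> op_support m A. True}. coeff (A (fst ij)) (snd ij) * z ^ snd ij * G (q ^ fst ij * z))"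
    by (rule sum_op_support[where P = "\<lambda>_. True"]) (auto simp: op_support_def le_degree)
  finally show "qop_apply \<omega> (int K) 0 (op_support m A) (op_coeff A) G z = qop_fun q m A G z"
    by (simp add: qop_apply_def qop_weight_def qop_exp_def op_coeff_def p)
  show "qop_rhs \<omega> 0 a z = poly a z" by (simp add: qop_rhs_def poly_altdef)
qed

section \<open>The chain of transformations\<close>

lemma iterated_laplace_step:
  assumes "t \<ge> 1"
  shows "iterated_laplace lq \<kappa> K lam t f = q_laplace lq (\<kappa> t) K lam (iterated_laplace lq \<kappa> K lam (t - 1) f)"
proof -
  have "[1..<Suc t] = [1..<Suc (t - 1)] @ [t]" using assms by (cases t) auto
  then show ?thesis by (simp add: iterated_laplace_def)
qed

lemma not_on_pole_spiral:
  assumes "- lam \<in> R" "z \<notin> spirals \<omega> R" shows "z \<noteq> - (\<omega> powi k * lam)"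
proof
  assume "z = - (\<omega> powi k * lam)"
  then have "z = \<omega> powi k * (- lam)" by simp
  then show False using assms unfolding spirals_def by blast
qed

text \<open>By induction on \<open>t\<close>, the transform number \<open>t - 1\<close> continues to a global solution at level \<open>\<sigma> t\<close> with controlled growth.
  The growth makes the next transform converge; the equation of the next level, which holds near the
  origin, continues it; and its boundedness near the origin, away from the poles, is the
  starting point for the recurrence that controls its growth. The point \<open>-lam\<close> is in \<open>R\<close> because the
  transforms have their poles on its spiral.\<close>

lemma resummation_chain:
  fixes \<sigma> :: "nat \<Rightarrow> int" and N :: "nat \<Rightarrow> nat" and \<kappa> :: "nat \<Rightarrow> real"
  assumes \<omega>: "norm \<omega> > 1" "\<omega> = qpow lq (1 / of_nat K)" and K: "K > 0" and r: "r \<ge> 1"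
    and N: "\<And>t. t \<in> {1..r} \<Longrightarrow> N t > 0" "\<And>t. t \<in> {1..r} \<Longrightarrow> real K / \<kappa> t = real (N t)"
    and \<sigma>: "\<And>t. t \<in> {1..r} \<Longrightarrow> \<sigma> t = \<sigma> (t + 1) + int (N t)"
    and S: "finite S" and lead: "\<And>t. qop_lead \<omega> L (\<sigma> t) S c \<noteq> 0"
    and R: "finite R" "0 \<notin> R" "- lam \<in> R"
    and roots: "\<And>t z. t \<in> {1..r + 1} \<Longrightarrow> z \<noteq> 0 \<Longrightarrow> poly (qop_lead \<omega> L (\<sigma> t) S c) z = 0 \<Longrightarrow> z \<in> R"
    and slope: "\<And>t ij. t \<in> {1..r} \<Longrightarrow> ij \<in> S \<Longrightarrow>
      (int (snd ij) - int (degree (qop_lead \<omega> L (\<sigma> t) S c))) * int (N t) \<le> qop_order L (\<sigma> t) S - qop_exp L (\<sigma> t) ij"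
    and lam: "lam \<noteq> 0" "lam \<notin> spirals \<omega> R"
    and f0: "\<delta>0 > 0" "f0 holomorphic_on ball 0 \<delta>0"
      "\<And>z. norm z < \<delta>0 \<Longrightarrow> qop_apply \<omega> L (\<sigma> 1) S c f0 z = qop_rhs \<omega> (\<sigma> 1) a z"
  defines "g \<equiv> \<lambda>i. iterated_laplace lq \<kappa> K lam i f0"
  shows "\<And>t. t \<in> {1..r} \<Longrightarrow> g (t - 1) \<in> H_space lq (\<kappa> t) K lam"
    "\<And>t. t \<in> {1..r} \<Longrightarrow> q_laplace_converges lq (\<kappa> t) K lam (g (t - 1))"
    "\<exists>F. \<exists>\<delta>>0. F meromorphic_on (- {0}) \<and> (\<forall>z. z \<noteq> 0 \<longrightarrow> norm z < \<delta> \<longrightarrow> F z = g (r - 1) z) \<and>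
       (\<forall>z. z \<noteq> 0 \<longrightarrow> z \<notin> spirals \<omega> R \<longrightarrow> F analytic_on {z} \<and> qop_apply \<omega> L (\<sigma> r) S c F z = qop_rhs \<omega> (\<sigma> r) a z) \<and>
       H_continuation lq (\<kappa> r) K lam (g (r - 1)) F \<and>
       (\<exists>C M. 0 \<le> C \<and> 1 \<le> M \<and> (\<forall>k. norm (F (\<omega> powi k * lam)) \<le> gauss_growth \<omega> (N r) C M k))"
proof -
  have \<omega>0: "\<omega> \<noteq> 0" using \<omega> by auto
  let ?X = "spirals \<omega> R"
  define stage where "stage = (\<lambda>t F. F meromorphic_on (- {0}) \<and> (\<exists>\<delta>>0. \<forall>z. z \<noteq> 0 \<longrightarrow> norm z < \<delta> \<longrightarrow> F z = g (t - 1) z) \<and>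
       (\<forall>z. z \<noteq> 0 \<longrightarrow> z \<notin> ?X \<longrightarrow> F analytic_on {z} \<and> qop_apply \<omega> L (\<sigma> t) S c F z = qop_rhs \<omega> (\<sigma> t) a z) \<and>
       (\<forall>D. compact D \<longrightarrow> 0 \<notin> D \<longrightarrow> D \<inter> ?X = {} \<longrightarrow>
         (\<exists>C M. 0 \<le> C \<and> 1 \<le> M \<and> (\<forall>z\<in>D. \<forall>k. norm (F (\<omega> powi k * z)) \<le> gauss_growth \<omega> (N t) C M k))))"
  have lamk: "\<omega> powi k * lam \<noteq> 0" "\<omega> powi k * lam \<notin> ?X" for k using lam \<omega>0 spirals_shift[OF \<omega>0] by auto
  \<comment> \<open>a global solution of level \<open>t\<close> is a continuation as required, and can be transformed\<close>
  have use_stage: "H_continuation lq (\<kappa> t) K lam (g (t - 1)) F"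
      "\<exists>C M. 0 \<le> C \<and> 1 \<le> M \<and> (\<forall>k. norm (F (\<omega> powi k * lam)) \<le> gauss_growth \<omega> (N t) C M k)"
      "q_laplace_term lq (\<kappa> t) K lam (g (t - 1)) z = lap_term \<omega> (N t) lam (\<lambda>k. F (\<omega> powi k * lam)) z"
      "q_laplace lq (\<kappa> t) K lam (g (t - 1)) = lap \<omega> (N t) lam (\<lambda>k. F (\<omega> powi k * lam))"
      "g (t - 1) \<in> H_space lq (\<kappa> t) K lam"
    if st: "stage t F" and t: "t \<in> {1..r}" for t F z
  proof -
    obtain \<delta> where F: "F meromorphic_on (- {0})" "\<delta> > 0" "\<And>z. z \<noteq> 0 \<Longrightarrow> norm z < \<delta> \<Longrightarrow> F z = g (t - 1) z"
      "\<And>z. z \<noteq> 0 \<Longrightarrow> z \<notin> ?X \<Longrightarrow> F analytic_on {z}"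
      "\<And>D. compact D \<Longrightarrow> 0 \<notin> D \<Longrightarrow> D \<inter> ?X = {} \<Longrightarrow> \<exists>C M. 0 \<le> C \<and> 1 \<le> M \<and> (\<forall>z\<in>D. \<forall>k. norm (F (\<omega> powi k * z)) \<le> gauss_growth \<omega> (N t) C M k)"
    proof -
      from st[unfolded stage_def] obtain \<delta> where "\<delta> > 0" "\<forall>z. z \<noteq> 0 \<longrightarrow> norm z < \<delta> \<longrightarrow> F z = g (t - 1) z" by (elim conjE exE)
      with st[unfolded stage_def] show ?thesis by (intro that[of \<delta>]) (elim conjE; simp)+
    qed
    have pw: "norm (exp lq) powr (1 / \<kappa> t) = norm \<omega> ^ N t"
    proof -
      have "norm \<omega> = norm (exp lq) powr (1 / real K)"
        by (simp add: \<omega>(2) qpow_def powr_def)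
      then have "norm \<omega> ^ N t = norm (exp lq) powr (1 / real K * real (N t))"
        by (simp add: powr_powr powr_realpow[symmetric])
      also have "1 / real K * real (N t) = 1 / \<kappa> t" using N(2)[OF t] N(1)[OF t] K by (simp add: field_simps)
      finally show ?thesis by simp
    qed
    show H: "H_continuation lq (\<kappa> t) K lam (g (t - 1)) F"
      by (rule H_continuationI[OF \<omega> N(1)[OF t] pw R(1,2) lam F(4) F(2,3) F(5)])
    show "\<exists>C M. 0 \<le> C \<and> 1 \<le> M \<and> (\<forall>k. norm (F (\<omega> powi k * lam)) \<le> gauss_growth \<omega> (N t) C M k)"
      using F(5)[of "{lam}"] lam by auto
    note Q = q_laplace_eq_lap[OF \<omega> K N(1)[OF t] N(2)[OF t] lam(1) F(1) F(4)[OF lamk] F(2,3) H]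
    show "q_laplace_term lq (\<kappa> t) K lam (g (t - 1)) z = lap_term \<omega> (N t) lam (\<lambda>k. F (\<omega> powi k * lam)) z"
      by (rule Q(1))
    show "q_laplace lq (\<kappa> t) K lam (g (t - 1)) = lap \<omega> (N t) lam (\<lambda>k. F (\<omega> powi k * lam))" by (rule Q(2))
    show "g (t - 1) \<in> H_space lq (\<kappa> t) K lam"
      unfolding H_space_def using H mero_germs0I[OF F(1,2,3)] by blast
  qed
  \<comment> \<open>a local solution of level \<open>t\<close>, bounded under contraction, extends and grows in a controlled way\<close>
  have make_stage: "\<exists>F. stage t F"
    if t: "t \<in> {1..r}" and \<delta>: "\<delta> > 0" and gm: "g (t - 1) meromorphic_on (ball 0 \<delta> - {0})"
      and ga: "\<And>z. z \<noteq> 0 \<Longrightarrow> norm z < \<delta> \<Longrightarrow> z \<notin> ?X \<Longrightarrow> g (t - 1) analytic_on {z} \<and> qop_apply \<omega> L (\<sigma> t) S c (g (t - 1)) z = qop_rhs \<omega> (\<sigma> t) a z"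
      and bd: "\<And>D. compact D \<Longrightarrow> 0 \<notin> D \<Longrightarrow> D \<inter> ?X = {} \<Longrightarrow> \<exists>B k0. \<forall>z\<in>D. \<forall>k\<ge>k0. norm (g (t - 1) (\<omega> powi (- k) * z)) \<le> B" for t \<delta>
  proof -
    have t': "t \<in> {1..r + 1}" using t by simp
    have "\<exists>F. \<exists>\<delta>'>0. F meromorphic_on (- {0}) \<and> (\<forall>z. z \<noteq> 0 \<longrightarrow> norm z < \<delta>' \<longrightarrow> F z = g (t - 1) z) \<and>
      (\<forall>z. z \<noteq> 0 \<longrightarrow> z \<notin> ?X \<longrightarrow> F analytic_on {z} \<and> qop_apply \<omega> L (\<sigma> t) S c F z = qop_rhs \<omega> (\<sigma> t) a z)"
      by (rule qop_extend[OF \<omega>(1) S R(1,2) roots[OF t'] \<delta> gm]) (use ga in blast)+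
    then obtain F \<delta>' where Fall: "\<delta>' > 0" "F meromorphic_on (- {0})" "\<forall>z. z \<noteq> 0 \<longrightarrow> norm z < \<delta>' \<longrightarrow> F z = g (t - 1) z"
      "\<forall>z. z \<noteq> 0 \<longrightarrow> z \<notin> ?X \<longrightarrow> F analytic_on {z} \<and> qop_apply \<omega> L (\<sigma> t) S c F z = qop_rhs \<omega> (\<sigma> t) a z"
      by (elim exE conjE)
    have F: "\<delta>' > 0" "F meromorphic_on (- {0})" "\<And>z. z \<noteq> 0 \<Longrightarrow> norm z < \<delta>' \<Longrightarrow> F z = g (t - 1) z"
      "\<And>z. z \<noteq> 0 \<Longrightarrow> z \<notin> ?X \<Longrightarrow> F analytic_on {z}"
      "\<And>z. z \<noteq> 0 \<Longrightarrow> z \<notin> ?X \<Longrightarrow> qop_apply \<omega> L (\<sigma> t) S c F z = qop_rhs \<omega> (\<sigma> t) a z"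
      using Fall by simp_all
    have gr: "\<exists>C M. 0 \<le> C \<and> 1 \<le> M \<and> (\<forall>z\<in>D. \<forall>k. norm (F (\<omega> powi k * z)) \<le> gauss_growth \<omega> (N t) C M k)"
      if D: "compact D" "0 \<notin> D" "D \<inter> ?X = {}" for D
    proof -
      obtain B k0 where B: "\<And>z k. z \<in> D \<Longrightarrow> k0 \<le> k \<Longrightarrow> norm (g (t - 1) (\<omega> powi (- k) * z)) \<le> B" using bd[OF D] by blast
      obtain r2 where r2: "r2 > 0" "\<And>z. z \<in> D \<Longrightarrow> norm z \<le> r2" using compact_imp_bounded[OF D(1)] by (metis bounded_pos)
      obtain k1 where k1: "r2 / \<delta>' < norm \<omega> ^ k1" using \<omega> real_arch_pow by blast
      have bdd: "norm (F (\<omega> powi (- k) * z)) \<le> B" if z: "z \<in> D" and k: "k \<ge> max k0 (int k1)" for z k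
      proof -
        have "norm \<omega> powi (- k) \<le> norm \<omega> powi (- int k1)" using \<omega> k by (intro power_int_increasing) auto
        then have "norm (\<omega> powi (- k) * z) \<le> norm \<omega> powi (- int k1) * r2"
          unfolding norm_mult norm_power_int using r2(2)[OF z] by (intro mult_mono) auto
        also have "\<dots> < \<delta>'" using k1 F(1) \<omega>0 by (simp add: power_int_minus field_simps)
        finally have "F (\<omega> powi (- k) * z) = g (t - 1) (\<omega> powi (- k) * z)" using z D \<omega>0 by (intro F(3)) auto
        then show ?thesis using B[OF z, of k] k by simp
      qed
      show ?thesis
        by (rule qop_growth[OF \<omega>(1) N(1)[OF t] S lead R(1,2) roots[OF t'] slope[OF t] F(4) F(5) D bdd])
    qed
    have "\<exists>\<delta>>0. \<forall>z. z \<noteq> 0 \<longrightarrow> norm z < \<delta> \<longrightarrow> F z = g (t - 1) z" using Fall(1,3) by (rule exI[of _ \<delta>', OF conjI])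
    moreover have "\<forall>D. compact D \<longrightarrow> 0 \<notin> D \<longrightarrow> D \<inter> ?X = {} \<longrightarrow>
         (\<exists>C M. 0 \<le> C \<and> 1 \<le> M \<and> (\<forall>z\<in>D. \<forall>k. norm (F (\<omega> powi k * z)) \<le> gauss_growth \<omega> (N t) C M k))"
      by (intro allI impI gr)
    ultimately have "stage t F" unfolding stage_def using Fall(2,4) by (intro conjI)
    then show "\<exists>F. stage t F" by blast
  qed
  have st: "\<exists>F. stage t F" if "1 \<le> t" "t \<le> r" for t
    using that
  proof (induction t rule: dec_induct)
    case base
    have g0: "g (1 - 1) = f0" by (simp add: g_def iterated_laplace_def)
    have an: "f0 analytic_on ball 0 \<delta>0" using f0(2) by (simp add: analytic_on_open)
    show ?case
    proof (rule make_stage[of 1 \<delta>0], unfold g0)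
      show "f0 meromorphic_on (ball 0 \<delta>0 - {0})"
        by (rule meromorphic_on_subset[OF analytic_on_imp_meromorphic_on[OF an]]) auto
      show "f0 analytic_on {z} \<and> qop_apply \<omega> L (\<sigma> 1) S c f0 z = qop_rhs \<omega> (\<sigma> 1) a z" if "norm z < \<delta>0" for z
        using analytic_on_subset[OF an, of "{z}"] f0(3) that by auto
      fix D assume D: "compact D" "0 \<notin> (D :: complex set)"
      have "continuous_on (cball 0 (\<delta>0 / 2)) f0"
        by (rule continuous_on_subset[OF holomorphic_on_imp_continuous_on[OF f0(2)]]) (use f0(1) in auto)
      then have "bounded (f0 ` cball 0 (\<delta>0 / 2))" using compact_cball compact_continuous_image compact_imp_bounded by blast
      then obtain B where "\<forall>w\<in>f0 ` cball 0 (\<delta>0 / 2). norm w \<le> B" unfolding bounded_iff ..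
      then have B: "norm (f0 w) \<le> B" if "norm w \<le> \<delta>0 / 2" for w using that by simp
      obtain r2 where r2: "r2 > 0" "\<And>z. z \<in> D \<Longrightarrow> norm z \<le> r2" using compact_imp_bounded[OF D(1)] by (metis bounded_pos)
      obtain k1 where k1: "r2 / (\<delta>0 / 2) < norm \<omega> ^ k1" using \<omega> real_arch_pow by blast
      have "norm (f0 (\<omega> powi (- k) * z)) \<le> B" if z: "z \<in> D" and k: "int k1 \<le> k" for z k
      proof (rule B)
        have "norm \<omega> powi (- k) \<le> norm \<omega> powi (- int k1)" using \<omega> k by (intro power_int_increasing) auto
        then have "norm (\<omega> powi (- k) * z) \<le> norm \<omega> powi (- int k1) * r2"
          unfolding norm_mult norm_power_int using r2(2)[OF z] by (intro mult_mono) auto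
        also have "\<dots> \<le> \<delta>0 / 2" using k1 f0(1) \<omega>0 by (simp add: power_int_minus field_simps)
        finally show "norm (\<omega> powi (- k) * z) \<le> \<delta>0 / 2" .
      qed
      then show "\<exists>B k0. \<forall>z\<in>D. \<forall>k\<ge>k0. norm (f0 (\<omega> powi (- k) * z)) \<le> B" by blast
    qed (use r f0 in auto)
  next
    case (step t)
    then have t: "t \<in> {1..r}" "Suc t \<in> {1..r}" by auto
    obtain F where F: "stage t F" using step by auto
    note U = use_stage[OF F t(1)]
    obtain C M where CM: "0 \<le> C" "1 \<le> M" "\<And>k. norm (F (\<omega> powi k * lam)) \<le> gauss_growth \<omega> (N t) C M k" using U(2) by blast
    have gS: "g (Suc t - 1) = lap \<omega> (N t) lam (\<lambda>k. F (\<omega> powi k * lam))"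
      using iterated_laplace_step[of t lq \<kappa> K lam f0] t U(4) by (simp add: g_def)
    have eq: "qop_apply \<omega> L (\<sigma> (Suc t) + int (N t)) S c F (\<omega> powi k * lam) = qop_rhs \<omega> (\<sigma> (Suc t) + int (N t)) a (\<omega> powi k * lam)" for k
      using F lamk[of k] \<sigma>[OF t(1)] by (simp add: stage_def)
    from lap_solves_near_0[OF \<omega>(1) N(1)[OF t(1)] lam(1) S CM(2,1,3) eq, folded gS]
    obtain \<delta> where \<delta>: "\<delta> > 0" "g (Suc t - 1) meromorphic_on (ball 0 \<delta> - {0})"
      and \<delta>3: "\<forall>z. z \<noteq> 0 \<longrightarrow> norm z < \<delta> \<longrightarrow> (\<forall>k::int. z \<noteq> - (\<omega> powi k * lam)) \<longrightarrow>
         g (Suc t - 1) analytic_on {z} \<and> qop_apply \<omega> L (\<sigma> (Suc t)) S c (g (Suc t - 1)) z = qop_rhs \<omega> (\<sigma> (Suc t)) a z"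
      by (elim exE conjE)
    show ?case
    proof (rule make_stage[OF t(2) \<delta>(1,2)])
      show "g (Suc t - 1) analytic_on {z} \<and> qop_apply \<omega> L (\<sigma> (Suc t)) S c (g (Suc t - 1)) z = qop_rhs \<omega> (\<sigma> (Suc t)) a z"
        if "z \<noteq> 0" "norm z < \<delta>" "z \<notin> ?X" for z
        by (rule \<delta>3[rule_format]) (use that not_on_pole_spiral[OF R(3)] in auto)
      show "\<exists>B k0. \<forall>z\<in>D. \<forall>k\<ge>k0. norm (g (Suc t - 1) (\<omega> powi (- k) * z)) \<le> B"
        if D: "compact D" "0 \<notin> D" "D \<inter> ?X = {}" for D
        unfolding gS by (rule lap_bounded[OF \<omega>(1) N(1)[OF t(1)] lam(1) CM(2,1,3) D(1,2)])
          (use D(3) not_on_pole_spiral[OF R(3)] in blast)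
    qed
  qed
  show "g (t - 1) \<in> H_space lq (\<kappa> t) K lam" if t: "t \<in> {1..r}" for t
    using st[of t] use_stage(5) t by auto
  show "q_laplace_converges lq (\<kappa> t) K lam (g (t - 1))" if t: "t \<in> {1..r}" for t
  proof -
    obtain F where F: "stage t F" using st t by auto
    note U = use_stage[OF F t]
    obtain C M where CM: "0 \<le> C" "1 \<le> M" "\<And>k. norm (F (\<omega> powi k * lam)) \<le> gauss_growth \<omega> (N t) C M k" using U(2) by blast
    have eq: "qop_apply \<omega> L (\<sigma> (t + 1) + int (N t)) S c F (\<omega> powi k * lam) = qop_rhs \<omega> (\<sigma> (t + 1) + int (N t)) a (\<omega> powi k * lam)" for k
      using F lamk[of k] \<sigma>[OF t] by (simp add: stage_def)
    obtain \<delta> where "\<delta> > 0" "\<And>z. z \<noteq> 0 \<Longrightarrow> norm z < \<delta> \<Longrightarrow> lap_term \<omega> (N t) lam (\<lambda>k. F (\<omega> powi k * lam)) z summable_on UNIV"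
    proof -
      from lap_solves_near_0[OF \<omega>(1) N(1)[OF t] lam(1) S CM(2,1,3) eq] obtain \<delta> where
        "\<delta> > 0" "\<forall>z. z \<noteq> 0 \<longrightarrow> norm z < \<delta> \<longrightarrow> lap_term \<omega> (N t) lam (\<lambda>k. F (\<omega> powi k * lam)) z summable_on UNIV" by (elim exE conjE)
      then show ?thesis using that by simp
    qed
    then show ?thesis by (rule q_laplace_convergesI[OF U(3)])
  qed
  obtain F where F: "stage r F" using st r by auto
  have rr: "r \<in> {1..r}" using r by simp
  show "\<exists>F. \<exists>\<delta>>0. F meromorphic_on (- {0}) \<and> (\<forall>z. z \<noteq> 0 \<longrightarrow> norm z < \<delta> \<longrightarrow> F z = g (r - 1) z) \<and>
       (\<forall>z. z \<noteq> 0 \<longrightarrow> z \<notin> spirals \<omega> R \<longrightarrow> F analytic_on {z} \<and> qop_apply \<omega> L (\<sigma> r) S c F z = qop_rhs \<omega> (\<sigma> r) a z) \<and>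
       H_continuation lq (\<kappa> r) K lam (g (r - 1)) F \<and>
       (\<exists>C M. 0 \<le> C \<and> 1 \<le> M \<and> (\<forall>k. norm (F (\<omega> powi k * lam)) \<le> gauss_growth \<omega> (N r) C M k))"
  proof -
    from F[unfolded stage_def] obtain \<delta> where \<delta>: "\<delta> > 0" "\<forall>z. z \<noteq> 0 \<longrightarrow> norm z < \<delta> \<longrightarrow> F z = g (r - 1) z"
      and 1: "F meromorphic_on (- {0})" 
        "\<forall>z. z \<noteq> 0 \<longrightarrow> z \<notin> spirals \<omega> R \<longrightarrow> F analytic_on {z} \<and> qop_apply \<omega> L (\<sigma> r) S c F z = qop_rhs \<omega> (\<sigma> r) a z"
      by (elim exE conjE)
    show ?thesis
      by (rule exI[of _ F], rule exI[of _ \<delta>]) (rule conjI \<delta> 1 use_stage(1,2)[OF F rr])+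
  qed
qed

section \<open>Slopes, levels and classes of spirals\<close>

text \<open>A telescoping sum, which identifies the levels with the reciprocals of the slopes.\<close>

lemma sum_inverse_levels:
  fixes \<mu> \<kappa> :: "nat \<Rightarrow> real"
  assumes "\<And>i. i \<in> {1..r} \<Longrightarrow> inverse (\<kappa> i) = inverse (\<mu> i) - (if i = r then 0 else inverse (\<mu> (i + 1)))"
    and "t \<le> r" "t \<ge> 1"
  shows "(\<Sum>u=t..r. inverse (\<kappa> u)) = inverse (\<mu> t)"
  using assms(2,3)
proof (induction t rule: inc_induct)
  case base then show ?case using assms(1)[of r] by simp
next
  case (step t)
  have "(\<Sum>u=t..r. inverse (\<kappa> u)) = inverse (\<kappa> t) + (\<Sum>u=Suc t..r. inverse (\<kappa> u))"
    using step by (intro sum.atLeast_Suc_atMost) simp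
  also have "\<dots> = inverse (\<mu> t)" using step assms(1)[of t] by simp
  finally show ?case .
qed

lemma common_denominator:
  fixes x :: "'a \<Rightarrow> real"
  assumes "finite I" "\<And>i. i \<in> I \<Longrightarrow> x i \<in> \<rat> \<and> x i > 0"
  shows "\<exists>k>0::nat. \<forall>i\<in>I. of_nat k / x i \<in> \<nat> - {0}"
  using assms
proof (induction I rule: finite_induct)
  case empty show ?case by (auto intro: exI[of _ 1])
next
  case (insert i I)
  then obtain k :: nat where k: "k > 0" "\<And>j. j \<in> I \<Longrightarrow> of_nat k / x j \<in> \<nat> - {0}" by auto
  have "x i \<in> \<rat>" "x i > 0" using insert.prems by auto
  then have "\<bar>x i\<bar> = x i" "x i \<noteq> 0" by simp_all
  with Rats_abs_nat_div_natE[OF \<open>x i \<in> \<rat>\<close>] obtain a b :: nat where ab: "b \<noteq> 0" "x i = real a / real b" by metis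
  with \<open>x i > 0\<close> have a: "a > 0" by (cases a) auto
  have "of_nat (k * a) / x j \<in> \<nat> - {0}" if "j \<in> insert i I" for j
  proof (cases "j = i")
    case True
    have "of_nat (k * a) / x i = real (k * b)" unfolding ab(2) using ab(1) a by (simp add: field_simps)
    then show ?thesis using True k ab by (simp del: of_nat_mult)
  next
    case False
    then have "of_nat k / x j \<in> \<nat> - {0}" using k that by simp
    then obtain l where l: "of_nat k / x j = real l" "real l \<noteq> 0" by (metis DiffE Nats_cases singletonI)
    have "of_nat (k * a) / x j = (of_nat k / x j) * real a" by simp
    then have "of_nat (k * a) / x j = real (l * a)" unfolding l by simp
    then show ?thesis using l(2) a by (simp del: of_nat_mult)
  qed
  then show ?case using k(1) a by (intro exI[of _ "k * a"]) simp
qed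

text \<open>The remainder of \<open>K\<close> modulo the least denominator would be a smaller one.\<close>

lemma least_denominator_dvd:
  fixes x :: real
  assumes n: "n = (LEAST k::nat. k > 0 \<and> of_nat k / x \<in> \<nat> - {0})"
    and K: "K > 0" "of_nat K / x \<in> \<nat> - {0}" and x: "x > 0"
  shows "n > 0" "of_nat n / x \<in> \<nat> - {0}" "n dvd K"
proof -
  let ?P = "\<lambda>k::nat. k > 0 \<and> of_nat k / x \<in> \<nat> - {0}"
  have Pn: "?P n" unfolding n using K by (intro LeastI[of ?P K]) simp
  then show n0: "n > 0" and "of_nat n / x \<in> \<nat> - {0}" by simp_all
  have "K mod n = 0"
  proof (rule ccontr)
    assume pos: "K mod n \<noteq> 0"
    obtain u v where uv: "of_nat K / x = real u" "of_nat n / x = real v" using K(2) Pn by (auto elim!: Nats_cases)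
    have "real K = real (K div n) * real n + real (K mod n)"
      unfolding of_nat_mult[symmetric] of_nat_add[symmetric] by simp
    then have "of_nat (K mod n) / x = real u - real (K div n) * real v"
      unfolding uv[symmetric] using x by (simp add: field_simps)
    also have "\<dots> = of_int (int u - int (K div n) * int v)" by simp
    finally have e: "of_nat (K mod n) / x = real_of_int (int u - int (K div n) * int v)" .
    moreover have "of_nat (K mod n) / x > 0" using pos x by simp
    ultimately have i: "int u - int (K div n) * int v > 0" by linarith
    define l where "l = nat (int u - int (K div n) * int v)"
    have l: "int l = int u - int (K div n) * int v" "l > 0" using i by (simp_all add: l_def)
    have "of_nat (K mod n) / x = real l" unfolding e l(1)[symmetric] by simp
    then have "of_nat (K mod n) / x \<in> \<nat> - {0}" using l(2) by simp
    then have "?P (K mod n)" using pos by simp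
    then have "n \<le> K mod n" unfolding n by (rule Least_le)
    moreover have "K mod n < n" using n0 by simp
    ultimately show False by simp
  qed
  then show "n dvd K" by (simp add: mod_eq_0_iff_dvd)
qed

lemma op_support_nonempty:
  assumes "s \<in> slopes m A" "s > 0"
  shows "op_support m A \<noteq> {}"
proof
  assume "op_support m A = {}"
  then have "A i = 0" if "i \<le> m" for i using that by (auto simp: op_support_def poly_eq_iff)
  then have "newton_points m A = {}" by (auto simp: newton_points_def)
  then have "newton_vertices m A = {}"
    using extreme_newton_points[of _ m A] by (auto simp: newton_vertices_extreme)
  then show False using assms by (simp add: slopes_def)
qed

lemma qop_exp_slope:
  assumes "real K * s = real_of_int \<sigma>"
  shows "real_of_int (qop_exp (int K) \<sigma> (i, j)) = real K * (real i - s * real j)"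
  using assms by (simp add: qop_exp_def algebra_simps)

lemma qop_top_slope:
  assumes K: "K > 0" and s: "real K * s = real_of_int \<sigma>" and S: "finite S" and v: "(i0, j0) \<in> qop_top (int K) \<sigma> S"
    and ij: "(i, j) \<in> S"
  shows "real i - s * real j \<le> real i0 - s * real j0"
    "real i - s * real j = real i0 - s * real j0 \<longleftrightarrow> (i, j) \<in> qop_top (int K) \<sigma> S"
proof -
  have v': "qop_order (int K) \<sigma> S = qop_exp (int K) \<sigma> (i0, j0)" using v by (simp add: qop_top_def)
  have "real_of_int (qop_exp (int K) \<sigma> (i, j)) \<le> real_of_int (qop_exp (int K) \<sigma> (i0, j0))"
    using qop_exp_le[OF S ij, of "int K" \<sigma>] v' by simp
  then show "real i - s * real j \<le> real i0 - s * real j0" unfolding qop_exp_slope[OF s] using K by simp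
  have "(i, j) \<in> qop_top (int K) \<sigma> S \<longleftrightarrow> real_of_int (qop_exp (int K) \<sigma> (i, j)) = real_of_int (qop_exp (int K) \<sigma> (i0, j0))"
    using ij v' by (auto simp: qop_top_def)
  then show "real i - s * real j = real i0 - s * real j0 \<longleftrightarrow> (i, j) \<in> qop_top (int K) \<sigma> S"
    unfolding qop_exp_slope[OF s] using K by simp
qed

text \<open>The degree of the leading polynomial at the higher level is the largest \<open>j\<close> among the monomials with the
  largest exponent. In the absence of slopes in between, this monomial still has the largest exponent at
  the lower level. Expressed in terms of the exponents of the higher level, that is the inequality needed
  for the growth estimate.\<close>

lemma growth_slope_condition:
  assumes \<omega>: "\<omega> \<noteq> 0" and K: "K > 0" and ne: "op_support m A \<noteq> {}"
    and s: "0 \<le> s0" "s0 < s1" "real K * s0 = real_of_int \<sigma>0" "real K * s1 = real_of_int \<sigma>1"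
    and gap: "\<And>s. s0 < s \<Longrightarrow> s < s1 \<Longrightarrow> 1 / s \<notin> positive_slopes m A"
    and ij: "ij \<in> op_support m A"
  shows "(int (snd ij) - int (degree (qop_lead \<omega> (int K) \<sigma>1 (op_support m A) (op_coeff A)))) * (\<sigma>1 - \<sigma>0)
    \<le> qop_order (int K) \<sigma>1 (op_support m A) - qop_exp (int K) \<sigma>1 ij"
proof -
  let ?S = "op_support m A" and ?l = "qop_lead \<omega> (int K) \<sigma>1 (op_support m A) (op_coeff A)"
  note fin = finite_op_support[of m A]
  have fT: "finite (qop_top (int K) \<sigma>1 ?S)" using fin by (simp add: qop_top_def)
  have nT: "qop_top (int K) \<sigma>1 ?S \<noteq> {}" by (rule qop_top_nonempty[OF fin ne])
  have "Max (snd ` qop_top (int K) \<sigma>1 ?S) \<in> snd ` qop_top (int K) \<sigma>1 ?S" using fT nT by (intro Max_in) auto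
  then obtain i0 j0 where v: "(i0, j0) \<in> qop_top (int K) \<sigma>1 ?S" and j0: "j0 = Max (snd ` qop_top (int K) \<sigma>1 ?S)" by auto
  have up: "j \<le> j0" if "(i, j) \<in> qop_top (int K) \<sigma>1 ?S" for i j
    unfolding j0 by (rule Max_ge) (use fT that in force)+
  have vS: "(i0, j0) \<in> ?S" using v by (simp add: qop_top_def)
  have "coeff ?l j0 \<noteq> 0"
    using qop_lead_coeff[OF fin _ v, of \<omega> "op_coeff A"] K vS \<omega>
    by (auto simp: op_support_def op_coeff_def qop_weight_def)
  moreover have "degree ?l \<le> j0"
    unfolding qop_lead_def by (rule degree_sum_le[OF fT]) (use up in \<open>auto intro!: order_trans[OF degree_monom_le]\<close>)
  ultimately have deg: "degree ?l = j0" by (simp add: le_antisym le_degree)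
  obtain i j where [simp]: "ij = (i, j)" by (cases ij)
  have "real i - s0 * real j \<le> real i0 - s0 * real j0"
  proof (rule steepest_vertex_persists[OF fin vS s(2)])
    show "real i' - s1 * real j' \<le> real i0 - s1 * real j0" if "(i', j') \<in> ?S" for i' j'
      by (rule qop_top_slope(1)[OF K s(4) fin v that])
    show "j' \<le> j0" if "(i', j') \<in> ?S" "real i' - s1 * real j' = real i0 - s1 * real j0" for i' j'
      using qop_top_slope(2)[OF K s(4) fin v that(1)] that up by blast
    show False if t: "s0 < s" "s < s1" "(i', j') \<in> ?S" "j0 < j'" "real i' - s * real j' = real i0 - s * real j0"
      "\<forall>i' j'. (i', j') \<in> ?S \<longrightarrow> real i' - s * real j' \<le> real i0 - s * real j0" for s i' j'
    proof -
      have "1 / s \<in> positive_slopes m A"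
        by (rule tie_imp_slope[OF _ _ vS refl t(3,5,4)]) (use t s in auto)
      then show False using gap t by blast
    qed
    show "(i, j) \<in> ?S" using ij by simp
  qed
  then have "real K * (real i - s0 * real j) \<le> real K * (real i0 - s0 * real j0)" using K by simp
  then have "qop_exp (int K) \<sigma>0 (i, j) \<le> qop_exp (int K) \<sigma>0 (i0, j0)"
    unfolding qop_exp_slope[OF s(3), symmetric] by simp
  moreover have "qop_order (int K) \<sigma>1 ?S = qop_exp (int K) \<sigma>1 (i0, j0)" using v by (simp add: qop_top_def)
  ultimately show ?thesis unfolding deg by (simp add: qop_exp_def algebra_simps)
qed

text \<open>In the absence of smaller positive slopes, the lowest maximiser at the top level is the lowest monomial
  altogether.\<close>

lemma lowest_vertex_is_top:
  assumes K: "K > 0" and ne: "op_support m A \<noteq> {}"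
    and s: "0 < s1" "real K * s1 = real_of_int \<sigma>1"
    and gap: "\<And>s. s1 < s \<Longrightarrow> 1 / s \<notin> positive_slopes m A"
  obtains v where "v \<in> qop_top (int K) \<sigma>1 (op_support m A)" "\<And>ij. ij \<in> op_support m A \<Longrightarrow> snd v \<le> snd ij"
proof -
  let ?S = "op_support m A"
  note fin = finite_op_support[of m A]
  have fT: "finite (qop_top (int K) \<sigma>1 ?S)" using fin by (simp add: qop_top_def)
  have nT: "qop_top (int K) \<sigma>1 ?S \<noteq> {}" by (rule qop_top_nonempty[OF fin ne])
  have "Min (snd ` qop_top (int K) \<sigma>1 ?S) \<in> snd ` qop_top (int K) \<sigma>1 ?S" using fT nT by (intro Min_in) auto
  then obtain i0 j0 where v: "(i0, j0) \<in> qop_top (int K) \<sigma>1 ?S" and j0: "j0 = Min (snd ` qop_top (int K) \<sigma>1 ?S)" by auto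
  have lo: "j0 \<le> j" if "(i, j) \<in> qop_top (int K) \<sigma>1 ?S" for i j
    unfolding j0 by (rule Min_le) (use fT that in force)+
  have vS: "(i0, j0) \<in> ?S" using v by (simp add: qop_top_def)
  have "j0 \<le> j" if ij: "(i, j) \<in> ?S" for i j
  proof (rule lowest_vertex_minimal[OF fin vS _ _ _ ij])
    show "real i' - s1 * real j' \<le> real i0 - s1 * real j0" if "(i', j') \<in> ?S" for i' j'
      by (rule qop_top_slope(1)[OF K s(2) fin v that])
    show "j0 \<le> j'" if "(i', j') \<in> ?S" "real i' - s1 * real j' = real i0 - s1 * real j0" for i' j'
      using qop_top_slope(2)[OF K s(2) fin v that(1)] that lo by blast
    show False if t: "s1 < s" "(i', j') \<in> ?S" "j' < j0" "real i' - s * real j' = real i0 - s * real j0"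
      "\<forall>i' j'. (i', j') \<in> ?S \<longrightarrow> real i' - s * real j' \<le> real i0 - s * real j0" for s i' j'
    proof -
      have "1 / s \<in> positive_slopes m A"
        by (rule tie_imp_slope[OF _ _ t(2,4) vS refl t(3)]) (use t s in auto)
      then show False using gap t by blast
    qed
  qed
  then show ?thesis by (intro that[OF v]) auto
qed

text \<open>A spiral of \<open>\<omega>\<close> splits into \<open>c\<close> spirals of \<open>\<omega>\<^sup>c\<close>; so finitely many classes of the coarser kind cover finitely
  many spirals.\<close>

lemma spiral_classes:
  assumes \<omega>: "\<omega> \<noteq> 0" "\<omega> ^ c = qpow lq (1 / of_nat n)" and c: "c > 0" and R: "finite R" "0 \<notin> R"
  obtains \<Sigma> where "\<Sigma> \<subseteq> (- {0}) // qcong lq n" "finite \<Sigma>"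
    "\<And>\<Lambda> lam. \<Lambda> \<in> (- {0}) // qcong lq n - \<Sigma> \<Longrightarrow> lam \<in> \<Lambda> \<Longrightarrow> lam \<noteq> 0 \<and> lam \<notin> spirals \<omega> R"
proof
  define \<Sigma> where "\<Sigma> = (\<lambda>(d, \<rho>). qcong lq n `` {\<omega> ^ d * \<rho>}) ` ({..<c} \<times> R)"
  show "finite \<Sigma>" using R by (simp add: \<Sigma>_def)
  show "\<Sigma> \<subseteq> (- {0}) // qcong lq n" unfolding \<Sigma>_def using \<omega> R by (auto intro!: quotientI)
  fix \<Lambda> lam assume L: "\<Lambda> \<in> (- {0}) // qcong lq n - \<Sigma>" and lam: "lam \<in> \<Lambda>"
  have L': "\<Lambda> \<in> (- {0}) // qcong lq n" using L by simp
  have lam0: "lam \<in> - {0}" by (rule subsetD[OF in_quotient_imp_subset[OF equiv_qcong L'] lam])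
  have cl: "\<Lambda> = qcong lq n `` {lam}" 
  proof -
    obtain x where x: "x \<in> - {0}" "\<Lambda> = qcong lq n `` {x}" using L' by (rule quotientE)
    then have "(x, lam) \<in> qcong lq n" using lam by simp
    then show ?thesis unfolding x(2) by (rule equiv_class_eq[OF equiv_qcong])
  qed
  have "lam \<notin> spirals \<omega> R"
  proof
    assume "lam \<in> spirals \<omega> R"
    then obtain k \<rho> where k: "\<rho> \<in> R" "lam = \<omega> powi k * \<rho>" by (auto simp: spirals_def)
    define d where "d = nat (k mod int c)"
    have d: "d < c" "int d = k mod int c" using c by (simp_all add: d_def nat_less_iff)
    have "\<omega> powi k = \<omega> powi (int c * (k div int c) + int d)" unfolding d by simp
    also have "\<dots> = (\<omega> ^ c) powi (k div int c) * \<omega> ^ d" by (simp add: powi_add[OF \<omega>(1)] power_int_mult)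
    finally have "lam = qpow lq (of_int (k div int c) / of_nat n) * (\<omega> ^ d * \<rho>)"
      unfolding qpow_powi k(2) \<omega>(2) by simp
    moreover have "\<omega> ^ d * \<rho> \<noteq> 0" using \<omega> R k by auto
    ultimately have "(\<omega> ^ d * \<rho>, lam) \<in> qcong lq n" unfolding qcong_def by blast
    then have "qcong lq n `` {\<omega> ^ d * \<rho>} = \<Lambda>" unfolding cl by (rule equiv_class_eq[OF equiv_qcong])
    then have "\<Lambda> \<in> \<Sigma>" unfolding \<Sigma>_def using d(1) k(1) by (intro image_eqI[of _ _ "(d, \<rho>)"]) auto
    then show False using L by simp
  qed
  then show "lam \<noteq> 0 \<and> lam \<notin> spirals \<omega> R" using lam0 by simp
qed

section \<open>The last Laplace transformation and the theorem\<close>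

text \<open>At level \<open>0\<close> there is no further growth to control; the equation is that of the original operator, and it only
  serves to extend the transform to a meromorphic function.\<close>

lemma last_laplace:
  assumes \<omega>: "norm \<omega> > 1" "\<omega> = qpow lq (1 / of_nat K)" "\<omega> ^ c = qpow lq (1 / of_nat n)"
    and K: "K = c * n" "c > 0" "n > 0" and \<nu>: "\<nu> > 0" "real n / \<kappa> = real \<nu>"
    and S: "finite S" and R: "finite R" "0 \<notin> R" "- lam \<in> R"
    and roots: "\<And>z. z \<noteq> 0 \<Longrightarrow> poly (qop_lead \<omega> (int K) 0 S cf) z = 0 \<Longrightarrow> z \<in> R"
    and lam: "lam \<noteq> 0" "lam \<notin> spirals \<omega> R"
    and Fm: "F meromorphic_on (- {0})" and \<delta>: "\<delta> > 0" "\<And>z. z \<noteq> 0 \<Longrightarrow> norm z < \<delta> \<Longrightarrow> F z = f z"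
    and Fa: "\<And>z. z \<noteq> 0 \<Longrightarrow> z \<notin> spirals \<omega> R \<Longrightarrow>
      F analytic_on {z} \<and> qop_apply \<omega> (int K) (int (c * \<nu>)) S cf F z = qop_rhs \<omega> (int (c * \<nu>)) a z"
    and H: "H_continuation lq \<kappa> K lam f F"
    and CM: "0 \<le> C" "1 \<le> M" "\<And>k. norm (F (\<omega> powi k * lam)) \<le> gauss_growth \<omega> (c * \<nu>) C M k"
  shows "q_laplace_converges lq \<kappa> n lam f"
    "\<exists>G. G meromorphic_on (- {0}) \<and> extends_germ0 (- {0}) G (q_laplace lq \<kappa> n lam f) \<and>
      (\<forall>z. z \<noteq> 0 \<longrightarrow> z \<notin> spirals \<omega> R \<longrightarrow> qop_apply \<omega> (int K) 0 S cf G z = qop_rhs \<omega> 0 a z)"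
proof -
  have \<omega>0: "\<omega> \<noteq> 0" using \<omega> by auto
  define \<eta> where "\<eta> = \<omega> ^ c"
  have \<eta>: "norm \<eta> > 1" "\<eta> = qpow lq (1 / of_nat n)"
    using one_less_power[OF \<omega>(1) K(2)] \<omega>(3) unfolding \<eta>_def norm_power by (simp_all only: norm_power)
  have pw: "\<eta> powi k = \<omega> powi (int c * k)" for k unfolding \<eta>_def by (simp only: power_int_mult power_int_of_nat)
  have lamk: "\<omega> powi k * lam \<noteq> 0" "\<omega> powi k * lam \<notin> spirals \<omega> R" for k
    using lam \<omega>0 spirals_shift[OF \<omega>0] by auto
  have Fk: "F analytic_on {\<eta> powi k * lam}" for k unfolding pw using Fa[OF lamk] by blast
  have eq: "qop_apply \<eta> (int n) (0 + int \<nu>) S cf F (\<eta> powi k * lam) = qop_rhs \<eta> (0 + int \<nu>) a (\<eta> powi k * lam)" for k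
    unfolding pw unfolding \<eta>_def qop_rescale using Fa[OF lamk, of "int c * k"] by (simp add: K)
  have gr: "norm (F (\<eta> powi k * lam)) \<le> gauss_growth \<eta> \<nu> C (M ^ c) k" for k
    using CM(3)[of "int c * k"] unfolding gauss_growth_rescale[OF K(2) \<nu>(1)] pw unfolding \<eta>_def .
  have M: "1 \<le> M ^ c" using CM by simp
  define g where "g = lap \<eta> \<nu> lam (\<lambda>k. F (\<eta> powi k * lam))"
  note Q = q_laplace_eq_lap[OF \<eta> K(3) \<nu> lam(1) Fm Fk \<delta> H_continuation_coarser[OF H K(1,3,2)]]
  from lap_solves_near_0[OF \<eta>(1) \<nu>(1) lam(1) S M CM(1) gr eq, folded g_def]
  obtain \<delta>1 where d1: "\<delta>1 > 0" "g meromorphic_on (ball 0 \<delta>1 - {0})"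
    "\<forall>z. z \<noteq> 0 \<longrightarrow> norm z < \<delta>1 \<longrightarrow> lap_term \<eta> \<nu> lam (\<lambda>k. F (\<eta> powi k * lam)) z summable_on UNIV"
    and d1': "\<forall>z. z \<noteq> 0 \<longrightarrow> norm z < \<delta>1 \<longrightarrow> (\<forall>k::int. z \<noteq> - (\<eta> powi k * lam)) \<longrightarrow>
       g analytic_on {z} \<and> qop_apply \<eta> (int n) 0 S cf g z = qop_rhs \<eta> 0 a z" by (elim exE conjE)
  show "q_laplace_converges lq \<kappa> n lam f"
    by (rule q_laplace_convergesI[OF Q(1) d1(1)]) (assumption | rule d1(3)[rule_format])+
  have loc: "g analytic_on {z} \<and> qop_apply \<omega> (int K) 0 S cf g z = qop_rhs \<omega> 0 a z"
    if z: "z \<noteq> 0" "norm z < \<delta>1" "z \<notin> spirals \<omega> R" for z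
  proof -
    have "\<forall>k::int. z \<noteq> - (\<eta> powi k * lam)" unfolding pw using not_on_pole_spiral[OF R(3) z(3)] by blast
    with d1' z have "g analytic_on {z} \<and> qop_apply \<eta> (int n) 0 S cf g z = qop_rhs \<eta> 0 a z" by blast
    then show ?thesis unfolding \<eta>_def qop_rescale K(1) by simp
  qed
  have "\<exists>G. \<exists>\<delta>'>0. G meromorphic_on (- {0}) \<and> (\<forall>z. z \<noteq> 0 \<longrightarrow> norm z < \<delta>' \<longrightarrow> G z = g z) \<and>
      (\<forall>z. z \<noteq> 0 \<longrightarrow> z \<notin> spirals \<omega> R \<longrightarrow> G analytic_on {z} \<and> qop_apply \<omega> (int K) 0 S cf G z = qop_rhs \<omega> 0 a z)"
    by (rule qop_extend[OF \<omega>(1) S R(1,2) roots d1(1,2)]) (use loc in blast)+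
  then obtain G \<delta>2 where G: "\<delta>2 > 0" "G meromorphic_on (- {0})" "\<forall>z. z \<noteq> 0 \<longrightarrow> norm z < \<delta>2 \<longrightarrow> G z = g z"
    "\<forall>z. z \<noteq> 0 \<longrightarrow> z \<notin> spirals \<omega> R \<longrightarrow> G analytic_on {z} \<and> qop_apply \<omega> (int K) 0 S cf G z = qop_rhs \<omega> 0 a z"
    by (elim exE conjE)
  have "extends_germ0 (- {0}) G (q_laplace lq \<kappa> n lam f)"
    unfolding extends_germ0_def
  proof (intro exI[of _ \<delta>2] conjI)
    have "open (- {0} \<inter> (ball 0 \<delta>2 - {0}) :: complex set)" by (intro open_Int open_delete) auto
    from eventually_in_cosparse[OF order_refl this]
    show "\<forall>\<^sub>\<approx>z\<in>- {0} \<inter> (ball 0 \<delta>2 - {0}). G z = q_laplace lq \<kappa> n lam f z"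
      by (rule eventually_mono) (use G(3) in \<open>auto simp: Q(2) g_def\<close>)
  qed (rule G(1))
  then show "\<exists>G. G meromorphic_on (- {0}) \<and> extends_germ0 (- {0}) G (q_laplace lq \<kappa> n lam f) \<and>
      (\<forall>z. z \<noteq> 0 \<longrightarrow> z \<notin> spirals \<omega> R \<longrightarrow> qop_apply \<omega> (int K) 0 S cf G z = qop_rhs \<omega> 0 a z)"
    using G(2,4) by blast
qed


theorem theorem1p10:
  fixes q lq :: complex and h :: "complex fps" and m r K n :: nat
    and A :: "nat \<Rightarrow> complex poly" and a :: "complex poly"
    and \<mu> \<kappa> :: "nat \<Rightarrow> real"
  assumes "norm q > 1" and "exp lq = q"
    and "h \<noteq> 0" and "solves_qdiff_equation q h"
    and "vector_space.dim ratfun_scale (qshift_space q h) = m + 1"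
    and "Gcd (insert a (A ` {..m})) = 1"
    and "qop_fps q m A h = fps_of_poly a"
    and "\<exists>s\<in>slopes m A. s > 0"
    and "strict_mono_on {1..r} \<mu>" and "\<mu> ` {1..r} = positive_slopes m A"
    and "\<And>i. i \<in> {1..r} \<Longrightarrow>
           inverse (\<kappa> i) = inverse (\<mu> i) - (if i = r then 0 else inverse (\<mu> (i + 1)))"
    and "K = (LEAST k. k > 0 \<and> (\<forall>i\<in>{1..r}. of_nat k / \<kappa> i \<in> \<nat> - {0}))"
    and "n = (LEAST k. k > 0 \<and> of_nat k / \<kappa> r \<in> \<nat> - {0})"
  shows "\<exists>\<Sigma> \<subseteq> (- {0}) // qcong lq n. finite \<Sigma> \<and>
    (\<forall>\<Lambda> \<in> (- {0}) // qcong lq n - \<Sigma>. \<forall>lam\<in>\<Lambda>.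
      (let B = iterated_borel lq \<kappa> r h;
           g = (\<lambda>i. iterated_laplace lq \<kappa> K lam i (eval_fps B));
           S = q_laplace lq (\<kappa> r) n lam (g (r - 1))
       in fps_conv_radius B > 0 \<and>
          eval_fps B \<in> H_space lq (\<kappa> 1) K lam \<and>
          (\<forall>i\<in>{1..r - 1}. q_laplace_converges lq (\<kappa> i) K lam (g (i - 1)) \<and>
             g i \<in> H_space lq (\<kappa> (i + 1)) K lam) \<and>
          q_laplace_converges lq (\<kappa> r) n lam (g (r - 1)) \<and>
          (\<exists>G. G meromorphic_on (- {0}) \<and> extends_germ0 (- {0}) G S \<and>
             (\<forall>\<^sub>\<approx>z\<in>- {0}. qop_fun q m A G z = poly a z))))"
proof -
  note mono = assms(9) and slopes = assms(10) and kappa = assms(11)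
  obtain s1 where s1: "s1 \<in> slopes m A" "s1 > 0" using assms(8) by blast
  then have "s1 \<in> positive_slopes m A" by (simp add: positive_slopes_def slope_rational)
  then have r: "r \<ge> 1" unfolding slopes[symmetric] by auto
  have ne: "op_support m A \<noteq> {}" by (rule op_support_nonempty[OF s1])
  note fin = finite_op_support[of m A]
  have mu: "\<mu> t > 0" "\<mu> t \<in> \<rat>" if "t \<in> {1..r}" for t
    using imageI[OF that, of \<mu>] unfolding slopes positive_slopes_def by auto
  have mu_less: "\<mu> t < \<mu> u \<longleftrightarrow> t < u" if "t \<in> {1..r}" "u \<in> {1..r}" for t u
    by (rule strict_mono_on_less[OF mono that])
  have kappa_pos: "\<kappa> t > 0" "\<kappa> t \<in> \<rat>" if t: "t \<in> {1..r}" for t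
  proof -
    have "inverse (\<kappa> t) > 0 \<and> inverse (\<kappa> t) \<in> \<rat>"
    proof (cases "t = r")
      case True then show ?thesis using kappa[OF t] mu[OF t] by simp
    next
      case False
      then have t': "t + 1 \<in> {1..r}" using t by auto
      have "inverse (\<mu> (t + 1)) < inverse (\<mu> t)" using mu_less[OF t t'] mu[OF t] by (intro less_imp_inverse_less) auto
      then show ?thesis using kappa[OF t] False mu[OF t] mu[OF t'] by simp
    qed
    then show "\<kappa> t > 0" "\<kappa> t \<in> \<rat>" using Rats_inverse[of "inverse (\<kappa> t)"] by auto
  qed
  \<comment> \<open>the level \<open>\<sigma> t\<close> of the equation after \<open>t - 1\<close> Laplace transformations, and the step \<open>N t\<close>\<close>
  have "\<exists>k>0::nat. \<forall>i\<in>{1..r}. of_nat k / \<kappa> i \<in> \<nat> - {0}"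
    by (rule common_denominator) (use kappa_pos in auto)
  then have K: "K > 0" "\<And>t. t \<in> {1..r} \<Longrightarrow> of_nat K / \<kappa> t \<in> \<nat> - {0}"
    using LeastI_ex[of "\<lambda>k::nat. k > 0 \<and> (\<forall>i\<in>{1..r}. of_nat k / \<kappa> i \<in> \<nat> - {0})"] unfolding assms(12)[symmetric] by auto
  have rr: "r \<in> {1..r}" "1 \<in> {1..r}" using r by auto
  note n = least_denominator_dvd[OF assms(13) K(1) K(2)[OF rr(1)] kappa_pos(1)[OF rr(1)]]
  obtain c where c: "K = c * n" using n(3) by (auto simp: dvd_def mult.commute)
  then have c0: "c > 0" using K(1) by (cases c) auto
  define s where "s = (\<lambda>t. if t \<in> {1..r} then inverse (\<mu> t) else 0)"
  define N where "N = (\<lambda>t. nat \<lfloor>of_nat K / \<kappa> t\<rfloor>)"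
  define \<sigma> where "\<sigma> = (\<lambda>t. \<Sum>u=t..r. int (N u))"
  have N: "N t > 0" "real K / \<kappa> t = real (N t)" if t: "t \<in> {1..r}" for t
  proof -
    obtain l where "of_nat K / \<kappa> t = real l" "real l \<noteq> 0" using K(2)[OF t] by (metis DiffE Nats_cases singletonI)
    then show "N t > 0" "real K / \<kappa> t = real (N t)" by (simp_all add: N_def)
  qed
  have \<sigma>: "\<sigma> t = \<sigma> (t + 1) + int (N t)" if "t \<in> {1..r}" for t
    using that sum.atLeast_Suc_atMost[of t r "\<lambda>u. int (N u)"] by (simp add: \<sigma>_def)
  have \<sigma>0: "\<sigma> (r + 1) = 0" by (simp add: \<sigma>_def)
  have level: "real K * s t = real_of_int (\<sigma> t)" if t: "t \<in> {1..r + 1}" for t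
  proof (cases "t = r + 1")
    case True show ?thesis unfolding True using \<sigma>0 by (simp add: s_def)
  next
    case False
    then have t': "t \<in> {1..r}" using t by auto
    have "real_of_int (\<sigma> t) = (\<Sum>u=t..r. real K * inverse (\<kappa> u))"
      unfolding \<sigma>_def of_int_sum by (intro sum.cong refl) (use N(2) t' in \<open>simp add: divide_inverse\<close>)
    also have "\<dots> = real K * inverse (\<mu> t)"
      unfolding sum_distrib_left[symmetric] using sum_inverse_levels[of r \<kappa> \<mu> t, OF kappa] t' by simp
    finally show ?thesis using t' by (simp add: s_def)
  qed
  \<comment> \<open>a slope in between would be a value of \<open>\<mu>\<close> between those at consecutive indices\<close>
  have gap: "1 / x \<notin> positive_slopes m A" if t: "t \<in> {1..r}" and x: "s (t + 1) < x" "x < s t" for t x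
  proof
    assume "1 / x \<in> positive_slopes m A"
    then obtain u where u: "u \<in> {1..r}" "1 / x = \<mu> u" unfolding slopes[symmetric] by auto
    then have xu: "x = inverse (\<mu> u)" by (metis inverse_eq_divide inverse_inverse_eq)
    have "\<mu> t < \<mu> u" using x(2) t mu[OF u(1)] mu[OF t] by (simp add: s_def xu)
    then have "t < u" using mu_less t u by blast
    then have t': "t + 1 \<in> {1..r}" using u t by auto
    have "\<mu> u < \<mu> (t + 1)" using x(1) t' mu[OF u(1)] mu[OF t'] by (simp add: s_def xu)
    then have "u < t + 1" using mu_less t' u by blast
    with \<open>t < u\<close> show False by simp
  qed
  have gap1: "1 / x \<notin> positive_slopes m A" if x: "s 1 < x" for x
  proof
    assume "1 / x \<in> positive_slopes m A"
    then obtain u where u: "u \<in> {1..r}" "1 / x = \<mu> u" unfolding slopes[symmetric] by auto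
    then have xu: "x = inverse (\<mu> u)" by (metis inverse_eq_divide inverse_inverse_eq)
    have "\<mu> u < \<mu> 1" using x rr mu[OF u(1)] mu[OF rr(2)] by (simp add: s_def xu)
    then have "u < 1" using mu_less rr u by blast
    then show False using u by simp
  qed
  have s_less: "0 \<le> s (t + 1)" "s (t + 1) < s t" if t: "t \<in> {1..r}" for t
    using mu[of "t + 1"] mu[OF t] mu_less[of t "t + 1"] t by (auto simp: s_def)

  define \<omega> where "\<omega> = qpow lq (1 / of_nat K)"
  have pow: "\<omega> ^ K = q" "\<omega> ^ c = qpow lq (1 / of_nat n)"
  proof -
    have "\<omega> powi int K = qpow lq 1" "\<omega> powi int c = qpow lq (1 / of_nat n)"
      unfolding \<omega>_def qpow_powi[symmetric] using K(1) n(1) c0 by (simp_all add: c)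
    then show "\<omega> ^ K = q" "\<omega> ^ c = qpow lq (1 / of_nat n)" using assms(2) by (simp_all add: qpow_def)
  qed
  have \<omega>: "norm \<omega> > 1" using assms(1) pow(1) norm_power[of \<omega> K] power_le_one[of "norm \<omega>" K] by (metis norm_ge_zero not_less)
  then have \<omega>0: "\<omega> \<noteq> 0" by auto
  define lead where "lead = (\<lambda>t. qop_lead \<omega> (int K) (\<sigma> t) (op_support m A) (op_coeff A))"
  have lead: "lead t \<noteq> 0" for t
    unfolding lead_def by (rule qop_lead_nonzero[OF \<omega>0 fin ne]) (use K(1) in \<open>auto simp: op_support_def op_coeff_def\<close>)
  \<comment> \<open>the singularities that do not depend on the direction \<open>lam\<close>\<close>
  define R where "R = (\<Union>t\<in>{1..r + 1}. {z. poly (lead t) z = 0}) - {0}"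
  have R: "finite R" "0 \<notin> R" using lead by (auto simp: R_def poly_roots_finite)
  define B where "B = iterated_borel lq \<kappa> r h"
  have B: "fps_nth B l = fps_nth h l * \<omega> powi (- (\<sigma> 1 * int (l choose 2)))" for l
  proof -
    have "(\<Sum>i=1..r. inverse (\<kappa> i)) = s 1"
      using sum_inverse_levels[of r \<kappa> \<mu> 1, OF kappa] r by (simp add: s_def)
    also have "\<dots> = real_of_int (\<sigma> 1) / real K" using level[of 1] K(1) r by (simp add: field_simps)
    finally have e: "- (real (l choose 2) * (\<Sum>i=1..r. inverse (\<kappa> i))) = of_int (- (\<sigma> 1 * int (l choose 2))) / of_nat K"
      by simp
    show ?thesis unfolding B_def iterated_borel_nth e qpow_powi \<omega>_def[symmetric] ..
  qed
  obtain v where v: "v \<in> qop_top (int K) (\<sigma> 1) (op_support m A)" "\<And>ij. ij \<in> op_support m A \<Longrightarrow> snd v \<le> snd ij"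
  proof (rule lowest_vertex_is_top[OF K(1) ne _ level[of 1] gap1])
    show "0 < s 1" using mu[OF rr(2)] rr(2) by (simp add: s_def)
  qed (use r in auto)
  have rad: "fps_conv_radius B > 0" by (rule borel_radius_positive[OF \<omega> pow(1)[symmetric] K(1) B assms(7) v])
  obtain r0 where r0: "r0 > 0" "ereal r0 < fps_conv_radius B" using rad ereal_dense2 by (metis ereal_less(2))
  have "finite (insert 0 (qop_exp (int K) (\<sigma> 1) ` op_support m A))" using fin by simp
  from small_dilates[OF this r0(1) \<omega>0] obtain \<delta>1 where d1: "\<delta>1 > 0"
    "\<And>z e. norm z < \<delta>1 \<Longrightarrow> e \<in> insert 0 (qop_exp (int K) (\<sigma> 1) ` op_support m A) \<Longrightarrow> norm (\<omega> powi e * z) < r0"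
    by blast
  have Bhol: "eval_fps B holomorphic_on ball 0 \<delta>1"
  proof (rule holomorphic_on_eval_fps)
    show "ball 0 \<delta>1 \<subseteq> (eball 0 (fps_conv_radius B) :: complex set)"
    proof
      fix z :: complex assume "z \<in> ball 0 \<delta>1"
      then have "norm z < r0" using d1(2)[of z 0] by simp
      then have "ereal (norm z) < fps_conv_radius B" by (intro less_trans[OF _ r0(2)]) simp
      then show "z \<in> eball 0 (fps_conv_radius B)" by simp
    qed
  qed
  have Beq: "qop_apply \<omega> (int K) (\<sigma> 1) (op_support m A) (op_coeff A) (eval_fps B) z = qop_rhs \<omega> (\<sigma> 1) a z" if "norm z < \<delta>1" for z
  proof (rule borel_sum_equation[OF \<omega>0 pow(1)[symmetric] B assms(7)])
    fix ij assume "ij \<in> op_support m A"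
    then have "norm (\<omega> powi qop_exp (int K) (\<sigma> 1) ij * z) < r0" by (intro d1(2)[OF that]) simp
    then show "ereal (norm (\<omega> powi qop_exp (int K) (\<sigma> 1) ij * z)) < fps_conv_radius B"
      by (intro less_trans[OF _ r0(2)]) simp
  qed

  obtain \<Sigma> where \<Sigma>: "\<Sigma> \<subseteq> (- {0}) // qcong lq n" "finite \<Sigma>"
    "\<And>\<Lambda> lam. \<Lambda> \<in> (- {0}) // qcong lq n - \<Sigma> \<Longrightarrow> lam \<in> \<Lambda> \<Longrightarrow> lam \<noteq> 0 \<and> lam \<notin> spirals \<omega> R"
    by (rule spiral_classes[OF \<omega>0 pow(2) c0 R]) (rule that)
  show ?thesis
    unfolding Let_def B_def[symmetric]
  proof (rule exI[of _ \<Sigma>], intro conjI ballI \<Sigma>(1,2))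
    fix \<Lambda> lam assume "\<Lambda> \<in> (- {0}) // qcong lq n - \<Sigma>" "lam \<in> \<Lambda>"
    with \<Sigma>(3) have lam: "lam \<noteq> 0" "lam \<notin> spirals \<omega> R" by auto
    define R' where "R' = insert (- lam) R"
    have R': "finite R'" "0 \<notin> R'" "- lam \<in> R'" using R lam by (auto simp: R'_def)
    \<comment> \<open>\<open>lam\<close> is not on the spiral of \<open>-lam\<close>, since \<open>\<bar>\<omega>\<^sup>k\<bar> = 1\<close> for \<open>k = 0\<close> only\<close>
    have lam': "lam \<notin> spirals \<omega> R'"
    proof
      assume "lam \<in> spirals \<omega> R'"
      then obtain k \<rho> where k: "lam = \<omega> powi k * \<rho>" "\<rho> \<in> R'" by (auto simp: spirals_def)
      then have "\<rho> = - lam" using lam(2) by (auto simp: R'_def spirals_def)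
      then have k': "\<omega> powi k = - 1" using k(1) lam(1) by (metis mult.commute mult_cancel_left mult_minus_right mult_minus1_right minus_equation_iff)
      then have "norm \<omega> powi k = 1" unfolding norm_power_int[symmetric] by simp
      then have "k = 0" using \<omega> power_int_strict_increasing[of k 0 "norm \<omega>"] power_int_strict_increasing[of 0 k "norm \<omega>"] by (cases k "0::int" rule: linorder_cases) auto
      then show False using k' by simp
    qed
    have roots: "z \<in> R'" if "t \<in> {1..r + 1}" "z \<noteq> 0" "poly (qop_lead \<omega> (int K) (\<sigma> t) (op_support m A) (op_coeff A)) z = 0" for t z
      using that by (auto simp: R'_def R_def lead_def)
    have slope: "(int (snd ij) - int (degree (qop_lead \<omega> (int K) (\<sigma> t) (op_support m A) (op_coeff A)))) * int (N t)
      \<le> qop_order (int K) (\<sigma> t) (op_support m A) - qop_exp (int K) (\<sigma> t) ij" if t: "t \<in> {1..r}" and ij: "ij \<in> op_support m A" for t ij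
    proof -
      have "int (N t) = \<sigma> t - \<sigma> (t + 1)" using \<sigma>[OF t] by simp
      then show ?thesis
        using growth_slope_condition[OF \<omega>0 K(1) ne s_less[OF t] level level gap[OF t] ij] t by simp
    qed
    note chain = resummation_chain[where N = N and \<sigma> = \<sigma> and a = a, OF \<omega> \<omega>_def K(1) r _ _ _ fin _ R' _ _ lam(1) lam' d1(1) Bhol]
    let ?g = "\<lambda>i. iterated_laplace lq \<kappa> K lam i (eval_fps B)"
    have H: "?g (t - 1) \<in> H_space lq (\<kappa> t) K lam" and conv: "q_laplace_converges lq (\<kappa> t) K lam (?g (t - 1))"
      if "t \<in> {1..r}" for t
      by (rule chain(1,2)[OF _ _ _ _ _ _ _ that]; fact N \<sigma> lead[unfolded lead_def] roots slope Beq)+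
    show "fps_conv_radius B > 0" by (rule rad)
    show "eval_fps B \<in> H_space lq (\<kappa> 1) K lam" using H[OF rr(2)] by (simp add: iterated_laplace_def)
    show "q_laplace_converges lq (\<kappa> i) K lam (?g (i - 1))" if "i \<in> {1..r - 1}" for i
      by (rule conv) (use that in auto)
    show "?g i \<in> H_space lq (\<kappa> (i + 1)) K lam" if "i \<in> {1..r - 1}" for i
      using H[of "i + 1"] that by auto
    obtain \<nu> where \<nu>: "real n / \<kappa> r = real \<nu>" "real \<nu> \<noteq> 0" using n(2) by (metis DiffE Nats_cases singletonI)
    have "real (N r) = real c * (real n / \<kappa> r)" using N(2)[OF rr(1)] by (simp add: c)
    then have Nr: "N r = c * \<nu>" unfolding \<nu> of_nat_mult[symmetric] of_nat_eq_iff .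
    have \<sigma>r: "\<sigma> r = int (c * \<nu>)" using \<sigma>[OF rr(1)] \<sigma>0 Nr by simp
    have "\<exists>F. \<exists>\<delta>>0. F meromorphic_on (- {0}) \<and> (\<forall>z. z \<noteq> 0 \<longrightarrow> norm z < \<delta> \<longrightarrow> F z = ?g (r - 1) z) \<and>
       (\<forall>z. z \<noteq> 0 \<longrightarrow> z \<notin> spirals \<omega> R' \<longrightarrow> F analytic_on {z} \<and>
          qop_apply \<omega> (int K) (\<sigma> r) (op_support m A) (op_coeff A) F z = qop_rhs \<omega> (\<sigma> r) a z) \<and>
       H_continuation lq (\<kappa> r) K lam (?g (r - 1)) F \<and>
       (\<exists>C M. 0 \<le> C \<and> 1 \<le> M \<and> (\<forall>k. norm (F (\<omega> powi k * lam)) \<le> gauss_growth \<omega> (N r) C M k))"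
      by (rule chain(3)) (fact N \<sigma> lead[unfolded lead_def] roots slope Beq)+
    then obtain F \<delta> C M where F: "\<delta> > 0" "F meromorphic_on (- {0})" "\<forall>z. z \<noteq> 0 \<longrightarrow> norm z < \<delta> \<longrightarrow> F z = ?g (r - 1) z"
      "\<forall>z. z \<noteq> 0 \<longrightarrow> z \<notin> spirals \<omega> R' \<longrightarrow> F analytic_on {z} \<and> qop_apply \<omega> (int K) (\<sigma> r) (op_support m A) (op_coeff A) F z = qop_rhs \<omega> (\<sigma> r) a z"
      "H_continuation lq (\<kappa> r) K lam (?g (r - 1)) F"
      and CM: "0 \<le> C" "1 \<le> M" "\<forall>k. norm (F (\<omega> powi k * lam)) \<le> gauss_growth \<omega> (N r) C M k"
      by (elim exE conjE)
    have \<nu>0: "\<nu> > 0" using \<nu>(2) by simp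
    have roots0: "z \<in> R'" if "z \<noteq> 0" "poly (qop_lead \<omega> (int K) 0 (op_support m A) (op_coeff A)) z = 0" for z
      using roots[of "r + 1" z] that \<sigma>0 by simp
    note last = last_laplace[OF \<omega> \<omega>_def pow(2) c c0 n(1) \<nu>0 \<nu>(1) fin R' roots0 lam(1) lam' F(2,1) F(3)[rule_format]
       F(4)[unfolded \<sigma>r, rule_format] F(5) CM(1,2) CM(3)[unfolded Nr, rule_format]]
    show "q_laplace_converges lq (\<kappa> r) n lam (?g (r - 1))" by (rule last(1)) assumption+
    have "\<exists>G. G meromorphic_on (- {0}) \<and> extends_germ0 (- {0}) G (q_laplace lq (\<kappa> r) n lam (?g (r - 1))) \<and>
      (\<forall>z. z \<noteq> 0 \<longrightarrow> z \<notin> spirals \<omega> R' \<longrightarrow>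
         qop_apply \<omega> (int K) 0 (op_support m A) (op_coeff A) G z = qop_rhs \<omega> 0 a z)"
      by (rule last(2)) assumption+
    then obtain G where G: "G meromorphic_on (- {0})" "extends_germ0 (- {0}) G (q_laplace lq (\<kappa> r) n lam (?g (r - 1)))"
      "\<And>z. z \<noteq> 0 \<Longrightarrow> z \<notin> spirals \<omega> R' \<Longrightarrow> qop_fun q m A G z = poly a z"
      unfolding qop_apply_untransformed[OF pow(1)[symmetric]] by blast
    have "\<forall>\<^sub>\<approx>z\<in>- {0}. qop_fun q m A G z = poly a z"
    proof (subst eventually_cosparse_open_eq, simp add: open_Compl, intro ballI)
      fix z :: complex assume z: "z \<in> - {0}"
      have "\<forall>\<^sub>F w in at z. w \<noteq> 0"
        using eventually_at_in_open'[of "- {0}" z] z by (auto elim: eventually_mono)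
      moreover have "\<forall>\<^sub>F w in at z. w \<notin> spirals \<omega> R'" using spirals_sparse[OF \<omega> R'(1,2), of z] z by simp
      ultimately show "\<forall>\<^sub>F w in at z. qop_fun q m A G w = poly a w"
        by eventually_elim (rule G(3))
    qed
    with G(1,2) show "\<exists>G. G meromorphic_on (- {0}) \<and> extends_germ0 (- {0}) G (q_laplace lq (\<kappa> r) n lam (?g (r - 1))) \<and>
             (\<forall>\<^sub>\<approx>z\<in>- {0}. qop_fun q m A G z = poly a z)" by blast
  qed
qed

end
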